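(* Let $\lambda\in\overline{\mathrm{Pr}}_k^{\mathcal O_{\rm prin}}$. Then for every $w\in W$ the module $L^{\mathfrak g}_{\mathfrak b}(\lambda)$ is a strongly tame $\Gamma_{\rm st}(w(\Pi_{\rm st}))$-Gelfand–Tsetlin $\mathfrak g$-module.
   Context: Let $\mathfrak g=\mathfrak{sl}_{n+1}(\mathbb C)$, $n\ge1$, $E_{i,j}$ matrix units, $\mathfrak h$ traceless diagonal matrices, $\Delta_+=\{\varepsilon_i-\varepsilon_j:i<j\}$, $\Delta_-=-\Delta_+$, $\Pi_{\rm st}=(\alpha_1,\dots,\alpha_n)$, $\alpha_i=\varepsilon_i-\varepsilon_{i+1}$, $\mathfrak b$ the upper triangular Borel; $e_i=E_{i,i+1},f_i=E_{i+1,i},h_i=E_{ii}-E_{i+1,i+1}$. $(\cdot,\cdot)$ invariant form on $\mathfrak h^*$ with $(\alpha,\alpha)=2$; $\omega_i$ fundamental weights, $P^\vee=\bigoplus\mathbb Z\omega_i$, $\rho=\sum\omega_i$; $W$ Weyl group generated by $s_i$, $w\cdot\mu=w(\mu+\rho)-\rho$. Admissible weights: $k\in\mathbb Q$, $k+n+1=p/q$, $p,q\in\mathbb N$ coprime, $p\ge n+1$; $\overline{\mathrm{Pr}}_{k,\mathbb Z}=\{\sum\lambda_i\omega_i:\lambda_i\in\mathbb N_0,\sum\lambda_i\le p-n-1\}$; $C(w,\eta)$ for $w\in W,\eta\in P^\vee$ means: for all $\alpha\in\Delta_+$, $0\le(\eta,\alpha)\le q-1$ if $w(\alpha)\in\Delta_+$,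 $1\le(\eta,\alpha)\le q$ if $w(\alpha)\in\Delta_-$; $\overline{\mathrm{Pr}}_k=\{w\cdot(\mu-\tfrac pq\eta):\mu\in\overline{\mathrm{Pr}}_{k,\mathbb Z},w\in W,\eta\in P^\vee,C(w,\eta)\}$. $J_\mu=\mathrm{Ann}_{U(\mathfrak g)}L^{\mathfrak g}_{\mathfrak b}(\mu)$, $\mathcal V(J_\mu)\subset\mathfrak g^*$ the zero locus of $\mathrm{gr}J_\mu$; $\overline{\mathrm{Pr}}_k^{\mathcal O_{\rm prin}}=\{\mu\in\overline{\mathrm{Pr}}_k:\mathcal V(J_\mu)=\overline{\mathcal O_{\rm prin}^*}\}$, $\mathcal O_{\rm prin}^*$ the image of the principal nilpotent orbit in $\mathfrak g^*$ via the Killing form. $\overline W\subset\mathrm{Aut}(\mathfrak g)$ is generated by $r_i=\exp(\mathrm{ad}f_i)\exp(-\mathrm{ad}e_i)\exp(\mathrm{ad}f_i)$ and the involution $\sigma$: $e_i\mapsto e_{n+1-i}$, $f_i\mapsto f_{n+1-i}$, $h_i\mapsto-h_{n+1-i}$; it acts on $\mathfrak h^*$, roots and bases. An element $w=s_{i_1}\cdots s_{i_m}\in W$ acts on bases via $r_{i_1}\cdots r_{i_m}$. For $u\in\overline W$ and a module $M$, $M^u$ is $M$ with action $a\cdot v=u^{-1}(a)v$. A $\mathfrak g$-module $M$ is a strongly tame $\Gamma_{\rm st}$-Gelfand–Tsetlin module if it has a basis $\{T(v):v\in S\}$ indexed by a set $S$ of arrays $v=(v_{j,i})_{1\le i\le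 j\le n+1}$ of complex numbers such that for $k=1,\dots,n$: $e_kT(v)=-\sum_{i=1}^k\frac{\prod_{j=1}^{k+1}(v_{k,i}-v_{k+1,j})}{\prod_{j\ne i}(v_{k,i}-v_{k,j})}T(v+\delta^{k,i})$, $f_kT(v)=\sum_{i=1}^k\frac{\prod_{j=1}^{k-1}(v_{k,i}-v_{k-1,j})}{\prod_{j\ne i}(v_{k,i}-v_{k,j})}T(v-\delta^{k,i})$, $h_kT(v)=(2\sum_{i=1}^kv_{k,i}-\sum_{i=1}^{k-1}v_{k-1,i}-\sum_{i=1}^{k+1}v_{k+1,i}-1)T(v)$, with $\delta^{k,i}$ the array having $1$ at $(k,i)$ and $0$ elsewhere, summands with zero denominator omitted and $T(w)=0$ for $w\notin S$. For a base $\Pi'$, $M$ is strongly tame $\Gamma_{\rm st}(\Pi')$-Gelfand–Tsetlin if there is $u\in\overline W$ with $\Pi'=u(\Pi_{\rm st})$ (as ordered sets) and $M^{u^{-1}}$ strongly tame $\Gamma_{\rm st}$-Gelfand–Tsetlin.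
   Formalization: The involution σ is taken to send h_i to h_{n+1-i} instead of −h_{n+1-i}, because [e_i,f_i]=h_i makes the sign in the stated formula impossible for a Lie algebra automorphism; nothing in the claim is lost. *)

theory Defs
  imports "HOL-Analysis.Analysis"
begin

type_synonym mat = "nat \<Rightarrow> nat \<Rightarrow> complex"
type_synonym weight = "nat \<Rightarrow> complex"   (* Dynkin coordinates lambda_i = lambda(h_i), i = 1..n *)
type_synonym gtarray = "nat \<Rightarrow> nat \<Rightarrow> complex"  (* v j i, 1 <= i <= j <= n+1 *)

definition in_gl :: "nat \<Rightarrow> mat \<Rightarrow> bool" where
  "in_gl n A \<longleftrightarrow> (\<forall>a b. (a \<notin> {1..Suc n} \<or> b \<notin> {1..Suc n}) \<longrightarrow> A a b = 0)"

definition sl :: "nat \<Rightarrow> mat set" where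
  "sl n = {A. in_gl n A \<and> (\<Sum>a=1..Suc n. A a a) = 0}"

definition mmul :: "nat \<Rightarrow> mat \<Rightarrow> mat \<Rightarrow> mat" where
  "mmul n A B = (\<lambda>a b. \<Sum>c=1..Suc n. A a c * B c b)"

definition brk :: "nat \<Rightarrow> mat \<Rightarrow> mat \<Rightarrow> mat" where
  "brk n A B = (\<lambda>a b. mmul n A B a b - mmul n B A a b)"

definition idm :: "nat \<Rightarrow> mat" where
  "idm n = (\<lambda>a b. if a = b \<and> a \<in> {1..Suc n} then 1 else 0)"

definition Emat :: "nat \<Rightarrow> nat \<Rightarrow> mat" where
  "Emat i j = (\<lambda>a b. if a = i \<and> b = j then 1 else 0)"

definition ev :: "nat \<Rightarrow> mat" where "ev i = Emat i (Suc i)"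
definition fv :: "nat \<Rightarrow> mat" where "fv i = Emat (Suc i) i"
definition hv :: "nat \<Rightarrow> mat" where
  "hv i = (\<lambda>a b. if a = b \<and> a = i then 1 else if a = b \<and> a = Suc i then -1 else 0)"

definition trace :: "nat \<Rightarrow> mat \<Rightarrow> complex" where
  "trace n A = (\<Sum>a=1..Suc n. A a a)"

definition killing :: "nat \<Rightarrow> mat \<Rightarrow> mat \<Rightarrow> complex" where
  "killing n X Y = 2 * of_nat (Suc n) * trace n (mmul n X Y)"

definition cartan :: "nat \<Rightarrow> mat set" where
  "cartan n = {H \<in> sl n. \<forall>a b. a \<noteq> b \<longrightarrow> H a b = 0}"

definition lie_module :: "nat \<Rightarrow> (complex \<Rightarrow> 'v::ab_group_add \<Rightarrow> 'v) \<Rightarrow> (mat \<Rightarrow> 'v \<Rightarrow> 'v) \<Rightarrow> bool" where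
  "lie_module n sc \<rho> \<longleftrightarrow> Vector_Spaces.vector_space sc \<and>
     (\<forall>A\<in>sl n. Vector_Spaces.linear sc sc (\<rho> A)) \<and>
     (\<forall>A\<in>sl n. \<forall>B\<in>sl n. \<forall>x. \<rho> (\<lambda>a b. A a b + B a b) x = \<rho> A x + \<rho> B x) \<and>
     (\<forall>A\<in>sl n. \<forall>c x. \<rho> (\<lambda>a b. c * A a b) x = sc c (\<rho> A x)) \<and>
     (\<forall>A\<in>sl n. \<forall>B\<in>sl n. \<forall>x. \<rho> (brk n A B) x = \<rho> A (\<rho> B x) - \<rho> B (\<rho> A x))"

definition irreducible_mod :: "nat \<Rightarrow> (complex \<Rightarrow> 'v::ab_group_add \<Rightarrow> 'v) \<Rightarrow> (mat \<Rightarrow> 'v \<Rightarrow> 'v) \<Rightarrow> bool" where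
  "irreducible_mod n sc \<rho> \<longleftrightarrow> (\<exists>x::'v. x \<noteq> 0) \<and>
     (\<forall>U. module.subspace sc U \<and> (\<forall>A\<in>sl n. \<forall>x\<in>U. \<rho> A x \<in> U) \<longrightarrow> U = {0} \<or> U = UNIV)"

definition hw_vector :: "nat \<Rightarrow> (complex \<Rightarrow> 'v::ab_group_add \<Rightarrow> 'v) \<Rightarrow> (mat \<Rightarrow> 'v \<Rightarrow> 'v) \<Rightarrow> weight \<Rightarrow> 'v \<Rightarrow> bool" where
  "hw_vector n sc \<rho> lam v0 \<longleftrightarrow> v0 \<noteq> 0 \<and>
     (\<forall>a\<in>{1..Suc n}. \<forall>b\<in>{1..Suc n}. a < b \<longrightarrow> \<rho> (Emat a b) v0 = 0) \<and>
     (\<forall>i\<in>{1..n}. \<rho> (hv i) v0 = sc (lam i) v0)"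

definition is_L :: "nat \<Rightarrow> (complex \<Rightarrow> 'v::ab_group_add \<Rightarrow> 'v) \<Rightarrow> (mat \<Rightarrow> 'v \<Rightarrow> 'v) \<Rightarrow> weight \<Rightarrow> bool" where
  "is_L n sc \<rho> lam \<longleftrightarrow> lie_module n sc \<rho> \<and> irreducible_mod n sc \<rho> \<and> (\<exists>v0. hw_vector n sc \<rho> lam v0)"

text \<open>Basis of sl(n+1): (a,b) with a \<noteq> b stands for E_ab, (a,a) for h_a.
  Elements of the tensor algebra T(g) are finitely supported functions on words
  over this basis; they act on modules through their image in U(g).\<close>
definition bidx :: "nat \<Rightarrow> (nat \<times> nat) set" where
  "bidx n = {(a,b). a \<in> {1..Suc n} \<and> b \<in> {1..Suc n} \<and> a \<noteq> b} \<union> {(a,a) | a. a \<in> {1..n}}"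

definition bas :: "nat \<times> nat \<Rightarrow> mat" where
  "bas x = (if fst x = snd x then hv (fst x) else Emat (fst x) (snd x))"

definition supp :: "((nat \<times> nat) list \<Rightarrow> complex) \<Rightarrow> (nat \<times> nat) list set" where
  "supp p = {w. p w \<noteq> 0}"

definition tensor_elt :: "nat \<Rightarrow> ((nat \<times> nat) list \<Rightarrow> complex) \<Rightarrow> bool" where
  "tensor_elt n p \<longleftrightarrow> finite (supp p) \<and> (\<forall>w\<in>supp p. set w \<subseteq> bidx n)"

definition act_word :: "(mat \<Rightarrow> 'v \<Rightarrow> 'v) \<Rightarrow> (nat \<times> nat) list \<Rightarrow> 'v \<Rightarrow> 'v" where
  "act_word \<rho> w x = foldr (\<lambda>b y. \<rho> (bas b) y) w x"

definition act :: "(complex \<Rightarrow> 'v::ab_group_add \<Rightarrow> 'v) \<Rightarrow> (mat \<Rightarrow> 'v \<Rightarrow> 'v) \<Rightarrow> ((nat \<times> nat) list \<Rightarrow> complex) \<Rightarrow> 'v \<Rightarrow> 'v" where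
  "act sc \<rho> p x = (\<Sum>w\<in>supp p. sc (p w) (act_word \<rho> w x))"

definition tdeg :: "((nat \<times> nat) list \<Rightarrow> complex) \<Rightarrow> nat" where
  "tdeg p = (if supp p = {} then 0 else Max (length ` supp p))"

text \<open>Evaluation at xi in g* of the image in S(g) = C[g*] of the top-degree component.\<close>
definition top_eval :: "((nat \<times> nat) list \<Rightarrow> complex) \<Rightarrow> (mat \<Rightarrow> complex) \<Rightarrow> complex" where
  "top_eval p xi = (\<Sum>w\<in>{w\<in>supp p. length w = tdeg p}. p w * (\<Prod>b\<leftarrow>w. xi (bas b)))"

text \<open>Zero locus in g* of gr(Ann M), transported to g via the Killing form:
  Y corresponds to the functional X \<mapsto> killing X Y.\<close>
definition assoc_var :: "nat \<Rightarrow> (complex \<Rightarrow> 'v::ab_group_add \<Rightarrow> 'v) \<Rightarrow> (mat \<Rightarrow> 'v \<Rightarrow> 'v) \<Rightarrow> mat set" where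
  "assoc_var n sc \<rho> = {Y \<in> sl n. \<forall>p. tensor_elt n p \<and> (\<forall>x. act sc \<rho> p x = 0)
        \<longrightarrow> top_eval p (\<lambda>X. killing n X Y) = 0}"

definition principal_nilp :: "nat \<Rightarrow> mat" where
  "principal_nilp n = (\<lambda>a b. if b = Suc a \<and> a \<in> {1..n} then 1 else 0)"

definition O_prin :: "nat \<Rightarrow> mat set" where
  "O_prin n = {mmul n (mmul n g (principal_nilp n)) g' | g g'.
      in_gl n g \<and> in_gl n g' \<and> mmul n g g' = idm n}"

definition alpha :: "nat \<Rightarrow> nat \<Rightarrow> nat \<Rightarrow> complex" where
  "alpha n i j = (if j \<in> {1..n} then (if j = i then 2 else if j = Suc i \<or> i = Suc j then -1 else 0) else 0)"

definition sref :: "nat \<Rightarrow> nat \<Rightarrow> weight \<Rightarrow> weight" where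
  "sref n i lam = (\<lambda>j. lam j - lam i * alpha n i j)"

text \<open>The Weyl group element s_{i1}...s_{im} given by the word [i1,...,im].\<close>
definition wact :: "nat \<Rightarrow> nat list \<Rightarrow> weight \<Rightarrow> weight" where
  "wact n w lam = foldr (sref n) w lam"

definition posroot :: "nat \<Rightarrow> nat \<Rightarrow> nat \<Rightarrow> weight" where
  "posroot n a b = (\<lambda>j. \<Sum>k=a..<b. alpha n k j)"

definition is_posroot :: "nat \<Rightarrow> weight \<Rightarrow> bool" where
  "is_posroot n \<beta> \<longleftrightarrow> (\<exists>a b. 1 \<le> a \<and> a < b \<and> b \<le> Suc n \<and> (\<forall>j\<in>{1..n}. \<beta> j = posroot n a b j))"

definition rho_w :: weight where "rho_w = (\<lambda>j. 1)"

definition dot :: "nat \<Rightarrow> nat list \<Rightarrow> weight \<Rightarrow> weight" where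
  "dot n w lam = (\<lambda>j. wact n w (\<lambda>i. lam i + rho_w i) j - rho_w j)"

text \<open>(eta, eps_a - eps_b) for a coweight eta in Dynkin coordinates.\<close>
definition pair_root :: "(nat \<Rightarrow> int) \<Rightarrow> nat \<Rightarrow> nat \<Rightarrow> int" where
  "pair_root eta a b = (\<Sum>k=a..<b. eta k)"

definition Ccond :: "nat \<Rightarrow> nat \<Rightarrow> nat list \<Rightarrow> (nat \<Rightarrow> int) \<Rightarrow> bool" where
  "Ccond n q w eta \<longleftrightarrow> (\<forall>a b. 1 \<le> a \<and> a < b \<and> b \<le> Suc n \<longrightarrow>
     (if is_posroot n (wact n w (posroot n a b))
      then 0 \<le> pair_root eta a b \<and> pair_root eta a b \<le> int q - 1
      else 1 \<le> pair_root eta a b \<and> pair_root eta a b \<le> int q))"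

definition admissible_level :: "nat \<Rightarrow> rat \<Rightarrow> nat \<Rightarrow> nat \<Rightarrow> bool" where
  "admissible_level n k p q \<longleftrightarrow> 0 < p \<and> 0 < q \<and> coprime p q \<and> Suc n \<le> p \<and>
     k + of_nat (Suc n) = of_nat p / of_nat q"

definition Pr_Z :: "nat \<Rightarrow> nat \<Rightarrow> (nat \<Rightarrow> nat) set" where
  "Pr_Z n p = {mu. (\<Sum>i=1..n. mu i) + Suc n \<le> p}"

definition Pr_bar :: "nat \<Rightarrow> nat \<Rightarrow> nat \<Rightarrow> weight set" where
  "Pr_bar n p q = {lam. \<exists>mu w eta. mu \<in> Pr_Z n p \<and> set w \<subseteq> {1..n} \<and> Ccond n q w eta \<and>
      (\<forall>j\<in>{1..n}. lam j = dot n w (\<lambda>i. of_nat (mu i) - (of_nat p / of_nat q) * of_int (eta i)) j)}"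

definition ad :: "nat \<Rightarrow> mat \<Rightarrow> mat \<Rightarrow> mat" where "ad n X = brk n X"

text \<open>exp(ad X) for nilpotent X in sl(n+1): (ad X)^m = 0 for m \<ge> 2n+1.\<close>
definition exp_ad :: "nat \<Rightarrow> mat \<Rightarrow> mat \<Rightarrow> mat" where
  "exp_ad n X Y = (\<lambda>a b. \<Sum>m<2 * Suc n. ((ad n X ^^ m) Y) a b / of_nat (fact m))"

definition rW :: "nat \<Rightarrow> nat \<Rightarrow> mat \<Rightarrow> mat" where
  "rW n i = exp_ad n (fv i) \<circ> exp_ad n (\<lambda>a b. - ev i a b) \<circ> exp_ad n (fv i)"

text \<open>The diagram involution: e_i \<mapsto> e_{n+1-i}, f_i \<mapsto> f_{n+1-i} (hence h_i \<mapsto> h_{n+1-i}).\<close>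
definition sigmaW :: "nat \<Rightarrow> mat \<Rightarrow> mat" where
  "sigmaW n Y = (\<lambda>a b. if a \<in> {1..Suc n} \<and> b \<in> {1..Suc n}
      then - ((-1) ^ (a + b)) * Y (Suc (Suc n) - b) (Suc (Suc n) - a) else 0)"

inductive_set Wbar :: "nat \<Rightarrow> (mat \<Rightarrow> mat) set" for n where
  Wbar_id: "id \<in> Wbar n"
| Wbar_r: "u \<in> Wbar n \<Longrightarrow> i \<in> {1..n} \<Longrightarrow> rW n i \<circ> u \<in> Wbar n"
| Wbar_sigma: "u \<in> Wbar n \<Longrightarrow> sigmaW n \<circ> u \<in> Wbar n"

text \<open>lam(H) for lam in Dynkin coordinates and H in the Cartan subalgebra: omega_k(H) = H_11+...+H_kk.\<close>
definition weval :: "nat \<Rightarrow> weight \<Rightarrow> mat \<Rightarrow> complex" where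
  "weval n lam H = (\<Sum>k=1..n. lam k * (\<Sum>a=1..k. H a a))"

text \<open>u(Pi_st) = w(Pi_st) as ordered sets: u(alpha_i) = w(alpha_i) for all i,
  where u acts on h* by (u lam)(u H) = lam(H).\<close>
definition maps_base :: "nat \<Rightarrow> (mat \<Rightarrow> mat) \<Rightarrow> nat list \<Rightarrow> bool" where
  "maps_base n u w \<longleftrightarrow> (\<forall>i\<in>{1..n}. \<forall>H\<in>cartan n.
      weval n (wact n w (alpha n i)) (u H) = weval n (alpha n i) H)"

definition gt_arrays :: "nat \<Rightarrow> gtarray set" where
  "gt_arrays n = {v. \<forall>j i. \<not> (1 \<le> i \<and> i \<le> j \<and> j \<le> Suc n) \<longrightarrow> v j i = 0}"

definition shift :: "gtarray \<Rightarrow> nat \<Rightarrow> nat \<Rightarrow> complex \<Rightarrow> gtarray" where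
  "shift v k i c = (\<lambda>j l. if j = k \<and> l = i then v j l + c else v j l)"

definition strongly_tame_GT :: "nat \<Rightarrow> (complex \<Rightarrow> 'v::ab_group_add \<Rightarrow> 'v) \<Rightarrow> (mat \<Rightarrow> 'v \<Rightarrow> 'v) \<Rightarrow> bool" where
  "strongly_tame_GT n sc \<rho> \<longleftrightarrow> (\<exists>(S :: gtarray set) (T :: gtarray \<Rightarrow> 'v).
     S \<subseteq> gt_arrays n \<and> inj_on T S \<and> \<not> module.dependent sc (T ` S) \<and> module.span sc (T ` S) = UNIV \<and>
     (let Tm = (\<lambda>u. if u \<in> S then T u else 0) in
     (\<forall>v\<in>S. \<forall>k\<in>{1..n}.
        \<rho> (ev k) (T v) = - (\<Sum>i=1..k.
           (let den = (\<Prod>j\<in>{1..k}-{i}. v k i - v k j) in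
            if den = 0 then 0
            else sc ((\<Prod>j=1..Suc k. v k i - v (Suc k) j) / den) (Tm (shift v k i 1)))) \<and>
        \<rho> (fv k) (T v) = (\<Sum>i=1..k.
           (let den = (\<Prod>j\<in>{1..k}-{i}. v k i - v k j) in
            if den = 0 then 0
            else sc ((\<Prod>j=1..k-1. v k i - v (k-1) j) / den) (Tm (shift v k i (-1))))) \<and>
        \<rho> (hv k) (T v) = sc (2 * (\<Sum>i=1..k. v k i) - (\<Sum>i=1..k-1. v (k-1) i)
                              - (\<Sum>i=1..Suc k. v (Suc k) i) - 1) (T v))))"

text \<open>M is strongly tame Gamma_st(u(Pi_st))-GT iff M^{u^{-1}} (action a.v = u(a) v) is strongly tame.\<close>

end

theory Submission
  imports Defs "HOL-Library.Multiset_Order" "HOL-Library.Function_Algebras"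
begin

text \<open>Write \<open>y\<^sup>m\<close> for the ordered product of lowering operators given by a multiset \<open>m\<close> of negative
  roots. If the vectors \<open>y\<^sup>m v\<^sub>0\<close> were linearly dependent, the spaces \<open>U\<^sub>d(\<g>) / Ann\<close> would grow with \<open>d\<close>
  too slowly for the zero locus of \<open>gr Ann\<close> to contain the principal orbit, on which enough coordinate functions
  are algebraically independent. So the simple module is a Verma module.

  If \<open>\<lambda> + \<rho>\<close> took an integral value on some positive coroot, admissibility would make that value positive.
  On a root of minimal height with this property, Gelfand--Tsetlin theory for the corresponding block yields a
  singular vector below \<open>v\<^sub>0\<close>, contradicting simplicity. Hence all these values are nonintegral.

  For the order of the indices given by a Weyl group element, the generic Gelfand--Tsetlin operators act on functions
  on a set \<open>S\<close> of integral arrays, truncated from all arrays by invariance conditions. This module has a highest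
  weight vector of the required weight and the character of a Verma module. The map from the Verma module to it is
  injective by simplicity, hence onto the span of the point functions, whose preimages form the tame basis.\<close>

section \<open>Linear algebra\<close>

text \<open>The growth count compares exponents. With \<open>D\<close> positive roots, a dependence
  leaves of order \<open>M^(D-1)\<close> spanning vectors of length below \<open>M\<close>. An
  operator of degree \<open>d\<close> is determined by its values on words of length linear in
  \<open>d\<close>, so such operators fill a space of dimension of order \<open>d^(2D-2)\<close>;
  homogeneous functions of degree \<open>d\<close> on an orbit of dimension \<open>2D\<close> need
  order \<open>d^(2D-1)\<close>. The Gelfand-Tsetlin formulas have denominators and break down at
  integral differences. For a root of minimal height with integral value, only the first and the
  last column of its block differ by an integer. The last column never enters a denominator, so the
  formulas survive, and the integer opens one more invariant set. Cutting it off makes the truncated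
  module too small for a Verma module; positivity of the integer keeps the highest weight vector
  outside the cut. No universal module is built: independence of the vectors \<open>y^m v0\<close>
  makes the submodule generated by a pair of highest weight vectors in a product the graph of a map,
  which replaces the universal property of Verma modules.\<close>

lemma homogeneous_system_solution:
  fixes m :: "'e \<Rightarrow> 'i \<Rightarrow> 'a::field"
  assumes "finite E" "finite I" "card E < card I"
  shows "\<exists>c. (\<exists>i\<in>I. c i \<noteq> 0) \<and> (\<forall>e\<in>E. (\<Sum>i\<in>I. c i * m e i) = 0)"
  using assms
proof (induction E arbitrary: I m rule: finite_induct)
  case empty
  then have "I \<noteq> {}" by auto
  then show ?case by (intro exI[of _ "\<lambda>_. 1"]) auto
next
  case (insert e E)
  show ?case
  proof (cases "\<forall>i\<in>I. m e i = 0")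
    case True
    have "card E < card I" using insert by simp
    then obtain c where "\<exists>i\<in>I. c i \<noteq> 0" "\<forall>e\<in>E. (\<Sum>i\<in>I. c i * m e i) = 0"
      using insert.IH insert.prems by blast
    then show ?thesis using True by (intro exI[of _ c]) auto
  next
    case False
    then obtain i0 where i0: "i0 \<in> I" "m e i0 \<noteq> 0" by auto
    let ?I = "I - {i0}"
    have "card E < card ?I" using insert i0 by simp
    then obtain c where c: "\<exists>i\<in>?I. c i \<noteq> 0"
      "\<forall>e'\<in>E. (\<Sum>i\<in>?I. c i * (m e' i - m e' i0 * m e i / m e i0)) = 0"
      using insert.IH[of ?I "\<lambda>e' i. m e' i - m e' i0 * m e i / m e i0"] insert.prems by blast
    \<comment> \<open>Equation \<open>e\<close> is solved for the unknown \<open>i0\<close>;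
      \<open>c\<close> solves the other equations after this substitution.\<close>
    define d where "d = c(i0 := - (\<Sum>i\<in>?I. c i * m e i) / m e i0)"
    have sum_d: "(\<Sum>i\<in>I. d i * m e' i) = d i0 * m e' i0 + (\<Sum>i\<in>?I. c i * m e' i)" for e'
    proof -
      have "(\<Sum>i\<in>I. d i * m e' i) = d i0 * m e' i0 + (\<Sum>i\<in>?I. d i * m e' i)"
        using i0 insert.prems by (simp add: sum.remove)
      also have "(\<Sum>i\<in>?I. d i * m e' i) = (\<Sum>i\<in>?I. c i * m e' i)"
        by (intro sum.cong) (auto simp: d_def)
      finally show ?thesis .
    qed
    have "(\<Sum>i\<in>I. d i * m e i) = 0" unfolding sum_d using i0 by (simp add: d_def)
    moreover have "(\<Sum>i\<in>I. d i * m e' i) = 0" if "e' \<in> E" for e'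
    proof -
      have "0 = (\<Sum>i\<in>?I. c i * m e' i - c i * m e i * (m e' i0 / m e i0))"
        using c(2) that by (simp add: algebra_simps)
      also have "\<dots> = (\<Sum>i\<in>?I. c i * m e' i) - (\<Sum>i\<in>?I. c i * m e i) * (m e' i0 / m e i0)"
        by (simp add: sum_subtractf sum_distrib_right sum_divide_distrib)
      also have "\<dots> = (\<Sum>i\<in>I. d i * m e' i)" unfolding sum_d by (simp add: d_def)
      finally show ?thesis by simp
    qed
    moreover have "\<exists>i\<in>I. d i \<noteq> 0" using c(1) by (auto simp: d_def)
    ultimately show ?thesis by (intro exI[of _ d]) auto
  qed
qed

lemma univariate_independent:
  fixes c :: "nat \<Rightarrow> 'a::field_char_0"
  assumes "infinite X" "finite K" "\<And>x. x \<in> X \<Longrightarrow> (\<Sum>k\<in>K. c k * x ^ k) = 0" "k \<in> K"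
  shows "c k = 0"
proof -
  define p where "p = (\<Sum>k\<in>K. monom (c k) k)"
  have "poly p x = 0" if "x \<in> X" for x
    using assms(3)[OF that] by (simp add: p_def poly_sum poly_monom)
  then have "X \<subseteq> {x. poly p x = 0}" by auto
  then have "p = 0" using assms(1) poly_roots_finite finite_subset by blast
  then have "coeff p k = 0" by simp
  then show ?thesis using assms(2,4) by (simp add: p_def coeff_sum)
qed

text \<open>With the other variables fixed, the sum is a polynomial in the variable
  \<open>j0\<close> with infinitely many zeros. Each of its coefficients, a sum over a fibre
  \<open>Ie e\<close>, therefore vanishes and involves one variable less. Exponents are compared on
  \<open>J\<close> only, because the index functions may be nonzero elsewhere.\<close>

lemma monomials_independent:
  fixes c :: "('j \<Rightarrow> nat) \<Rightarrow> 'a::field_char_0"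
  assumes "finite J" "finite I" "\<And>j. j \<in> J \<Longrightarrow> infinite (X j)"
    "\<And>g h. g \<in> I \<Longrightarrow> h \<in> I \<Longrightarrow> (\<And>j. j \<in> J \<Longrightarrow> g j = h j) \<Longrightarrow> g = h"
    "\<And>x. (\<And>j. j \<in> J \<Longrightarrow> x j \<in> X j) \<Longrightarrow> (\<Sum>g\<in>I. c g * (\<Prod>j\<in>J. x j ^ g j)) = 0"
    "g \<in> I"
  shows "c g = 0"
  using assms
proof (induction J arbitrary: I c g rule: finite_induct)
  case empty
  have "I = {g}" using empty.prems(3,5) by blast
  then show ?case using empty.prems(4)[of undefined] by simp
next
  case (insert j0 J)
  define Ie where "Ie e = {h\<in>I. h j0 = e}" for e
  have vanish: "(\<Sum>h\<in>Ie e. c h * (\<Prod>j\<in>J. x j ^ h j)) = 0"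
    if x: "\<And>j. j \<in> J \<Longrightarrow> x j \<in> X j" and e: "e \<in> (\<lambda>h. h j0) ` I" for x e
  proof (rule univariate_independent[of "X j0" "(\<lambda>h. h j0) ` I" "\<lambda>e. \<Sum>h\<in>Ie e. c h * (\<Prod>j\<in>J. x j ^ h j)"])
    show "infinite (X j0)" using insert.prems(2) by simp
    show "finite ((\<lambda>h. h j0) ` I)" using insert.prems(1) by simp
    fix y assume y: "y \<in> X j0"
    have "0 = (\<Sum>g\<in>I. c g * (\<Prod>j\<in>insert j0 J. (x(j0 := y)) j ^ g j))"
      by (rule insert.prems(4)[symmetric]) (use x y in auto)
    also have "\<dots> = (\<Sum>g\<in>I. c g * (\<Prod>j\<in>J. x j ^ g j) * y ^ g j0)"
    proof (rule sum.cong, simp)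
      fix g
      have "(\<Prod>j\<in>J. (x(j0 := y)) j ^ g j) = (\<Prod>j\<in>J. x j ^ g j)"
        by (rule prod.cong) (use insert.hyps in auto)
      then show "c g * (\<Prod>j\<in>insert j0 J. (x(j0 := y)) j ^ g j) = c g * (\<Prod>j\<in>J. x j ^ g j) * y ^ g j0"
        using insert.hyps by simp
    qed
    also have "\<dots> = (\<Sum>e\<in>(\<lambda>h. h j0) ` I. \<Sum>h\<in>Ie e. c h * (\<Prod>j\<in>J. x j ^ h j) * y ^ h j0)"
      unfolding Ie_def using insert.prems(1) by (rule sum.image_gen)
    also have "\<dots> = (\<Sum>e\<in>(\<lambda>h. h j0) ` I. (\<Sum>h\<in>Ie e. c h * (\<Prod>j\<in>J. x j ^ h j)) * y ^ e)"
      by (intro sum.cong) (auto simp: sum_distrib_right Ie_def)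
    finally show "(\<Sum>e\<in>(\<lambda>h. h j0) ` I. (\<Sum>h\<in>Ie e. c h * (\<Prod>j\<in>J. x j ^ h j)) * y ^ e) = 0" by simp
  qed (use e in auto)
  show ?case
  proof (rule insert.IH[of "Ie (g j0)"])
    show "finite (Ie (g j0))" using insert.prems(1) by (simp add: Ie_def)
    show "infinite (X j)" if "j \<in> J" for j using insert.prems(2) that by simp
    show "g' = h" if "g' \<in> Ie (g j0)" "h \<in> Ie (g j0)" "\<And>j. j \<in> J \<Longrightarrow> g' j = h j" for g' h
      using insert.prems(3)[of g' h] that by (metis (mono_tags, lifting) Ie_def insertE mem_Collect_eq)
    show "(\<Sum>h\<in>Ie (g j0). c h * (\<Prod>j\<in>J. x j ^ h j)) = 0" if "\<And>j. j \<in> J \<Longrightarrow> x j \<in> X j" for x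
      using vanish[of x "g j0"] that insert.prems(5) by auto
    show "g \<in> Ie (g j0)" using insert.prems(5) by (simp add: Ie_def)
  qed
qed

text \<open>At an entry of maximal norm \<open>M > 0\<close>, the deviation from the identity
  contributes less than \<open>N\<close> times \<open>M / N\<close>, which is absurd. This supplies
  an open set of invertible matrices, from which points of the principal orbit are made.\<close>

lemma diag_dominant_injective:
  fixes P :: "nat \<Rightarrow> nat \<Rightarrow> complex"
  assumes "\<And>a b. a \<in> {1..N} \<Longrightarrow> b \<in> {1..N} \<Longrightarrow> norm (P a b - (if a = b then 1 else 0)) < 1 / real N"
    and "\<And>a. a \<in> {1..N} \<Longrightarrow> (\<Sum>b=1..N. P a b * x b) = 0" and "b \<in> {1..N}"
  shows "x b = 0"
proof -
  define M where "M = Max ((\<lambda>b. norm (x b)) ` {1..N})"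
  have N: "N \<ge> 1" using assms(3) by auto
  have "M \<in> (\<lambda>b. norm (x b)) ` {1..N}" unfolding M_def by (rule Max_in) (use N in auto)
  then obtain a where a: "a \<in> {1..N}" "norm (x a) = M" by auto
  have le: "norm (x b) \<le> M" if "b \<in> {1..N}" for b
    unfolding M_def by (rule Max_ge) (use that in auto)
  have "M \<le> 0"
  proof (rule ccontr)
    assume "\<not> M \<le> 0"
    then have pos: "M > 0" by simp
    have "x a = (\<Sum>b=1..N. (if a = b then 1 else 0) * x b) - (\<Sum>b=1..N. P a b * x b)"
      using a assms(2)[OF a(1)] by (simp add: if_distrib[of "\<lambda>u. u * _"] cong: if_cong)
    also have "\<dots> = (\<Sum>b=1..N. ((if a = b then 1 else 0) - P a b) * x b)"
      by (simp add: sum_subtractf[symmetric] algebra_simps)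
    finally have "M \<le> (\<Sum>b=1..N. norm (((if a = b then 1 else 0) - P a b) * x b))"
      using a(2) norm_sum by metis
    also have "\<dots> < (\<Sum>b=1..N. 1 / real N * M)"
    proof (rule sum_strict_mono)
      fix b assume b: "b \<in> {1..N}"
      have "norm (((if a = b then 1 else 0) - P a b) * x b)
          = norm (P a b - (if a = b then 1 else 0)) * norm (x b)"
        by (simp add: norm_mult norm_minus_commute)
      also have "\<dots> \<le> norm (P a b - (if a = b then 1 else 0)) * M"
        using le[OF b] by (intro mult_left_mono) auto
      also have "\<dots> < 1 / real N * M" using assms(1)[OF a(1) b] pos by (intro mult_strict_right_mono) auto
      finally show "norm (((if a = b then 1 else 0) - P a b) * x b) < 1 / real N * M" .
    qed (use N in auto)
    also have "\<dots> = M" using N by simp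
    finally show False by simp
  qed
  then show ?thesis using le[OF assms(3)] norm_ge_zero[of "x b"] by (metis norm_le_zero_iff order_trans)
qed

lemma mmul_assoc: "mmul n (mmul n A B) C = mmul n A (mmul n B C)"
proof (intro ext)
  fix a b
  have "mmul n (mmul n A B) C a b = (\<Sum>c=1..Suc n. \<Sum>d=1..Suc n. A a d * B d c * C c b)"
    by (simp add: mmul_def sum_distrib_right del: sum.cl_ivl_Suc)
  also have "\<dots> = (\<Sum>d=1..Suc n. \<Sum>c=1..Suc n. A a d * B d c * C c b)" by (rule sum.swap)
  also have "\<dots> = mmul n A (mmul n B C) a b"
    by (simp add: mmul_def sum_distrib_left mult.assoc del: sum.cl_ivl_Suc)
  finally show "mmul n (mmul n A B) C a b = mmul n A (mmul n B C) a b" .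
qed

lemma mmul_in_gl: "in_gl n A \<Longrightarrow> in_gl n B \<Longrightarrow> in_gl n (mmul n A B)"
  by (auto simp: in_gl_def mmul_def intro!: sum.neutral)

lemma mmul_idm: "in_gl n A \<Longrightarrow> mmul n A (idm n) = A" "in_gl n A \<Longrightarrow> mmul n (idm n) A = A"
proof -
  assume A: "in_gl n A"
  show "mmul n A (idm n) = A"
  proof (intro ext)
    fix a b
    have "mmul n A (idm n) a b = (\<Sum>c=1..Suc n. if c = b then A a b else 0)"
      unfolding mmul_def idm_def by (rule sum.cong) auto
    also have "\<dots> = (if b \<in> {1..Suc n} then A a b else 0)" by (simp only: sum.delta finite_atLeastAtMost)
    also have "\<dots> = A a b" using A by (auto simp: in_gl_def)
    finally show "mmul n A (idm n) a b = A a b" .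
  qed
  show "mmul n (idm n) A = A"
  proof (intro ext)
    fix a b
    have "mmul n (idm n) A a b = (\<Sum>c=1..Suc n. if c = a then A a b else 0)"
      unfolding mmul_def idm_def by (rule sum.cong) auto
    also have "\<dots> = (if a \<in> {1..Suc n} then A a b else 0)" by (simp only: sum.delta finite_atLeastAtMost)
    also have "\<dots> = A a b" using A by (auto simp: in_gl_def)
    finally show "mmul n (idm n) A a b = A a b" .
  qed
qed

text \<open>Each unit column gives \<open>n + 1\<close> equations in \<open>n + 2\<close> unknowns,
  the unknown of index \<open>0\<close> being the coefficient of the unit vector; injectivity makes
  it nonzero. The right inverse \<open>g\<close> is a left inverse by injectivity applied to the
  columns of \<open>g P - 1\<close>.\<close>

lemma injective_imp_inverse:
  assumes P: "in_gl n P"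
    and inj: "\<And>x b. (\<And>a. a \<in> {1..Suc n} \<Longrightarrow> (\<Sum>b=1..Suc n. P a b * x b) = 0) \<Longrightarrow> b \<in> {1..Suc n} \<Longrightarrow> x b = 0"
  obtains g where "in_gl n g" "mmul n P g = idm n" "mmul n g P = idm n"
proof -
  have col: "\<exists>y. \<forall>a\<in>{1..Suc n}. (\<Sum>b=1..Suc n. P a b * y b) = idm n a j" if j: "j \<in> {1..Suc n}" for j
  proof -
    let ?m = "\<lambda>a b. if b = 0 then idm n a j else P a b"
    have *: "{0..Suc n} = insert 0 {1..Suc n}" by auto
    obtain c where c: "\<exists>i\<in>{0..Suc n}. c i \<noteq> 0" "\<forall>a\<in>{1..Suc n}. (\<Sum>i\<in>{0..Suc n}. c i * ?m a i) = 0"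
      using homogeneous_system_solution[of "{1..Suc n}" "{0..Suc n}" ?m] by auto
    have c2: "c 0 * idm n a j + (\<Sum>b=1..Suc n. P a b * c b) = 0" if "a \<in> {1..Suc n}" for a
    proof -
      have "0 = (\<Sum>i\<in>insert 0 {1..Suc n}. c i * ?m a i)" using c(2) that unfolding * by auto
      also have "\<dots> = c 0 * idm n a j + (\<Sum>b=1..Suc n. c b * ?m a b)" by (subst sum.insert) auto
      also have "(\<Sum>b=1..Suc n. c b * ?m a b) = (\<Sum>b=1..Suc n. P a b * c b)" by (rule sum.cong) auto
      finally show ?thesis by simp
    qed
    have "c 0 \<noteq> 0"
    proof
      assume "c 0 = 0"
      then have "c b = 0" if "b \<in> {1..Suc n}" for b using inj[of c b] c2 that by simp
      then show False using c(1) \<open>c 0 = 0\<close> unfolding * by auto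
    qed
    have "(\<Sum>b=1..Suc n. P a b * (- c b / c 0)) = idm n a j" if "a \<in> {1..Suc n}" for a
    proof -
      have "(\<Sum>b=1..Suc n. P a b * (- c b / c 0)) = - (\<Sum>b=1..Suc n. P a b * c b) / c 0"
        by (simp only: sum_negf[symmetric] sum_divide_distrib) (simp add: algebra_simps)
      also have "(\<Sum>b=1..Suc n. P a b * c b) = - (c 0 * idm n a j)"
        using c2[OF that] by (simp only: eq_neg_iff_add_eq_0 add.commute)
      also have "- (- (c 0 * idm n a j)) / c 0 = idm n a j" using \<open>c 0 \<noteq> 0\<close> by simp
      finally show ?thesis .
    qed
    then show ?thesis by (intro exI[of _ "\<lambda>b. - c b / c 0"]) auto
  qed
  then obtain y where y: "\<And>j a. j \<in> {1..Suc n} \<Longrightarrow> a \<in> {1..Suc n} \<Longrightarrow> (\<Sum>b=1..Suc n. P a b * y j b) = idm n a j"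
    by metis
  define g where "g = (\<lambda>b j. if b \<in> {1..Suc n} \<and> j \<in> {1..Suc n} then y j b else 0)"
  have g: "in_gl n g" by (auto simp: g_def in_gl_def)
  have Pg: "mmul n P g = idm n"
  proof (intro ext)
    fix a j
    show "mmul n P g a j = idm n a j"
    proof (cases "a \<in> {1..Suc n} \<and> j \<in> {1..Suc n}")
      case True
      have "mmul n P g a j = (\<Sum>b=1..Suc n. P a b * y j b)"
        unfolding mmul_def by (rule sum.cong) (use True in \<open>auto simp: g_def\<close>)
      then show ?thesis using y True by simp
    next
      case False
      then show ?thesis using mmul_in_gl[OF P g] by (auto simp: in_gl_def idm_def)
    qed
  qed
  have "mmul n g P a j = idm n a j" for a j
  proof (cases "a \<in> {1..Suc n} \<and> j \<in> {1..Suc n}")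
    case True
    define x where "x = (\<lambda>b. mmul n g P b j - idm n b j)"
    have "(\<Sum>b=1..Suc n. P a b * x b) = 0" for a
    proof -
      have "(\<Sum>b=1..Suc n. P a b * x b) = mmul n P (mmul n g P) a j - mmul n P (idm n) a j"
        unfolding x_def mmul_def[of n P] by (simp only: sum_subtractf[symmetric] right_diff_distrib)
      also have "\<dots> = 0" by (simp only: mmul_assoc[symmetric] Pg mmul_idm[OF P]) simp
      finally show ?thesis .
    qed
    then have "x a = 0" using inj[of x a] True by blast
    then show ?thesis by (simp add: x_def)
  next
    case False
    then show ?thesis using mmul_in_gl[OF g P] by (auto simp: in_gl_def idm_def)
  qed
  then have "mmul n g P = idm n" by blast
  with g Pg that show thesis by blast
qed

section \<open>Words of lowering operators\<close>

definition sl_letters :: "nat \<Rightarrow> (nat \<times> nat) set" where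
  "sl_letters n = {(a,b). a \<in> {1..Suc n} \<and> b \<in> {1..Suc n} \<and> a \<noteq> b}"

definition neg_letters :: "nat \<Rightarrow> (nat \<times> nat) set" where
  "neg_letters n = {(a,b). 1 \<le> b \<and> b < a \<and> a \<le> Suc n}"

text \<open>A letter \<open>(a,b)\<close> stands for the matrix unit in row \<open>a\<close> and
  column \<open>b\<close>, of weight \<open>eps_a - eps_b\<close>. Weights of words are recorded in
  these epsilon coordinates, while \<open>lam\<close> is given in Dynkin coordinates.\<close>

definition letter_wt :: "nat \<times> nat \<Rightarrow> nat \<Rightarrow> int" where
  "letter_wt x = (\<lambda>c. (if fst x = c then 1 else 0) - (if snd x = c then 1 else 0))"

definition mset_wt :: "(nat \<times> nat) multiset \<Rightarrow> nat \<Rightarrow> int" where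
  "mset_wt m = (\<lambda>c. \<Sum>x\<in>#m. letter_wt x c)"

lemma mset_wt_simps [simp]:
  "mset_wt {#} = (\<lambda>_. 0)"
  "mset_wt (add_mset x m) = (\<lambda>c. letter_wt x c + mset_wt m c)"
  "mset_wt (m + m') = (\<lambda>c. mset_wt m c + mset_wt m' c)"
  by (auto simp: mset_wt_def)

lemma finite_sl_letters [simp]: "finite (sl_letters n)"
  by (rule finite_subset[of _ "{1..Suc n} \<times> {1..Suc n}"]) (auto simp: sl_letters_def)

lemma finite_neg_letters [simp]: "finite (neg_letters n)"
  by (rule finite_subset[of _ "{1..Suc n} \<times> {1..Suc n}"]) (auto simp: neg_letters_def)

lemma neg_letters_subset: "neg_letters n \<subseteq> sl_letters n"
  by (auto simp: sl_letters_def neg_letters_def)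

lemma mmul_Emat_left: "c \<in> {1..Suc n} \<Longrightarrow> mmul n (Emat r c) A = (\<lambda>a b. if a = r then A c b else 0)"
proof (intro ext)
  fix a b assume c: "c \<in> {1..Suc n}"
  have "mmul n (Emat r c) A a b = (\<Sum>d=1..Suc n. if d = c then (if a = r then A c b else 0) else 0)"
    unfolding mmul_def Emat_def by (rule sum.cong) auto
  then show "mmul n (Emat r c) A a b = (if a = r then A c b else 0)"
    using c by (simp only: sum.delta finite_atLeastAtMost if_True)
qed

lemma mmul_Emat_right: "r \<in> {1..Suc n} \<Longrightarrow> mmul n A (Emat r c) = (\<lambda>a b. if b = c then A a r else 0)"
proof (intro ext)
  fix a b assume r: "r \<in> {1..Suc n}"
  have "mmul n A (Emat r c) a b = (\<Sum>d=1..Suc n. if d = r then (if b = c then A a r else 0) else 0)"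
    unfolding mmul_def Emat_def by (rule sum.cong) auto
  then show "mmul n A (Emat r c) a b = (if b = c then A a r else 0)"
    using r by (simp only: sum.delta finite_atLeastAtMost if_True)
qed

lemma brk_Emat:
  assumes "x \<in> {1..Suc n}" "y \<in> {1..Suc n}" "c \<in> {1..Suc n}" "d \<in> {1..Suc n}"
  shows "brk n (Emat x y) (Emat c d) =
    (\<lambda>a b. (if y = c then Emat x d a b else 0) - (if d = x then Emat c y a b else 0))"
  unfolding brk_def using assms by (simp only: mmul_Emat_left) (auto simp: Emat_def fun_eq_iff)

lemma Emat_in_sl: "(a,b) \<in> sl_letters n \<Longrightarrow> Emat a b \<in> sl n"
proof -
  assume ab: "(a,b) \<in> sl_letters n"
  have "(\<Sum>c=1..Suc n. Emat a b c c) = 0" by (rule sum.neutral) (use ab in \<open>auto simp: Emat_def sl_letters_def\<close>)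
  then show ?thesis using ab by (auto simp: sl_def in_gl_def Emat_def sl_letters_def)
qed

lemma trace_mmul_commute: "(\<Sum>a=1..Suc n. mmul n A B a a) = (\<Sum>a=1..Suc n. mmul n B A a a)"
  unfolding mmul_def by (subst sum.swap) (simp only: mult.commute)

lemma brk_in_sl: "A \<in> sl n \<Longrightarrow> B \<in> sl n \<Longrightarrow> brk n A B \<in> sl n"
proof -
  assume A: "A \<in> sl n" and B: "B \<in> sl n"
  have "in_gl n (mmul n A B)" "in_gl n (mmul n B A)" using A B mmul_in_gl by (auto simp: sl_def)
  then have "in_gl n (brk n A B)" unfolding in_gl_def brk_def by auto
  then show ?thesis using trace_mmul_commute[of n A B] by (simp only: sl_def mem_Collect_eq brk_def sum_subtractf) simp
qed

lemma cartan_imp_sl: "H \<in> cartan n \<Longrightarrow> H \<in> sl n" by (simp add: cartan_def)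

lemma hv_in_cartan: "i \<in> {1..n} \<Longrightarrow> hv i \<in> cartan n"
proof -
  assume i: "i \<in> {1..n}"
  have "(\<Sum>c=1..Suc n. hv i c c) = (\<Sum>c=1..Suc n. (if c = i then 1 else 0) + (if c = Suc i then -1 else 0))"
    by (rule sum.cong) (auto simp: hv_def)
  also have "\<dots> = 0" unfolding sum.distrib using i by (simp only: sum.delta finite_atLeastAtMost) auto
  finally show ?thesis using i by (auto simp: cartan_def sl_def in_gl_def hv_def)
qed

text \<open>Abel summation: the coefficient of \<open>hv k\<close> is the partial sum of the
  diagonal up to \<open>k\<close>, that is, the value of the fundamental weight \<open>k\<close> at
  \<open>H\<close>.\<close>

lemma cartan_expand:
  assumes "H \<in> cartan n"
  shows "H = (\<lambda>a b. \<Sum>k\<in>{1..n}. (\<Sum>c=1..k. H c c) * hv k a b)"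
proof (intro ext)
  fix a b
  let ?s = "\<lambda>k. \<Sum>c=1..k. H c c"
  have gl: "in_gl n H" and tr: "?s (Suc n) = 0" and od: "\<And>a b. a \<noteq> b \<Longrightarrow> H a b = 0"
    using assms by (auto simp: cartan_def sl_def)
  show "H a b = (\<Sum>k\<in>{1..n}. ?s k * hv k a b)"
  proof (cases "a = b \<and> a \<ge> 1 \<and> a \<le> Suc n")
    case False
    then have "(\<Sum>k\<in>{1..n}. ?s k * hv k a b) = 0" by (intro sum.neutral) (auto simp: hv_def)
    moreover have "H a b = 0" using False od[of a b] gl by (auto simp: in_gl_def)
    ultimately show ?thesis by simp
  next
    case True
    then have "(\<Sum>k\<in>{1..n}. ?s k * hv k a b)
      = (\<Sum>k\<in>{1..n}. (if k = a then ?s a else 0) + (if k = a - 1 then - ?s (a - 1) else 0))"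
      by (intro sum.cong) (auto simp: hv_def)
    also have "\<dots> = (if a \<le> n then ?s a else 0) - (if a - 1 \<ge> 1 then ?s (a - 1) else 0)"
      unfolding sum.distrib using True by (simp only: sum.delta finite_atLeastAtMost) auto
    also have "\<dots> = ?s a - ?s (a - 1)" using True tr by (cases "a = Suc n") auto
    also have "\<dots> = H a a" using True by (cases a) auto
    finally show ?thesis using True by simp
  qed
qed

lemma sl_expand:
  assumes "A \<in> sl n"
  defines "D \<equiv> (\<lambda>a b. if a = b then A a b else 0)"
  shows "D \<in> cartan n" "A = (\<lambda>a b. D a b + (\<Sum>x\<in>sl_letters n. A (fst x) (snd x) * Emat (fst x) (snd x) a b))"
proof -
  have "(\<Sum>c=1..Suc n. D c c) = (\<Sum>c=1..Suc n. A c c)" by (simp only: D_def refl if_True)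
  then show "D \<in> cartan n" using assms(1) by (auto simp: D_def cartan_def sl_def in_gl_def)
  show "A = (\<lambda>a b. D a b + (\<Sum>x\<in>sl_letters n. A (fst x) (snd x) * Emat (fst x) (snd x) a b))"
  proof (intro ext)
    fix a b
    have "(\<Sum>x\<in>sl_letters n. A (fst x) (snd x) * Emat (fst x) (snd x) a b)
        = (\<Sum>x\<in>sl_letters n. if x = (a,b) then A a b else 0)"
      by (rule sum.cong) (auto simp: Emat_def)
    also have "\<dots> = (if (a,b) \<in> sl_letters n then A a b else 0)" by (simp only: sum.delta finite_sl_letters)
    finally show "A a b = D a b + (\<Sum>x\<in>sl_letters n. A (fst x) (snd x) * Emat (fst x) (snd x) a b)"
      using assms(1) by (auto simp: D_def sl_letters_def sl_def in_gl_def)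
  qed
qed

lemma zero_in_sl: "(\<lambda>a b. 0) \<in> sl n"
  by (auto simp: sl_def in_gl_def)

lemma scale_in_sl: "A \<in> sl n \<Longrightarrow> (\<lambda>a b. c * A a b) \<in> sl n"
  by (auto simp: sl_def in_gl_def sum_distrib_left[symmetric] simp del: sum.cl_ivl_Suc)

lemma add_in_sl: "A \<in> sl n \<Longrightarrow> B \<in> sl n \<Longrightarrow> (\<lambda>a b. A a b + B a b) \<in> sl n"
  by (auto simp: sl_def in_gl_def sum.distrib simp del: sum.cl_ivl_Suc)

lemma sum_in_sl: "finite K \<Longrightarrow> (\<And>k. k \<in> K \<Longrightarrow> B k \<in> sl n) \<Longrightarrow> (\<lambda>a b. \<Sum>k\<in>K. c k * B k a b) \<in> sl n"
  by (induction K rule: finite_induct) (simp_all add: zero_in_sl add_in_sl scale_in_sl)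

lemma bas_neg: "x \<in> sl_letters n \<Longrightarrow> bas x = Emat (fst x) (snd x)"
  by (auto simp: bas_def sl_letters_def)

lemma bas_in_sl: "x \<in> sl_letters n \<Longrightarrow> bas x \<in> sl n"
  using Emat_in_sl[of "fst x" "snd x" n] by (simp add: bas_neg)

lemma act_word_simps [simp]:
  "act_word \<rho> [] x = x" "act_word \<rho> (b # w) x = \<rho> (bas b) (act_word \<rho> w x)"
  "act_word \<rho> (w @ w') x = act_word \<rho> w (act_word \<rho> w' x)"
  by (simp_all add: act_word_def)

section \<open>Modules over sl(n+1), highest weight vectors and weight spaces\<close>

locale sl_module = vector_space sc for sc :: "complex \<Rightarrow> 'v::ab_group_add \<Rightarrow> 'v" +
  fixes n :: nat and \<rho> :: "mat \<Rightarrow> 'v \<Rightarrow> 'v"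
  assumes lie: "lie_module n sc \<rho>"
begin

lemma lin: "A \<in> sl n \<Longrightarrow> Vector_Spaces.linear sc sc (\<rho> A)"
  using lie by (simp add: lie_module_def)

lemma
  assumes "A \<in> sl n"
  shows rho_add: "\<rho> A (x + y) = \<rho> A x + \<rho> A y"
    and rho_scale: "\<rho> A (sc c x) = sc c (\<rho> A x)"
    and rho_zero: "\<rho> A 0 = 0"
    and rho_diff: "\<rho> A (x - y) = \<rho> A x - \<rho> A y"
    and rho_sum: "\<rho> A (\<Sum>i\<in>I. f i) = (\<Sum>i\<in>I. \<rho> A (f i))"
proof -
  interpret L: Vector_Spaces.linear sc sc "\<rho> A" using lin[OF assms] .
  show "\<rho> A (x + y) = \<rho> A x + \<rho> A y" "\<rho> A (sc c x) = sc c (\<rho> A x)" "\<rho> A 0 = 0"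
    "\<rho> A (x - y) = \<rho> A x - \<rho> A y" "\<rho> A (\<Sum>i\<in>I. f i) = (\<Sum>i\<in>I. \<rho> A (f i))"
    by (simp_all add: L.add L.scale L.zero L.diff L.sum)
qed

lemma rho_span_image:
  assumes A: "A \<in> sl n" and "\<And>x. x \<in> X \<Longrightarrow> \<rho> A x \<in> span Y" and z: "z \<in> span X"
  shows "\<rho> A z \<in> span Y"
  using z
proof (induction rule: span_induct_alt)
  case base show ?case by (simp add: rho_zero[OF A] span_zero)
next
  case (step c x y)
  then show ?case using assms(2) by (simp add: rho_add[OF A] rho_scale[OF A] span_add span_scale)
qed

lemma rho_add_left: "A \<in> sl n \<Longrightarrow> B \<in> sl n \<Longrightarrow> \<rho> (\<lambda>a b. A a b + B a b) x = \<rho> A x + \<rho> B x"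
  using lie by (simp add: lie_module_def)

lemma rho_scale_left: "A \<in> sl n \<Longrightarrow> \<rho> (\<lambda>a b. c * A a b) x = sc c (\<rho> A x)"
  using lie by (simp add: lie_module_def)

lemma rho_zero_left: "\<rho> (\<lambda>a b. 0) x = 0"
  using rho_scale_left[OF zero_in_sl, of 0 x] by simp

lemma rho_brk: "A \<in> sl n \<Longrightarrow> B \<in> sl n \<Longrightarrow> \<rho> A (\<rho> B x) = \<rho> B (\<rho> A x) + \<rho> (brk n A B) x"
  using lie by (simp add: lie_module_def)

lemma rho_sum_left:
  "finite K \<Longrightarrow> (\<And>k. k \<in> K \<Longrightarrow> B k \<in> sl n) \<Longrightarrow>
    \<rho> (\<lambda>a b. \<Sum>k\<in>K. c k * B k a b) x = (\<Sum>k\<in>K. sc (c k) (\<rho> (B k) x))"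
proof (induction K rule: finite_induct)
  case empty show ?case by (simp add: rho_zero_left)
next
  case (insert k K)
  then show ?case
    using rho_add_left[OF scale_in_sl[of "B k" n "c k"] sum_in_sl[of K B n c], of x]
    by (simp add: rho_scale_left)
qed

lemma rho_expand:
  assumes A: "A \<in> sl n"
  shows "\<rho> A x = \<rho> (\<lambda>a b. if a = b then A a b else 0) x
    + (\<Sum>l\<in>sl_letters n. sc (A (fst l) (snd l)) (\<rho> (Emat (fst l) (snd l)) x))"
proof -
  note e = sl_expand[OF A]
  have "\<rho> A x = \<rho> (\<lambda>a b. if a = b then A a b else 0) x +
    \<rho> (\<lambda>a b. \<Sum>x\<in>sl_letters n. A (fst x) (snd x) * Emat (fst x) (snd x) a b) x"
    by (subst e(2)) (rule rho_add_left[OF cartan_imp_sl[OF e(1)]], rule sum_in_sl, auto intro: Emat_in_sl)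
  also have "\<rho> (\<lambda>a b. \<Sum>x\<in>sl_letters n. A (fst x) (snd x) * Emat (fst x) (snd x) a b) x
    = (\<Sum>l\<in>sl_letters n. sc (A (fst l) (snd l)) (\<rho> (Emat (fst l) (snd l)) x))"
    by (rule rho_sum_left) (auto intro: Emat_in_sl)
  finally show ?thesis .
qed

lemma rho_cartan:
  assumes H: "H \<in> cartan n" and "\<And>k. k \<in> {1..n} \<Longrightarrow> \<rho> (hv k) x = sc (mu k) x"
  shows "\<rho> H x = sc (weval n mu H) x"
proof -
  have "\<rho> H x = (\<Sum>k\<in>{1..n}. sc (\<Sum>c=1..k. H c c) (\<rho> (hv k) x))"
    by (subst cartan_expand[OF H]) (rule rho_sum_left, simp, blast intro: cartan_imp_sl hv_in_cartan)
  also have "\<dots> = (\<Sum>k\<in>{1..n}. sc (mu k * (\<Sum>c=1..k. H c c)) x)"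
    by (rule sum.cong) (simp_all add: assms(2) mult.commute)
  also have "\<dots> = sc (weval n mu H) x" by (simp only: weval_def scale_sum_left)
  finally show ?thesis .
qed

lemma linear_act_word:
  assumes "\<And>b. b \<in> set w \<Longrightarrow> bas b \<in> sl n"
  shows act_word_add: "act_word \<rho> w (x + y) = act_word \<rho> w x + act_word \<rho> w y"
    and act_word_scale: "act_word \<rho> w (sc c x) = sc c (act_word \<rho> w x)"
    and act_word_zero: "act_word \<rho> w 0 = 0"
    and act_word_sum: "act_word \<rho> w (\<Sum>i\<in>I. f i) = (\<Sum>i\<in>I. act_word \<rho> w (f i))"
  using assms by (induction w) (simp_all add: rho_add rho_scale rho_zero rho_sum)

end

text \<open>Irreducibility stays outside the locale because it is also instantiated at truncated
  Gelfand-Tsetlin modules, at products of two modules, at blocks, and at singular vectors.\<close>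

locale hw_module = sl_module +
  fixes lam :: weight and v0 :: 'a
  assumes hw: "hw_vector n sc \<rho> lam v0"
begin

text \<open>The bound on the length is strict: \<open>wspan 0 U\<close> is zero, and
  \<open>wspan (length w) U\<close> contains exactly the contributions of words shorter than
  \<open>w\<close>.\<close>

definition words :: "nat \<Rightarrow> (nat \<Rightarrow> int) set \<Rightarrow> 'a set" where
  "words k U = {act_word \<rho> w v0 | w. set w \<subseteq> neg_letters n \<and> length w < k \<and> mset_wt (mset w) \<in> U}"

definition wspan :: "nat \<Rightarrow> (nat \<Rightarrow> int) set \<Rightarrow> 'a set" where
  "wspan k U = span (words k U)"

lemma wspan_mono: "k \<le> k' \<Longrightarrow> U \<subseteq> U' \<Longrightarrow> wspan k U \<subseteq> wspan k' U'"
  unfolding wspan_def by (rule span_mono) (force simp: words_def)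

lemma word_in_wspan:
  "set w \<subseteq> neg_letters n \<Longrightarrow> length w < k \<Longrightarrow> mset_wt (mset w) \<in> U \<Longrightarrow> act_word \<rho> w v0 \<in> wspan k U"
  unfolding wspan_def by (rule span_base) (auto simp: words_def)

lemma neg_in_sl: "x \<in> neg_letters n \<Longrightarrow> bas x \<in> sl n"
  using neg_letters_subset bas_in_sl by blast

lemma bas_neg': "x \<in> neg_letters n \<Longrightarrow> bas x = Emat (fst x) (snd x)"
  using neg_letters_subset bas_neg by blast

lemma wspan_step:
  assumes y: "y \<in> neg_letters n" and x: "x \<in> wspan k U"
  shows "\<rho> (bas y) x \<in> wspan (Suc k) ((\<lambda>\<nu> c. letter_wt y c + \<nu> c) ` U)"
  unfolding wspan_def
proof (rule rho_span_image[OF neg_in_sl[OF y] _ x[unfolded wspan_def]])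
  fix z assume "z \<in> words k U"
  then obtain w where w: "z = act_word \<rho> w v0" "set w \<subseteq> neg_letters n" "length w < k" "mset_wt (mset w) \<in> U"
    by (auto simp: words_def)
  show "\<rho> (bas y) z \<in> span (words (Suc k) ((\<lambda>\<nu> c. letter_wt y c + \<nu> c) ` U))"
    by (rule span_base) (use w y in \<open>force simp: words_def intro!: exI[of _ "y # w"]\<close>)
qed

lemma wspan_step_UNIV: "y \<in> neg_letters n \<Longrightarrow> x \<in> wspan k UNIV \<Longrightarrow> \<rho> (bas y) x \<in> wspan (Suc k) UNIV"
  using wspan_step[of y x k UNIV] wspan_mono[of "Suc k" "Suc k" _ UNIV] by blast

lemma v0_nonzero: "v0 \<noteq> 0" using hw by (simp add: hw_vector_def)

lemma rho_upper_v0: "a \<in> {1..Suc n} \<Longrightarrow> b \<in> {1..Suc n} \<Longrightarrow> a < b \<Longrightarrow> \<rho> (Emat a b) v0 = 0"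
  using hw by (simp add: hw_vector_def)

lemma rho_cartan_v0: "H \<in> cartan n \<Longrightarrow> \<rho> H v0 = sc (weval n lam H) v0"
  using rho_cartan[of H v0 lam] hw by (simp add: hw_vector_def)

lemma rho_v0: "A \<in> sl n \<Longrightarrow> \<rho> A v0 \<in> wspan 2 UNIV"
proof -
  assume A: "A \<in> sl n"
  have "\<rho> (Emat (fst l) (snd l)) v0 \<in> wspan 2 UNIV" if l: "l \<in> sl_letters n" for l
  proof (cases "l \<in> neg_letters n")
    case True
    then show ?thesis using word_in_wspan[of "[l]" 2 UNIV] bas_neg' by simp
  next
    case False
    then have "\<rho> (Emat (fst l) (snd l)) v0 = 0"
      using l by (intro rho_upper_v0) (auto simp: sl_letters_def neg_letters_def)
    then show ?thesis by (simp add: wspan_def span_zero)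
  qed
  moreover have "\<rho> (\<lambda>a b. if a = b then A a b else 0) v0 \<in> wspan 2 UNIV"
    using rho_cartan_v0[OF sl_expand(1)[OF A]] word_in_wspan[of "[]" 2 UNIV]
    by (simp add: wspan_def span_scale)
  ultimately show ?thesis
    unfolding wspan_def by (subst rho_expand[OF A]) (auto intro!: span_add span_sum span_scale)
qed

text \<open>Commuting \<open>A\<close> past the first letter leaves a bracket that is again in
  \<open>sl n\<close> and acts on a shorter word, so an element of the algebra lengthens words by at
  most one.\<close>

lemma rho_word_filtered:
  "A \<in> sl n \<Longrightarrow> set w \<subseteq> neg_letters n \<Longrightarrow> \<rho> A (act_word \<rho> w v0) \<in> wspan (length w + 2) UNIV"
proof (induction w arbitrary: A)
  case Nil then show ?case using rho_v0 by (simp add: numeral_2_eq_2)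
next
  case (Cons y w)
  then have y: "y \<in> neg_letters n" by simp
  have "\<rho> A (act_word \<rho> (y # w) v0) = \<rho> (bas y) (\<rho> A (act_word \<rho> w v0)) + \<rho> (brk n A (bas y)) (act_word \<rho> w v0)"
    using rho_brk[OF Cons.prems(1) neg_in_sl[OF y]] by simp
  moreover have "\<rho> (bas y) (\<rho> A (act_word \<rho> w v0)) \<in> wspan (length (y # w) + 2) UNIV"
    using wspan_step_UNIV[OF y Cons.IH[of A]] Cons.prems by simp
  moreover have "\<rho> (brk n A (bas y)) (act_word \<rho> w v0) \<in> wspan (length (y # w) + 2) UNIV"
    using Cons.IH[OF brk_in_sl[OF Cons.prems(1) neg_in_sl[OF y]]] Cons.prems
      wspan_mono[of "length w + 2" "length (y # w) + 2" UNIV UNIV] by auto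
  ultimately show ?case by (simp add: wspan_def span_add)
qed

lemma rho_wspan:
  assumes A: "A \<in> sl n" and x: "x \<in> wspan k UNIV"
  shows "\<rho> A x \<in> wspan (Suc k) UNIV"
  unfolding wspan_def[of "Suc k"]
proof (rule rho_span_image[OF A _ x[unfolded wspan_def]], fold wspan_def)
  fix x assume "x \<in> words k UNIV"
  then obtain w where w: "x = act_word \<rho> w v0" "set w \<subseteq> neg_letters n" "length w < k" by (auto simp: words_def)
  then show "\<rho> A x \<in> wspan (Suc k) UNIV"
    using rho_word_filtered[OF A w(2)] wspan_mono[of "length w + 2" "Suc k" UNIV UNIV] by auto
qed

text \<open>The weight space of weight \<open>lam + \<nu>\<close>, described by spanning words
  instead of eigenvalue equations; the eigenvalues follow in
  \<open>rho_cartan_wt_space\<close>.\<close>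

definition wt_space :: "(nat \<Rightarrow> int) \<Rightarrow> 'a set" where
  "wt_space \<nu> = span {act_word \<rho> w v0 | w. set w \<subseteq> neg_letters n \<and> mset_wt (mset w) = \<nu>}"

lemma word_in_wt_space: "set w \<subseteq> neg_letters n \<Longrightarrow> mset_wt (mset w) = \<nu> \<Longrightarrow> act_word \<rho> w v0 \<in> wt_space \<nu>"
  unfolding wt_space_def by (rule span_base) auto

lemma wt_space_step:
  assumes y: "y \<in> neg_letters n" and x: "x \<in> wt_space \<nu>"
  shows "\<rho> (bas y) x \<in> wt_space (\<lambda>c. letter_wt y c + \<nu> c)"
  unfolding wt_space_def
proof (rule rho_span_image[OF neg_in_sl[OF y] _ x[unfolded wt_space_def]])
  fix z assume "z \<in> {act_word \<rho> w v0 |w. set w \<subseteq> neg_letters n \<and> mset_wt (mset w) = \<nu>}"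
  then obtain w where w: "z = act_word \<rho> w v0" "set w \<subseteq> neg_letters n" "mset_wt (mset w) = \<nu>"
    by auto
  show "\<rho> (bas y) z \<in> span {act_word \<rho> w v0 |w. set w \<subseteq> neg_letters n \<and> mset_wt (mset w) = (\<lambda>c. letter_wt y c + \<nu> c)}"
    by (rule span_base) (use w y in \<open>force intro!: exI[of _ "y # w"]\<close>)
qed

lemma brk_cartan_letter:
  assumes "H \<in> cartan n" "y \<in> sl_letters n"
  shows "brk n H (bas y) = (\<lambda>a b. (H (fst y) (fst y) - H (snd y) (snd y)) * bas y a b)"
  using assms unfolding brk_def bas_neg[OF assms(2)]
  by (subst mmul_Emat_right, force simp: sl_letters_def, subst mmul_Emat_left, force simp: sl_letters_def)
    (auto simp: Emat_def fun_eq_iff cartan_def)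

text \<open>The value at \<open>H\<close> of the weight \<open>lam + \<nu>\<close>, combining Dynkin
  coordinates for \<open>lam\<close> with epsilon coordinates for \<open>\<nu>\<close>.\<close>

definition cart_eig :: "mat \<Rightarrow> (nat \<Rightarrow> int) \<Rightarrow> complex" where
  "cart_eig H \<nu> = weval n lam H + (\<Sum>c=1..Suc n. of_int (\<nu> c) * H c c)"

lemma cart_eig_add: 
  assumes "y \<in> sl_letters n"
  shows "cart_eig H (\<lambda>c. letter_wt y c + \<nu> c) = H (fst y) (fst y) - H (snd y) (snd y) + cart_eig H \<nu>"
proof -
  have "(\<Sum>c=1..Suc n. of_int (letter_wt y c + \<nu> c) * H c c)
    = (\<Sum>c=1..Suc n. (if c = fst y then H (fst y) (fst y) else 0) - (if c = snd y then H (snd y) (snd y) else 0) + of_int (\<nu> c) * H c c)"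
    by (rule sum.cong) (auto simp: letter_wt_def algebra_simps)
  also have "\<dots> = H (fst y) (fst y) - H (snd y) (snd y) + (\<Sum>c=1..Suc n. of_int (\<nu> c) * H c c)"
    unfolding sum.distrib sum_subtractf using assms
    by (simp only: sum.delta finite_atLeastAtMost) (auto simp: sl_letters_def)
  finally show ?thesis by (simp add: cart_eig_def)
qed

lemma rho_cartan_word:
  "H \<in> cartan n \<Longrightarrow> set w \<subseteq> neg_letters n \<Longrightarrow>
    \<rho> H (act_word \<rho> w v0) = sc (cart_eig H (mset_wt (mset w))) (act_word \<rho> w v0)"
proof (induction w)
  case Nil
  then show ?case using rho_cartan_v0 by (simp add: cart_eig_def)
next
  case (Cons y w)
  then have y: "y \<in> neg_letters n" and ysl: "y \<in> sl_letters n" using neg_letters_subset by auto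
  have "\<rho> H (act_word \<rho> (y # w) v0) = \<rho> (bas y) (\<rho> H (act_word \<rho> w v0)) + \<rho> (brk n H (bas y)) (act_word \<rho> w v0)"
    using rho_brk[OF cartan_imp_sl[OF Cons.prems(1)] neg_in_sl[OF y]] by simp
  also have "\<dots> = sc (cart_eig H (mset_wt (mset (y # w)))) (act_word \<rho> (y # w) v0)"
    using Cons ysl by (simp add: brk_cartan_letter rho_scale_left bas_in_sl rho_scale cart_eig_add scale_left_distrib add.commute)
  finally show ?case .
qed

lemma rho_cartan_wt_space:
  assumes "H \<in> cartan n" "x \<in> wt_space \<nu>"
  shows "\<rho> H x = sc (cart_eig H \<nu>) x"
  using assms(2) unfolding wt_space_def
proof (induction rule: span_induct_alt)
  case base then show ?case using rho_zero cartan_imp_sl assms(1) by simp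
next
  case (step c x y)
  then show ?case using rho_cartan_word[OF assms(1)] cartan_imp_sl[OF assms(1)]
    by (auto simp: rho_add rho_scale scale_right_distrib mult.commute)
qed

text \<open>Commuting the matrix unit past the first letter produces a Cartan element, another
  matrix unit up to sign, or zero. The Cartan case is covered by \<open>rho_cartan_word\<close>, the
  others by induction, which therefore runs over all \<open>c\<close> and \<open>d\<close>.\<close>

lemma Emat_word_wt:
  "(c,d) \<in> sl_letters n \<Longrightarrow> set w \<subseteq> neg_letters n \<Longrightarrow>
    \<rho> (Emat c d) (act_word \<rho> w v0) \<in> wt_space (\<lambda>a. letter_wt (c,d) a + mset_wt (mset w) a)"
proof (induction w arbitrary: c d)
  case Nil
  show ?case
  proof (cases "(c,d) \<in> neg_letters n")
    case True
    then show ?thesis using word_in_wt_space[of "[(c,d)]"] bas_neg'[OF True] by simp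
  next
    case False
    then show ?thesis using Nil rho_upper_v0[of c d]
      by (auto simp: sl_letters_def neg_letters_def wt_space_def span_zero)
  qed
next
  case (Cons y w)
  then have y: "y \<in> neg_letters n" and ysl: "y \<in> sl_letters n" and w: "set w \<subseteq> neg_letters n"
    using neg_letters_subset by auto
  obtain r s where rs: "y = (r,s)" by force
  let ?U = "wt_space (\<lambda>a. letter_wt (c,d) a + mset_wt (mset (y # w)) a)"
  let ?x = "act_word \<rho> w v0"
  have mem: "c \<in> {1..Suc n}" "d \<in> {1..Suc n}" "r \<in> {1..Suc n}" "s \<in> {1..Suc n}" "c \<noteq> d" "r \<noteq> s"
    using Cons.prems(1) ysl rs by (auto simp: sl_letters_def)
  have eq: "\<rho> (Emat c d) (act_word \<rho> (y # w) v0) = \<rho> (bas y) (\<rho> (Emat c d) ?x) + \<rho> (brk n (Emat c d) (bas y)) ?x"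
    using rho_brk[OF Emat_in_sl[OF Cons.prems(1)] neg_in_sl[OF y]] by simp
  have 1: "\<rho> (bas y) (\<rho> (Emat c d) ?x) \<in> ?U"
    using wt_space_step[OF y Cons.IH[OF Cons.prems(1) w]] by (simp add: add.left_commute)
  have br: "brk n (Emat c d) (bas y) = (\<lambda>a b. (if d = r then Emat c s a b else 0) - (if s = c then Emat r d a b else 0))"
    using brk_Emat[OF mem(1-4)] unfolding bas_neg[OF ysl] by (simp add: rs)
  consider "d = r" "s = c" | "d = r" "s \<noteq> c" | "d \<noteq> r" "s = c" | "d \<noteq> r" "s \<noteq> c" by blast
  then have 2: "\<rho> (brk n (Emat c d) (bas y)) ?x \<in> ?U"
  proof cases
    case 1
    have "brk n (Emat c d) (bas y) \<in> cartan n"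
      using brk_in_sl[OF Emat_in_sl[OF Cons.prems(1)] neg_in_sl[OF y]]
      unfolding cartan_def mem_Collect_eq br using 1 by (auto simp: Emat_def)
    then have "\<rho> (brk n (Emat c d) (bas y)) ?x = sc (cart_eig (brk n (Emat c d) (bas y)) (mset_wt (mset w))) ?x"
      using rho_cartan_word w by blast
    moreover have "?x \<in> ?U" by (rule word_in_wt_space[OF w]) (auto simp: rs 1 letter_wt_def fun_eq_iff)
    ultimately show ?thesis by (simp add: wt_space_def span_scale)
  next
    case 2
    then have "brk n (Emat c d) (bas y) = Emat c s" unfolding br by simp
    moreover have "(c,s) \<in> sl_letters n" using mem 2 by (auto simp: sl_letters_def)
    then have "\<rho> (Emat c s) ?x \<in> wt_space (\<lambda>a. letter_wt (c,s) a + mset_wt (mset w) a)" using Cons.IH w by blast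
    moreover have "(\<lambda>a. letter_wt (c,s) a + mset_wt (mset w) a) = (\<lambda>a. letter_wt (c,d) a + mset_wt (mset (y # w)) a)"
      by (auto simp: rs 2 letter_wt_def fun_eq_iff)
    ultimately show ?thesis by simp
  next
    case 3
    then have "brk n (Emat c d) (bas y) = (\<lambda>a b. (-1) * Emat r d a b)" unfolding br by simp
    moreover have rd: "(r,d) \<in> sl_letters n" using mem 3 by (auto simp: sl_letters_def)
    then have "\<rho> (Emat r d) ?x \<in> wt_space (\<lambda>a. letter_wt (r,d) a + mset_wt (mset w) a)" using Cons.IH w by blast
    moreover have "(\<lambda>a. letter_wt (r,d) a + mset_wt (mset w) a) = (\<lambda>a. letter_wt (c,d) a + mset_wt (mset (y # w)) a)"
      by (auto simp: rs 3 letter_wt_def fun_eq_iff)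
    ultimately show ?thesis using rho_scale_left[OF Emat_in_sl[OF rd], of "-1"] by (simp add: wt_space_def span_neg)
  next
    case 4
    then have "brk n (Emat c d) (bas y) = (\<lambda>a b. 0)" unfolding br by simp
    then show ?thesis by (simp add: rho_zero_left wt_space_def span_zero)
  qed
  show ?case unfolding eq using 1 2 by (simp add: wt_space_def span_add)
qed

lemma Emat_wt_space:
  assumes cd: "(c,d) \<in> sl_letters n" and x: "x \<in> wt_space \<nu>"
  shows "\<rho> (Emat c d) x \<in> wt_space (\<lambda>a. letter_wt (c,d) a + \<nu> a)"
  unfolding wt_space_def[of "\<lambda>a. letter_wt (c,d) a + \<nu> a"]
proof (rule rho_span_image[OF Emat_in_sl[OF cd] _ x[unfolded wt_space_def]], fold wt_space_def)
  fix z assume "z \<in> {act_word \<rho> w v0 |w. set w \<subseteq> neg_letters n \<and> mset_wt (mset w) = \<nu>}"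
  then show "\<rho> (Emat c d) z \<in> wt_space (\<lambda>a. letter_wt (c,d) a + \<nu> a)"
    using Emat_word_wt[OF cd] by auto
qed

text \<open>Two strictly lower matrix units cannot be composable in both orders, so their bracket is
  a single lowering letter up to sign, or zero. Two letters are thus traded for one of the same
  total weight.\<close>

lemma neg_commutator:
  assumes x: "x \<in> neg_letters n" and y: "y \<in> neg_letters n" and z: "z \<in> wspan k {\<nu>}"
  shows "\<rho> (bas y) (\<rho> (bas x) z) - \<rho> (bas x) (\<rho> (bas y) z)
    \<in> wspan (Suc k) {\<lambda>c. letter_wt x c + letter_wt y c + \<nu> c}"
proof -
  obtain r s where rs: "y = (r,s)" by force
  obtain c d where cd: "x = (c,d)" by force
  have m: "r \<in> {1..Suc n}" "s \<in> {1..Suc n}" "c \<in> {1..Suc n}" "d \<in> {1..Suc n}" "s < r" "d < c"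
    using x y by (auto simp: rs cd neg_letters_def)
  let ?B = "brk n (bas y) (bas x)"
  have br: "?B = (\<lambda>a b. (if s = c then Emat r d a b else 0) - (if d = r then Emat c s a b else 0))"
    using brk_Emat[OF m(1-4)] unfolding bas_neg'[OF x] bas_neg'[OF y] by (simp add: rs cd)
  have "\<rho> (bas y) (\<rho> (bas x) z) - \<rho> (bas x) (\<rho> (bas y) z) = \<rho> ?B z"
    using rho_brk[OF neg_in_sl[OF y] neg_in_sl[OF x]] by simp
  moreover consider "s = c" "d \<noteq> r" | "s \<noteq> c" "d = r" | "s \<noteq> c" "d \<noteq> r" using m by fastforce
  then have "\<rho> ?B z \<in> wspan (Suc k) {\<lambda>c. letter_wt x c + letter_wt y c + \<nu> c}"
  proof cases
    case 1
    then have l: "(r,d) \<in> neg_letters n" and B: "?B = bas (r,d)" using m unfolding br by (auto simp: neg_letters_def bas_def)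
    have "(\<lambda>a. letter_wt x a + letter_wt y a + \<nu> a) = (\<lambda>a. letter_wt (r,d) a + \<nu> a)"
      using 1 by (auto simp: rs cd letter_wt_def)
    then show ?thesis unfolding B using wspan_step[OF l z] by simp
  next
    case 2
    then have l: "(c,s) \<in> neg_letters n" and B: "?B = (\<lambda>a b. (-1) * bas (c,s) a b)"
      using m unfolding br by (auto simp: neg_letters_def bas_def fun_eq_iff)
    have "\<rho> (bas (c,s)) z \<in> wspan (Suc k) {\<lambda>c. letter_wt x c + letter_wt y c + \<nu> c}"
    proof -
      have "(\<lambda>a. letter_wt x a + letter_wt y a + \<nu> a) = (\<lambda>a. letter_wt (c,s) a + \<nu> a)"
        using 2 by (auto simp: rs cd letter_wt_def)
      then show ?thesis using wspan_step[OF l z] by simp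
    qed
    then show ?thesis using rho_scale_left[OF neg_in_sl[OF l], of "-1"] by (simp add: B wspan_def span_neg)
  next
    case 3
    then have "?B = (\<lambda>a b. 0)" unfolding br by simp
    then show ?thesis by (simp add: rho_zero_left wspan_def span_zero)
  qed
  ultimately show ?thesis by simp
qed

section \<open>Reordering words: the spanning half of the Poincare-Birkhoff-Witt theorem\<close>

lemma move_letter:
  assumes y: "y \<in> neg_letters n" and t: "set t \<subseteq> neg_letters n"
  shows "set u \<subseteq> neg_letters n \<Longrightarrow>
    act_word \<rho> (y # u @ t) v0 - act_word \<rho> (u @ y # t) v0
      \<in> wspan (Suc (length u + length t)) {mset_wt (mset (y # u @ t))}"
proof (induction u)
  case Nil show ?case by (simp add: wspan_def span_zero)
next
  case (Cons x u)
  then have x: "x \<in> neg_letters n" by simp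
  let ?z = "act_word \<rho> (u @ t) v0"
  let ?z' = "act_word \<rho> (u @ y # t) v0"
  have "?z \<in> wspan (Suc (length u + length t)) {mset_wt (mset (u @ t))}"
    by (rule word_in_wspan) (use Cons t in auto)
  note 1 = neg_commutator[OF x y this]
  note 2 = wspan_step[OF x Cons.IH]
  have e: "act_word \<rho> (y # (x # u) @ t) v0 - act_word \<rho> ((x # u) @ y # t) v0
    = (\<rho> (bas y) (\<rho> (bas x) ?z) - \<rho> (bas x) (\<rho> (bas y) ?z)) + \<rho> (bas x) (\<rho> (bas y) ?z - ?z')"
    by (simp add: rho_diff[OF neg_in_sl[OF x]])
  show ?case unfolding e wspan_def
    by (rule span_add; fold wspan_def)
      (use 1 2 Cons.prems in \<open>simp_all add: add.commute add.left_commute\<close>)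
qed

text \<open>Bringing the first letter of \<open>w\<close> to its position in \<open>w'\<close> costs
  only shorter words of the same weight; the remaining letters are reordered by induction.\<close>

lemma reorder:
  "set w \<subseteq> neg_letters n \<Longrightarrow> mset w = mset w' \<Longrightarrow>
    act_word \<rho> w v0 - act_word \<rho> w' v0 \<in> wspan (length w) {mset_wt (mset w)}"
proof (induction w arbitrary: w')
  case Nil then show ?case by (simp add: wspan_def span_zero)
next
  case (Cons y w)
  then have "y \<in> set w'" by (metis list.set_intros(1) set_mset_mset)
  then obtain u t where w': "w' = u @ y # t" by (meson split_list)
  then have m: "mset w = mset (u @ t)" using Cons.prems by simp
  have st: "set u \<subseteq> neg_letters n" "set t \<subseteq> neg_letters n" "y \<in> neg_letters n"
    using Cons.prems mset_eq_setD[OF Cons.prems(2)] w' by auto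
  have len: "length w = length u + length t" using mset_eq_length[OF m] by simp
  have 1: "\<rho> (bas y) (act_word \<rho> w v0 - act_word \<rho> (u @ t) v0) \<in> wspan (length (y # w)) {mset_wt (mset (y # w))}"
    using wspan_step[OF st(3) Cons.IH[OF _ m]] Cons.prems(1) by simp
  have 2: "act_word \<rho> (y # u @ t) v0 - act_word \<rho> (u @ y # t) v0 \<in> wspan (length (y # w)) {mset_wt (mset (y # w))}"
    using move_letter[OF st(3,2,1)] unfolding mset.simps m by (simp add: len add.commute)
  have "act_word \<rho> (y # w) v0 - act_word \<rho> w' v0
    = \<rho> (bas y) (act_word \<rho> w v0 - act_word \<rho> (u @ t) v0) + (act_word \<rho> (y # u @ t) v0 - act_word \<rho> (u @ y # t) v0)"
    by (simp add: rho_diff[OF neg_in_sl[OF st(3)]] w')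
  then show ?case using 1 2 by (simp add: wspan_def span_add)
qed

end

text \<open>An ordering of the letters is chosen for each multiset separately, without coherence
  between different multisets. The Levi blocks exploit this freedom: an ordering given on a block is
  extended arbitrarily to the remaining multisets.\<close>

definition word_choice :: "((nat \<times> nat) multiset \<Rightarrow> (nat \<times> nat) list) \<Rightarrow> bool" where
  "word_choice wd \<longleftrightarrow> (\<forall>m. mset (wd m) = m)"

lemma word_choice_set: "word_choice wd \<Longrightarrow> set (wd m) = set_mset m"
  by (metis set_mset_mset word_choice_def)

lemma word_choice_length: "word_choice wd \<Longrightarrow> length (wd m) = size m"
  by (metis size_mset word_choice_def)

lemma word_choice_exists: "\<exists>wd. word_choice wd"
  unfolding word_choice_def by (metis ex_mset)

context hw_module begin

text \<open>By \<open>reorder\<close>, \<open>w\<close> differs from the chosen word with the same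
  letters by shorter words of the same weight, to which the induction applies. Length and weight
  bounds are carried along for the later counts.\<close>

lemma pbw_spanning:
  assumes wd: "word_choice wd"
  shows "set w \<subseteq> neg_letters n \<Longrightarrow> act_word \<rho> w v0 \<in>
    span {act_word \<rho> (wd m) v0 | m. set_mset m \<subseteq> neg_letters n \<and> size m \<le> length w \<and> mset_wt m = mset_wt (mset w)}"
proof (induction w rule: length_induct)
  case (1 w)
  let ?S = "{act_word \<rho> (wd m) v0 | m. set_mset m \<subseteq> neg_letters n \<and> size m \<le> length w \<and> mset_wt m = mset_wt (mset w)}"
  have "words (length w) {mset_wt (mset w)} \<subseteq> span ?S"
  proof
    fix x assume "x \<in> words (length w) {mset_wt (mset w)}"
    then obtain w' where w': "x = act_word \<rho> w' v0" "set w' \<subseteq> neg_letters n" "length w' < length w"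
      "mset_wt (mset w') = mset_wt (mset w)" by (auto simp: words_def)
    then have "x \<in> span {act_word \<rho> (wd m) v0 | m. set_mset m \<subseteq> neg_letters n \<and> size m \<le> length w' \<and> mset_wt m = mset_wt (mset w')}"
      using "1.IH" by blast
    then show "x \<in> span ?S" using w' by (elim set_mp[OF span_mono, rotated]) force
  qed
  then have sub: "wspan (length w) {mset_wt (mset w)} \<subseteq> span ?S"
    unfolding wspan_def by (simp add: span_minimal)
  have "mset w = mset (wd (mset w))" using wd by (simp add: word_choice_def)
  from reorder[OF "1.prems" this] sub
  have "act_word \<rho> w v0 - act_word \<rho> (wd (mset w)) v0 \<in> span ?S" by blast
  moreover have "act_word \<rho> (wd (mset w)) v0 \<in> span ?S"
    by (rule span_base) (use "1.prems" in \<open>auto intro!: exI[of _ "mset w"]\<close>)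
  ultimately show ?case using span_add by fastforce
qed

lemma wspan_pbw:
  assumes "word_choice wd"
  shows "wspan k UNIV \<subseteq> span {act_word \<rho> (wd m) v0 | m. set_mset m \<subseteq> neg_letters n \<and> size m < k}"
  unfolding wspan_def
proof (rule span_minimal)
  show "words k UNIV \<subseteq> span {act_word \<rho> (wd m) v0 |m. set_mset m \<subseteq> neg_letters n \<and> size m < k}"
  proof
    fix x assume "x \<in> words k UNIV"
    then obtain w where w: "x = act_word \<rho> w v0" "set w \<subseteq> neg_letters n" "length w < k" by (auto simp: words_def)
    show "x \<in> span {act_word \<rho> (wd m) v0 |m. set_mset m \<subseteq> neg_letters n \<and> size m < k}"
      unfolding w(1) by (rule set_mp[OF span_mono pbw_spanning[OF assms w(2)]]) (use w(3) in force)
  qed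
qed simp

definition pbw_all :: "'a set" where
  "pbw_all = span {act_word \<rho> w v0 | w. set w \<subseteq> neg_letters n}"

lemma pbw_all_stable:
  assumes A: "A \<in> sl n" and x: "x \<in> pbw_all"
  shows "\<rho> A x \<in> pbw_all"
  unfolding pbw_all_def
proof (rule rho_span_image[OF A _ x[unfolded pbw_all_def]])
  fix x assume "x \<in> {act_word \<rho> w v0 | w. set w \<subseteq> neg_letters n}"
  then obtain w where w: "x = act_word \<rho> w v0" "set w \<subseteq> neg_letters n" by auto
  have "wspan (length w + 2) UNIV \<subseteq> span {act_word \<rho> w v0 |w. set w \<subseteq> neg_letters n}"
    unfolding wspan_def by (rule span_mono) (auto simp: words_def)
  then show "\<rho> A x \<in> span {act_word \<rho> w v0 |w. set w \<subseteq> neg_letters n}"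
    using rho_word_filtered[OF A w(2)] w(1) by blast
qed

lemma pbw_all_eq:
  assumes "word_choice wd"
  shows "pbw_all = span {act_word \<rho> (wd m) v0 | m. set_mset m \<subseteq> neg_letters n}"
proof
  show "pbw_all \<subseteq> span {act_word \<rho> (wd m) v0 | m. set_mset m \<subseteq> neg_letters n}"
    unfolding pbw_all_def
  proof (rule span_minimal)
    show "{act_word \<rho> w v0 |w. set w \<subseteq> neg_letters n} \<subseteq> span {act_word \<rho> (wd m) v0 |m. set_mset m \<subseteq> neg_letters n}"
    proof
      fix x assume "x \<in> {act_word \<rho> w v0 |w. set w \<subseteq> neg_letters n}"
      then obtain w where w: "x = act_word \<rho> w v0" "set w \<subseteq> neg_letters n" by auto
      show "x \<in> span {act_word \<rho> (wd m) v0 |m. set_mset m \<subseteq> neg_letters n}"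
        unfolding w(1) by (rule set_mp[OF span_mono pbw_spanning[OF assms w(2)]]) force
    qed
  qed simp
  show "span {act_word \<rho> (wd m) v0 | m. set_mset m \<subseteq> neg_letters n} \<subseteq> pbw_all"
    unfolding pbw_all_def by (rule span_mono) (use word_choice_set[OF assms] in blast)
qed

lemma pbw_all_UNIV:
  assumes "irreducible_mod n sc \<rho>"
  shows "pbw_all = UNIV"
proof -
  have "subspace pbw_all" by (simp add: pbw_all_def)
  moreover have "v0 \<in> pbw_all"
    unfolding pbw_all_def by (rule span_base) (auto intro!: exI[of _ "[]"])
  ultimately show ?thesis using assms pbw_all_stable v0_nonzero
    unfolding irreducible_mod_def by blast
qed

text \<open>Freeness of the submodule generated by \<open>v0\<close> over the enveloping algebra of
  the lowering operators: this submodule is then a Verma module.\<close>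

definition pbw_free :: "((nat \<times> nat) multiset \<Rightarrow> (nat \<times> nat) list) \<Rightarrow> bool" where
  "pbw_free wd \<longleftrightarrow> (\<forall>I c. finite I \<longrightarrow> (\<forall>m\<in>I. set_mset m \<subseteq> neg_letters n) \<longrightarrow>
     (\<Sum>m\<in>I. sc (c m) (act_word \<rho> (wd m) v0)) = 0 \<longrightarrow> (\<forall>m\<in>I. c m = 0))"

end

section \<open>Growth of operators and the principal orbit\<close>

text \<open>Some letter \<open>x\<close> occurs in \<open>m\<close> less often than in
  \<open>a0\<close>. This leaves at most \<open>count a0 x\<close> values for the multiplicity of
  \<open>x\<close> and fewer than or exactly \<open>M\<close> for each of the other
  \<open>card L - 1\<close> letters; summing over \<open>x\<close> gives the factor
  \<open>size a0\<close>.\<close>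

lemma card_multisets_avoiding:
  fixes M :: nat
  assumes L: "finite L" and a0: "set_mset a0 \<subseteq> L"
  defines "S \<equiv> {m. set_mset m \<subseteq> L \<and> size m < M \<and> \<not> a0 \<subseteq># m}"
  shows "finite S" "card S \<le> size a0 * M ^ (card L - 1)"
proof -
  define T where "T x = {m. set_mset m \<subseteq> L \<and> size m < M \<and> count m x < count a0 x}" for x
  have S: "S \<subseteq> (\<Union>x\<in>L. T x)"
  proof
    fix m assume m: "m \<in> S"
    then obtain x where x: "count m x < count a0 x" by (auto simp: S_def subseteq_mset_def not_le)
    then have "x \<in># a0" by (metis count_eq_zero_iff not_less_zero)
    then show "m \<in> (\<Union>x\<in>L. T x)" using x m a0 by (auto simp: S_def T_def)
  qed
  have T: "finite (T x) \<and> card (T x) \<le> count a0 x * M ^ (card L - 1)" if x: "x \<in> L" for x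
  proof -
    let ?Q = "PiE L (\<lambda>y. if y = x then {..<count a0 x} else {..<M})"
    have inj: "inj_on (\<lambda>m. restrict (count m) L) (T x)"
    proof (rule inj_onI, rule multiset_eqI)
      fix m m' y assume mm: "m \<in> T x" "m' \<in> T x" "restrict (count m) L = restrict (count m') L"
      show "count m y = count m' y"
      proof (cases "y \<in> L")
        case True then show ?thesis using fun_cong[OF mm(3), of y] by simp
      next
        case False
        then show ?thesis using mm by (metis (mono_tags, lifting) T_def count_eq_zero_iff mem_Collect_eq subsetD)
      qed
    qed
    have sub: "(\<lambda>m. restrict (count m) L) ` T x \<subseteq> ?Q"
    proof (rule image_subsetI, rule restrict_PiE_iff[THEN iffD2], rule ballI)
      fix m y assume m: "m \<in> T x" "y \<in> L"
      have "count m y < M" using m(1) count_le_size[of m y] by (simp add: T_def)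
      then show "count m y \<in> (if y = x then {..<count a0 x} else {..<M})" using m(1) by (auto simp: T_def)
    qed
    have fin: "finite ?Q" using L by (intro finite_PiE) auto
    have "card ?Q = (\<Prod>y\<in>L. if y = x then count a0 x else M)"
      using L by (subst card_PiE) (auto intro!: prod.cong)
    also have "\<dots> = count a0 x * (\<Prod>y\<in>L-{x}. if y = x then count a0 x else M)"
      using L x by (simp add: prod.remove)
    also have "(\<Prod>y\<in>L-{x}. if y = x then count a0 x else M) = (\<Prod>y\<in>L-{x}. M)"
      by (rule prod.cong) auto
    also have "\<dots> = M ^ (card L - 1)" using L x by simp
    finally have "card ?Q = count a0 x * M ^ (card L - 1)" .
    then show ?thesis using card_inj_on_le[OF inj sub fin] finite_imageD[OF finite_subset[OF sub fin] inj] by simp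
  qed
  then have finU: "finite (\<Union>x\<in>L. T x)" using L by blast
  then show "finite S" using S finite_subset by blast
  have "card S \<le> card (\<Union>x\<in>L. T x)" using card_mono[OF finU S] .
  also have "\<dots> \<le> (\<Sum>x\<in>L. card (T x))" by (rule card_UN_le[OF L])
  also have "\<dots> \<le> (\<Sum>x\<in>L. count a0 x * M ^ (card L - 1))" using T by (intro sum_mono) auto
  also have "\<dots> = (\<Sum>x\<in>L. count a0 x) * M ^ (card L - 1)" by (simp add: sum_distrib_right)
  also have "(\<Sum>x\<in>L. count a0 x) = (\<Sum>x\<in>set_mset a0. count a0 x)"
    using L a0 by (intro sum.mono_neutral_right) (auto simp: not_in_iff)
  also have "\<dots> = size a0" by (simp add: size_multiset_overloaded_eq)
  finally show "card S \<le> size a0 * M ^ (card L - 1)" .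
qed

lemma (in vector_space) span_finite_image:
  assumes "finite K" "x \<in> span {f m | m. m \<in> K}"
  shows "\<exists>q. x = (\<Sum>m\<in>K. scale (q m) (f m))"
  using assms(2)
proof (induction rule: span_induct_alt)
  case base
  show ?case by (intro exI[of _ "\<lambda>_. 0"]) simp
next
  case (step c x y)
  then obtain m q where m: "m \<in> K" "x = f m" and q: "y = (\<Sum>m\<in>K. scale (q m) (f m))" by auto
  have "scale c x + y = (\<Sum>k\<in>K. scale (if k = m then c else 0) (f k)) + (\<Sum>k\<in>K. scale (q k) (f k))"
  proof -
    have "(\<Sum>k\<in>K. scale (if k = m then c else 0) (f k)) = (\<Sum>k\<in>K. if k = m then scale c (f m) else 0)"
      by (rule sum.cong) auto
    also have "\<dots> = scale c x" using assms(1) m by simp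
    finally show ?thesis using q by simp
  qed
  also have "\<dots> = (\<Sum>k\<in>K. scale ((if k = m then c else 0) + q k) (f k))"
    by (simp only: scale_left_distrib sum.distrib)
  finally show ?case by (rule exI[of _ "\<lambda>k. (if k = m then c else 0) + q k"])
qed

context hw_module begin

text \<open>A Groebner-type reduction. A relation has a leading multiset \<open>a0\<close>: maximal
  size, then maximal in the multiset order. Every monomial divisible by \<open>a0\<close> is
  rewritten through the relation into smaller ones, since reordering creates only shorter words.
  Hence the monomials not divisible by \<open>a0\<close> suffice, with the length filtration
  respected.\<close>

lemma leading_monomial_spanning:
  assumes wd: "word_choice wd"
    and I: "finite I" "\<And>m. m \<in> I \<Longrightarrow> set_mset m \<subseteq> neg_letters n"
    and rel: "(\<Sum>m\<in>I. sc (c m) (act_word \<rho> (wd m) v0)) = 0"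
    and m1: "m1 \<in> I" "c m1 \<noteq> 0"
  obtains a0 where "set_mset a0 \<subseteq> neg_letters n"
    "\<And>M. wspan M UNIV \<subseteq> span {act_word \<rho> (wd m) v0 | m.
        set_mset m \<subseteq> neg_letters n \<and> size m < M \<and> \<not> a0 \<subseteq># m}"
proof -
  define I' where "I' = {m\<in>I. c m \<noteq> 0}"
  define e where "e = Max (size ` I')"
  \<comment> \<open>Coding letters by natural numbers makes the multiset order total, well-founded
    and compatible with sums, so it serves as a monomial order.\<close>
  define enc where "enc = image_mset prod_encode"
  define J where "J = {m\<in>I'. size m = e}"
  have fin: "finite I'" "finite J" using I by (auto simp: I'_def J_def)
  have "m1 \<in> I'" using m1 by (simp add: I'_def)
  then have "e \<in> size ` I'" unfolding e_def using fin by (intro Max_in) auto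
  then have "J \<noteq> {}" by (auto simp: J_def)
  then have "Max (enc ` J) \<in> enc ` J" using fin by (intro Max_in) auto
  then obtain a0 where a0: "a0 \<in> J" "enc a0 = Max (enc ` J)" by auto
  have max_enc: "enc m \<le> enc a0" if "m \<in> J" for m using that fin a0(2) by simp
  have size_le: "size m \<le> e" if "m \<in> I'" for m unfolding e_def using that fin by (intro Max_ge) auto
  have enc_inj: "enc m = enc m' \<longleftrightarrow> m = m'" for m m'
    unfolding enc_def using multiset.inj_map[OF inj_prod_encode[of UNIV]] by (auto dest: injD)
  have a0I: "a0 \<in> I'" "size a0 = e" "c a0 \<noteq> 0" using a0 by (auto simp: J_def I'_def)
  define S where "S M = {act_word \<rho> (wd m) v0 | m. set_mset m \<subseteq> neg_letters n \<and> size m < M \<and> \<not> a0 \<subseteq># m}" for M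
  have S_mono: "span (S M) \<subseteq> span (S (Suc M))" for M by (rule span_mono) (auto simp: S_def)
  have pbw: "act_word \<rho> (wd m) v0 \<in> span (S M)" if "set_mset m \<subseteq> neg_letters n" "size m < M" for m M
    using that
  proof (induction M arbitrary: m)
    case 0 then show ?case by simp
  next
    case (Suc M)
    have low: "wspan M UNIV \<subseteq> span (S (Suc M))"
    proof -
      have "span {act_word \<rho> (wd m) v0 | m. set_mset m \<subseteq> neg_letters n \<and> size m < M} \<subseteq> span (S M)"
        by (rule span_minimal) (use Suc.IH in auto)
      then show ?thesis using wspan_pbw[OF wd, of M] S_mono[of M] by blast
    qed
    show ?case using Suc.prems
    proof (induction "enc m" arbitrary: m rule: less_induct)
      case less
      consider "size m < M" | "\<not> a0 \<subseteq># m" | "size m = M" "a0 \<subseteq># m" using less.prems by linarith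
      then show ?case
      proof cases
        case 1 then show ?thesis using Suc.IH[of m] less.prems S_mono by blast
      next
        case 2 then show ?thesis by (intro span_base) (use less.prems in \<open>auto simp: S_def\<close>)
      next
        case 3
        \<comment> \<open>The relation is multiplied by the monomial of \<open>d\<close>. Its
          leading term becomes the monomial of \<open>m\<close> up to shorter words; every other
          term is shorter or has a smaller code.\<close>
        define d where "d = m - a0"
        have m: "m = d + a0" using 3 by (simp add: d_def)
        have setd: "set_mset d \<subseteq> neg_letters n" using less.prems m by auto
        have cat: "act_word \<rho> (wd d @ wd m') v0 - act_word \<rho> (wd (d + m')) v0 \<in> span (S (Suc M))"
          if "set_mset m' \<subseteq> neg_letters n" "size m' \<le> e" for m'
        proof -
          have "act_word \<rho> (wd d @ wd m') v0 - act_word \<rho> (wd (d + m')) v0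
            \<in> wspan (length (wd d @ wd m')) {mset_wt (mset (wd d @ wd m'))}"
            by (rule reorder) (use that setd wd word_choice_set[OF wd] in \<open>auto simp: word_choice_def\<close>)
          moreover have "length (wd d @ wd m') \<le> M"
            using that 3 m a0I by (simp add: word_choice_length[OF wd])
          ultimately show ?thesis using low wspan_mono[of _ M _ UNIV] by blast
        qed
        have t: "act_word \<rho> (wd d @ wd m') v0 \<in> span (S (Suc M))" if m': "m' \<in> I'" "m' \<noteq> a0" for m'
        proof -
          have s: "set_mset m' \<subseteq> neg_letters n" using m' I by (auto simp: I'_def)
          have "act_word \<rho> (wd (d + m')) v0 \<in> span (S (Suc M))"
          proof (cases "size (d + m') < M")
            case True
            then show ?thesis using Suc.IH[of "d + m'"] s setd S_mono by auto
          next
            case False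
            then have sz: "size (d + m') = M" "m' \<in> J" using size_le[OF m'(1)] 3 m a0I m' by (auto simp: J_def)
            then have "enc m' < enc a0" using max_enc[of m'] enc_inj[of m' a0] m' by simp
            then have "enc (d + m') < enc m" by (simp add: m enc_def)
            then show ?thesis using less.hyps[of "d + m'"] s setd sz by simp
          qed
          then show ?thesis using cat[OF s size_le[OF m'(1)]] span_add by fastforce
        qed
        have lw: "\<And>b. b \<in> set (wd d) \<Longrightarrow> bas b \<in> sl n" using setd word_choice_set[OF wd] neg_in_sl by auto
        have "0 = (\<Sum>m\<in>I'. sc (c m) (act_word \<rho> (wd m) v0))"
          unfolding rel[symmetric] by (rule sum.mono_neutral_right) (use I in \<open>auto simp: I'_def\<close>)
        then have "0 = act_word \<rho> (wd d) (\<Sum>m\<in>I'. sc (c m) (act_word \<rho> (wd m) v0))"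
          using act_word_zero[OF lw] by simp
        also have "\<dots> = (\<Sum>m\<in>I'. sc (c m) (act_word \<rho> (wd d @ wd m) v0))"
          by (simp add: act_word_sum[OF lw] act_word_scale[OF lw])
        also have "\<dots> = sc (c a0) (act_word \<rho> (wd d @ wd a0) v0)
            + (\<Sum>m\<in>I'-{a0}. sc (c m) (act_word \<rho> (wd d @ wd m) v0))"
          using a0I fin by (simp add: sum.remove)
        finally have "sc (c a0) (act_word \<rho> (wd d @ wd a0) v0)
            = - (\<Sum>m\<in>I'-{a0}. sc (c m) (act_word \<rho> (wd d @ wd m) v0))"
          by (simp add: eq_neg_iff_add_eq_0)
        also have "\<dots> \<in> span (S (Suc M))"
          by (intro span_neg span_sum span_scale t) auto
        finally have "sc (inverse (c a0)) (sc (c a0) (act_word \<rho> (wd d @ wd a0) v0)) \<in> span (S (Suc M))"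
          by (rule span_scale)
        then have "act_word \<rho> (wd d @ wd a0) v0 \<in> span (S (Suc M))" using a0I by simp
        moreover have "act_word \<rho> (wd d @ wd a0) v0 - act_word \<rho> (wd m) v0 \<in> span (S (Suc M))"
          unfolding m by (rule cat) (use a0I I in \<open>auto simp: I'_def\<close>)
        ultimately show ?thesis using span_diff by fastforce
      qed
    qed
  qed
  show thesis
  proof (rule that[of a0])
    show "set_mset a0 \<subseteq> neg_letters n" using a0I I by (auto simp: I'_def)
    fix M
    have "span {act_word \<rho> (wd m) v0 | m. set_mset m \<subseteq> neg_letters n \<and> size m < M} \<subseteq> span (S M)"
      by (rule span_minimal) (use pbw in auto)
    then show "wspan M UNIV \<subseteq> span {act_word \<rho> (wd m) v0 | m. set_mset m \<subseteq> neg_letters n \<and> size m < M \<and> \<not> a0 \<subseteq># m}"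
      using wspan_pbw[OF wd, of M] unfolding S_def by blast
  qed
qed

section \<open>Operators determined by their values on short words\<close>

definition lin_op :: "('a \<Rightarrow> 'a) \<Rightarrow> bool" where
  "lin_op A \<longleftrightarrow> (\<forall>x y. A (x + y) = A x + A y) \<and> (\<forall>c x. A (sc c x) = sc c (A x))"

lemma lin_opD: "lin_op A \<Longrightarrow> A (x + y) = A x + A y" "lin_op A \<Longrightarrow> A (sc c x) = sc c (A x)"
  "lin_op A \<Longrightarrow> A 0 = 0" "lin_op A \<Longrightarrow> A (x - y) = A x - A y"
proof -
  assume A: "lin_op A"
  show 1: "A (x + y) = A x + A y" for x y using A by (simp add: lin_op_def)
  show "A (sc c x) = sc c (A x)" for x using A by (simp add: lin_op_def)
  from this[of 0] A show "A 0 = 0" unfolding lin_op_def by (metis scale_zero_left)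
  show "A (x - y) = A x - A y" using 1[of "x - y" y] by (simp add: eq_diff_eq)
qed

lemma lin_op_rho: "A \<in> sl n \<Longrightarrow> lin_op (\<rho> A)"
  by (simp add: lin_op_def rho_add rho_scale)

lemma lin_op_commutator:
  "lin_op A \<Longrightarrow> B \<in> sl n \<Longrightarrow> lin_op (\<lambda>x. \<rho> B (A x) - A (\<rho> B x))"
  by (simp add: lin_op_def rho_add rho_scale scale_right_diff_distrib)

lemma lin_op_add: "lin_op A \<Longrightarrow> lin_op B \<Longrightarrow> lin_op (\<lambda>x. A x + B x)"
  by (simp add: lin_op_def scale_right_distrib)

lemma lin_op_scale: "lin_op A \<Longrightarrow> lin_op (\<lambda>x. sc c (A x))"
  by (simp add: lin_op_def scale_right_distrib mult.commute)

text \<open>Operators killed by any \<open>j\<close> successive commutators with lowering operators; words of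
  degree \<open>d\<close> are such with \<open>j\<close> linear in \<open>d\<close>, so they are determined by finitely many vectors.\<close>
primrec comm_ord :: "nat \<Rightarrow> ('a \<Rightarrow> 'a) \<Rightarrow> bool" where
  "comm_ord 0 A \<longleftrightarrow> (\<forall>x. A x = 0)"
| "comm_ord (Suc j) A \<longleftrightarrow> (\<forall>y\<in>neg_letters n. comm_ord j (\<lambda>x. \<rho> (bas y) (A x) - A (\<rho> (bas y) x)))"

lemma comm_ord_zero: "comm_ord j (\<lambda>x. 0)"
  by (induction j) (auto simp: rho_zero neg_in_sl)

lemma comm_ord_add: "comm_ord j A \<Longrightarrow> comm_ord j B \<Longrightarrow> comm_ord j (\<lambda>x. A x + B x)"
proof (induction j arbitrary: A B)
  case 0 then show ?case by simp
next
  case (Suc j)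
  show ?case unfolding comm_ord.simps
  proof
    fix y assume y: "y \<in> neg_letters n"
    have "comm_ord j (\<lambda>x. (\<rho> (bas y) (A x) - A (\<rho> (bas y) x)) + (\<rho> (bas y) (B x) - B (\<rho> (bas y) x)))"
      using Suc.IH Suc.prems y by simp
    then show "comm_ord j (\<lambda>x. \<rho> (bas y) (A x + B x) - (A (\<rho> (bas y) x) + B (\<rho> (bas y) x)))"
      by (simp add: rho_add neg_in_sl y algebra_simps)
  qed
qed

lemma comm_ord_scale: "comm_ord j A \<Longrightarrow> comm_ord j (\<lambda>x. sc c (A x))"
proof (induction j arbitrary: A)
  case 0 then show ?case by simp
next
  case (Suc j)
  show ?case unfolding comm_ord.simps
  proof
    fix y assume y: "y \<in> neg_letters n"
    have "comm_ord j (\<lambda>x. sc c (\<rho> (bas y) (A x) - A (\<rho> (bas y) x)))" using Suc y by simp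
    then show "comm_ord j (\<lambda>x. \<rho> (bas y) (sc c (A x)) - sc c (A (\<rho> (bas y) x)))"
      by (simp add: rho_scale neg_in_sl y scale_right_diff_distrib)
  qed
qed

text \<open>The Leibniz rule splits the commutator of \<open>y\<close> with a product into two
  products, each with one order lowered. With orders \<open>Suc i\<close> and \<open>Suc j\<close>
  the sum of \<open>i\<close> and \<open>j\<close> drops by one, as for nilpotent
  derivations.\<close>

lemma comm_ord_compose:
  "comm_ord (Suc i) A \<Longrightarrow> comm_ord (Suc j) B \<Longrightarrow> lin_op A \<Longrightarrow> comm_ord (Suc (i + j)) (\<lambda>x. A (B x))"
proof (induction "i + j" arbitrary: i j A B)
  case 0
  show ?case unfolding comm_ord.simps
  proof
    fix y assume y: "y \<in> neg_letters n"
    have "A (\<rho> (bas y) x) = \<rho> (bas y) (A x)" "B (\<rho> (bas y) x) = \<rho> (bas y) (B x)" for x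
      using 0 y by (auto simp: lin_opD)
    then show "comm_ord (i + j) (\<lambda>x. \<rho> (bas y) (A (B x)) - A (B (\<rho> (bas y) x)))"
      by (simp add: comm_ord_zero)
  qed
next
  case (Suc k)
  show ?case unfolding comm_ord.simps
  proof
    fix y assume y: "y \<in> neg_letters n"
    let ?A = "\<lambda>x. \<rho> (bas y) (A x) - A (\<rho> (bas y) x)"
    let ?B = "\<lambda>x. \<rho> (bas y) (B x) - B (\<rho> (bas y) x)"
    have cA: "comm_ord i ?A" and cB: "comm_ord j ?B" using Suc.prems y by auto
    have lA: "lin_op ?A"
      by (rule lin_op_commutator[OF Suc.prems(3) neg_in_sl[OF y]])
    have 1: "comm_ord (i + j) (\<lambda>x. ?A (B x))"
    proof (cases i)
      case 0 then have "?A x = 0" for x using cA by simp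
      then show ?thesis by (simp add: comm_ord_zero)
    next
      case (Suc i')
      then show ?thesis using Suc.hyps(1)[of i' j ?A B] Suc.hyps(2) cA Suc.prems(2) lA by simp
    qed
    have 2: "comm_ord (i + j) (\<lambda>x. A (?B x))"
    proof (cases j)
      case 0 then have "?B x = 0" for x using cB by simp
      then show ?thesis by (simp add: comm_ord_zero lin_opD(3)[OF Suc.prems(3)])
    next
      case (Suc j')
      then show ?thesis using Suc.hyps(1)[of i j' A ?B] Suc.hyps(2) cB Suc.prems by simp
    qed
    show "comm_ord (i + j) (\<lambda>x. \<rho> (bas y) (A (B x)) - A (B (\<rho> (bas y) x)))"
      using comm_ord_add[OF 1 2] by (simp add: lin_opD(4)[OF Suc.prems(3)])
  qed
qed

text \<open>A bracket with a lowering letter raises the difference of row and column index by at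
  least one on all nonzero entries, and this difference never exceeds \<open>n\<close>.\<close>

lemma comm_ord_rho_height:
  assumes "B \<in> sl n" "\<And>a b. B a b \<noteq> 0 \<Longrightarrow> int a - int b \<ge> int n + 1 - int k"
  shows "comm_ord k (\<rho> B)"
  using assms
proof (induction k arbitrary: B)
  case 0
  have "B a b = 0" for a b
  proof (rule ccontr)
    assume "B a b \<noteq> 0"
    then have "int a - int b \<ge> int n + 1" "a \<le> Suc n" "b \<ge> 1" using 0 by (force simp: sl_def in_gl_def)+
    then show False by simp
  qed
  then have "B = (\<lambda>a b. 0)" by blast
  then show ?case using rho_zero_left by simp
next
  case (Suc k)
  show ?case unfolding comm_ord.simps
  proof
    fix y assume y: "y \<in> neg_letters n"
    have r: "fst y \<in> {1..Suc n}" "snd y \<in> {1..Suc n}" "snd y < fst y" using y by (auto simp: neg_letters_def)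
    have eq: "(\<lambda>x. \<rho> (bas y) (\<rho> B x) - \<rho> B (\<rho> (bas y) x)) = \<rho> (brk n (bas y) B)"
      using rho_brk[OF neg_in_sl[OF y] Suc.prems(1)] by auto
    have "int a - int b \<ge> int n + 1 - int k" if "brk n (bas y) B a b \<noteq> 0" for a b
    proof -
      have "brk n (bas y) B a b = (if a = fst y then B (snd y) b else 0) - (if b = snd y then B a (fst y) else 0)"
        unfolding brk_def bas_neg'[OF y] by (simp only: mmul_Emat_left[OF r(2)] mmul_Emat_right[OF r(1)])
      then have "(a = fst y \<and> B (snd y) b \<noteq> 0) \<or> (b = snd y \<and> B a (fst y) \<noteq> 0)" using that by (auto split: if_splits)
      then show ?thesis using Suc.prems(2)[of "snd y" b] Suc.prems(2)[of a "fst y"] r(3) by auto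
    qed
    then show "comm_ord k (\<lambda>x. \<rho> (bas y) (\<rho> B x) - \<rho> B (\<rho> (bas y) x))"
      unfolding eq using Suc.IH[OF brk_in_sl[OF neg_in_sl[OF y] Suc.prems(1)]] by blast
  qed
qed

text \<open>The differences range from \<open>-n\<close> to \<open>n\<close>, so
  \<open>2 n + 1\<close> brackets exhaust them.\<close>

lemma comm_ord_rho: "B \<in> sl n \<Longrightarrow> comm_ord (Suc (2 * n)) (\<rho> B)"
proof (rule comm_ord_rho_height)
  fix a b assume "B \<in> sl n" "B a b \<noteq> 0"
  then have "a \<in> {1..Suc n}" "b \<in> {1..Suc n}" by (auto simp: sl_def in_gl_def)
  then show "int n + 1 - int (Suc (2 * n)) \<le> int a - int b" by auto
qed

text \<open>Every commutator of \<open>A\<close> with a lowering operator has order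
  \<open>j - 1\<close> and kills the words shorter by one, so it vanishes by induction. Then
  \<open>A\<close> commutes with all lowering operators and kills \<open>v0\<close>, hence kills
  every word. An operator of order \<open>j\<close> is thus determined on words of length below
  \<open>j\<close>.\<close>

lemma comm_ord_vanish:
  assumes "pbw_all = UNIV"
  shows "comm_ord j A \<Longrightarrow> lin_op A \<Longrightarrow> (\<And>x. x \<in> wspan j UNIV \<Longrightarrow> A x = 0) \<Longrightarrow> A x = 0"
proof (induction j arbitrary: A x)
  case 0 then show ?case by simp
next
  case (Suc j)
  have comm: "A (\<rho> (bas y) x) = \<rho> (bas y) (A x)" if y: "y \<in> neg_letters n" for x y
  proof -
    let ?B = "\<lambda>x. \<rho> (bas y) (A x) - A (\<rho> (bas y) x)"
    have "?B x = 0"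
    proof (rule Suc.IH[where A = ?B])
      show "comm_ord j ?B" using Suc.prems y by simp
      show "lin_op ?B" by (rule lin_op_commutator[OF Suc.prems(2) neg_in_sl[OF y]])
      fix x assume x: "x \<in> wspan j UNIV"
      then have "x \<in> wspan (Suc j) UNIV" using wspan_mono[of j "Suc j" UNIV UNIV] by auto
      then show "?B x = 0" using wspan_step_UNIV[OF y x] Suc.prems(3) rho_zero neg_in_sl[OF y] by simp
    qed
    then show ?thesis by simp
  qed
  have A0: "A v0 = 0" using Suc.prems(3)[of v0] word_in_wspan[of "[]" "Suc j" UNIV] by simp
  have words: "A (act_word \<rho> w v0) = 0" if "set w \<subseteq> neg_letters n" for w
    using that by (induction w) (auto simp: A0 comm rho_zero neg_in_sl)
  have "x \<in> span {act_word \<rho> w v0 | w. set w \<subseteq> neg_letters n}"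
    using assms by (simp add: pbw_all_def)
  then show ?case
  proof (induction rule: span_induct_alt)
    case base show ?case using Suc.prems(2) by (rule lin_opD)
  next
    case (step c x y)
    then show ?case using words by (auto simp: lin_opD[OF Suc.prems(2)])
  qed
qed

text \<open>A relation rather than a function, since one operator may arise from several homogeneous
  expressions. It records the operator together with the degree \<open>d\<close> polynomial that the
  expression induces through the Killing form; \<open>symb_vanish\<close> controls the ambiguity on
  the associated variety.\<close>

inductive symb :: "nat \<Rightarrow> ('a \<Rightarrow> 'a) \<Rightarrow> (mat \<Rightarrow> complex) \<Rightarrow> bool" where
  word: "set w \<subseteq> bidx n \<Longrightarrow> symb (length w) (act_word \<rho> w) (\<lambda>Y. \<Prod>b\<leftarrow>w. killing n (bas b) Y)"
| zero: "symb d (\<lambda>x. 0) (\<lambda>Y. 0)"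
| add: "symb d A F \<Longrightarrow> symb d B G \<Longrightarrow> symb d (\<lambda>x. A x + B x) (\<lambda>Y. F Y + G Y)"
| scale: "symb d A F \<Longrightarrow> symb d (\<lambda>x. sc c (A x)) (\<lambda>Y. c * F Y)"

lemma bidx_in_sl: "b \<in> bidx n \<Longrightarrow> bas b \<in> sl n"
  using Emat_in_sl[of "fst b" "snd b" n] cartan_imp_sl[OF hv_in_cartan[of "fst b" n]]
  by (auto simp: bidx_def bas_def sl_letters_def)

lemma symb_lin_op: "symb d A F \<Longrightarrow> lin_op A"
proof (induction rule: symb.induct)
  case (word w)
  then show ?case using bidx_in_sl unfolding lin_op_def by (auto intro!: act_word_add act_word_scale)
next
  case (zero d) show ?case by (simp add: lin_op_def)
qed (auto intro: lin_op_add lin_op_scale)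

lemma symb_comm_ord: "symb d A F \<Longrightarrow> comm_ord (Suc (2 * n * d)) A"
proof (induction rule: symb.induct)
  case (word w)
  then show ?case
  proof (induction w)
    case Nil
    then show ?case by simp
  next
    case (Cons b w)
    then have b: "bas b \<in> sl n" using bidx_in_sl by simp
    have "comm_ord (Suc (2 * n + 2 * n * length w)) (\<lambda>x. \<rho> (bas b) (act_word \<rho> w x))"
      by (rule comm_ord_compose[OF comm_ord_rho[OF b] Cons.IH lin_op_rho[OF b]]) (use Cons.prems in simp)
    then show ?case by (simp add: algebra_simps)
  qed
next
  case (zero d) show ?case by (rule comm_ord_zero)
next
  case (add d A F B G) then show ?case by (intro comm_ord_add)
next
  case (scale d A F c) then show ?case by (intro comm_ord_scale)
qed

lemma symb_wspan: "symb d A F \<Longrightarrow> x \<in> wspan k UNIV \<Longrightarrow> A x \<in> wspan (k + d) UNIV"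
proof (induction rule: symb.induct)
  case (word w)
  then show ?case by (induction w) (auto intro!: rho_wspan bidx_in_sl)
qed (auto simp: wspan_def intro: span_zero span_add span_scale)

lemma symb_mult: "symb d A F \<Longrightarrow> symb e B G \<Longrightarrow> symb (d + e) (\<lambda>x. A (B x)) (\<lambda>Y. F Y * G Y)"
proof (induction rule: symb.induct)
  case (word w)
  from word(2,1) show ?case
  proof (induction rule: symb.induct)
    case (word w')
    have "act_word \<rho> (w @ w') = (\<lambda>x. act_word \<rho> w (act_word \<rho> w' x))" by auto
    then show ?case using symb.word[of "w @ w'"] word by simp
  next
    case (zero d)
    then have "act_word \<rho> w 0 = 0" using bidx_in_sl by (intro act_word_zero) auto
    then show ?case using symb.zero by simp
  next
    case (add d A F B G)
    then have "act_word \<rho> w (x + y) = act_word \<rho> w x + act_word \<rho> w y" for x y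
      using bidx_in_sl by (intro act_word_add) auto
    then show ?case using symb.add[OF add.IH(1)[OF add.prems] add.IH(2)[OF add.prems]] by (simp add: algebra_simps)
  next
    case (scale d A F c)
    then have "act_word \<rho> w (sc c x) = sc c (act_word \<rho> w x)" for x
      using bidx_in_sl by (intro act_word_scale) auto
    then show ?case using symb.scale[OF scale.IH[OF scale.prems], of c] by (simp add: algebra_simps)
  qed
next
  case (zero d)
  then show ?case using symb.zero by simp
next
  case (add d A F B' G')
  then show ?case using symb.add[OF add.IH(1)[OF add.prems] add.IH(2)[OF add.prems]] by (simp add: algebra_simps)
next
  case (scale d A F c)
  then show ?case using symb.scale[OF scale.IH[OF scale.prems], of c] by (simp add: algebra_simps)
qed

text \<open>The tensor \<open>p\<close> has only words of length \<open>d\<close>. Cancellation may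
  empty its support, but no term of lower degree appears, so \<open>top_eval\<close> sees the whole
  polynomial \<open>F\<close>.\<close>

lemma symb_represented:
  "symb d A F \<Longrightarrow> \<exists>p. tensor_elt n p \<and> (\<forall>w\<in>supp p. length w = d) \<and> (\<forall>x. act sc \<rho> p x = A x) \<and>
     (\<forall>Y. F Y = (\<Sum>w\<in>supp p. p w * (\<Prod>b\<leftarrow>w. killing n (bas b) Y)))"
proof (induction rule: symb.induct)
  case (word w)
  define p where "p = (\<lambda>w'. if w' = w then (1::complex) else 0)"
  have "supp p = {w}" by (auto simp: supp_def p_def)
  then show ?case using word by (intro exI[of _ p]) (auto simp: tensor_elt_def act_def p_def)
next
  case (zero d)
  have "supp (\<lambda>w. 0) = {}" by (simp add: supp_def)
  then show ?case by (intro exI[of _ "\<lambda>w. 0"]) (auto simp: tensor_elt_def act_def)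
next
  case (add d A F B G)
  then obtain p q where
    p: "tensor_elt n p" "\<forall>w\<in>supp p. length w = d" "\<forall>x. act sc \<rho> p x = A x"
       "\<forall>Y. F Y = (\<Sum>w\<in>supp p. p w * (\<Prod>b\<leftarrow>w. killing n (bas b) Y))" and
    q: "tensor_elt n q" "\<forall>w\<in>supp q. length w = d" "\<forall>x. act sc \<rho> q x = B x"
       "\<forall>Y. G Y = (\<Sum>w\<in>supp q. q w * (\<Prod>b\<leftarrow>w. killing n (bas b) Y))" by blast
  let ?r = "\<lambda>w. p w + q w"
  let ?U = "supp p \<union> supp q"
  have sub: "supp ?r \<subseteq> ?U" by (auto simp: supp_def)
  have fin: "finite ?U" using p q by (simp add: tensor_elt_def)
  have "act sc \<rho> ?r x = A x + B x" for x
  proof -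
    have "act sc \<rho> ?r x = (\<Sum>w\<in>?U. sc (p w + q w) (act_word \<rho> w x))"
      unfolding act_def using sub fin by (intro sum.mono_neutral_left) (auto simp: supp_def)
    also have "\<dots> = (\<Sum>w\<in>?U. sc (p w) (act_word \<rho> w x)) + (\<Sum>w\<in>?U. sc (q w) (act_word \<rho> w x))"
      by (simp add: scale_left_distrib sum.distrib)
    also have "(\<Sum>w\<in>?U. sc (p w) (act_word \<rho> w x)) = act sc \<rho> p x"
      unfolding act_def using fin by (intro sum.mono_neutral_right) (auto simp: supp_def)
    also have "(\<Sum>w\<in>?U. sc (q w) (act_word \<rho> w x)) = act sc \<rho> q x"
      unfolding act_def using fin by (intro sum.mono_neutral_right) (auto simp: supp_def)
    finally show ?thesis using p q by simp
  qed
  moreover have "F Y + G Y = (\<Sum>w\<in>supp ?r. ?r w * (\<Prod>b\<leftarrow>w. killing n (bas b) Y))" for Y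
  proof -
    let ?k = "\<lambda>w. \<Prod>b\<leftarrow>w. killing n (bas b) Y"
    have "(\<Sum>w\<in>supp ?r. ?r w * ?k w) = (\<Sum>w\<in>?U. ?r w * ?k w)"
      using sub fin by (intro sum.mono_neutral_left) (auto simp: supp_def)
    also have "\<dots> = (\<Sum>w\<in>?U. p w * ?k w) + (\<Sum>w\<in>?U. q w * ?k w)"
      by (simp add: distrib_right sum.distrib)
    also have "(\<Sum>w\<in>?U. p w * ?k w) = (\<Sum>w\<in>supp p. p w * ?k w)"
      using fin by (intro sum.mono_neutral_right) (auto simp: supp_def)
    also have "(\<Sum>w\<in>?U. q w * ?k w) = (\<Sum>w\<in>supp q. q w * ?k w)"
      using fin by (intro sum.mono_neutral_right) (auto simp: supp_def)
    finally show ?thesis using p q by simp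
  qed
  moreover have "tensor_elt n ?r" using p(1) q(1) sub finite_subset[OF sub fin] unfolding tensor_elt_def by blast
  ultimately show ?case using p q sub by (intro exI[of _ ?r]) blast
next
  case (scale d A F c)
  then obtain p where
    p: "tensor_elt n p" "\<forall>w\<in>supp p. length w = d" "\<forall>x. act sc \<rho> p x = A x"
       "\<forall>Y. F Y = (\<Sum>w\<in>supp p. p w * (\<Prod>b\<leftarrow>w. killing n (bas b) Y))" by blast
  let ?r = "\<lambda>w. c * p w"
  have sub: "supp ?r \<subseteq> supp p" by (auto simp: supp_def)
  have fin: "finite (supp p)" using p by (simp add: tensor_elt_def)
  have "act sc \<rho> ?r x = sc c (A x)" for x
  proof -
    have "act sc \<rho> ?r x = (\<Sum>w\<in>supp p. sc (?r w) (act_word \<rho> w x))"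
      unfolding act_def using sub fin by (intro sum.mono_neutral_left) (auto simp: supp_def)
    also have "\<dots> = sc c (act sc \<rho> p x)" by (simp add: act_def scale_sum_right)
    finally show ?thesis using p by simp
  qed
  moreover have "c * F Y = (\<Sum>w\<in>supp ?r. ?r w * (\<Prod>b\<leftarrow>w. killing n (bas b) Y))" for Y
  proof -
    let ?k = "\<lambda>w. \<Prod>b\<leftarrow>w. killing n (bas b) Y"
    have "(\<Sum>w\<in>supp ?r. ?r w * ?k w) = (\<Sum>w\<in>supp p. ?r w * ?k w)"
      using sub fin by (intro sum.mono_neutral_left) (auto simp: supp_def)
    then show ?thesis using p by (simp add: sum_distrib_left mult.assoc)
  qed
  moreover have "tensor_elt n ?r" using p(1) sub finite_subset[OF sub fin] unfolding tensor_elt_def by blast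
  ultimately show ?case using p sub by (intro exI[of _ ?r]) blast
qed

lemma symb_vanish:
  assumes s: "symb d A F" and A: "\<And>x. A x = 0" and Y: "Y \<in> assoc_var n sc \<rho>"
  shows "F Y = 0"
proof -
  obtain p where p: "tensor_elt n p" "\<forall>w\<in>supp p. length w = d" "\<forall>x. act sc \<rho> p x = A x"
    "\<forall>Y. F Y = (\<Sum>w\<in>supp p. p w * (\<Prod>b\<leftarrow>w. killing n (bas b) Y))"
    using symb_represented[OF s] by blast
  have "top_eval p (\<lambda>X. killing n X Y) = 0" using Y p(1,3) A by (auto simp: assoc_var_def)
  moreover have "{w\<in>supp p. length w = tdeg p} = supp p"
  proof (cases "supp p = {}")
    case False
    then have "length ` supp p = {d}" using p(2) by force
    then have "tdeg p = d" using False by (simp add: tdeg_def)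
    then show ?thesis using p(2) by auto
  qed auto
  ultimately show ?thesis using p(4) by (simp add: top_eval_def)
qed

text \<open>Polynomials are compared on trace zero matrices only: there, but not on all matrices, a
  diagonal entry is a combination of Killing pairings with the \<open>hv\<close>.\<close>

definition symb_on :: "nat \<Rightarrow> ('a \<Rightarrow> 'a) \<Rightarrow> (mat \<Rightarrow> complex) \<Rightarrow> bool" where
  "symb_on d A F \<longleftrightarrow> (\<exists>G. symb d A G \<and> (\<forall>Y\<in>sl n. G Y = F Y))"

lemma symb_on_cong: "symb_on d A F \<Longrightarrow> (\<And>Y. Y \<in> sl n \<Longrightarrow> F Y = G Y) \<Longrightarrow> symb_on d A G"
  by (auto simp: symb_on_def)

lemma symb_on_add: "symb_on d A F \<Longrightarrow> symb_on d B G \<Longrightarrow> symb_on d (\<lambda>x. A x + B x) (\<lambda>Y. F Y + G Y)"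
proof -
  assume "symb_on d A F" "symb_on d B G"
  then obtain F' G' where "symb d A F'" "\<forall>Y\<in>sl n. F' Y = F Y" "symb d B G'" "\<forall>Y\<in>sl n. G' Y = G Y"
    by (auto simp: symb_on_def)
  then show ?thesis unfolding symb_on_def by (intro exI[of _ "\<lambda>Y. F' Y + G' Y"]) (auto intro: symb.add)
qed

lemma symb_on_scale: "symb_on d A F \<Longrightarrow> symb_on d (\<lambda>x. sc c (A x)) (\<lambda>Y. c * F Y)"
proof -
  assume "symb_on d A F"
  then obtain F' where "symb d A F'" "\<forall>Y\<in>sl n. F' Y = F Y" by (auto simp: symb_on_def)
  then show ?thesis unfolding symb_on_def by (intro exI[of _ "\<lambda>Y. c * F' Y"]) (auto intro: symb.scale)
qed

lemma symb_on_mult: "symb_on d A F \<Longrightarrow> symb_on e B G \<Longrightarrow> symb_on (d + e) (\<lambda>x. A (B x)) (\<lambda>Y. F Y * G Y)"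
proof -
  assume "symb_on d A F" "symb_on e B G"
  then obtain F' G' where "symb d A F'" "\<forall>Y\<in>sl n. F' Y = F Y" "symb e B G'" "\<forall>Y\<in>sl n. G' Y = G Y"
    by (auto simp: symb_on_def)
  then show ?thesis unfolding symb_on_def by (intro exI[of _ "\<lambda>Y. F' Y * G' Y"]) (auto intro: symb_mult)
qed

lemma symb_on_zero: "symb_on d (\<lambda>x. 0) (\<lambda>Y. 0)"
  unfolding symb_on_def by (rule exI[of _ "\<lambda>Y. 0"]) (auto intro: symb.zero)

lemma symb_on_one: "symb_on 0 (\<lambda>x. x) (\<lambda>Y. 1)"
proof -
  have "act_word \<rho> [] = (\<lambda>x. x)" by auto
  then show ?thesis unfolding symb_on_def using symb.word[of "[]"] by (intro exI[of _ "\<lambda>Y. 1"]) simp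
qed

lemma symb_on_sum:
  "finite K \<Longrightarrow> (\<And>k. k \<in> K \<Longrightarrow> symb_on d (A k) (F k)) \<Longrightarrow>
    symb_on d (\<lambda>x. \<Sum>k\<in>K. sc (c k) (A k x)) (\<lambda>Y. \<Sum>k\<in>K. c k * F k Y)"
proof (induction K rule: finite_induct)
  case empty show ?case by (simp add: symb_on_zero)
next
  case (insert k K)
  then show ?case using symb_on_add[OF symb_on_scale[of d "A k" "F k" "c k"]] by simp
qed

lemma symb_on_power: "symb_on d A F \<Longrightarrow> \<exists>B. symb_on (d * k) B (\<lambda>Y. F Y ^ k)"
proof (induction k)
  case 0 then show ?case using symb_on_one by auto
next
  case (Suc k)
  then show ?case using symb_on_mult by fastforce
qed

lemma symb_on_monomial:
  assumes "finite J" "\<And>j. j \<in> J \<Longrightarrow> \<exists>A. symb_on (d j) A (F j)"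
  shows "\<exists>B. symb_on (\<Sum>j\<in>J. d j * g j) B (\<lambda>Y. \<Prod>j\<in>J. F j Y ^ g j)"
  using assms
proof (induction J rule: finite_induct)
  case empty then show ?case using symb_on_one by auto
next
  case (insert j J)
  then obtain A B where "symb_on (d j) A (F j)" "symb_on (\<Sum>j\<in>J. d j * g j) B (\<lambda>Y. \<Prod>j\<in>J. F j Y ^ g j)" by blast
  moreover from this(1) obtain C where "symb_on (d j * g j) C (\<lambda>Y. F j Y ^ g j)" using symb_on_power by blast
  ultimately show ?case using symb_on_mult unfolding sum.insert[OF insert.hyps] prod.insert[OF insert.hyps] by blast
qed

lemma symb_on_scale_iff:
  assumes "c \<noteq> 0" "\<exists>A. symb_on d A (\<lambda>Y. c * F Y)"
  shows "\<exists>A. symb_on d A F"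
proof -
  obtain A where "symb_on d A (\<lambda>Y. c * F Y)" using assms by blast
  from symb_on_cong[OF symb_on_scale[OF this, of "inverse c"], of F] assms(1) show ?thesis
    by (auto simp: field_simps)
qed

text \<open>Pairing with the transposed matrix unit reads off an entry outside the diagonal. On the
  diagonal, pairing with the \<open>hv\<close> gives the differences \<open>Y 1 1 - Y c c\<close>,
  and their sum over \<open>c\<close> is \<open>n + 1\<close> times \<open>Y 1 1\<close> because the
  trace vanishes.\<close>

lemma symb_on_coordinate:
  assumes ab: "a \<in> {1..Suc n}" "b \<in> {1..Suc n}"
  shows "\<exists>A. symb_on 1 A (\<lambda>Y. Y a b)"
proof -
  have letter: "\<exists>A. symb_on 1 A (\<lambda>Y. trace n (mmul n (bas x) Y))" if "x \<in> bidx n" for x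
  proof (rule symb_on_scale_iff[of "2 * of_nat (Suc n)"])
    have "symb 1 (act_word \<rho> [x]) (\<lambda>Y. killing n (bas x) Y)" using symb.word[of "[x]"] that by simp
    then show "\<exists>A. symb_on 1 A (\<lambda>Y. 2 * of_nat (Suc n) * trace n (mmul n (bas x) Y))"
      unfolding symb_on_def killing_def by blast
  qed (simp add: of_nat_neq_0 del: of_nat_Suc)
  have tr: "trace n (mmul n (Emat c d) Y) = Y d c" if "c \<in> {1..Suc n}" "d \<in> {1..Suc n}" for c d Y
  proof -
    have "trace n (mmul n (Emat c d) Y) = (\<Sum>a=1..Suc n. if a = c then Y d c else 0)"
      unfolding trace_def mmul_Emat_left[OF that(2)] by (rule sum.cong) auto
    then show ?thesis using that by (simp only: sum.delta finite_atLeastAtMost if_True)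
  qed
  show ?thesis
  proof (cases "a = b")
    case False
    then have "(b,a) \<in> bidx n" "bas (b,a) = Emat b a" using ab by (auto simp: bidx_def bas_def)
    then show ?thesis using letter[of "(b,a)"] tr[OF ab(2,1)] by simp
  next
    case True
    have step: "\<exists>A. symb_on 1 A (\<lambda>Y. Y c c - Y (Suc c) (Suc c))" if c: "c \<in> {1..n}" for c
    proof -
      have h: "hv c = (\<lambda>a b. Emat c c a b - Emat (Suc c) (Suc c) a b)" by (auto simp: hv_def Emat_def fun_eq_iff)
      have "trace n (mmul n (bas (c,c)) Y) = Y c c - Y (Suc c) (Suc c)" for Y
      proof -
        have "trace n (mmul n (bas (c,c)) Y) = trace n (mmul n (Emat c c) Y) - trace n (mmul n (Emat (Suc c) (Suc c)) Y)"
          by (simp only: bas_def fst_conv snd_conv if_True h trace_def mmul_def left_diff_distrib sum_subtractf refl)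
        then show ?thesis using tr[of c c Y] tr[of "Suc c" "Suc c" Y] c by simp
      qed
      then show ?thesis using letter[of "(c,c)"] c by (simp add: bidx_def)
    qed
    have diff: "\<exists>A. symb_on 1 A (\<lambda>Y. Y 1 1 - Y c c)" if "c \<ge> 1" "c \<le> Suc n" for c
      using that
    proof (induction c rule: nat_induct_at_least)
      case base show ?case using symb_on_zero by auto
    next
      case (Suc c)
      obtain A B where "symb_on 1 A (\<lambda>Y. Y 1 1 - Y c c)" "symb_on 1 B (\<lambda>Y. Y c c - Y (Suc c) (Suc c))"
        using Suc step[of c] by auto
      from symb_on_add[OF this] show ?case by auto
    qed
    then have "\<forall>c\<in>{1..Suc n}. \<exists>A. symb_on 1 A (\<lambda>Y. Y 1 1 - Y c c)" by auto
    from bchoice[OF this] obtain A where A: "\<And>c. c \<in> {1..Suc n} \<Longrightarrow> symb_on 1 (A c) (\<lambda>Y. Y 1 1 - Y c c)" by blast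
    have "symb_on 1 (\<lambda>x. \<Sum>c\<in>{1..Suc n}. sc 1 (A c x)) (\<lambda>Y. \<Sum>c\<in>{1..Suc n}. 1 * (Y 1 1 - Y c c))"
      by (rule symb_on_sum) (use A in auto)
    then have "\<exists>A. symb_on 1 A (\<lambda>Y. of_nat (Suc n) * Y 1 1)"
      by (intro exI, rule symb_on_cong) (simp add: sum_subtractf sl_def del: sum.cl_ivl_Suc of_nat_Suc)
    then obtain B where B: "symb_on 1 B (\<lambda>Y. Y 1 1)"
      using symb_on_scale_iff[of "of_nat (Suc n)" 1 "\<lambda>Y. Y 1 1"] of_nat_neq_0 by blast
    from symb_on_add[OF B symb_on_scale[OF A[OF ab(1)], of "-1"]] show ?thesis using True by auto
  qed
qed

end

text \<open>The entry \<open>j\<close> of the first row of the matrix power \<open>Y^k\<close>, for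
  \<open>j\<close> in range.\<close>

primrec row_power :: "nat \<Rightarrow> mat \<Rightarrow> nat \<Rightarrow> nat \<Rightarrow> complex" where
  "row_power n Y 0 j = (if j = 1 then 1 else 0)"
| "row_power n Y (Suc k) j = (\<Sum>c=1..Suc n. row_power n Y k c * Y c j)"

text \<open>For the conjugate \<open>Y\<close> of the principal nilpotent \<open>J\<close> with
  \<open>P Y = J P\<close>, each row of \<open>P\<close> times \<open>Y\<close> is the next row. If
  the first row of \<open>P\<close> is the first unit vector, the rows of \<open>P\<close> are
  therefore the first rows of the powers of \<open>Y\<close>. So the first rows of
  \<open>Y, ..., Y^n\<close> can be prescribed freely near the identity, which gives as many
  independent functions as the orbit has dimensions.\<close>

lemma O_prin_row_power:
  assumes P: "in_gl n P" and first: "\<And>j. P 1 j = (if j = 1 then 1 else 0)"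
    and near: "\<And>a b. a \<in> {1..Suc n} \<Longrightarrow> b \<in> {1..Suc n} \<Longrightarrow> norm (P a b - (if a = b then 1 else 0)) < 1 / real (Suc n)"
  obtains Y where "Y \<in> O_prin n" "\<And>k j. k \<le> n \<Longrightarrow> row_power n Y k j = P (Suc k) j"
proof -
  obtain g where g: "in_gl n g" "mmul n P g = idm n" "mmul n g P = idm n"
  proof (rule injective_imp_inverse[OF P])
    fix x :: "nat \<Rightarrow> complex" and b
    assume "\<And>a. a \<in> {1..Suc n} \<Longrightarrow> (\<Sum>b=1..Suc n. P a b * x b) = 0" "b \<in> {1..Suc n}"
    then show "x b = 0" using diag_dominant_injective[of "Suc n" P x b] near by blast
  qed
  let ?J = "principal_nilp n"
  have J: "in_gl n ?J" by (auto simp: in_gl_def principal_nilp_def)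
  define Y where "Y = mmul n (mmul n g ?J) P"
  have "Y \<in> O_prin n" unfolding O_prin_def Y_def using P g by blast
  have PY: "mmul n P Y = mmul n ?J P"
    unfolding Y_def by (simp add: mmul_assoc[symmetric] g(2) mmul_idm(2)[OF J])
  have JP: "mmul n ?J P a j = P (Suc a) j" if a: "a \<in> {1..n}" for a j
  proof -
    have "mmul n ?J P a j = (\<Sum>c=1..Suc n. if c = Suc a then P (Suc a) j else 0)"
      unfolding mmul_def principal_nilp_def by (rule sum.cong) (use a in auto)
    then show ?thesis using a by (simp only: sum.delta finite_atLeastAtMost) auto
  qed
  have "row_power n Y k j = P (Suc k) j" if "k \<le> n" for k j
    using that
  proof (induction k arbitrary: j)
    case 0 then show ?case using first by simp
  next
    case (Suc k)
    have "row_power n Y (Suc k) j = mmul n P Y (Suc k) j"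
      using Suc by (simp only: row_power.simps mmul_def)
    then show ?case using PY JP[of "Suc k" j] Suc.prems by simp
  qed
  then show thesis using that \<open>Y \<in> O_prin n\<close> by blast
qed

lemma card_neg_letters: "2 * card (neg_letters n) = n * Suc n"
proof -
  let ?S = "{1..Suc n} \<times> {1..Suc n}"
  let ?D = "(\<lambda>a. (a,a)) ` {1..Suc n}"
  have split: "?S = neg_letters n \<union> prod.swap ` neg_letters n \<union> ?D"
    by (auto simp: neg_letters_def image_iff)
  have "card ?S = card (neg_letters n \<union> prod.swap ` neg_letters n) + card ?D"
    unfolding split by (rule card_Un_disjoint) (simp_all, auto simp: neg_letters_def)
  also have "card (neg_letters n \<union> prod.swap ` neg_letters n) = card (neg_letters n) + card (prod.swap ` neg_letters n)"
    by (rule card_Un_disjoint) (simp_all, auto simp: neg_letters_def)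
  also have "card (prod.swap ` neg_letters n) = card (neg_letters n)" by (rule card_image) simp
  also have "card ?D = Suc n" by (subst card_image) (auto simp: inj_on_def)
  finally show ?thesis by (simp add: card_cartesian_product)
qed

section \<open>Algebraically independent symbols and the dimension count\<close>

context hw_module begin

lemma symb_on_row_power: "j \<in> {1..Suc n} \<Longrightarrow> \<exists>A. symb_on k A (\<lambda>Y. row_power n Y k j)"
proof (induction k arbitrary: j)
  case 0
  have "symb_on 0 (\<lambda>x. sc (if j = 1 then 1 else 0) x) (\<lambda>Y. (if j = 1 then 1 else 0) * 1)"
    by (rule symb_on_scale[OF symb_on_one])
  then show ?case by auto
next
  case (Suc k)
  have "\<exists>A. symb_on (Suc k) A (\<lambda>Y. row_power n Y k c * Y c j)" if c: "c \<in> {1..Suc n}" for c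
  proof -
    obtain A B where "symb_on k A (\<lambda>Y. row_power n Y k c)" "symb_on 1 B (\<lambda>Y. Y c j)"
      using Suc.IH[OF c] symb_on_coordinate[OF c Suc.prems] by blast
    from symb_on_mult[OF this] show ?thesis by auto
  qed
  then have "\<forall>c\<in>{1..Suc n}. \<exists>A. symb_on (Suc k) A (\<lambda>Y. row_power n Y k c * Y c j)" by blast
  from bchoice[OF this] obtain A where "\<And>c. c \<in> {1..Suc n} \<Longrightarrow> symb_on (Suc k) (A c) (\<lambda>Y. row_power n Y k c * Y c j)" by blast
  then have "symb_on (Suc k) (\<lambda>x. \<Sum>c\<in>{1..Suc n}. sc 1 (A c x)) (\<lambda>Y. \<Sum>c\<in>{1..Suc n}. 1 * (row_power n Y k c * Y c j))"
    by (intro symb_on_sum) auto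
  then show ?case by (auto simp del: sum.cl_ivl_Suc)
qed

end

context hw_module begin

text \<open>Monomials of equal degree \<open>d\<close> in the first-row functions are symbols of
  operators. If the module were not free, there would be more such monomials than matrix entries
  determining the operators, so some nonzero combination would act as zero. Its symbol would vanish
  on the principal orbit, against the independence of the monomials there.\<close>

theorem principal_variety_imp_free:
  assumes n: "n \<ge> 1" and irr: "irreducible_mod n sc \<rho>" and var: "O_prin n \<subseteq> assoc_var n sc \<rho>"
    and wd: "word_choice wd"
  shows "pbw_free wd"
proof (rule ccontr)
  assume "\<not> pbw_free wd"
  then obtain I c where "\<not> (finite I \<longrightarrow> (\<forall>m\<in>I. set_mset m \<subseteq> neg_letters n) \<longrightarrow>
     (\<Sum>m\<in>I. sc (c m) (act_word \<rho> (wd m) v0)) = 0 \<longrightarrow> (\<forall>m\<in>I. c m = 0))"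
    unfolding pbw_free_def not_all by (elim exE)
  then obtain m1 where I: "finite I" "\<And>m. m \<in> I \<Longrightarrow> set_mset m \<subseteq> neg_letters n"
      "(\<Sum>m\<in>I. sc (c m) (act_word \<rho> (wd m) v0)) = 0" "m1 \<in> I" "c m1 \<noteq> 0"
    by auto
  obtain a0 where a0: "set_mset a0 \<subseteq> neg_letters n"
    "\<And>M. wspan M UNIV \<subseteq> span {act_word \<rho> (wd m) v0 | m.
        set_mset m \<subseteq> neg_letters n \<and> size m < M \<and> \<not> a0 \<subseteq># m}"
    using leading_monomial_spanning[OF wd I] by blast
  define S where "S M = {m. set_mset m \<subseteq> neg_letters n \<and> size m < M \<and> \<not> a0 \<subseteq># m}" for M
  define D where "D = card (neg_letters n)"
  have finS: "finite (S M)" and cardS: "card (S M) \<le> size a0 * M ^ (D - 1)" for M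
    using card_multisets_avoiding[OF finite_neg_letters a0(1)] by (simp_all add: S_def D_def)
  have spanS: "wspan M UNIV \<subseteq> span {act_word \<rho> (wd m) v0 | m. m \<in> S M}" for M
    using a0(2) by (simp add: S_def)
  have D2: "2 * D = n * Suc n" using card_neg_letters by (simp add: D_def)
  then have D1: "D \<ge> 1" using n by (cases D) auto
  \<comment> \<open>The pairs \<open>(k,j)\<close> index the entries of the first rows of
    \<open>Y, ..., Y^n\<close>; their number \<open>n (n + 1) = 2 D\<close> is the dimension of the
    principal orbit.\<close>
  define J where "J = {1..n} \<times> {1..Suc n}"
  \<comment> \<open>The function at this index is \<open>Y 1 1\<close>, of degree one. Its powers
    fill up every monomial to the common degree \<open>d\<close>.\<close>
  define i0 where "i0 = (1::nat, 1::nat)"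
  define J' where "J' = J - {i0}"
  have J: "finite J" "i0 \<in> J" "finite J'" "card J = 2 * D" "i0 \<notin> J'"
  proof -
    show "finite J" "i0 \<in> J" "finite J'" "i0 \<notin> J'" using n by (simp_all add: J_def i0_def J'_def)
    show "card J = 2 * D" unfolding J_def D2 card_cartesian_product by simp
  qed
  have Jins: "J = insert i0 J'" using J(2) by (auto simp: J'_def)
  have cardJ': "card J' = 2 * D - 1" unfolding J'_def using J(1,2,4) by simp
  \<comment> \<open>\<open>C\<close> is the sum of the degrees of the functions, so degree
    \<open>d = t C\<close> accommodates all exponents up to \<open>t\<close>. \<open>M1\<close> is
    the commutator order in degree \<open>d\<close>, and \<open>Q\<close> is chosen so that
    \<open>M1\<close> and \<open>M1 + d\<close> are at most \<open>Q (t + 1)\<close>. The value of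
    \<open>t\<close> turns the bound for \<open>card E\<close> into \<open>t (t + 1)^(2D-2)\<close>,
    below the number \<open>(t + 1)^(2D-1)\<close> of monomials.\<close>
  define C where "C = (\<Sum>j\<in>J. fst j)"
  define Q where "Q = 2 * n * C + 1 + C"
  define t where "t = size a0 * size a0 * Q ^ (2 * (D - 1))"
  define d where "d = t * C"
  define M1 where "M1 = Suc (2 * n * d)"
  define G where "G = PiE J' (\<lambda>_. {0..t})"
  have finG: "finite G" unfolding G_def by (intro finite_PiE J(3)) auto
  have cardG: "card G = Suc t ^ (2 * D - 1)" unfolding G_def by (simp add: card_PiE[OF J(3)] cardJ')
  \<comment> \<open>Positions of the matrix of an operator of degree \<open>d\<close>, from spanning
    vectors of length below \<open>M1\<close> to those of length below \<open>M1 + d\<close>;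
    vanishing at all of them forces the operator to be zero.\<close>
  define E where "E = S M1 \<times> S (M1 + d)"
  have cardE: "card E < card G"
  proof -
    have M1: "M1 \<le> Q * Suc t" "M1 + d \<le> Q * Suc t" by (auto simp: M1_def d_def Q_def algebra_simps)
    have "card E \<le> (size a0 * M1 ^ (D - 1)) * (size a0 * (M1 + d) ^ (D - 1))"
      unfolding E_def card_cartesian_product by (intro mult_mono cardS) auto
    also have "\<dots> \<le> (size a0 * (Q * Suc t) ^ (D - 1)) * (size a0 * (Q * Suc t) ^ (D - 1))"
      using M1 by (intro mult_mono power_mono) auto
    also have "\<dots> = (size a0 * size a0) * (Q * Suc t) ^ (2 * (D - 1))"
      by (simp only: mult_2 power_add mult.assoc mult.left_commute)
    also have "\<dots> = t * Suc t ^ (2 * (D - 1))" by (simp only: t_def power_mult_distrib mult.assoc)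
    also have "\<dots> < Suc t * Suc t ^ (2 * (D - 1))" by simp
    also have "\<dots> = Suc t ^ (Suc (2 * (D - 1)))" by simp
    also have "Suc (2 * (D - 1)) = 2 * D - 1" using D1 by simp
    finally show ?thesis by (simp add: cardG)
  qed
  define fill where "fill g = d - (\<Sum>j\<in>J'. fst j * g j)" for g
  define h where "h g = g(i0 := fill g)" for g
  have deg: "(\<Sum>j\<in>J. fst j * h g j) = d" if g: "g \<in> G" for g
  proof -
    have "(\<Sum>j\<in>J'. fst j * g j) \<le> (\<Sum>j\<in>J'. fst j * t)"
      using g by (intro sum_mono mult_mono) (auto simp: G_def)
    also have "\<dots> \<le> (\<Sum>j\<in>J. fst j * t)" unfolding Jins using J(3,5) by simp
    also have "\<dots> = d" by (simp add: d_def C_def sum_distrib_left mult.commute)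
    finally have le: "(\<Sum>j\<in>J'. fst j * g j) \<le> d" .
    have "(\<Sum>j\<in>J. fst j * h g j) = fst i0 * h g i0 + (\<Sum>j\<in>J'. fst j * h g j)" unfolding Jins using J(3,5) by simp
    also have "(\<Sum>j\<in>J'. fst j * h g j) = (\<Sum>j\<in>J'. fst j * g j)" using J(5) by (intro sum.cong) (auto simp: h_def)
    finally show ?thesis using le by (simp add: h_def fill_def i0_def)
  qed
  have "\<exists>A. symb_on d A (\<lambda>Y. \<Prod>j\<in>J. row_power n Y (fst j) (snd j) ^ h g j)" if g: "g \<in> G" for g
    using symb_on_monomial[OF J(1), of fst "\<lambda>j Y. row_power n Y (fst j) (snd j)" "h g"] symb_on_row_power
    unfolding deg[OF g] by (auto simp: J_def)
  then have "\<forall>g\<in>G. \<exists>A. symb_on d A (\<lambda>Y. \<Prod>j\<in>J. row_power n Y (fst j) (snd j) ^ h g j)" by blast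
  from bchoice[OF this] obtain A where A: "\<And>g. g \<in> G \<Longrightarrow> symb_on d (A g) (\<lambda>Y. \<Prod>j\<in>J. row_power n Y (fst j) (snd j) ^ h g j)"
    by blast
  have "\<exists>q. A g (act_word \<rho> (wd m) v0) = (\<Sum>m'\<in>S (M1 + d). sc (q m') (act_word \<rho> (wd m') v0))"
    if g: "g \<in> G" and m: "m \<in> S M1" for g m
  proof (rule span_finite_image[OF finS])
    obtain F where F: "symb d (A g) F" using A[OF g] by (auto simp: symb_on_def)
    have "act_word \<rho> (wd m) v0 \<in> wspan M1 UNIV"
      by (rule word_in_wspan) (use m word_choice_set[OF wd] word_choice_length[OF wd] in \<open>auto simp: S_def\<close>)
    then show "A g (act_word \<rho> (wd m) v0) \<in> span {act_word \<rho> (wd m') v0 | m'. m' \<in> S (M1 + d)}"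
      using symb_wspan[OF F] spanS by blast
  qed
  then obtain q where q: "\<And>g m. g \<in> G \<Longrightarrow> m \<in> S M1 \<Longrightarrow>
      A g (act_word \<rho> (wd m) v0) = (\<Sum>m'\<in>S (M1 + d). sc (q g m m') (act_word \<rho> (wd m') v0))"
    by metis
  obtain k where k: "\<exists>g\<in>G. k g \<noteq> 0" "\<forall>e\<in>E. (\<Sum>g\<in>G. k g * q g (fst e) (snd e)) = 0"
    using homogeneous_system_solution[OF _ finG cardE, of "\<lambda>e g. q g (fst e) (snd e)"] finS
    unfolding E_def by blast
  define B where "B x = (\<Sum>g\<in>G. sc (k g) (A g x))" for x
  define F where "F Y = (\<Sum>g\<in>G. k g * (\<Prod>j\<in>J. row_power n Y (fst j) (snd j) ^ h g j))" for Y
  have "symb_on d B F" unfolding B_def[abs_def] F_def[abs_def] by (rule symb_on_sum[OF finG A])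
  then obtain F' where F': "symb d B F'" "\<And>Y. Y \<in> sl n \<Longrightarrow> F' Y = F Y" by (auto simp: symb_on_def)
  note linB = lin_opD[OF symb_lin_op[OF F'(1)]]
  have gen0: "B (act_word \<rho> (wd m) v0) = 0" if m: "m \<in> S M1" for m
  proof -
    have "B (act_word \<rho> (wd m) v0) = (\<Sum>g\<in>G. \<Sum>m'\<in>S (M1 + d). sc (k g * q g m m') (act_word \<rho> (wd m') v0))"
      unfolding B_def by (intro sum.cong) (simp_all add: q[OF _ m] scale_sum_right)
    also have "\<dots> = (\<Sum>m'\<in>S (M1 + d). \<Sum>g\<in>G. sc (k g * q g m m') (act_word \<rho> (wd m') v0))" by (rule sum.swap)
    also have "\<dots> = (\<Sum>m'\<in>S (M1 + d). sc (\<Sum>g\<in>G. k g * q g m m') (act_word \<rho> (wd m') v0))"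
      by (simp add: scale_sum_left)
    also have "\<dots> = 0" using k(2) m by (intro sum.neutral) (auto simp: E_def)
    finally show ?thesis .
  qed
  have "B x = 0" if "x \<in> wspan M1 UNIV" for x
  proof -
    have "x \<in> span {act_word \<rho> (wd m) v0 | m. m \<in> S M1}" using that spanS by blast
    then show ?thesis
      by (induction rule: span_induct_alt) (auto simp: linB gen0)
  qed
  then have B0: "B x = 0" for x
    using comm_ord_vanish[OF pbw_all_UNIV[OF irr] symb_comm_ord[OF F'(1)] symb_lin_op[OF F'(1)]]
    unfolding M1_def by blast
  have F0: "F Y = 0" if "Y \<in> O_prin n" for Y
  proof -
    have "Y \<in> assoc_var n sc \<rho>" using that var by blast
    then show ?thesis using symb_vanish[OF F'(1) B0] F'(2)[of Y] by (simp add: assoc_var_def)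
  qed
  have inj: "inj_on h G"
  proof (rule inj_onI)
    fix g g' assume gg: "g \<in> G" "g' \<in> G" "h g = h g'"
    show "g = g'"
    proof
      fix j
      show "g j = g' j"
      proof (cases "j = i0")
        case True
        then show ?thesis using gg(1,2) J(5) PiE_arb[of g J' "\<lambda>_. {0..t}"] PiE_arb[of g' J' "\<lambda>_. {0..t}"]
            unfolding G_def by metis
      next
        case False
        then show ?thesis using fun_cong[OF gg(3), of j] by (simp add: h_def)
      qed
    qed
  qed
  define k' where "k' f = k (the_inv_into G h f)" for f
  have k': "k' (h g) = k g" if "g \<in> G" for g using that inj by (simp add: k'_def the_inv_into_f_f)
  \<comment> \<open>The function with index \<open>(k,j)\<close> prescribes the entry of
    \<open>P\<close> in row \<open>k + 1\<close> and column \<open>j\<close>, so its values range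
    over a ball around the corresponding entry of the identity.\<close>
  define X :: "nat \<times> nat \<Rightarrow> complex set"
    where "X j = ball (if Suc (fst j) = snd j then 1 else 0) (1 / real (Suc n))" for j
  have vanish: "(\<Sum>f\<in>h ` G. k' f * (\<Prod>j\<in>J. x j ^ f j)) = 0" if x: "\<And>j. j \<in> J \<Longrightarrow> x j \<in> X j" for x
  proof -
    define P where "P = (\<lambda>a b. if a \<in> {1..Suc n} \<and> b \<in> {1..Suc n} then
        (if a = 1 then if b = 1 then 1 else 0 else x (a - 1, b)) else 0)"
    have glP: "in_gl n P" by (auto simp: in_gl_def P_def)
    have first: "P 1 j = (if j = 1 then 1 else 0)" for j by (auto simp: P_def)
    have near: "norm (P a b - (if a = b then 1 else 0)) < 1 / real (Suc n)"
      if ab: "a \<in> {1..Suc n}" "b \<in> {1..Suc n}" for a b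
    proof (cases "a = 1")
      case True then show ?thesis using ab by (auto simp: P_def)
    next
      case False
      then have "x (a - 1, b) \<in> X (a - 1, b)" using ab by (intro x) (auto simp: J_def)
      then have "norm (x (a - 1, b) - (if a = b then 1 else 0)) < 1 / real (Suc n)"
        using False ab by (simp add: X_def dist_norm norm_minus_commute)
      then show ?thesis using False ab by (simp add: P_def)
    qed
    obtain Y where Y: "Y \<in> O_prin n" "\<And>k j. k \<le> n \<Longrightarrow> row_power n Y k j = P (Suc k) j"
      using O_prin_row_power[OF glP first near] by blast
    have "0 = F Y" using F0[OF Y(1)] by simp
    also have "\<dots> = (\<Sum>g\<in>G. k g * (\<Prod>j\<in>J. x j ^ h g j))"
      unfolding F_def
    proof (intro sum.cong refl arg_cong2[of _ _ _ _ "(*)"] prod.cong)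
      fix j g assume "j \<in> J"
      then show "row_power n Y (fst j) (snd j) ^ h g j = x j ^ h g j"
        by (auto simp: Y(2) J_def P_def)
    qed
    also have "\<dots> = (\<Sum>f\<in>h ` G. k' f * (\<Prod>j\<in>J. x j ^ f j))"
      by (subst sum.reindex[OF inj]) (simp add: k')
    finally show ?thesis by simp
  qed
  have "k' f = 0" if f: "f \<in> h ` G" for f
  proof (rule monomials_independent[OF J(1) _ _ _ vanish f])
    show "finite (h ` G)" using finG by simp
    show "infinite (X j)" for j
      using uncountable_ball[of "1 / real (Suc n)" "if Suc (fst j) = snd j then 1 else 0 :: complex"]
      unfolding X_def by (auto intro: countable_finite)
    show "f = f'" if ff: "f \<in> h ` G" "f' \<in> h ` G" "\<And>j. j \<in> J \<Longrightarrow> f j = f' j" for f f'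
    proof
      fix j
      show "f j = f' j"
      proof (cases "j \<in> J")
        case True then show ?thesis using ff by simp
      next
        case False
        then have "j \<notin> J'" "j \<noteq> i0" using Jins by auto
        then show ?thesis using ff(1,2) PiE_arb[of _ J' "\<lambda>_. {0..t}" j]
          unfolding G_def h_def by fastforce
      qed
    qed
  qed
  then show False using k(1) k' by auto
qed

end

section \<open>An interpolation identity for the Gelfand-Tsetlin coefficients\<close>

lemma linear_factors_coeffs:
  fixes x :: "'i \<Rightarrow> 'a::field"
  assumes "finite I"
  defines "Q \<equiv> \<Prod>i\<in>I. [:- x i, 1:]"
  shows "degree Q = card I" "coeff Q (card I) = 1"
    "I \<noteq> {} \<Longrightarrow> coeff Q (card I - 1) = - (\<Sum>i\<in>I. x i)"
proof -
  show deg: "degree Q = card I" unfolding Q_def by (subst degree_prod_eq_sum_degree) auto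
  have "lead_coeff Q = 1" unfolding Q_def by (simp add: lead_coeff_prod)
  then show "coeff Q (card I) = 1" using deg by simp
  show "coeff Q (card I - 1) = - (\<Sum>i\<in>I. x i)" if "I \<noteq> {}"
    using assms(1) that unfolding Q_def
  proof (induction rule: finite_ne_induct)
    case (singleton a) then show ?case by simp
  next
    case (insert a I)
    let ?Q = "\<Prod>i\<in>I. [:- x i, 1:]"
    have "degree ?Q = card I" by (subst degree_prod_eq_sum_degree) auto
    moreover have "lead_coeff ?Q = 1" by (simp add: lead_coeff_prod)
    ultimately have l: "coeff ?Q (card I) = 1" by simp
    obtain c where c: "card I = Suc c" using insert by (cases "card I") auto
    have "coeff (\<Prod>i\<in>insert a I. [:- x i, 1:]) (card (insert a I) - 1) = - x a * coeff ?Q (card I) + coeff ?Q (card I - 1)"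
      using insert c by simp
    then show ?case using insert l by simp
  qed
qed

text \<open>Both \<open>g\<close> and the product \<open>Q\<close> of the factors at the nodes are
  monic of degree \<open>card I\<close>, so \<open>g - Q\<close> has smaller degree and equals its
  Lagrange interpolant, whose values at the nodes are those of \<open>g\<close>. The identity
  compares the coefficients of degree \<open>card I - 1\<close>.\<close>

lemma lagrange_sum:
  fixes x :: "'i \<Rightarrow> 'a::field"
  assumes I: "finite I" "I \<noteq> {}" "inj_on x I"
    and g: "degree g = card I" "lead_coeff g = 1"
  shows "(\<Sum>i\<in>I. poly g (x i) / (\<Prod>j\<in>I-{i}. x i - x j)) = coeff g (card I - 1) + (\<Sum>i\<in>I. x i)"
proof -
  define Q where "Q = (\<Prod>i\<in>I. [:- x i, 1:])"
  define L where "L i = (\<Prod>j\<in>I-{i}. [:- x j, 1:])" for i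
  define D where "D i = (\<Prod>j\<in>I-{i}. x i - x j)" for i
  note Qc = linear_factors_coeffs[OF I(1), of x, folded Q_def]
  have D0: "D i \<noteq> 0" if "i \<in> I" for i
    using I that by (auto simp: D_def dest: inj_onD)
  have c1: "card I \<ge> 1" using I by (simp add: Suc_leI card_gt_0_iff)
  have Lc: "degree (L i) = card I - 1" "coeff (L i) (card I - 1) = 1" if "i \<in> I" for i
    using linear_factors_coeffs(1,2)[of "I - {i}" x] I that by (simp_all add: L_def)
  define h where "h = g - Q"
  have Q0: "poly Q (x i) = 0" if "i \<in> I" for i
    using I that by (auto simp: Q_def poly_prod)
  define P where "P = h - (\<Sum>i\<in>I. smult (poly g (x i) / D i) (L i))"
  have LP: "poly (L i) (x k) = (if i = k then D k else 0)" if "i \<in> I" "k \<in> I" for i k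
    using I that by (auto simp: L_def D_def poly_prod)
  have "poly P (x k) = 0" if k: "k \<in> I" for k
  proof -
    have "(\<Sum>i\<in>I. poly g (x i) / D i * poly (L i) (x k)) = (\<Sum>i\<in>I. if i = k then poly g (x k) else 0)"
      by (rule sum.cong) (use k D0 LP in auto)
    also have "\<dots> = poly g (x k)" using I k by simp
    finally show ?thesis using Q0[OF k] by (simp add: P_def h_def poly_sum)
  qed
  then have roots: "x ` I \<subseteq> {r. poly P r = 0}" by auto
  have Pz: "P = 0"
  proof (rule ccontr)
    assume nz: "P \<noteq> 0"
    have "coeff P m = 0" if "m \<ge> card I" for m
    proof -
      have "coeff (L i) m = 0" if "i \<in> I" for i
        using Lc(1)[OF that] \<open>m \<ge> card I\<close> c1 by (intro coeff_eq_0) auto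
      moreover have "coeff g m = coeff Q m"
        using g Qc(1,2) that by (cases "m = card I") (auto simp: coeff_eq_0)
      ultimately show ?thesis by (simp add: P_def h_def coeff_sum)
    qed
    then have "degree P < card I" using nz by (metis leading_coeff_0_iff not_le)
    moreover have "card I \<le> card {r. poly P r = 0}"
      using card_mono[OF poly_roots_finite[OF nz] roots] card_image[OF I(3)] by simp
    ultimately show False using card_poly_roots_bound[OF nz] by simp
  qed
  have "0 = coeff P (card I - 1)" by (simp add: Pz)
  also have "\<dots> = coeff g (card I - 1) - coeff Q (card I - 1) - (\<Sum>i\<in>I. poly g (x i) / D i * coeff (L i) (card I - 1))"
    by (simp add: P_def h_def coeff_sum)
  also have "(\<Sum>i\<in>I. poly g (x i) / D i * coeff (L i) (card I - 1)) = (\<Sum>i\<in>I. poly g (x i) / D i)"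
    by (rule sum.cong[OF refl]) (simp only: Lc mult_1_right)
  finally show ?thesis using Qc(3) I by (simp add: D_def)
qed

text \<open>This is the diagonal part of the relation between raising and lowering operators of one
  row. It is Lagrange's sum over the \<open>2 k\<close> nodes \<open>x i\<close> and
  \<open>x i - 1\<close>, for the monic polynomial with the \<open>k + 1\<close> roots
  \<open>a j\<close> and the \<open>k - 1\<close> roots \<open>b j - 1\<close>; the hypothesis on
  differences makes the nodes distinct.\<close>

lemma gt_diagonal_identity:
  fixes x a b :: "nat \<Rightarrow> complex"
  assumes k: "k \<ge> 1"
    and x: "\<And>i j. i \<in> {1..k} \<Longrightarrow> j \<in> {1..k} \<Longrightarrow> i \<noteq> j \<Longrightarrow> x i - x j \<notin> {0, 1, -1}"
  shows "(\<Sum>i=1..k. (\<Prod>j=1..Suc k. x i - a j) * (\<Prod>j=1..k-1. x i + 1 - b j) /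
              ((\<Prod>j\<in>{1..k}-{i}. x i - x j) * (\<Prod>j\<in>{1..k}-{i}. x i + 1 - x j))
            - (\<Prod>j=1..Suc k. x i - 1 - a j) * (\<Prod>j=1..k-1. x i - b j) /
              ((\<Prod>j\<in>{1..k}-{i}. x i - x j) * (\<Prod>j\<in>{1..k}-{i}. x i - 1 - x j)))
    = 2 * (\<Sum>i=1..k. x i) - (\<Sum>i=1..k-1. b i) - (\<Sum>i=1..Suc k. a i) - 1"
proof -
  let ?K = "{1..k}"
  define I where "I = ?K \<times> (UNIV :: bool set)"
  define y where "y p = (if snd p then x (fst p) - 1 else x (fst p))" for p :: "nat \<times> bool"
  define R where "R = {1..Suc k} <+> {1..k-1}"
  define r where "r = (\<lambda>s. case s of Inl j \<Rightarrow> a j | Inr j \<Rightarrow> b j - 1)"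
  define g where "g = (\<Prod>s\<in>R. [:- r s, 1:])"
  have finR: "finite R" "R \<noteq> {}" by (auto simp: R_def)
  have cardR: "card R = 2 * k" using k by (simp add: R_def card_Plus)
  have finI: "finite I" "I \<noteq> {}" using k by (auto simp: I_def)
  have cardI: "card I = 2 * k" by (simp add: I_def card_cartesian_product card_UNIV_bool)
  note gc = linear_factors_coeffs[OF finR(1), of r, folded g_def]
  have inj: "inj_on y I"
  proof (rule inj_onI)
    fix p p' assume p: "p \<in> I" "p' \<in> I" "y p = y p'"
    obtain i u where pi: "p = (i,u)" by force
    obtain j v where pj: "p' = (j,v)" by force
    have ij: "i \<in> ?K" "j \<in> ?K" using p pi pj by (auto simp: I_def)
    have "i = j" using x[OF ij] p(3) by (cases u; cases v) (auto simp: y_def pi pj algebra_simps)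
    then show "p = p'" using p(3) by (cases u; cases v) (auto simp: y_def pi pj)
  qed
  have pg: "poly g u = (\<Prod>j=1..Suc k. u - a j) * (\<Prod>j=1..k-1. u + 1 - b j)" for u
  proof -
    have "poly g u = (\<Prod>s\<in>R. u - r s)" by (simp add: g_def poly_prod)
    also have "\<dots> = (\<Prod>j=1..Suc k. u - r (Inl j)) * (\<Prod>j=1..k-1. u - r (Inr j))"
      unfolding R_def by (subst prod.Plus) auto
    finally show ?thesis by (simp add: r_def algebra_simps del: prod.cl_ivl_Suc)
  qed
  have den: "(\<Prod>p\<in>I-{(i,u)}. y (i,u) - y p) =
      (if u then - (\<Prod>j\<in>?K-{i}. x i - 1 - x j) * (\<Prod>j\<in>?K-{i}. x i - x j)
       else (\<Prod>j\<in>?K-{i}. x i - x j) * (\<Prod>j\<in>?K-{i}. x i + 1 - x j))" if i: "i \<in> ?K" for i u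
  proof -
    have s: "I - {(i,u)} = insert (i, \<not> u) ((?K - {i}) \<times> UNIV)" using i by (auto simp: I_def)
    have "(\<Prod>p\<in>I-{(i,u)}. y (i,u) - y p) = (y (i,u) - y (i, \<not> u)) * (\<Prod>p\<in>(?K-{i}) \<times> UNIV. y (i,u) - y p)"
      unfolding s by (rule prod.insert) auto
    also have "(\<Prod>p\<in>(?K-{i}) \<times> (UNIV :: bool set). y (i,u) - y p)
      = (\<Prod>j\<in>?K-{i}. \<Prod>v\<in>UNIV. y (i,u) - y (j,v))"
      by (subst prod.cartesian_product) (auto intro!: prod.cong)
    also have "\<dots> = (\<Prod>j\<in>?K-{i}. (y (i,u) - x j) * (y (i,u) + 1 - x j))"
      by (rule prod.cong) (auto simp: UNIV_bool y_def algebra_simps)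
    also have "\<dots> = (\<Prod>j\<in>?K-{i}. y (i,u) - x j) * (\<Prod>j\<in>?K-{i}. y (i,u) + 1 - x j)"
      by (rule prod.distrib)
    finally show ?thesis by (auto simp: y_def)
  qed
  have "(\<Sum>p\<in>I. poly g (y p) / (\<Prod>q\<in>I-{p}. y p - y q))
      = (\<Sum>i\<in>?K. \<Sum>u\<in>UNIV. poly g (y (i,u)) / (\<Prod>q\<in>I-{(i,u)}. y (i,u) - y q))"
    unfolding I_def by (subst sum.cartesian_product) (auto intro!: sum.cong)
  also have "\<dots> = (\<Sum>i\<in>?K. (\<Prod>j=1..Suc k. x i - a j) * (\<Prod>j=1..k-1. x i + 1 - b j) /
              ((\<Prod>j\<in>?K-{i}. x i - x j) * (\<Prod>j\<in>?K-{i}. x i + 1 - x j))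
            - (\<Prod>j=1..Suc k. x i - 1 - a j) * (\<Prod>j=1..k-1. x i - b j) /
              ((\<Prod>j\<in>?K-{i}. x i - x j) * (\<Prod>j\<in>?K-{i}. x i - 1 - x j)))"
  proof (rule sum.cong[OF refl])
    fix i assume i: "i \<in> ?K"
    show "(\<Sum>u\<in>UNIV. poly g (y (i,u)) / (\<Prod>q\<in>I-{(i,u)}. y (i,u) - y q)) =
      (\<Prod>j=1..Suc k. x i - a j) * (\<Prod>j=1..k-1. x i + 1 - b j) /
              ((\<Prod>j\<in>?K-{i}. x i - x j) * (\<Prod>j\<in>?K-{i}. x i + 1 - x j))
            - (\<Prod>j=1..Suc k. x i - 1 - a j) * (\<Prod>j=1..k-1. x i - b j) /
              ((\<Prod>j\<in>?K-{i}. x i - x j) * (\<Prod>j\<in>?K-{i}. x i - 1 - x j))"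
      unfolding den[OF i] pg UNIV_bool
      by (simp add: y_def mult.commute del: prod.cl_ivl_Suc)
  qed
  finally have eq: "(\<Sum>p\<in>I. poly g (y p) / (\<Prod>q\<in>I-{p}. y p - y q)) = \<dots>" .
  have lag: "(\<Sum>p\<in>I. poly g (y p) / (\<Prod>q\<in>I-{p}. y p - y q)) = coeff g (card I - 1) + (\<Sum>p\<in>I. y p)"
    by (rule lagrange_sum[OF finI inj]) (use gc(1,2) cardR cardI in auto)
  have "(\<Sum>s\<in>R. r s) = (\<Sum>j=1..Suc k. a j) + (\<Sum>j=1..k-1. b j - 1)"
    unfolding R_def by (subst sum.Plus) (auto simp: r_def)
  also have "(\<Sum>j=1..k-1. b j - 1) = (\<Sum>j=1..k-1. b j) - of_nat (k - 1)" by (simp add: sum_subtractf)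
  finally have sr: "(\<Sum>s\<in>R. r s) = (\<Sum>j=1..Suc k. a j) + (\<Sum>j=1..k-1. b j) - of_nat (k - 1)" by simp
  have "(\<Sum>p\<in>I. y p) = (\<Sum>i\<in>?K. \<Sum>u\<in>UNIV. y (i,u))"
    unfolding I_def by (subst sum.cartesian_product) (auto intro!: sum.cong)
  also have "\<dots> = (\<Sum>i\<in>?K. 2 * x i - 1)" by (rule sum.cong) (auto simp: UNIV_bool y_def)
  also have "\<dots> = 2 * (\<Sum>i\<in>?K. x i) - of_nat k" by (simp add: sum_subtractf sum_distrib_left)
  finally have sy: "(\<Sum>p\<in>I. y p) = 2 * (\<Sum>i\<in>?K. x i) - of_nat k" .
  have "coeff g (card I - 1) = - (\<Sum>s\<in>R. r s)" using gc(3) finR cardR cardI by simp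
  then show ?thesis unfolding eq[symmetric] lag sr sy using k by (simp add: of_nat_diff del: sum.cl_ivl_Suc)
qed

section \<open>From Chevalley generators to matrix units\<close>

definition comm :: "'r::ring \<Rightarrow> 'r \<Rightarrow> 'r" where "comm x y = x * y - y * x"

lemma comm_simps [simp]:
  "comm x 0 = 0" "comm 0 y = 0" "comm x x = 0"
  "comm x (y + z) = comm x y + comm x z" "comm (x + y) z = comm x z + comm y z"
  "comm x (y - z) = comm x y - comm x z" "comm (x - y) z = comm x z - comm y z"
  "comm x (- y) = - comm x y" "comm (- x) y = - comm x y"
  by (simp_all add: comm_def algebra_simps)

lemma comm_sym: "comm x y = - comm y x"
  by (simp add: comm_def)

lemma comm_jacobi: "comm x (comm y z) = comm (comm x y) z + comm y (comm x z)"
  by (simp add: comm_def algebra_simps)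

lemma comm_jacobi': "comm (comm x y) z = comm x (comm y z) - comm y (comm x z)"
  by (simp add: comm_def algebra_simps)

text \<open>Applying the derivation of \<open>y\<close> twice to \<open>[x,z] = 0\<close> leaves, by
  the Leibniz rule and the two Serre relations, twice the bracket of \<open>[y,x]\<close> and
  \<open>[y,z]\<close>; hence the condition on 2-torsion.\<close>

lemma comm_serre_A3:
  assumes two: "\<And>u::'r::ring. u + u = 0 \<Longrightarrow> u = 0"
    and "comm x z = (0::'r)" "comm y (comm y x) = 0" "comm y (comm y z) = 0"
  shows "comm (comm x y) (comm y z) = 0"
proof -
  have "comm y (comm y (comm x z)) = comm (comm y (comm y x)) z + (comm (comm y x) (comm y z)
     + comm (comm y x) (comm y z)) + comm x (comm y (comm y z))"
    by (simp add: comm_def algebra_simps)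
  then have "comm (comm y x) (comm y z) + comm (comm y x) (comm y z) = 0" using assms(2-4) by simp
  then have "comm (comm y x) (comm y z) = 0" by (rule two)
  then show ?thesis by (simp add: comm_sym[of x y])
qed

text \<open>The left-normed bracket of \<open>e a, ..., e (a + d)\<close>, which represents the
  matrix unit in row \<open>a\<close> and column \<open>a + d + 1\<close>.\<close>

primrec chain :: "(nat \<Rightarrow> 'r::ring) \<Rightarrow> nat \<Rightarrow> nat \<Rightarrow> 'r" where
  "chain e a 0 = e a"
| "chain e a (Suc d) = comm (chain e a d) (e (a + Suc d))"

text \<open>Chevalley-Serre relations in an arbitrary ring without 2-torsion. The elements
  \<open>D a\<close> stand for the diagonal matrix units, so the target is gl(n+1), whose bracket
  formula is uniform in all index pairs.\<close>

locale chevalley_gl =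
  fixes n :: nat and e f D :: "nat \<Rightarrow> 'r::ring"
  assumes two: "\<And>u::'r. u + u = 0 \<Longrightarrow> u = 0"
    and DD: "\<lbrakk>a \<in> {1..Suc n}; b \<in> {1..Suc n}\<rbrakk> \<Longrightarrow> comm (D a) (D b) = 0"
    and De: "\<lbrakk>a \<in> {1..Suc n}; k \<in> {1..n}\<rbrakk> \<Longrightarrow>
      comm (D a) (e k) = (if a = k then e k else 0) - (if a = Suc k then e k else 0)"
    and Df: "\<lbrakk>a \<in> {1..Suc n}; k \<in> {1..n}\<rbrakk> \<Longrightarrow>
      comm (D a) (f k) = (if a = Suc k then f k else 0) - (if a = k then f k else 0)"
    and ef: "\<lbrakk>k \<in> {1..n}; l \<in> {1..n}\<rbrakk> \<Longrightarrow> comm (e k) (f l) = (if k = l then D k - D (Suc k) else 0)"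
    and ee: "\<lbrakk>k \<in> {1..n}; l \<in> {1..n}; k \<noteq> Suc l; l \<noteq> Suc k\<rbrakk> \<Longrightarrow> comm (e k) (e l) = 0"
    and ff: "\<lbrakk>k \<in> {1..n}; l \<in> {1..n}; k \<noteq> Suc l; l \<noteq> Suc k\<rbrakk> \<Longrightarrow> comm (f k) (f l) = 0"
    and serre_e: "\<lbrakk>k \<in> {1..n}; l \<in> {1..n}; k = Suc l \<or> l = Suc k\<rbrakk> \<Longrightarrow> comm (e k) (comm (e k) (e l)) = 0"
    and serre_f: "\<lbrakk>k \<in> {1..n}; l \<in> {1..n}; k = Suc l \<or> l = Suc k\<rbrakk> \<Longrightarrow> comm (f k) (comm (f k) (f l)) = 0"
begin

text \<open>The Chevalley involution. Statements proved above the diagonal transfer through it to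
  the part below.\<close>

lemma swap: "chevalley_gl n (\<lambda>k. - f k) (\<lambda>k. - e k) (\<lambda>a. - D a)"
proof
  show "comm (- f k) (- e l) = (if k = l then - D k - - D (Suc k) else 0)"
    if "k \<in> {1..n}" "l \<in> {1..n}" for k l
    using ef[OF that(2,1)] by (simp add: comm_sym[of "f k"])
  show "u = 0" if "u + u = 0" for u :: 'r using two that by blast
qed (use DD De Df ee ff serre_e serre_f in auto)

lemma fe: "\<lbrakk>k \<in> {1..n}; l \<in> {1..n}\<rbrakk> \<Longrightarrow> comm (f k) (e l) = (if k = l then D (Suc k) - D k else 0)"
  using ef[of l k] by (auto simp: comm_sym[of "f k"])

lemma chain_D:
  "\<lbrakk>c \<in> {1..Suc n}; a \<ge> 1; a + d \<le> n\<rbrakk> \<Longrightarrow>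
    comm (D c) (chain e a d) = (if c = a then chain e a d else 0) - (if c = Suc (a + d) then chain e a d else 0)"
proof (induction d)
  case 0 then show ?case using De[of c a] by simp
next
  case (Suc d)
  have "comm (D c) (e (a + Suc d)) = (if c = a + Suc d then e (a + Suc d) else 0) - (if c = Suc (a + Suc d) then e (a + Suc d) else 0)"
    using Suc.prems by (intro De) auto
  then show ?case using Suc by (auto simp: comm_jacobi)
qed

lemma chain_far:
  "\<lbrakk>a \<ge> 1; a + d \<le> n; k \<in> {1..n}; Suc k < a \<or> k > Suc (a + d)\<rbrakk> \<Longrightarrow> comm (e k) (chain e a d) = 0"
proof (induction d)
  case 0 then show ?case using ee[of k a] by auto
next
  case (Suc d)
  moreover have "comm (e k) (e (a + Suc d)) = 0" using Suc.prems by (intro ee) auto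
  ultimately show ?case by (auto simp: comm_jacobi)
qed

lemma chain_left:
  "\<lbrakk>a \<ge> 2; a + d \<le> n\<rbrakk> \<Longrightarrow> comm (e (a - 1)) (chain e a d) = chain e (a - 1) (Suc d)"
proof (induction d)
  case 0 then show ?case by simp
next
  case (Suc d)
  have "comm (e (a - 1)) (e (a + Suc d)) = 0" using Suc.prems by (intro ee) auto
  then have "comm (e (a - 1)) (chain e a (Suc d)) = comm (chain e (a - 1) (Suc d)) (e (a + Suc d))"
    using Suc by (simp add: comm_jacobi)
  moreover have "a + Suc d = a - 1 + Suc (Suc d)" using Suc.prems by simp
  ultimately show ?case by (simp only: chain.simps(2)[of e "a - 1" "Suc d"])
qed

text \<open>Induction on the length of the chain, written as \<open>[[Y', y], z]\<close>. A
  generator before the last two passes to the shorter chain. For \<open>y\<close> the relation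
  needed is \<open>comm_serre_A3\<close>; for \<open>z\<close> the chain is rewritten as
  \<open>[Y', [y, z]]\<close>, and the Serre relation between \<open>z\<close> and \<open>y\<close>
  applies.\<close>

lemma chain_inner:
  "\<lbrakk>a \<ge> 1; a + d \<le> n; a \<le> k; k \<le> a + d\<rbrakk> \<Longrightarrow> comm (e k) (chain e a d) = 0"
proof (induction d arbitrary: k rule: less_induct)
  case (less d)
  consider "d = 0" | "d = 1" | d' where "d = Suc (Suc d')" by (metis One_nat_def not0_implies_Suc)
  then show ?case
  proof cases
    case 1 then show ?thesis using less.prems by simp
  next
    case 2
    then have "k = a \<or> k = Suc a" using less.prems by auto
    then show ?thesis
    proof
      assume "k = a"
      then show ?thesis using serre_e[of a "Suc a"] less.prems 2 by simp
    next
      assume "k = Suc a"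
      then show ?thesis using serre_e[of "Suc a" a] less.prems 2 by (simp add: comm_sym[of "e a"])
    qed
  next
    case 3
    define z where "z = e (a + d)"
    define y where "y = e (a + Suc d')"
    define Y' where "Y' = chain e a d'"
    define Y where "Y = chain e a (Suc d')"
    have ch: "chain e a d = comm Y z" "Y = comm Y' y" by (simp_all add: 3 Y_def z_def y_def Y'_def)
    have Yz: "comm z Y' = 0" unfolding z_def Y'_def using less.prems 3 by (intro chain_far) auto
    have yz: "comm y (comm y z) = 0" "comm z (comm z y) = 0"
      unfolding y_def z_def using less.prems 3 serre_e[of "a + Suc d'" "a + d"] serre_e[of "a + d" "a + Suc d'"] by auto
    consider "k \<le> a + d'" | "k = a + Suc d'" | "k = a + d" using less.prems 3 by linarith
    then show ?thesis
    proof cases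
      case 1
      have "comm (e k) Y = 0" unfolding Y_def using less.prems 1 3 by (intro less.IH) auto
      moreover have "comm (e k) z = 0" unfolding z_def using less.prems 1 3 by (intro ee) auto
      ultimately show ?thesis by (simp add: ch(1) comm_jacobi)
    next
      case 2
      have k: "e k = y" by (simp add: y_def 2)
      have yY: "comm y Y = 0" unfolding Y_def k[symmetric] using less.prems 2 3 by (intro less.IH) auto
      have "comm y (comm y Y') = 0" using yY by (simp add: ch(2) comm_sym[of Y' y])
      then have "comm Y (comm y z) = 0"
        unfolding ch(2) using Yz yz(1) by (intro comm_serre_A3[OF two]) (simp_all add: comm_sym[of Y' z])
      then show ?thesis using yY comm_jacobi[of y Y z] by (simp add: k ch(1))
    next
      case 3
      have k: "e k = z" by (simp add: z_def 3)
      have "comm z (comm y z) = 0" using yz(2) by (simp add: comm_sym[of y z])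
      moreover have "comm Y z = comm Y' (comm y z)"
        using Yz comm_jacobi'[of Y' y z] by (simp add: ch(2) comm_sym[of Y' z])
      ultimately show ?thesis using Yz comm_jacobi[of z Y' "comm y z"] by (simp add: k ch(1))
    qed
  qed
qed

lemma f_chain_far:
  "\<lbrakk>a \<ge> 1; a + d \<le> n; k \<in> {1..n}; k < a \<or> k > a + d\<rbrakk> \<Longrightarrow> comm (f k) (chain e a d) = 0"
proof (induction d)
  case 0 then show ?case using fe[of k a] by auto
next
  case (Suc d)
  moreover have "comm (f k) (e (a + Suc d)) = 0" using Suc.prems by (subst fe) auto
  ultimately show ?case by (auto simp: comm_jacobi)
qed

lemma f_chain_top:
  assumes "a \<ge> 1" "a + Suc d \<le> n"
  shows "comm (f (a + Suc d)) (chain e a (Suc d)) = - chain e a d"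
proof -
  let ?k = "a + Suc d"
  let ?Y = "chain e a d"
  have 1: "comm (f ?k) ?Y = 0" using assms by (intro f_chain_far) auto
  have 2: "comm (f ?k) (e ?k) = D (Suc ?k) - D ?k" using assms by (subst fe) auto
  have "comm (D (Suc ?k)) ?Y = 0" "comm (D ?k) ?Y = - ?Y"
    using assms chain_D[of "Suc ?k" a d] chain_D[of ?k a d] by auto
  then have 3: "comm ?Y (D (Suc ?k)) = 0" "comm ?Y (D ?k) = ?Y"
    by (simp_all add: comm_sym[of ?Y])
  show ?thesis unfolding chain.simps comm_jacobi 1 2 using 3 by simp
qed

lemma f_chain_bottom:
  assumes "a \<ge> 1" "a + Suc d \<le> n"
  shows "comm (f a) (chain e a (Suc d)) = chain e (Suc a) d"
proof -
  let ?Z = "chain e (Suc a) d"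
  have c: "chain e a (Suc d) = comm (e a) ?Z" using chain_left[of "Suc a" d] assms by simp
  have 1: "comm (f a) ?Z = 0" using assms by (intro f_chain_far) auto
  have 2: "comm (f a) (e a) = D (Suc a) - D a" using assms by (subst fe) auto
  have 3: "comm (D (Suc a)) ?Z = ?Z" "comm (D a) ?Z = 0"
    using assms chain_D[of "Suc a" "Suc a" d] chain_D[of a "Suc a" d] by auto
  show ?thesis unfolding c comm_jacobi 1 2 using 3 by simp
qed

lemma f_chain_mid:
  "\<lbrakk>a \<ge> 1; a + d \<le> n; a < k; k < a + d\<rbrakk> \<Longrightarrow> comm (f k) (chain e a d) = 0"
proof (induction d)
  case 0 then show ?case by simp
next
  case (Suc d)
  have z: "comm (f k) (e (a + Suc d)) = 0" using Suc.prems by (subst fe) auto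
  consider "k < a + d" | d' where "k = a + d" "d = Suc d'"
  proof (cases "k < a + d")
    case True then show ?thesis using that by blast
  next
    case False
    then have "k = a + d" "d \<noteq> 0" using Suc.prems by auto
    then show ?thesis using that not0_implies_Suc by blast
  qed
  then show ?case
  proof cases
    case 1 then show ?thesis using Suc z by (simp add: comm_jacobi)
  next
    case (2 d')
    have "comm (f k) (chain e a d) = - chain e a d'" using f_chain_top[of a d'] Suc.prems 2 by simp
    moreover have "comm (e (a + Suc d)) (chain e a d') = 0" using Suc.prems 2 by (intro chain_far) auto
    ultimately show ?thesis using z by (simp add: comm_jacobi comm_sym[of "chain e a d'"])
  qed
qed

text \<open>Below the diagonal this is the negative of the upper construction for the generators of
  \<open>swap\<close>. With this sign \<open>X (Suc k) k\<close> is \<open>f k\<close>, and the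
  involution takes the uniform form \<open>X_swap\<close>.\<close>

definition X :: "nat \<Rightarrow> nat \<Rightarrow> 'r" where
  "X a b = (if a < b then chain e a (b - a - 1) else if a = b then D a
     else - chain (\<lambda>k. - f k) b (a - b - 1))"

lemma X_e: "X k (Suc k) = e k" and X_f: "X (Suc k) k = f k" and X_D: "X a a = D a"
  by (simp_all add: X_def)

lemma X_upper_bracket:
  assumes cd: "c \<in> {1..Suc n}" "d \<in> {1..Suc n}" "c < d" and k: "k \<in> {1..n}"
  shows "comm (e k) (X c d) = (if Suc k = c then X k d else 0) - (if d = k then X c (Suc k) else 0)"
    and "comm (f k) (X c d) = (if k = c then X (Suc k) d else 0) - (if d = Suc k then X c k else 0)"
proof -
  obtain m where m: "d = Suc (c + m)" using cd(3) less_iff_Suc_add by auto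
  have X: "X c (Suc (c + m)) = chain e c m" by (simp add: X_def)
  have cm: "c \<ge> 1" "c + m \<le> n" using cd m by auto
  consider "Suc k < c \<or> k > Suc (c + m)" | "Suc k = c" | "c \<le> k" "k \<le> c + m" | "k = Suc (c + m)" by linarith
  then show "comm (e k) (X c d) = (if Suc k = c then X k d else 0) - (if d = k then X c (Suc k) else 0)"
  proof cases
    case 1 then show ?thesis using chain_far[OF cm k] m by (auto simp: X)
  next
    case 2
    then have "X k d = chain e k (Suc m)" using m by (simp add: X_def)
    then show ?thesis using chain_left[of c m] 2 cm k m by (auto simp: X)
  next
    case 3 then show ?thesis using chain_inner[OF cm 3] m by (auto simp: X)
  next
    case 4
    then have "X c (Suc k) = chain e c (Suc m)" by (simp add: X_def)
    then show ?thesis using 4 m by (auto simp: X comm_sym[of "e _"])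
  qed
  consider "m = 0" | m' where "m = Suc m'" by (cases m) auto
  then show "comm (f k) (X c d) = (if k = c then X (Suc k) d else 0) - (if d = Suc k then X c k else 0)"
  proof cases
    case 1
    then show ?thesis using fe[of k c] k cm m X_D[of "Suc c"] X_D[of c] by (auto simp: X_e)
  next
    case (2 m')
    note m' = this
    have X2: "X c (Suc (Suc (c + m'))) = chain e c (Suc m')" using X m' by (simp del: chain.simps)
    consider "k < c \<or> k > c + m" | "k = c" | "c < k" "k < c + m" | "k = c + m" by linarith
    then show ?thesis
    proof cases
      case 1 then show ?thesis using f_chain_far[OF cm k] m by (auto simp: X)
    next
      case 2
      have "X (Suc k) d = chain e (Suc c) m'" using m 2 m' by (simp add: X_def)
      then show ?thesis using f_chain_bottom[of c m'] 2 m' cm m by (auto simp: X2 simp del: chain.simps)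
    next
      case 3 then show ?thesis using f_chain_mid[OF cm 3] m by (auto simp: X)
    next
      case 4
      have "X c k = chain e c m'" using m' 4 by (simp add: X_def)
      then show ?thesis using f_chain_top[of c m'] m' 4 cm m by (auto simp: X2 simp del: chain.simps)
    qed
  qed
qed

lemma X_upper_bracket_D:
  assumes "c \<in> {1..Suc n}" "d \<in> {1..Suc n}" "c < d" "a \<in> {1..Suc n}"
  shows "comm (D a) (X c d) = (if a = c then X a d else 0) - (if a = d then X c a else 0)"
proof -
  obtain m where m: "d = Suc (c + m)" using assms(3) less_iff_Suc_add by auto
  have "X c (Suc (c + m)) = chain e c m" by (simp add: X_def)
  moreover have "c \<ge> 1" "c + m \<le> n" using assms m by auto
  ultimately show ?thesis using chain_D[OF assms(4), of c m] m by auto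
qed

lemma X_swap: "chevalley_gl.X (\<lambda>k. - f k) (\<lambda>k. - e k) (\<lambda>a. - D a) a b = - X b a"
  by (simp add: chevalley_gl.X_def[OF swap] X_def)

lemma X_bracket_generators:
  assumes cd: "c \<in> {1..Suc n}" "d \<in> {1..Suc n}"
  shows "k \<in> {1..n} \<Longrightarrow> comm (e k) (X c d) = (if Suc k = c then X k d else 0) - (if d = k then X c (Suc k) else 0)"
    and "k \<in> {1..n} \<Longrightarrow> comm (f k) (X c d) = (if k = c then X (Suc k) d else 0) - (if d = Suc k then X c k else 0)"
    and "a \<in> {1..Suc n} \<Longrightarrow> comm (D a) (X c d) = (if a = c then X a d else 0) - (if a = d then X c a else 0)"
proof -
  interpret sw: chevalley_gl n "\<lambda>k. - f k" "\<lambda>k. - e k" "\<lambda>a. - D a" by (rule swap)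
  consider "c < d" | "c = d" | "d < c" by linarith
  then have *: "(k \<in> {1..n} \<longrightarrow> comm (e k) (X c d) = (if Suc k = c then X k d else 0) - (if d = k then X c (Suc k) else 0)) \<and>
    (k \<in> {1..n} \<longrightarrow> comm (f k) (X c d) = (if k = c then X (Suc k) d else 0) - (if d = Suc k then X c k else 0)) \<and>
    (a \<in> {1..Suc n} \<longrightarrow> comm (D a) (X c d) = (if a = c then X a d else 0) - (if a = d then X c a else 0))" for k a
  proof cases
    case 1 then show ?thesis using X_upper_bracket[OF cd] X_upper_bracket_D[OF cd] by blast
  next
    case 2
    have "comm (e k) (D c) = - (if c = k then e k else 0) + (if c = Suc k then e k else 0)" if "k \<in> {1..n}"
      using De[OF cd(1) that] by (auto simp: comm_sym[of "e k"])
    moreover have "comm (f k) (D c) = - (if c = Suc k then f k else 0) + (if c = k then f k else 0)" if "k \<in> {1..n}"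
      using Df[OF cd(1) that] by (auto simp: comm_sym[of "f k"])
    ultimately show ?thesis using 2 DD cd by (auto simp: X_D X_e X_f)
  next
    case 3
    show ?thesis using sw.X_upper_bracket[OF cd(2,1) 3, of k] sw.X_upper_bracket_D[OF cd(2,1) 3, of a] 3 cd
      unfolding X_swap by (auto split: if_splits)
  qed
  show "k \<in> {1..n} \<Longrightarrow> comm (e k) (X c d) = (if Suc k = c then X k d else 0) - (if d = k then X c (Suc k) else 0)"
    "k \<in> {1..n} \<Longrightarrow> comm (f k) (X c d) = (if k = c then X (Suc k) d else 0) - (if d = Suc k then X c k else 0)"
    "a \<in> {1..Suc n} \<Longrightarrow> comm (D a) (X c d) = (if a = c then X a d else 0) - (if a = d then X c a else 0)"
    using * by blast+
qed

text \<open>Since \<open>X a (b + 1)\<close> is the bracket of \<open>X a b\<close> with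
  \<open>e b\<close>, the Jacobi identity reduces each step to the induction hypothesis and to
  brackets with a generator.\<close>

lemma X_upper_gl:
  "\<lbrakk>a \<ge> 1; a + m \<le> n; c \<in> {1..Suc n}; d \<in> {1..Suc n}\<rbrakk> \<Longrightarrow>
    comm (X a (Suc (a + m))) (X c d) =
      (if Suc (a + m) = c then X a d else 0) - (if d = a then X c (Suc (a + m)) else 0)"
proof (induction m arbitrary: c d)
  case 0
  then show ?case using X_bracket_generators(1)[of c d a] by (auto simp: X_e)
next
  case (Suc m)
  let ?b = "Suc (a + m)"
  have b: "?b \<in> {1..n}" "?b \<in> {1..Suc n}" "Suc ?b \<in> {1..Suc n}" using Suc.prems by auto
  have X: "X a (Suc (a + Suc m)) = comm (X a ?b) (e ?b)" by (simp add: X_def)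
  have IH: "comm (X a ?b) (X c d) = (if ?b = c then X a d else 0) - (if d = a then X c ?b else 0)"
    if "c \<in> {1..Suc n}" "d \<in> {1..Suc n}" for c d
    using Suc.IH[OF _ _ that] Suc.prems by simp
  have E: "comm (e ?b) (X c d) = (if Suc ?b = c then X ?b d else 0) - (if d = ?b then X c (Suc ?b) else 0)"
    if "c \<in> {1..Suc n}" "d \<in> {1..Suc n}" for c d
    using X_bracket_generators(1)[OF that b(1)] .
  have "a \<in> {1..Suc n}" using Suc.prems by auto
  then show ?case unfolding X comm_jacobi'
    using Suc.prems(3,4) b by (auto simp: IH E)
qed

theorem X_gl:
  assumes ab: "a \<in> {1..Suc n}" "b \<in> {1..Suc n}" and cd: "c \<in> {1..Suc n}" "d \<in> {1..Suc n}"
  shows "comm (X a b) (X c d) = (if b = c then X a d else 0) - (if d = a then X c b else 0)"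
proof -
  interpret sw: chevalley_gl n "\<lambda>k. - f k" "\<lambda>k. - e k" "\<lambda>a. - D a" by (rule swap)
  consider m where "b = Suc (a + m)" | "a = b" | m where "a = Suc (b + m)"
    using less_iff_Suc_add[of a b] less_iff_Suc_add[of b a] linorder_less_linear[of a b] by blast
  then show ?thesis
  proof cases
    case 1 then show ?thesis using X_upper_gl[of a _ c d] ab cd by auto
  next
    case 2 then show ?thesis using X_bracket_generators(3)[OF cd ab(1)] by (auto simp: X_D)
  next
    case (3 m)
    then show ?thesis using sw.X_upper_gl[of b m d c] ab cd unfolding X_swap by (auto split: if_splits)
  qed
qed

end

section \<open>The generic Gelfand--Tsetlin operators\<close>

type_synonym latt = "nat \<Rightarrow> nat \<Rightarrow> int"

text \<open>A separate type turns composition into multiplication in a ring, so that the bracket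
  calculus above applies. The operators act on all functions on the lattice, which spares any
  finiteness condition on supports.\<close>

typedef endo = "{X :: (latt \<Rightarrow> complex) \<Rightarrow> (latt \<Rightarrow> complex).
    (\<forall>f g. X (f + g) = X f + X g) \<and> (\<forall>c f. X (\<lambda>z. c * f z) = (\<lambda>z. c * X f z))}"
  by (rule exI[of _ "\<lambda>f. f"]) auto

setup_lifting type_definition_endo

instantiation endo :: ring_1
begin

lift_definition zero_endo :: endo is "\<lambda>f. 0" by (auto simp: fun_eq_iff)
lift_definition one_endo :: endo is "\<lambda>f. f" by auto
lift_definition plus_endo :: "endo \<Rightarrow> endo \<Rightarrow> endo" is "\<lambda>X Y f. X f + Y f"
  by (auto simp: fun_eq_iff algebra_simps)
lift_definition minus_endo :: "endo \<Rightarrow> endo \<Rightarrow> endo" is "\<lambda>X Y f. X f - Y f"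
  by (auto simp: fun_eq_iff algebra_simps)
lift_definition uminus_endo :: "endo \<Rightarrow> endo" is "\<lambda>X f. - X f"
  by (auto simp: fun_eq_iff algebra_simps)
lift_definition times_endo :: "endo \<Rightarrow> endo \<Rightarrow> endo" is "\<lambda>X Y f. X (Y f)"
  by auto

instance
proof
  show "(0::endo) \<noteq> 1" by transfer (auto simp: fun_eq_iff intro!: exI[of _ "\<lambda>_. 1"])
qed (transfer; auto simp: fun_eq_iff algebra_simps)+

end

lemma endo_two: "u + u = 0 \<Longrightarrow> u = (0::endo)"
  by transfer (auto simp: fun_eq_iff)

lift_definition app :: "endo \<Rightarrow> (latt \<Rightarrow> complex) \<Rightarrow> latt \<Rightarrow> complex" is "\<lambda>X f. X f" .

lemma app_simps:
  "app (X + Y) f = app X f + app Y f" "app (X - Y) f = app X f - app Y f" "app (X * Y) f = app X (app Y f)"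
  "app (- X) f = - app X f" "app 0 f = 0" "app X (f + g) = app X f + app X g" "app X (\<lambda>z. c * f z) = (\<lambda>z. c * app X f z)"
  by (transfer; auto)+

lemma app_sum: "app (\<Sum>i\<in>I. X i) f = (\<Sum>i\<in>I. app (X i) f)"
  by (induction I rule: infinite_finite_induct) (simp_all add: app_simps)

text \<open>A weighted shift: it sends the point function at \<open>w\<close> to \<open>g w\<close>
  times the point function at \<open>w + d\<close>.\<close>

lift_definition atom :: "(latt \<Rightarrow> complex) \<Rightarrow> latt \<Rightarrow> endo" is "\<lambda>g d f z. g (z - d) * f (z - d)"
  by (auto simp: fun_eq_iff algebra_simps)

lemma app_atom: "app (atom g d) f z = g (z - d) * f (z - d)"
  by transfer simp

lemma atom_mult: "atom g d * atom h d' = atom (\<lambda>w. h w * g (w + d')) (d + d')"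
proof -
  have "(\<lambda>f z. g (z - d) * (h (z - d - d') * f (z - d - d'))) =
    (\<lambda>f z. h (z - (d + d')) * g (z - (d + d') + d') * f (z - (d + d')))"
    by (simp add: algebra_simps)
  then show ?thesis by (transfer; simp)
qed

lemma atom_add: "atom g d + atom h d = atom (\<lambda>w. g w + h w) d"
  by transfer (auto simp: fun_eq_iff algebra_simps)

lemma atom_diff: "atom g d - atom h d = atom (\<lambda>w. g w - h w) d"
  by transfer (auto simp: fun_eq_iff algebra_simps)

lemma atom_zero: "(\<And>w. g w = 0) \<Longrightarrow> atom g d = 0"
  by transfer (auto simp: fun_eq_iff)

lemma atom_sum: "(\<Sum>i\<in>I. atom (g i) d) = atom (\<lambda>w. \<Sum>i\<in>I. g i w) d"
  by (induction I rule: infinite_finite_induct) (simp_all add: atom_add atom_zero)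

lemma comm_atom: "comm (atom g d) (atom h d') = atom (\<lambda>w. h w * g (w + d') - g w * h (w + d)) (d + d')"
  by (simp add: comm_def atom_mult atom_diff add.commute)

lemma comm_sum_left: "comm (\<Sum>i\<in>I. x i) y = (\<Sum>i\<in>I. comm (x i) y)"
  by (simp add: comm_def sum_distrib_left sum_distrib_right sum_subtractf)

lemma comm_sum_right: "comm y (\<Sum>i\<in>I. x i) = (\<Sum>i\<in>I. comm y (x i))"
  by (simp add: comm_def sum_distrib_left sum_distrib_right sum_subtractf)

text \<open>The double sum over \<open>i\<close> and \<open>i'\<close> equals itself with the
  indices exchanged. Twice the bracket is therefore a sum of symmetrized terms, and only these have
  to vanish.\<close>

lemma serre_sum:
  fixes a :: "'i \<Rightarrow> 'r::ring"
  assumes two: "\<And>u::'r. u + u = 0 \<Longrightarrow> u = 0"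
    and z: "\<And>i i' j. \<lbrakk>i \<in> K; i' \<in> K; j \<in> L\<rbrakk> \<Longrightarrow>
      comm (a i) (comm (a i') (b j)) + comm (a i') (comm (a i) (b j)) = 0"
  shows "comm (\<Sum>i\<in>K. a i) (comm (\<Sum>i\<in>K. a i) (\<Sum>j\<in>L. b j)) = 0"
proof (rule two)
  let ?Z = "\<lambda>i i' j. comm (a i) (comm (a i') (b j))"
  have e: "comm (\<Sum>i\<in>K. a i) (comm (\<Sum>i\<in>K. a i) (\<Sum>j\<in>L. b j)) = (\<Sum>i\<in>K. \<Sum>i'\<in>K. \<Sum>j\<in>L. ?Z i i' j)"
    by (simp only: comm_sum_left) (simp only: comm_sum_right)
  also have "\<dots> = (\<Sum>i'\<in>K. \<Sum>i\<in>K. \<Sum>j\<in>L. ?Z i i' j)" by (rule sum.swap)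
  finally have e': "comm (\<Sum>i\<in>K. a i) (comm (\<Sum>i\<in>K. a i) (\<Sum>j\<in>L. b j)) = (\<Sum>i\<in>K. \<Sum>i'\<in>K. \<Sum>j\<in>L. ?Z i' i j)" .
  have "comm (\<Sum>i\<in>K. a i) (comm (\<Sum>i\<in>K. a i) (\<Sum>j\<in>L. b j)) + comm (\<Sum>i\<in>K. a i) (comm (\<Sum>i\<in>K. a i) (\<Sum>j\<in>L. b j))
     = (\<Sum>i\<in>K. \<Sum>i'\<in>K. \<Sum>j\<in>L. ?Z i i' j + ?Z i' i j)"
    by (subst e, subst e') (simp add: sum.distrib)
  also have "\<dots> = 0" using z by (intro sum.neutral ballI) auto
  finally show "comm (\<Sum>i\<in>K. a i) (comm (\<Sum>i\<in>K. a i) (\<Sum>j\<in>L. b j)) + comm (\<Sum>i\<in>K. a i) (comm (\<Sum>i\<in>K. a i) (\<Sum>j\<in>L. b j)) = 0" .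
qed

definition unit :: "nat \<Rightarrow> nat \<Rightarrow> int \<Rightarrow> latt" where
  "unit k i c = (\<lambda>j l. if j = k \<and> l = i then c else 0)"

lemma serre_atoms:
  assumes "\<And>w.
      (\<beta> w * \<alpha>' (w + dj) * \<alpha> (w + dj + di') - 2 * (\<alpha>' w * \<beta> (w + di') * \<alpha> (w + di' + dj)) + \<alpha>' w * \<alpha> (w + di') * \<beta> (w + di' + di))
    + (\<beta> w * \<alpha> (w + dj) * \<alpha>' (w + dj + di) - 2 * (\<alpha> w * \<beta> (w + di) * \<alpha>' (w + di + dj)) + \<alpha> w * \<alpha>' (w + di) * \<beta> (w + di + di')) = 0"
  shows "comm (atom \<alpha> di) (comm (atom \<alpha>' di') (atom \<beta> dj)) + comm (atom \<alpha>' di') (comm (atom \<alpha> di) (atom \<beta> dj)) = 0"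
proof -
  have d: "di' + (di + dj) = di + (di' + dj)" by (simp add: add.left_commute)
  show ?thesis unfolding comm_atom d atom_add
  proof (rule atom_zero)
    fix w
    show "(\<beta> w * \<alpha>' (w + dj) - \<alpha>' w * \<beta> (w + di')) * \<alpha> (w + (di' + dj)) - \<alpha> w * (\<beta> (w + di) * \<alpha>' (w + di + dj) - \<alpha>' (w + di) * \<beta> (w + di + di')) +
       ((\<beta> w * \<alpha> (w + dj) - \<alpha> w * \<beta> (w + di)) * \<alpha>' (w + (di + dj)) - \<alpha>' w * (\<beta> (w + di') * \<alpha> (w + di' + dj) - \<alpha> (w + di') * \<beta> (w + di' + di))) = 0"
      using assms[of w] by (simp add: algebra_simps)
  qed
qed

text \<open>With \<open>x = p - p'\<close> the numerators of the two halves collapse to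
  \<open>- s (x - s)\<close> and \<open>s (x + s)\<close>. They cancel the second denominators,
  leaving \<open>s / x\<close> and \<open>- s / x\<close> times a common factor. The companion
  identity below follows the same pattern.\<close>

lemma serre_identity_1:
  fixes p p' q s :: complex
  assumes "p - p' \<noteq> 0" "p - p' \<noteq> s" "p' - p \<noteq> s"
  shows "b * ((p' - (q + s)) / (p' - p) * C') * ((p - (q + s)) / (p - (p' + s)) * C)
      - 2 * ((p' - q) / (p' - p) * C' * b * ((p - (q + s)) / (p - (p' + s)) * C))
      + (p' - q) / (p' - p) * C' * ((p - q) / (p - (p' + s)) * C) * b
    + (b * ((p - (q + s)) / (p - p') * C) * ((p' - (q + s)) / (p' - (p + s)) * C')
      - 2 * ((p - q) / (p - p') * C * b * ((p' - (q + s)) / (p' - (p + s)) * C'))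
      + (p - q) / (p - p') * C * ((p' - q) / (p' - (p + s)) * C') * b) = 0" (is "?L = 0")
proof -
  define x where "x = p - p'"
  have nz: "x \<noteq> 0" "x - s \<noteq> 0" "x + s \<noteq> 0" "- x \<noteq> s"
    using assms by (auto simp: x_def algebra_simps eq_neg_iff_add_eq_0)
  have r: "p' - p = - x" "p - (p' + s) = x - s" "p' - (p + s) = - (x + s)" "p' = p - x" by (auto simp: x_def)
  have 1: "(p - x - (q + s)) * (p - (q + s)) - 2 * ((p - x - q) * (p - (q + s))) + (p - x - q) * (p - q) = - s * (x - s)"
    by (simp add: algebra_simps)
  have 2: "(p - (q + s)) * (p - x - (q + s)) - 2 * ((p - q) * (p - x - (q + s))) + (p - q) * (p - x - q) = s * (x + s)"
    by (simp add: algebra_simps)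
  have "?L = b * C * C' * (((p - x - (q + s)) * (p - (q + s)) - 2 * ((p - x - q) * (p - (q + s))) + (p - x - q) * (p - q)) / (- x * (x - s))
     + ((p - (q + s)) * (p - x - (q + s)) - 2 * ((p - q) * (p - x - (q + s))) + (p - q) * (p - x - q)) / (- x * (x + s)))"
    unfolding r using nz by (simp add: x_def[symmetric] divide_simps) (simp add: algebra_simps)
  also have "\<dots> = 0" unfolding 1 2 mult_divide_mult_cancel_right[OF nz(2)] mult_divide_mult_cancel_right[OF nz(3)] by simp
  finally show ?thesis .
qed

lemma serre_identity_2:
  fixes p p' q s :: complex
  assumes "p - p' \<noteq> 0" "p - p' \<noteq> s" "p' - p \<noteq> s"
  shows "(q - p) * (q - p') * G * (C' / (p' - p)) * (C / (p - (p' + s)))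
      - 2 * (C' / (p' - p) * ((q - p) * (q - (p' + s)) * G) * (C / (p - (p' + s))))
      + C' / (p' - p) * (C / (p - (p' + s))) * ((q - (p + s)) * (q - (p' + s)) * G)
    + ((q - p) * (q - p') * G * (C / (p - p')) * (C' / (p' - (p + s)))
      - 2 * (C / (p - p') * ((q - (p + s)) * (q - p') * G) * (C' / (p' - (p + s))))
      + C / (p - p') * (C' / (p' - (p + s))) * ((q - (p + s)) * (q - (p' + s)) * G)) = 0" (is "?L = 0")
proof -
  define x where "x = p - p'"
  have nz: "x \<noteq> 0" "x - s \<noteq> 0" "x + s \<noteq> 0" "- x \<noteq> s"
    using assms by (auto simp: x_def algebra_simps eq_neg_iff_add_eq_0)
  have r: "p' - p = - x" "p - (p' + s) = x - s" "p' - (p + s) = - (x + s)" "p' = p - x" by (auto simp: x_def)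
  have 1: "(q - p) * (q - (p - x)) - 2 * ((q - p) * (q - (p - x + s))) + (q - (p + s)) * (q - (p - x + s)) = - s * (x - s)"
    by (simp add: algebra_simps)
  have 2: "(q - p) * (q - (p - x)) - 2 * ((q - (p + s)) * (q - (p - x))) + (q - (p + s)) * (q - (p - x + s)) = s * (x + s)"
    by (simp add: algebra_simps)
  have "?L = G * C * C' * (((q - p) * (q - (p - x)) - 2 * ((q - p) * (q - (p - x + s))) + (q - (p + s)) * (q - (p - x + s))) / (- x * (x - s))
     + ((q - p) * (q - (p - x)) - 2 * ((q - (p + s)) * (q - (p - x))) + (q - (p + s)) * (q - (p - x + s))) / (- x * (x + s)))"
    unfolding r using nz by (simp add: x_def[symmetric] divide_simps) (simp add: algebra_simps)
  also have "\<dots> = 0" unfolding 1 2 mult_divide_mult_cancel_right[OF nz(2)] mult_divide_mult_cancel_right[OF nz(3)] by simp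
  finally show ?thesis .
qed

text \<open>Denominators compare entries of rows up to \<open>n\<close>, which lie in columns up to
  \<open>n\<close>. Column \<open>n + 1\<close> occurs in the top row only and stays unconstrained,
  so that \<open>t 1 - t (Suc n)\<close> can be an integer in the block argument.\<close>

locale gt_generic =
  fixes n :: nat and t :: "nat \<Rightarrow> complex"
  assumes generic: "\<lbrakk>i \<in> {1..n}; j \<in> {1..n}; i \<noteq> j\<rbrakk> \<Longrightarrow> t i - t j \<notin> \<int>"
begin

definition V :: "nat \<Rightarrow> nat \<Rightarrow> latt \<Rightarrow> complex" where
  "V k i z = t i + of_int (z k i)"

lemma V_shift: "V k i (w + unit l j c) = V k i w + (if k = l \<and> i = j then of_int c else 0)"
  by (simp add: V_def unit_def)

lemma V_shift_row [simp]: "k \<noteq> l \<Longrightarrow> V k i (w + unit l j c) = V k i w"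
  by (simp add: V_shift)

lemma V_shift_col [simp]: "i \<noteq> j \<Longrightarrow> V k i (w + unit l j c) = V k i w"
  by (simp add: V_shift)

lemma V_shift_same [simp]: "V k i (w + unit k i c) = V k i w + of_int c"
  by (simp add: V_shift)

lemma V_diff: "\<lbrakk>i \<in> {1..n}; j \<in> {1..n}; i \<noteq> j\<rbrakk> \<Longrightarrow> V k i w - V k j w \<noteq> of_int c"
proof
  assume *: "i \<in> {1..n}" "j \<in> {1..n}" "i \<noteq> j" "V k i w - V k j w = of_int c"
  then have "t i - t j = of_int (c - w k i + w k j)" by (simp add: V_def algebra_simps)
  then show False using generic[OF *(1-3)] Ints_of_int by metis
qed

definition gcoef :: "complex \<Rightarrow> nat \<Rightarrow> nat \<Rightarrow> nat \<Rightarrow> latt \<Rightarrow> complex" where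
  "gcoef \<kappa> k r i w = \<kappa> * (\<Prod>m=1..r. V k i w - V r m w) / (\<Prod>m\<in>{1..k}-{i}. V k i w - V k m w)"

lemma gcoef_far: "\<lbrakk>l \<noteq> k; l \<noteq> r\<rbrakk> \<Longrightarrow> gcoef \<kappa> k r i (w + unit l j c) = gcoef \<kappa> k r i w"
  by (simp add: gcoef_def)

text \<open>This and the next splittings isolate the factors of a coefficient that a given shift
  moves, with a cofactor invariant under that shift. The relations then reduce to identities in very
  few complex unknowns.\<close>

lemma gcoef_split_row:
  assumes "r \<noteq> k" "j \<in> {1..r}"
  shows "\<exists>A. (\<forall>w. gcoef \<kappa> k r i w = (V k i w - V r j w) * A w) \<and> (\<forall>w c. A (w + unit r j c) = A w)"
proof (intro exI conjI allI)
  fix w c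
  let ?A = "\<lambda>w. \<kappa> * (\<Prod>m\<in>{1..r}-{j}. V k i w - V r m w) / (\<Prod>m\<in>{1..k}-{i}. V k i w - V k m w)"
  show "gcoef \<kappa> k r i w = (V k i w - V r j w) * ?A w"
    unfolding gcoef_def using assms by (subst prod.remove[of _ j]) auto
  have "(\<Prod>m\<in>{1..r}-{j}. V k i (w + unit r j c) - V r m (w + unit r j c)) = (\<Prod>m\<in>{1..r}-{j}. V k i w - V r m w)"
    using assms by (intro prod.cong) auto
  then show "?A (w + unit r j c) = ?A w" using assms by simp
qed

lemma gcoef_split_den:
  assumes "r \<noteq> k" "i' \<in> {1..k}" "i \<noteq> i'"
  shows "\<exists>C. (\<forall>w. gcoef \<kappa> k r i w = C w / (V k i w - V k i' w)) \<and> (\<forall>w c. C (w + unit k i' c) = C w)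
     \<and> (\<forall>w l j c. l \<noteq> k \<longrightarrow> l \<noteq> r \<longrightarrow> C (w + unit l j c) = C w)"
proof (intro exI conjI allI impI)
  fix w c l j
  let ?C = "\<lambda>w. \<kappa> * (\<Prod>m=1..r. V k i w - V r m w) / (\<Prod>m\<in>{1..k}-{i}-{i'}. V k i w - V k m w)"
  show "gcoef \<kappa> k r i w = ?C w / (V k i w - V k i' w)"
    unfolding gcoef_def using assms by (subst prod.remove[of "{1..k} - {i}" i']) auto
  have "(\<Prod>m\<in>{1..k}-{i}-{i'}. V k i (w + unit k i' c) - V k m (w + unit k i' c)) = (\<Prod>m\<in>{1..k}-{i}-{i'}. V k i w - V k m w)"
    using assms by (intro prod.cong) auto
  then show "?C (w + unit k i' c) = ?C w" using assms by simp
  show "?C (w + unit l j c) = ?C w" if "l \<noteq> k" "l \<noteq> r" using that by simp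
qed

lemma gcoef_split_both:
  assumes "r \<noteq> k" "j \<in> {1..r}" "i' \<in> {1..k}" "i \<noteq> i'"
  shows "\<exists>C. (\<forall>w. gcoef \<kappa> k r i w = (V k i w - V r j w) / (V k i w - V k i' w) * C w)
     \<and> (\<forall>w c. C (w + unit k i' c) = C w) \<and> (\<forall>w c. C (w + unit r j c) = C w)"
proof (intro exI conjI allI)
  fix w c
  let ?C = "\<lambda>w. \<kappa> * (\<Prod>m\<in>{1..r}-{j}. V k i w - V r m w) / (\<Prod>m\<in>{1..k}-{i}-{i'}. V k i w - V k m w)"
  show "gcoef \<kappa> k r i w = (V k i w - V r j w) / (V k i w - V k i' w) * ?C w"
    unfolding gcoef_def using assms
    by (subst prod.remove[of "{1..k} - {i}" i'], simp, simp, subst prod.remove[of "{1..r}" j]) auto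
  have "(\<Prod>m\<in>{1..k}-{i}-{i'}. V k i (w + unit k i' c) - V k m (w + unit k i' c)) = (\<Prod>m\<in>{1..k}-{i}-{i'}. V k i w - V k m w)"
    using assms by (intro prod.cong) auto
  then show "?C (w + unit k i' c) = ?C w" using assms by simp
  have "(\<Prod>m\<in>{1..r}-{j}. V k i (w + unit r j c) - V r m (w + unit r j c)) = (\<Prod>m\<in>{1..r}-{j}. V k i w - V r m w)"
    using assms by (intro prod.cong) auto
  then show "?C (w + unit r j c) = ?C w" using assms by simp
qed

lemma gcoef_split_two:
  assumes "r \<noteq> k" "j \<in> {1..r}" "j' \<in> {1..r}" "j \<noteq> j'"
  shows "\<exists>G. (\<forall>w. gcoef \<kappa> k r i w = (V k i w - V r j w) * (V k i w - V r j' w) * G w)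
     \<and> (\<forall>w c. G (w + unit r j c) = G w) \<and> (\<forall>w c. G (w + unit r j' c) = G w)"
proof (intro exI conjI allI)
  fix w c
  let ?G = "\<lambda>w. \<kappa> * (\<Prod>m\<in>{1..r}-{j}-{j'}. V k i w - V r m w) / (\<Prod>m\<in>{1..k}-{i}. V k i w - V k m w)"
  show "gcoef \<kappa> k r i w = (V k i w - V r j w) * (V k i w - V r j' w) * ?G w"
    unfolding gcoef_def using assms
    by (subst prod.remove[of "{1..r}" j], simp, simp, subst prod.remove[of "{1..r} - {j}" j']) auto
  have "(\<Prod>m\<in>{1..r}-{j}-{j'}. V k i (w + unit r j c) - V r m (w + unit r j c)) = (\<Prod>m\<in>{1..r}-{j}-{j'}. V k i w - V r m w)"
    using assms by (intro prod.cong) auto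
  then show "?G (w + unit r j c) = ?G w" using assms by simp
  have "(\<Prod>m\<in>{1..r}-{j}-{j'}. V k i (w + unit r j' c) - V r m (w + unit r j' c)) = (\<Prod>m\<in>{1..r}-{j}-{j'}. V k i w - V r m w)"
    using assms by (intro prod.cong) auto
  then show "?G (w + unit r j' c) = ?G w" using assms by simp
qed

text \<open>Raising operators are the case \<open>\<kappa> = -1\<close>, \<open>s = 1\<close>, \<open>r = k + 1\<close>, lowering operators the
  case \<open>\<kappa> = 1\<close>, \<open>s = -1\<close>, \<open>r = k - 1\<close>.\<close>
definition gop :: "complex \<Rightarrow> int \<Rightarrow> nat \<Rightarrow> nat \<Rightarrow> endo" where
  "gop \<kappa> s k r = (\<Sum>i=1..k. atom (gcoef \<kappa> k r i) (unit k i s))"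

lemma V_diff0: "\<lbrakk>i \<in> {1..n}; j \<in> {1..n}; i \<noteq> j\<rbrakk> \<Longrightarrow> V k i w - V k j w \<noteq> 0"
  using V_diff[of i j k w 0] by simp

lemma gop_far:
  assumes "k \<noteq> l" "k \<noteq> r'" "l \<noteq> r"
  shows "comm (gop \<kappa> s k r) (gop \<kappa>' s' l r') = 0"
  unfolding gop_def comm_sum_left comm_sum_right
  by (intro sum.neutral ballI, subst comm_atom, rule atom_zero) (use assms in \<open>simp add: gcoef_far mult.commute\<close>)

text \<open>The repeated operator shifts row \<open>k\<close> and has row \<open>l\<close> in its
  numerators, so the single shift in row \<open>l\<close> moves those numerators. For distinct
  columns this is \<open>serre_identity_1\<close>; for equal columns a second difference of a linear
  function vanishes.\<close>

lemma gop_serre_1: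
  assumes k: "k \<le> n" and ne: "l \<noteq> k" "r' \<noteq> k" "r' \<noteq> l"
  shows "comm (gop \<kappa> s k l) (comm (gop \<kappa> s k l) (gop \<kappa> s l r')) = 0"
  unfolding gop_def
proof (rule serre_sum[OF endo_two], assumption)
  fix i i' j assume i: "i \<in> {1..k}" "i' \<in> {1..k}" and j: "j \<in> {1..l}"
  have \<beta>: "gcoef \<kappa> l r' j (w + unit k a s) = gcoef \<kappa> l r' j w" for w a
    using ne by (intro gcoef_far) auto
  show "comm (atom (gcoef \<kappa> k l i) (unit k i s)) (comm (atom (gcoef \<kappa> k l i') (unit k i' s)) (atom (gcoef \<kappa> l r' j) (unit l j s))) +
       comm (atom (gcoef \<kappa> k l i') (unit k i' s)) (comm (atom (gcoef \<kappa> k l i) (unit k i s)) (atom (gcoef \<kappa> l r' j) (unit l j s))) = 0"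
  proof (rule serre_atoms, cases "i = i'")
    case True
    fix w
    obtain A where A: "\<And>w. gcoef \<kappa> k l i w = (V k i w - V l j w) * A w" "\<And>w c. A (w + unit l j c) = A w"
      using gcoef_split_row[OF ne(1) j] by metis
    have sw: "w + unit l j s + unit k i s = w + unit k i s + unit l j s" by (simp add: add.commute add.left_commute)
    show "gcoef \<kappa> l r' j w * gcoef \<kappa> k l i' (w + unit l j s) * gcoef \<kappa> k l i (w + unit l j s + unit k i' s) -
         2 * (gcoef \<kappa> k l i' w * gcoef \<kappa> l r' j (w + unit k i' s) * gcoef \<kappa> k l i (w + unit k i' s + unit l j s)) +
         gcoef \<kappa> k l i' w * gcoef \<kappa> k l i (w + unit k i' s) * gcoef \<kappa> l r' j (w + unit k i' s + unit k i s) +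
         (gcoef \<kappa> l r' j w * gcoef \<kappa> k l i (w + unit l j s) * gcoef \<kappa> k l i' (w + unit l j s + unit k i s) -
          2 * (gcoef \<kappa> k l i w * gcoef \<kappa> l r' j (w + unit k i s) * gcoef \<kappa> k l i' (w + unit k i s + unit l j s)) +
          gcoef \<kappa> k l i w * gcoef \<kappa> k l i' (w + unit k i s) * gcoef \<kappa> l r' j (w + unit k i s + unit k i' s)) = 0"
      unfolding True[symmetric] \<beta> A(1) using ne
      unfolding sw by (simp add: A(2); simp add: algebra_simps)
  next
    case False
    fix w
    obtain C where C: "\<And>w. gcoef \<kappa> k l i w = (V k i w - V l j w) / (V k i w - V k i' w) * C w"
      "\<And>w c. C (w + unit k i' c) = C w" "\<And>w c. C (w + unit l j c) = C w"
      using gcoef_split_both[OF ne(1) j i(2) False] by metis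
    obtain C' where C': "\<And>w. gcoef \<kappa> k l i' w = (V k i' w - V l j w) / (V k i' w - V k i w) * C' w"
      "\<And>w c. C' (w + unit k i c) = C' w" "\<And>w c. C' (w + unit l j c) = C' w"
      using gcoef_split_both[OF ne(1) j i(1)] False by metis
    have nz: "V k i w - V k i' w \<noteq> 0" "V k i w - V k i' w \<noteq> of_int s" "V k i' w - V k i w \<noteq> of_int s"
      using V_diff[of i i' k w] V_diff[of i' i k w] V_diff0[of i i' k w] i k False by auto
    show "gcoef \<kappa> l r' j w * gcoef \<kappa> k l i' (w + unit l j s) * gcoef \<kappa> k l i (w + unit l j s + unit k i' s) -
         2 * (gcoef \<kappa> k l i' w * gcoef \<kappa> l r' j (w + unit k i' s) * gcoef \<kappa> k l i (w + unit k i' s + unit l j s)) +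
         gcoef \<kappa> k l i' w * gcoef \<kappa> k l i (w + unit k i' s) * gcoef \<kappa> l r' j (w + unit k i' s + unit k i s) +
         (gcoef \<kappa> l r' j w * gcoef \<kappa> k l i (w + unit l j s) * gcoef \<kappa> k l i' (w + unit l j s + unit k i s) -
          2 * (gcoef \<kappa> k l i w * gcoef \<kappa> l r' j (w + unit k i s) * gcoef \<kappa> k l i' (w + unit k i s + unit l j s)) +
          gcoef \<kappa> k l i w * gcoef \<kappa> k l i' (w + unit k i s) * gcoef \<kappa> l r' j (w + unit k i s + unit k i' s)) = 0"
      unfolding \<beta> C(1) C'(1)
      using serre_identity_1[OF nz, of "gcoef \<kappa> l r' j w" "V l j w" "C' w" "C w"] ne False
      by (simp add: C(2,3) C'(2,3))
  qed
qed

text \<open>Here the single operator has row \<open>k\<close> in its numerators, so the repeated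
  shifts in row \<open>k\<close> move the numerator of the single operator; otherwise the case
  distinction is the same, with \<open>serre_identity_2\<close>.\<close>

lemma gop_serre_2:
  assumes k: "k \<le> n" and ne: "l \<noteq> k" "r \<noteq> k" "r \<noteq> l"
  shows "comm (gop \<kappa> s k r) (comm (gop \<kappa> s k r) (gop \<kappa> s l k)) = 0"
  unfolding gop_def
proof (rule serre_sum[OF endo_two], assumption)
  fix i i' j assume i: "i \<in> {1..k}" "i' \<in> {1..k}" and j: "j \<in> {1..l}"
  have \<alpha>: "gcoef \<kappa> k r a (w + unit l j s) = gcoef \<kappa> k r a w" for w a
    using ne by (intro gcoef_far) auto
  have sw: "w + unit l j s + u = w + u + unit l j s" for w u by (simp add: add.commute add.left_commute)
  show "comm (atom (gcoef \<kappa> k r i) (unit k i s)) (comm (atom (gcoef \<kappa> k r i') (unit k i' s)) (atom (gcoef \<kappa> l k j) (unit l j s))) +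
       comm (atom (gcoef \<kappa> k r i') (unit k i' s)) (comm (atom (gcoef \<kappa> k r i) (unit k i s)) (atom (gcoef \<kappa> l k j) (unit l j s))) = 0"
  proof (rule serre_atoms, cases "i = i'")
    case True
    fix w
    obtain G where G: "\<And>w. gcoef \<kappa> l k j w = (V l j w - V k i w) * G w" "\<And>w c. G (w + unit k i c) = G w"
      using gcoef_split_row[OF ne(1)[symmetric] i(1)] by metis
    define w1 where "w1 = w + unit k i s"
    have w1: "V k i w1 = V k i w + of_int s" "V l j w1 = V l j w" "G w1 = G w"
      using ne by (simp_all add: w1_def G(2))
    show "gcoef \<kappa> l k j w * gcoef \<kappa> k r i' (w + unit l j s) * gcoef \<kappa> k r i (w + unit l j s + unit k i' s) -
         2 * (gcoef \<kappa> k r i' w * gcoef \<kappa> l k j (w + unit k i' s) * gcoef \<kappa> k r i (w + unit k i' s + unit l j s)) +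
         gcoef \<kappa> k r i' w * gcoef \<kappa> k r i (w + unit k i' s) * gcoef \<kappa> l k j (w + unit k i' s + unit k i s) +
         (gcoef \<kappa> l k j w * gcoef \<kappa> k r i (w + unit l j s) * gcoef \<kappa> k r i' (w + unit l j s + unit k i s) -
          2 * (gcoef \<kappa> k r i w * gcoef \<kappa> l k j (w + unit k i s) * gcoef \<kappa> k r i' (w + unit k i s + unit l j s)) +
          gcoef \<kappa> k r i w * gcoef \<kappa> k r i' (w + unit k i s) * gcoef \<kappa> l k j (w + unit k i s + unit k i' s)) = 0"
      unfolding True[symmetric] sw \<alpha> G(1) w1_def[symmetric] using ne by (simp add: G(2) w1; simp add: algebra_simps)
  next
    case False
    fix w
    obtain G where G: "\<And>w. gcoef \<kappa> l k j w = (V l j w - V k i w) * (V l j w - V k i' w) * G w"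
      "\<And>w c. G (w + unit k i c) = G w" "\<And>w c. G (w + unit k i' c) = G w"
      using gcoef_split_two[OF ne(1)[symmetric] i False] by metis
    obtain C where C: "\<And>w. gcoef \<kappa> k r i w = C w / (V k i w - V k i' w)" "\<And>w c. C (w + unit k i' c) = C w"
      "\<And>w c. C (w + unit l j c) = C w"
      using gcoef_split_den[OF ne(2) i(2) False] ne by metis
    obtain C' where C': "\<And>w. gcoef \<kappa> k r i' w = C' w / (V k i' w - V k i w)" "\<And>w c. C' (w + unit k i c) = C' w"
      "\<And>w c. C' (w + unit l j c) = C' w"
      using gcoef_split_den[OF ne(2) i(1)] ne False by metis
    have nz: "V k i w - V k i' w \<noteq> 0" "V k i w - V k i' w \<noteq> of_int s" "V k i' w - V k i w \<noteq> of_int s"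
      using V_diff[of i i' k w] V_diff[of i' i k w] V_diff0[of i i' k w] i k False by auto
    show "gcoef \<kappa> l k j w * gcoef \<kappa> k r i' (w + unit l j s) * gcoef \<kappa> k r i (w + unit l j s + unit k i' s) -
         2 * (gcoef \<kappa> k r i' w * gcoef \<kappa> l k j (w + unit k i' s) * gcoef \<kappa> k r i (w + unit k i' s + unit l j s)) +
         gcoef \<kappa> k r i' w * gcoef \<kappa> k r i (w + unit k i' s) * gcoef \<kappa> l k j (w + unit k i' s + unit k i s) +
         (gcoef \<kappa> l k j w * gcoef \<kappa> k r i (w + unit l j s) * gcoef \<kappa> k r i' (w + unit l j s + unit k i s) -
          2 * (gcoef \<kappa> k r i w * gcoef \<kappa> l k j (w + unit k i s) * gcoef \<kappa> k r i' (w + unit k i s + unit l j s)) +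
          gcoef \<kappa> k r i w * gcoef \<kappa> k r i' (w + unit k i s) * gcoef \<kappa> l k j (w + unit k i s + unit k i' s)) = 0"
      unfolding sw \<alpha> G(1) C(1) C'(1)
      using serre_identity_2[OF nz, of "V l j w" "G w" "C' w" "C w"] ne False
      by (simp add: G(2,3) C(2,3) C'(2,3))
  qed
qed

definition gE :: "nat \<Rightarrow> endo" where "gE k = gop (-1) 1 k (Suc k)"
definition gF :: "nat \<Rightarrow> endo" where "gF k = gop 1 (-1) k (k - 1)"
text \<open>The eigenvalue of the diagonal matrix unit \<open>a\<close> on an array. The summand
  \<open>a - 1\<close> is the shift built into the array entries, and it produces the constant
  \<open>-1\<close> in the formula for \<open>hv\<close>.\<close>

definition dcoef :: "nat \<Rightarrow> latt \<Rightarrow> complex" where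
  "dcoef a z = (\<Sum>i=1..a. V a i z) - (\<Sum>i=1..a-1. V (a - 1) i z) + of_nat (a - 1)"
definition gD :: "nat \<Rightarrow> endo" where "gD a = atom (dcoef a) 0"

lemma dcoef_shift:
  assumes "i \<in> {1..k}" "a \<ge> 1"
  shows "dcoef a (w + unit k i s) = dcoef a w + (if a = k then of_int s else 0) - (if a = Suc k then of_int s else 0)"
proof -
  have row: "(\<Sum>m=1..b. V b m (w + unit k i s)) = (\<Sum>m=1..b. V b m w) + (if b = k then of_int s else 0)" for b
  proof (cases "b = k")
    case True
    have "(\<Sum>m=1..b. V b m (w + unit k i s)) = (\<Sum>m=1..b. V b m w + (if m = i then of_int s else 0))"
      using True by (intro sum.cong) (auto simp: V_shift)
    then show ?thesis using True assms by (simp add: sum.distrib)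
  qed simp
  show ?thesis unfolding dcoef_def row using assms by auto
qed

lemma comm_gD_gop:
  assumes "a \<ge> 1"
  shows "comm (gD a) (gop \<kappa> s k r) = (if a = k then of_int s * gop \<kappa> s k r else 0) - (if a = Suc k then of_int s * gop \<kappa> s k r else 0)"
proof -
  have sc: "of_int s * atom g d = atom (\<lambda>w. of_int s * g w) d" for g d
  proof -
    have one: "(1::endo) = atom (\<lambda>_. 1) 0" by transfer auto
    have "of_int s = atom (\<lambda>_. of_int s) 0"
    proof (induction s rule: int_induct[where k = 0])
      case base show ?case by (simp add: atom_zero)
    next
      case (step1 i)
      then show ?case by (simp only: of_int_add of_int_1 one atom_add)
    next
      case (step2 i)
      then show ?case by (simp only: of_int_diff of_int_1 one atom_diff)
    qed
    then show ?thesis by (simp add: atom_mult mult.commute)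
  qed
  have "comm (gD a) (gop \<kappa> s k r) = (\<Sum>i=1..k. atom (\<lambda>w. gcoef \<kappa> k r i w * dcoef a (w + unit k i s) - dcoef a w * gcoef \<kappa> k r i w) (unit k i s))"
    unfolding gD_def gop_def comm_sum_right comm_atom by simp
  also have "\<dots> = (\<Sum>i=1..k. (if a = k then of_int s * atom (gcoef \<kappa> k r i) (unit k i s) else 0)
      - (if a = Suc k then of_int s * atom (gcoef \<kappa> k r i) (unit k i s) else 0))"
  proof (rule sum.cong[OF refl])
    fix i assume i: "i \<in> {1..k}"
    show "atom (\<lambda>w. gcoef \<kappa> k r i w * dcoef a (w + unit k i s) - dcoef a w * gcoef \<kappa> k r i w) (unit k i s)
      = (if a = k then of_int s * atom (gcoef \<kappa> k r i) (unit k i s) else 0)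
      - (if a = Suc k then of_int s * atom (gcoef \<kappa> k r i) (unit k i s) else 0)"
    proof -
      have "gcoef \<kappa> k r i w * dcoef a (w + unit k i s) - dcoef a w * gcoef \<kappa> k r i w
        = ((if a = k then of_int s else 0) - (if a = Suc k then of_int s else 0)) * gcoef \<kappa> k r i w" for w
        unfolding dcoef_shift[OF i assms] by (auto simp: algebra_simps)
      moreover have "atom (\<lambda>w. - (of_int s * g w)) d = - atom (\<lambda>w. of_int s * g w) d" for g d
        by transfer (auto simp: fun_eq_iff)
      ultimately show ?thesis by (auto simp: sc atom_zero)
    qed
  qed
  also have "\<dots> = (if a = k then of_int s * gop \<kappa> s k r else 0) - (if a = Suc k then of_int s * gop \<kappa> s k r else 0)"
    by (simp add: gop_def sum_distrib_left sum_subtractf sum_negf)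
  finally show ?thesis .
qed

text \<open>For one row and two columns at difference \<open>x\<close>, both orders of composition
  have denominator \<open>- x (x + 1)\<close> and otherwise invariant factors. For
  \<open>l = k + 1\<close>, both orders contain the moved numerator \<open>- x (x + 1)\<close>,
  where \<open>x\<close> is the difference of the two entries. In the remaining cases neither shift
  affects the other coefficient.\<close>

lemma gE_gF_atoms:
  assumes i: "i \<in> {1..k}" and j: "j \<in> {1..l}" and kl: "k \<in> {1..n}" "l \<in> {1..n}" and ne: "(k,i) \<noteq> (l,j)"
  shows "comm (atom (gcoef (-1) k (Suc k) i) (unit k i 1)) (atom (gcoef 1 l (l - 1) j) (unit l j (-1))) = 0"
  unfolding comm_atom
proof (rule atom_zero)
  fix w
  consider "l = k" "i \<noteq> j" | "l = Suc k" | "l \<noteq> k" "l \<noteq> Suc k" using ne by auto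
  then show "gcoef 1 l (l - 1) j w * gcoef (-1) k (Suc k) i (w + unit l j (-1)) - gcoef (-1) k (Suc k) i w * gcoef 1 l (l - 1) j (w + unit k i 1) = 0"
  proof cases
    case 1
    have r: "Suc k \<noteq> k" "k - 1 \<noteq> k" using kl by auto
    have jk: "j \<in> {1..k}" using j 1 by simp
    obtain C where C: "\<And>w. gcoef (-1) k (Suc k) i w = C w / (V k i w - V k j w)" "\<And>w c. C (w + unit k j c) = C w"
      using gcoef_split_den[OF r(1) jk 1(2)] by metis
    obtain C' where C': "\<And>w. gcoef 1 k (k - 1) j w = C' w / (V k j w - V k i w)" "\<And>w c. C' (w + unit k i c) = C' w"
      using gcoef_split_den[OF r(2) i] 1 by metis
    have nz: "V k i w - V k j w \<noteq> 0" "V k i w - V k j w + 1 \<noteq> 0"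
      using V_diff[of i j k w "-1"] V_diff0[of i j k w] i jk kl 1 by (auto simp: eq_neg_iff_add_eq_0)
    define x where "x = V k i w - V k j w"
    have x: "V k j w - V k i w = - x" "V k j w - (V k i w + 1) = - (x + 1)" "V k i w - (V k j w - 1) = x + 1"
      by (auto simp: x_def)
    have x': "x * (- x - 1) = - (x * (x + 1))" by (simp add: algebra_simps)
    show ?thesis unfolding 1(1) C(1) C'(1) using 1 nz by (simp add: C(2) C'(2) x x_def[symmetric] x' mult.commute)
  next
    case 2
    obtain A where A: "\<And>w. gcoef (-1) k (Suc k) i w = (V k i w - V l j w) * A w" "\<And>w c. A (w + unit l j c) = A w"
      using gcoef_split_row[of "Suc k" k j "-1" i] j 2 by auto
    obtain A' where A': "\<And>w. gcoef 1 l k j w = (V l j w - V k i w) * A' w" "\<And>w c. A' (w + unit k i c) = A' w"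
      using gcoef_split_row[of k l i 1 j] i 2 by auto
    have l: "l - 1 = k" "l \<noteq> k" using 2 by auto
    show ?thesis unfolding l(1) A(1) A'(1) using l(2) by (simp add: A(2) A'(2) algebra_simps)
  next
    case 3
    then have "gcoef (-1) k (Suc k) i (w + unit l j (-1)) = gcoef (-1) k (Suc k) i w" by (intro gcoef_far) auto
    moreover have "gcoef 1 l (l - 1) j (w + unit k i 1) = gcoef 1 l (l - 1) j w"
      using 3 kl by (intro gcoef_far) auto
    ultimately show ?thesis by simp
  qed
qed

text \<open>Only terms moving the same entry up and down survive. They sum to a multiplication
  operator, whose coefficient is computed by \<open>gt_diagonal_identity\<close>.\<close>

lemma gE_gF:
  assumes kl: "k \<in> {1..n}" "l \<in> {1..n}"
  shows "comm (gE k) (gF l) = (if k = l then gD k - gD (Suc k) else 0)"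
proof -
  let ?c = "\<lambda>i j. comm (atom (gcoef (-1) k (Suc k) i) (unit k i 1)) (atom (gcoef 1 l (l - 1) j) (unit l j (-1)))"
  have e: "comm (gE k) (gF l) = (\<Sum>i=1..k. \<Sum>j=1..l. ?c i j)"
    unfolding gE_def gF_def gop_def by (simp only: comm_sum_left) (simp only: comm_sum_right)
  show ?thesis
  proof (cases "k = l")
    case False
    then have "(\<Sum>i=1..k. \<Sum>j=1..l. ?c i j) = 0"
      using gE_gF_atoms kl by (intro sum.neutral ballI) auto
    then show ?thesis using e False by simp
  next
    case True
    let ?h = "\<lambda>i w. gcoef 1 k (k - 1) i w * gcoef (-1) k (Suc k) i (w + unit k i (-1)) - gcoef (-1) k (Suc k) i w * gcoef 1 k (k - 1) i (w + unit k i 1)"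
    have u0: "unit k i 1 + unit k i (-1) = 0" for i by (auto simp: unit_def fun_eq_iff)
    have "(\<Sum>i=1..k. \<Sum>j=1..l. ?c i j) = (\<Sum>i=1..k. \<Sum>j=1..k. if j = i then ?c i i else 0)"
      using gE_gF_atoms[OF _ _ kl] True by (intro sum.cong) auto
    also have "\<dots> = (\<Sum>i=1..k. ?c i i)" by (intro sum.cong) auto
    also have "\<dots> = (\<Sum>i=1..k. atom (?h i) 0)"
      unfolding comm_atom True[symmetric] u0 ..
    also have "\<dots> = atom (\<lambda>w. \<Sum>i=1..k. ?h i w) 0" by (rule atom_sum)
    also have "(\<lambda>w. \<Sum>i=1..k. ?h i w) = (\<lambda>w. dcoef k w - dcoef (Suc k) w)"
    proof
      fix w
      let ?x = "\<lambda>i. V k i w" let ?a = "\<lambda>i. V (Suc k) i w" let ?b = "\<lambda>i. V (k - 1) i w"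
      have k1: "k \<ge> 1" "k - 1 \<noteq> k" using kl by auto
      have den: "(\<Prod>m\<in>{1..k}-{i}. V k i (w + unit k i c) - V k m (w + unit k i c)) = (\<Prod>m\<in>{1..k}-{i}. ?x i + of_int c - ?x m)" for i c
        by (rule prod.cong) auto
      have "(\<Sum>i=1..k. ?h i w) = (\<Sum>i=1..k. (\<Prod>j=1..Suc k. ?x i - ?a j) * (\<Prod>j=1..k-1. ?x i + 1 - ?b j) /
              ((\<Prod>j\<in>{1..k}-{i}. ?x i - ?x j) * (\<Prod>j\<in>{1..k}-{i}. ?x i + 1 - ?x j))
            - (\<Prod>j=1..Suc k. ?x i - 1 - ?a j) * (\<Prod>j=1..k-1. ?x i - ?b j) /
              ((\<Prod>j\<in>{1..k}-{i}. ?x i - ?x j) * (\<Prod>j\<in>{1..k}-{i}. ?x i - 1 - ?x j)))"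
        unfolding gcoef_def den using k1
        by (intro sum.cong refl) (simp add: mult.commute del: prod.cl_ivl_Suc)
      also have "\<dots> = 2 * (\<Sum>i=1..k. ?x i) - (\<Sum>i=1..k-1. ?b i) - (\<Sum>i=1..Suc k. ?a i) - 1"
      proof (rule gt_diagonal_identity[OF k1(1)])
        fix i j assume "i \<in> {1..k}" "j \<in> {1..k}" "i \<noteq> j"
        then show "?x i - ?x j \<notin> {0, 1, -1}"
          using V_diff[of i j k w 0] V_diff[of i j k w 1] V_diff[of i j k w "-1"] kl by auto
      qed
      also have "\<dots> = dcoef k w - dcoef (Suc k) w"
        using k1 by (simp add: dcoef_def of_nat_diff del: sum.cl_ivl_Suc)
      finally show "(\<Sum>i=1..k. ?h i w) = dcoef k w - dcoef (Suc k) w" .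
    qed
    finally show ?thesis using e True by (simp only: gD_def atom_diff refl if_True)
  qed
qed

sublocale chevalley_gl n gE gF gD
proof
  show "u = 0" if "u + u = 0" for u :: endo using that by (rule endo_two)
  show "comm (gD a) (gD b) = 0" for a b
    unfolding gD_def comm_atom by (rule atom_zero) simp
  show "comm (gD a) (gE k) = (if a = k then gE k else 0) - (if a = Suc k then gE k else 0)" if "a \<in> {1..Suc n}" for a k
    unfolding gE_def using that by (subst comm_gD_gop) auto
  show "comm (gD a) (gF k) = (if a = Suc k then gF k else 0) - (if a = k then gF k else 0)" if "a \<in> {1..Suc n}" for a k
    unfolding gF_def using that by (subst comm_gD_gop) auto
  show "comm (gE k) (gF l) = (if k = l then gD k - gD (Suc k) else 0)" if "k \<in> {1..n}" "l \<in> {1..n}" for k l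
    using gE_gF[OF that] .
  show "comm (gE k) (gE l) = 0" if "k \<in> {1..n}" "l \<in> {1..n}" "k \<noteq> Suc l" "l \<noteq> Suc k" for k l
    unfolding gE_def using that gop_far[of k l "Suc l" "Suc k"] by (cases "k = l") auto
  show "comm (gF k) (gF l) = 0" if "k \<in> {1..n}" "l \<in> {1..n}" "k \<noteq> Suc l" "l \<noteq> Suc k" for k l
    unfolding gF_def using that gop_far[of k l "l - 1" "k - 1"] by (cases "k = l") auto
  show "comm (gE k) (comm (gE k) (gE l)) = 0" if "k \<in> {1..n}" "l \<in> {1..n}" "k = Suc l \<or> l = Suc k" for k l
    using that(3)
  proof
    assume k: "k = Suc l"
    show ?thesis unfolding gE_def k using that k by (intro gop_serre_2) auto
  next
    assume l: "l = Suc k"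
    show ?thesis unfolding gE_def l using that l by (intro gop_serre_1) auto
  qed
  show "comm (gF k) (comm (gF k) (gF l)) = 0" if "k \<in> {1..n}" "l \<in> {1..n}" "k = Suc l \<or> l = Suc k" for k l
    using that(3)
  proof
    assume k: "k = Suc l"
    have "k - 1 = l" "l \<noteq> k" "l - 1 \<noteq> k" "l - 1 \<noteq> l" using k that by auto
    then show ?thesis unfolding gF_def using that gop_serre_1[of k l "l - 1" 1 "-1"] by simp
  next
    assume l: "l = Suc k"
    have "l - 1 = k" "l \<noteq> k" "k - 1 \<noteq> k" "k - 1 \<noteq> l" using l that by auto
    then show ?thesis unfolding gF_def using that gop_serre_2[of k l "k - 1" 1 "-1"] by simp
  qed
qed

end

section \<open>Sets closed under the operators\<close>

lemma gl_family_lie_module: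
  fixes sc :: "complex \<Rightarrow> 'v::ab_group_add \<Rightarrow> 'v"
  assumes vs: "Vector_Spaces.vector_space sc"
    and lin: "\<And>a b. \<lbrakk>a \<in> {1..Suc n}; b \<in> {1..Suc n}\<rbrakk> \<Longrightarrow> Vector_Spaces.linear sc sc (\<tau> a b)"
    and rel: "\<And>a b c d x. \<lbrakk>a \<in> {1..Suc n}; b \<in> {1..Suc n}; c \<in> {1..Suc n}; d \<in> {1..Suc n}\<rbrakk> \<Longrightarrow>
      \<tau> a b (\<tau> c d x) - \<tau> c d (\<tau> a b x) = (if b = c then \<tau> a d x else 0) - (if d = a then \<tau> c b x else 0)"
  defines "R \<equiv> \<lambda>(A::mat) x. \<Sum>a=1..Suc n. \<Sum>b=1..Suc n. sc (A a b) (\<tau> a b x)"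
  shows "lie_module n sc R"
proof -
  interpret vector_space sc by (rule vs)
  let ?N = "{1..Suc n}"
  note [simp del] = sum.cl_ivl_Suc
  have tadd: "\<tau> a b (x + y) = \<tau> a b x + \<tau> a b y" if "a \<in> ?N" "b \<in> ?N" for a b x y
    using lin[OF that] by (simp add: Vector_Spaces.linear_iff)
  have tsc: "\<tau> a b (sc c x) = sc c (\<tau> a b x)" if "a \<in> ?N" "b \<in> ?N" for a b c x
    using lin[OF that] by (simp add: Vector_Spaces.linear_iff)
  have tsum: "\<tau> a b (\<Sum>i\<in>I. f i) = (\<Sum>i\<in>I. \<tau> a b (f i))" if "a \<in> ?N" "b \<in> ?N" for a b I and f :: "nat \<Rightarrow> 'v"
  proof -
    interpret L: Vector_Spaces.linear sc sc "\<tau> a b" using lin[OF that] .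
    show ?thesis by (rule L.sum)
  qed
  have Radd: "R A (x + y) = R A x + R A y" for A x y
    unfolding R_def sum.distrib[symmetric] by (intro sum.cong refl) (simp add: tadd scale_right_distrib)
  have Rsc: "R A (sc c x) = sc c (R A x)" for A c x
    unfolding R_def scale_sum_right by (intro sum.cong refl) (simp add: tsc mult.commute)
  have lR: "Vector_Spaces.linear sc sc (R A)" for A
    unfolding Vector_Spaces.linear_iff using Radd Rsc vector_space_axioms by blast
  have RR: "R A (R B x) = (\<Sum>a\<in>?N. \<Sum>b\<in>?N. \<Sum>c\<in>?N. \<Sum>d\<in>?N. sc (A a b * B c d) (\<tau> a b (\<tau> c d x)))" for A B x
    unfolding R_def
    by (intro sum.cong refl) (simp add: tsum tsc scale_sum_right)
  have swap: "R B (R A x) = (\<Sum>a\<in>?N. \<Sum>b\<in>?N. \<Sum>c\<in>?N. \<Sum>d\<in>?N. sc (A a b * B c d) (\<tau> c d (\<tau> a b x)))" for A B x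
  proof -
    have "R B (R A x) = (\<Sum>c\<in>?N. \<Sum>d\<in>?N. \<Sum>a\<in>?N. \<Sum>b\<in>?N. sc (A a b * B c d) (\<tau> c d (\<tau> a b x)))"
      unfolding RR by (intro sum.cong refl) (simp add: mult.commute)
    also have "\<dots> = (\<Sum>c\<in>?N. \<Sum>a\<in>?N. \<Sum>d\<in>?N. \<Sum>b\<in>?N. sc (A a b * B c d) (\<tau> c d (\<tau> a b x)))"
      by (rule sum.cong[OF refl], rule sum.swap)
    also have "\<dots> = (\<Sum>c\<in>?N. \<Sum>a\<in>?N. \<Sum>b\<in>?N. \<Sum>d\<in>?N. sc (A a b * B c d) (\<tau> c d (\<tau> a b x)))"
      by (rule sum.cong[OF refl], rule sum.cong[OF refl], rule sum.swap)
    also have "\<dots> = (\<Sum>a\<in>?N. \<Sum>c\<in>?N. \<Sum>b\<in>?N. \<Sum>d\<in>?N. sc (A a b * B c d) (\<tau> c d (\<tau> a b x)))"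
      by (rule sum.swap)
    also have "\<dots> = (\<Sum>a\<in>?N. \<Sum>b\<in>?N. \<Sum>c\<in>?N. \<Sum>d\<in>?N. sc (A a b * B c d) (\<tau> c d (\<tau> a b x)))"
      by (rule sum.cong[OF refl], rule sum.swap)
    finally show ?thesis .
  qed
  have br: "R (brk n A B) x = R A (R B x) - R B (R A x)" for A B x
  proof -
    have "R A (R B x) - R B (R A x) = (\<Sum>a\<in>?N. \<Sum>b\<in>?N. \<Sum>c\<in>?N. \<Sum>d\<in>?N. sc (A a b * B c d) (\<tau> a b (\<tau> c d x) - \<tau> c d (\<tau> a b x)))"
      unfolding RR[of A B] swap[of B A] sum_subtractf[symmetric] scale_right_diff_distrib[symmetric] ..
    also have "\<dots> = (\<Sum>a\<in>?N. \<Sum>b\<in>?N. \<Sum>c\<in>?N. \<Sum>d\<in>?N. (if c = b then sc (A a b * B b d) (\<tau> a d x) else 0) - (if d = a then sc (A a b * B c a) (\<tau> c b x) else 0))"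
      by (intro sum.cong refl) (auto simp: rel scale_right_diff_distrib)
    also have "\<dots> = (\<Sum>a\<in>?N. \<Sum>b\<in>?N. \<Sum>c\<in>?N. \<Sum>d\<in>?N. (if c = b then sc (A a b * B b d) (\<tau> a d x) else 0))
       - (\<Sum>a\<in>?N. \<Sum>b\<in>?N. \<Sum>c\<in>?N. \<Sum>d\<in>?N. (if d = a then sc (A a b * B c a) (\<tau> c b x) else 0))"
      by (simp only: sum_subtractf)
    also have "(\<Sum>a\<in>?N. \<Sum>b\<in>?N. \<Sum>c\<in>?N. \<Sum>d\<in>?N. (if d = a then sc (A a b * B c a) (\<tau> c b x) else 0))
       = (\<Sum>a\<in>?N. \<Sum>b\<in>?N. \<Sum>c\<in>?N. sc (A a b * B c a) (\<tau> c b x))"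
      by (intro sum.cong refl) (simp only: sum.delta finite_atLeastAtMost if_True)
    also have "\<dots> = (\<Sum>a\<in>?N. \<Sum>c\<in>?N. \<Sum>b\<in>?N. sc (A a b * B c a) (\<tau> c b x))"
      by (rule sum.cong[OF refl], rule sum.swap)
    also have "\<dots> = (\<Sum>c\<in>?N. \<Sum>a\<in>?N. \<Sum>b\<in>?N. sc (A a b * B c a) (\<tau> c b x))" by (rule sum.swap)
    also have "\<dots> = (\<Sum>c\<in>?N. \<Sum>b\<in>?N. \<Sum>a\<in>?N. sc (A a b * B c a) (\<tau> c b x))"
      by (rule sum.cong[OF refl], rule sum.swap)
    also have "\<dots> = (\<Sum>c\<in>?N. \<Sum>b\<in>?N. sc (mmul n B A c b) (\<tau> c b x))"
      by (intro sum.cong refl) (simp only: mmul_def scale_sum_left mult.commute)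
    also have "(\<Sum>a\<in>?N. \<Sum>b\<in>?N. \<Sum>c\<in>?N. \<Sum>d\<in>?N. (if c = b then sc (A a b * B b d) (\<tau> a d x) else 0))
       = (\<Sum>a\<in>?N. \<Sum>b\<in>?N. \<Sum>d\<in>?N. \<Sum>c\<in>?N. (if c = b then sc (A a b * B b d) (\<tau> a d x) else 0))"
      by (rule sum.cong[OF refl], rule sum.cong[OF refl], rule sum.swap)
    also have "\<dots> = (\<Sum>a\<in>?N. \<Sum>b\<in>?N. \<Sum>d\<in>?N. sc (A a b * B b d) (\<tau> a d x))"
      by (intro sum.cong refl) (simp only: sum.delta finite_atLeastAtMost if_True)
    also have "\<dots> = (\<Sum>a\<in>?N. \<Sum>d\<in>?N. \<Sum>b\<in>?N. sc (A a b * B b d) (\<tau> a d x))"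
      by (rule sum.cong[OF refl], rule sum.swap)
    also have "\<dots> = (\<Sum>a\<in>?N. \<Sum>d\<in>?N. sc (mmul n A B a d) (\<tau> a d x))"
      by (intro sum.cong refl) (simp only: mmul_def scale_sum_left)
    also have "(\<Sum>a\<in>?N. \<Sum>d\<in>?N. sc (mmul n A B a d) (\<tau> a d x)) - (\<Sum>c\<in>?N. \<Sum>b\<in>?N. sc (mmul n B A c b) (\<tau> c b x)) = R (brk n A B) x"
      unfolding R_def brk_def scale_left_diff_distrib sum_subtractf ..
    finally show ?thesis ..
  qed
  have "R (\<lambda>a b. A a b + B a b) x = R A x + R B x" for A B x
    unfolding R_def by (simp only: scale_left_distrib sum.distrib)
  moreover have "R (\<lambda>a b. c * A a b) x = sc c (R A x)" for A c x
    unfolding R_def by (simp only: scale_sum_right scale_scale)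
  ultimately show ?thesis unfolding lie_module_def using vector_space_axioms lR br by blast
qed

definition fsc :: "complex \<Rightarrow> ('z \<Rightarrow> complex) \<Rightarrow> 'z \<Rightarrow> complex" where
  "fsc c f = (\<lambda>z. c * f z)"

lemma vector_space_fsc: "Vector_Spaces.vector_space fsc"
  by unfold_locales (auto simp: fsc_def fun_eq_iff algebra_simps)

context gt_generic begin

text \<open>Functions supported in such a set are preserved by the Chevalley generators, because a
  shift out of the set carries coefficient zero; brackets extend this to all
  \<open>X a b\<close>.\<close>

definition gclosed :: "latt set \<Rightarrow> bool" where
  "gclosed C \<longleftrightarrow> (\<forall>k\<in>{1..n}. \<forall>i\<in>{1..k}. \<forall>z\<in>C.
     (z + unit k i 1 \<in> C \<or> gcoef (-1) k (Suc k) i z = 0) \<and> (z + unit k i (-1) \<in> C \<or> gcoef 1 k (k - 1) i z = 0))"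

definition supp_in :: "latt set \<Rightarrow> (latt \<Rightarrow> complex) \<Rightarrow> bool" where
  "supp_in C f \<longleftrightarrow> (\<forall>z. f z \<noteq> 0 \<longrightarrow> z \<in> C)"

definition preserves :: "latt set \<Rightarrow> endo \<Rightarrow> bool" where
  "preserves C Y \<longleftrightarrow> (\<forall>f. supp_in C f \<longrightarrow> supp_in C (app Y f))"

lemma supp_in_add: "supp_in C f \<Longrightarrow> supp_in C g \<Longrightarrow> supp_in C (f + g)"
  by (auto simp: supp_in_def) (metis add_cancel_right_right)

lemma supp_in_diff: "supp_in C f \<Longrightarrow> supp_in C g \<Longrightarrow> supp_in C (f - g)"
  by (auto simp: supp_in_def) (metis diff_0_right)

lemma preserves_add: "preserves C Y \<Longrightarrow> preserves C Z \<Longrightarrow> preserves C (Y + Z)"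
  by (auto simp: preserves_def app_simps intro: supp_in_add)

lemma preserves_mult: "preserves C Y \<Longrightarrow> preserves C Z \<Longrightarrow> preserves C (Y * Z)"
  by (auto simp: preserves_def app_simps)

lemma preserves_diff: "preserves C Y \<Longrightarrow> preserves C Z \<Longrightarrow> preserves C (Y - Z)"
  by (auto simp: preserves_def app_simps intro: supp_in_diff)

lemma preserves_uminus: "preserves C Y \<Longrightarrow> preserves C (- Y)"
  by (auto simp: preserves_def app_simps supp_in_def)

lemma preserves_zero: "preserves C 0"
  by (auto simp: preserves_def app_simps supp_in_def)

lemma preserves_comm: "preserves C Y \<Longrightarrow> preserves C Z \<Longrightarrow> preserves C (comm Y Z)"
  unfolding comm_def by (intro preserves_diff preserves_mult)

lemma preserves_sum: "(\<And>i. i \<in> I \<Longrightarrow> preserves C (Y i)) \<Longrightarrow> preserves C (\<Sum>i\<in>I. Y i)"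
  by (induction I rule: infinite_finite_induct) (auto intro: preserves_zero preserves_add)

lemma preserves_atom: "(\<And>z. z \<in> C \<Longrightarrow> z + d \<in> C \<or> g z = 0) \<Longrightarrow> preserves C (atom g d)"
proof (unfold preserves_def supp_in_def, intro allI impI)
  fix f z
  assume C: "\<And>z. z \<in> C \<Longrightarrow> z + d \<in> C \<or> g z = 0" and f: "\<forall>z. f z \<noteq> 0 \<longrightarrow> z \<in> C"
    and nz: "app (atom g d) f z \<noteq> 0"
  then have "z - d \<in> C" "g (z - d) \<noteq> 0" by (auto simp: app_atom)
  then show "z \<in> C" using C[of "z - d"] by simp
qed

lemma preserves_chain: "(\<And>k. k \<in> {a..a + d} \<Longrightarrow> preserves C (e k)) \<Longrightarrow> preserves C (chain e a d)"
  by (induction d) (auto intro: preserves_comm)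

lemma preserves_X:
  assumes C: "gclosed C" and ab: "a \<in> {1..Suc n}" "b \<in> {1..Suc n}"
  shows "preserves C (X a b)"
proof -
  have E: "preserves C (gE k)" if "k \<in> {1..n}" for k
    unfolding gE_def gop_def using C that by (intro preserves_sum preserves_atom) (auto simp: gclosed_def)
  have F: "preserves C (gF k)" if "k \<in> {1..n}" for k
    unfolding gF_def gop_def using C that by (intro preserves_sum preserves_atom) (auto simp: gclosed_def)
  have D: "preserves C (gD k)" for k
    unfolding gD_def by (intro preserves_atom) simp
  show ?thesis unfolding X_def
    using ab by (auto intro!: D E F preserves_uminus preserves_chain)
qed

lemma app_gD: "app (gD a) f z = dcoef a z * f z"
  unfolding gD_def app_atom by simp

definition zd :: "nat \<Rightarrow> latt \<Rightarrow> int" where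
  "zd a z = (\<Sum>i=1..a. z a i) - (\<Sum>i=1..a-1. z (a - 1) i)"

lemma dcoef_zd: "a \<ge> 1 \<Longrightarrow> dcoef a z = t a + of_int (zd a z) + of_nat (a - 1)"
  by (cases a) (simp_all add: dcoef_def zd_def V_def sum.distrib)

definition wsupp :: "(nat \<Rightarrow> int) \<Rightarrow> (latt \<Rightarrow> complex) \<Rightarrow> bool" where
  "wsupp \<nu> f \<longleftrightarrow> (\<forall>z. f z \<noteq> 0 \<longrightarrow> (\<forall>a\<in>{1..Suc n}. zd a z = \<nu> a))"

text \<open>The operators \<open>gD a\<close> act by multiplication with \<open>dcoef a\<close>, so
  their bracket relation with \<open>X c d\<close> forces the eigenvalue wherever the image is
  nonzero.\<close>

lemma wsupp_X:
  assumes cd: "c \<in> {1..Suc n}" "d \<in> {1..Suc n}" and f: "wsupp \<nu> f"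
  shows "wsupp (\<lambda>a. \<nu> a + (if a = c then 1 else 0) - (if a = d then 1 else 0)) (app (X c d) f)"
  unfolding wsupp_def
proof (intro allI impI ballI)
  fix z a assume nz: "app (X c d) f z \<noteq> 0" and a: "a \<in> {1..Suc n}"
  let ?u = "(if a = c then 1 else 0) - (if a = d then 1 else 0) :: complex"
  let ?l = "t a + of_int (\<nu> a) + of_nat (a - 1)"
  have "app (gD a) f = (\<lambda>z. ?l * f z)"
    using f a by (auto simp: app_gD wsupp_def dcoef_zd fun_eq_iff)
  then have 1: "app (X c d) (app (gD a) f) z = ?l * app (X c d) f z" by (simp add: app_simps)
  have "app (comm (gD a) (X c d)) f z = ?u * app (X c d) f z"
    unfolding X_bracket_generators(3)[OF cd a] by (auto simp: app_simps)
  moreover have "app (comm (gD a) (X c d)) f z = dcoef a z * app (X c d) f z - app (X c d) (app (gD a) f) z"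
    by (simp add: comm_def app_simps app_gD)
  ultimately have "dcoef a z * app (X c d) f z = (?l + ?u) * app (X c d) f z"
    unfolding 1 by (simp add: algebra_simps)
  then have "dcoef a z = ?l + ?u" using nz by simp
  then have "of_int (zd a z) = (of_int (\<nu> a + (if a = c then 1 else 0) - (if a = d then 1 else 0)) :: complex)"
    using a by (simp add: dcoef_zd)
  then show "zd a z = \<nu> a + (if a = c then 1 else 0) - (if a = d then 1 else 0)" by (simp only: of_int_eq_iff)
qed

definition base :: "latt set" where
  "base = {z. \<forall>k i. \<not> (1 \<le> i \<and> i \<le> k \<and> k \<le> n) \<longrightarrow> z k i = 0}"

definition above :: "nat \<Rightarrow> nat \<Rightarrow> latt set" where
  "above x k = {z. z (k - 1) x \<le> z k x}"

lemma gclosed_base: "gclosed base"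
  by (auto simp: gclosed_def base_def unit_def)

lemma gclosed_Int: "gclosed C \<Longrightarrow> gclosed C' \<Longrightarrow> gclosed (C \<inter> C')"
  unfolding gclosed_def by blast

lemma gclosed_Un: "gclosed C \<Longrightarrow> gclosed C' \<Longrightarrow> gclosed (C \<union> C')"
  unfolding gclosed_def by blast

lemma gclosed_INT: "(\<And>p. p \<in> P \<Longrightarrow> gclosed (C p)) \<Longrightarrow> gclosed (\<Inter>p\<in>P. C p)"
  unfolding gclosed_def by blast

lemma gclosed_UN: "(\<And>p. p \<in> P \<Longrightarrow> gclosed (C p)) \<Longrightarrow> gclosed (\<Union>p\<in>P. C p)"
  unfolding gclosed_def by blast

lemma gcoef_zero: "m \<in> {1..r} \<Longrightarrow> V k i z = V r m z \<Longrightarrow> gcoef \<kappa> k r i z = 0"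
proof -
  assume "m \<in> {1..r}" "V k i z = V r m z"
  then have "(\<Prod>m=1..r. V k i z - V r m z) = 0" by (intro prod_zero) auto
  then show ?thesis by (simp add: gcoef_def)
qed

text \<open>The set can be left only at equality, by raising the entry in row \<open>k - 1\<close>
  or lowering the one in row \<open>k\<close>. Both coefficients contain the difference of these two
  entries of column \<open>x\<close> as a factor.\<close>

lemma gclosed_above:
  assumes xk: "1 \<le> x" "x < k"
  shows "gclosed (above x k)"
  unfolding gclosed_def
proof (intro ballI conjI)
  fix k' i z assume k': "k' \<in> {1..n}" and i: "i \<in> {1..k'}" and z: "z \<in> above x k"
  show "z + unit k' i 1 \<in> above x k \<or> gcoef (-1) k' (Suc k') i z = 0"
  proof (cases "k' = k - 1 \<and> i = x \<and> z (k - 1) x = z k x")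
    case True
    then have "V k' i z = V (Suc k') x z" "x \<in> {1..Suc k'}" using xk by (auto simp: V_def)
    then show ?thesis using gcoef_zero by blast
  next
    case False then show ?thesis using z xk by (auto simp: above_def unit_def)
  qed
  show "z + unit k' i (-1) \<in> above x k \<or> gcoef 1 k' (k' - 1) i z = 0"
  proof (cases "k' = k \<and> i = x \<and> z (k - 1) x = z k x")
    case True
    then have "V k' i z = V (k' - 1) x z" "x \<in> {1..k' - 1}" using xk by (auto simp: V_def)
    then show ?thesis using gcoef_zero by blast
  next
    case False then show ?thesis using z xk by (auto simp: above_def unit_def)
  qed
qed

text \<open>At \<open>z n 1 = - M\<close> the entry in row \<open>n\<close> and column
  \<open>1\<close> coincides with the last entry of the top row, whose offset is zero on
  \<open>base\<close>. The raising coefficient then vanishes. This is the additional invariant set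
  due to an integral value.\<close>

lemma gclosed_integral:
  assumes "t 1 - t (Suc n) = of_int M" "n \<ge> 1"
  shows "gclosed {z\<in>base. z n 1 \<le> - M}"
  unfolding gclosed_def
proof (intro ballI conjI)
  fix k i z assume k: "k \<in> {1..n}" and i: "i \<in> {1..k}" and z: "z \<in> {z\<in>base. z n 1 \<le> - M}"
  have b: "z + unit k i 1 \<in> base" "z + unit k i (-1) \<in> base"
    using z k i by (auto simp: base_def unit_def)
  show "z + unit k i 1 \<in> {z\<in>base. z n 1 \<le> - M} \<or> gcoef (-1) k (Suc k) i z = 0"
  proof (cases "k = n \<and> i = 1 \<and> z n 1 = - M")
    case True
    moreover have "z (Suc n) (Suc n) = 0" using z by (auto simp: base_def)
    ultimately have "V k i z = V (Suc k) (Suc n) z" using assms(1) by (simp add: V_def algebra_simps)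
    moreover have "Suc n \<in> {1..Suc k}" using True by auto
    ultimately show ?thesis using gcoef_zero by blast
  next
    case False then show ?thesis using z b by (auto simp: unit_def)
  qed
  show "z + unit k i (-1) \<in> {z\<in>base. z n 1 \<le> - M} \<or> gcoef 1 k (k - 1) i z = 0"
    using z b by (auto simp: unit_def)
qed

text \<open>The increment along a column between consecutive rows. As \<open>base\<close> freezes
  row \<open>n + 1\<close> at offset zero, the increments determine the array.\<close>

definition dd :: "nat \<Rightarrow> nat \<Rightarrow> latt \<Rightarrow> int" where "dd k x z = z k x - z (k - 1) x"

lemma base_telescope:
  assumes z: "z \<in> base" and a: "k \<le> Suc n"
  shows "z k a = - (\<Sum>j\<in>{k<..Suc n}. dd j a z)"
  using a
proof (induction k rule: inc_induct)
  case base then show ?case using z by (auto simp: base_def)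
next
  case (step k)
  have "{k<..Suc n} = insert (Suc k) {Suc k<..Suc n}" using step by auto
  then show ?case using step by (simp add: dd_def)
qed

lemma zd_dd:
  assumes z: "z \<in> base" and a: "a \<in> {1..Suc n}"
  shows "zd a z = (\<Sum>x\<in>{1..<a}. dd a x z) - (\<Sum>k\<in>{a<..Suc n}. dd k a z)"
proof -
  obtain b where b: "a = Suc b" using a by (cases a) auto
  have "zd a z = z a a + (\<Sum>x\<in>{1..<a}. dd a x z)"
    by (simp add: zd_def b dd_def sum_subtractf atLeastLessThanSuc_atLeastAtMost)
  then show ?thesis using base_telescope[OF z, of a a] a by simp
qed

end

section \<open>Truncated Gelfand--Tsetlin modules\<close>

text \<open>The twist is conjugation by a signed permutation matrix: the signs at the summation
  index square to one and the permutation reindexes the matrix product, so brackets are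
  respected.\<close>

lemma lie_module_signed_permutation:
  assumes "lie_module n sc \<rho>" and perm: "\<pi> permutes {1..Suc n}" and sg: "\<And>a. sg a * sg a = 1"
  shows "lie_module n sc (\<lambda>B. \<rho> (\<lambda>a b. sg a * sg b * B (\<pi> a) (\<pi> b)))"
proof -
  define \<psi> where "\<psi> = (\<lambda>(B::mat) a b. sg a * sg b * B (\<pi> a) (\<pi> b))"
  interpret sl_module sc n \<rho>
    using assms(1) by (simp add: sl_module_def sl_module_axioms_def lie_module_def)
  have reindex: "(\<Sum>a=1..Suc n. g (\<pi> a)) = (\<Sum>a=1..Suc n. g a)" for g :: "nat \<Rightarrow> complex"
    using sum.permute[OF perm, of g] by (simp add: comp_def)
  have sl: "\<psi> B \<in> sl n" if B: "B \<in> sl n" for B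
  proof -
    have gl: "in_gl n B" using B by (simp add: sl_def)
    have "in_gl n (\<psi> B)"
      unfolding in_gl_def \<psi>_def
    proof (intro allI impI)
      fix a b assume "a \<notin> {1..Suc n} \<or> b \<notin> {1..Suc n}"
      then have "\<pi> a \<notin> {1..Suc n} \<or> \<pi> b \<notin> {1..Suc n}" using permutes_in_image[OF perm] by simp
      then show "sg a * sg b * B (\<pi> a) (\<pi> b) = 0" using gl by (auto simp: in_gl_def)
    qed
    moreover have "(\<Sum>a=1..Suc n. \<psi> B a a) = (\<Sum>a=1..Suc n. B (\<pi> a) (\<pi> a))"
      unfolding \<psi>_def by (intro sum.cong) (simp_all add: sg)
    then have "(\<Sum>a=1..Suc n. \<psi> B a a) = 0" using reindex[of "\<lambda>a. B a a"] B by (simp only: sl_def mem_Collect_eq)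
    ultimately show ?thesis by (simp only: sl_def mem_Collect_eq simp_thms)
  qed
  have mm: "mmul n (\<psi> A) (\<psi> B) = \<psi> (mmul n A B)" for A B
  proof (intro ext)
    fix a b
    have "mmul n (\<psi> A) (\<psi> B) a b = (\<Sum>c=1..Suc n. sg a * sg b * (A (\<pi> a) (\<pi> c) * B (\<pi> c) (\<pi> b)))"
      unfolding mmul_def \<psi>_def
    proof (intro sum.cong refl)
      fix c
      have "sg a * sg c * A (\<pi> a) (\<pi> c) * (sg c * sg b * B (\<pi> c) (\<pi> b)) = (sg c * sg c) * (sg a * sg b * (A (\<pi> a) (\<pi> c) * B (\<pi> c) (\<pi> b)))"
        by (simp add: algebra_simps)
      then show "sg a * sg c * A (\<pi> a) (\<pi> c) * (sg c * sg b * B (\<pi> c) (\<pi> b)) = sg a * sg b * (A (\<pi> a) (\<pi> c) * B (\<pi> c) (\<pi> b))"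
        by (simp add: sg)
    qed
    also have "\<dots> = sg a * sg b * (\<Sum>c=1..Suc n. A (\<pi> a) c * B c (\<pi> b))"
      unfolding sum_distrib_left[symmetric] using reindex[of "\<lambda>c. A (\<pi> a) c * B c (\<pi> b)"] by simp
    finally show "mmul n (\<psi> A) (\<psi> B) a b = \<psi> (mmul n A B) a b" by (simp add: \<psi>_def mmul_def)
  qed
  have br: "\<psi> (brk n A B) = brk n (\<psi> A) (\<psi> B)" for A B
    unfolding brk_def mm by (auto simp: \<psi>_def algebra_simps fun_eq_iff)
  have add: "\<psi> (\<lambda>a b. A a b + B a b) = (\<lambda>a b. \<psi> A a b + \<psi> B a b)"
    and scale: "\<psi> (\<lambda>a b. c * A a b) = (\<lambda>a b. c * \<psi> A a b)" for A B c
    by (auto simp: \<psi>_def algebra_simps fun_eq_iff)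
  have "\<forall>A\<in>sl n. Vector_Spaces.linear sc sc (\<rho> (\<psi> A))" using lin sl by blast
  moreover have "\<forall>A\<in>sl n. \<forall>B\<in>sl n. \<forall>x. \<rho> (\<lambda>a b. \<psi> A a b + \<psi> B a b) x = \<rho> (\<psi> A) x + \<rho> (\<psi> B) x"
    using rho_add_left sl by blast
  moreover have "\<forall>A\<in>sl n. \<forall>c x. \<rho> (\<lambda>a b. c * \<psi> A a b) x = sc c (\<rho> (\<psi> A) x)"
    using rho_scale_left sl by blast
  moreover have "\<forall>A\<in>sl n. \<forall>B\<in>sl n. \<forall>x. \<rho> (brk n (\<psi> A) (\<psi> B)) x = \<rho> (\<psi> A) (\<rho> (\<psi> B) x) - \<rho> (\<psi> B) (\<rho> (\<psi> A) x)"
  proof (intro ballI allI)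
    fix A B x assume "A \<in> sl n" "B \<in> sl n"
    from rho_brk[OF sl[OF this(1)] sl[OF this(2)], of x]
    show "\<rho> (brk n (\<psi> A) (\<psi> B)) x = \<rho> (\<psi> A) (\<rho> (\<psi> B) x) - \<rho> (\<psi> B) (\<rho> (\<psi> A) x)"
      by (simp only: add_diff_cancel_left')
  qed
  ultimately have "lie_module n sc (\<lambda>B. \<rho> (\<psi> B))"
    unfolding lie_module_def br add scale using vector_space_axioms by blast
  then show ?thesis by (simp add: \<psi>_def)
qed

definition pairs :: "nat \<Rightarrow> (nat \<times> nat) set" where
  "pairs n = {(x,k). 1 \<le> x \<and> x < k \<and> k \<le> Suc n}"

lemma finite_pairs [simp]: "finite (pairs n)"
  by (rule finite_subset[of _ "{1..Suc n} \<times> {1..Suc n}"]) (auto simp: pairs_def)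

lemma sum_pairs_incidence:
  fixes g :: "nat \<times> nat \<Rightarrow> int"
  assumes "a \<in> {1..Suc n}"
  shows "(\<Sum>p\<in>pairs n. g p * ((if snd p = a then 1 else 0) - (if fst p = a then 1 else 0)))
    = (\<Sum>x\<in>{1..<a}. g (x,a)) - (\<Sum>k\<in>{a<..Suc n}. g (a,k))"
proof -
  have "(\<Sum>p\<in>pairs n. g p * ((if snd p = a then 1 else 0) - (if fst p = a then 1 else 0)))
    = (\<Sum>p\<in>pairs n. if snd p = a then g p else 0) - (\<Sum>p\<in>pairs n. if fst p = a then g p else 0)"
    unfolding sum_subtractf[symmetric] by (rule sum.cong) auto
  also have "(\<Sum>p\<in>pairs n. if snd p = a then g p else 0) = (\<Sum>p\<in>{p\<in>pairs n. snd p = a}. g p)"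
    by (simp add: sum.inter_filter)
  also have "{p\<in>pairs n. snd p = a} = (\<lambda>x. (x,a)) ` {1..<a}" using assms by (auto simp: pairs_def)
  also have "(\<Sum>p\<in>(\<lambda>x. (x,a)) ` {1..<a}. g p) = (\<Sum>x\<in>{1..<a}. g (x,a))"
    by (subst sum.reindex) (auto simp: inj_on_def)
  also have "(\<Sum>p\<in>pairs n. if fst p = a then g p else 0) = (\<Sum>p\<in>{p\<in>pairs n. fst p = a}. g p)"
    by (simp add: sum.inter_filter)
  also have "{p\<in>pairs n. fst p = a} = (\<lambda>k. (a,k)) ` {a<..Suc n}" using assms by (auto simp: pairs_def)
  also have "(\<Sum>p\<in>(\<lambda>k. (a,k)) ` {a<..Suc n}. g p) = (\<Sum>k\<in>{a<..Suc n}. g (a,k))"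
    by (subst sum.reindex) (auto simp: inj_on_def)
  finally show ?thesis .
qed

text \<open>The array offsets of the highest weight vector for the order of the indices given by \<open>\<pi>\<close>.\<close>
definition zmin :: "nat \<Rightarrow> (nat \<Rightarrow> nat) \<Rightarrow> latt" where
  "zmin n \<pi> = (\<lambda>k x. if 1 \<le> x \<and> x \<le> k \<and> k \<le> n then \<Sum>j\<in>{k<..Suc n}. if \<pi> x < \<pi> j then 0 else 1 else 0)"

lemma zmin_sum:
  assumes "1 \<le> x" "x \<le> k" "k \<le> Suc n"
  shows "zmin n \<pi> k x = (\<Sum>j\<in>{k<..Suc n}. if \<pi> x < \<pi> j then 0 else 1)"
  using assms by (cases "k = Suc n") (auto simp: zmin_def)

lemma zmin_step:
  assumes "(x,k) \<in> pairs n"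
  shows "zmin n \<pi> k x - zmin n \<pi> (k - 1) x = (if \<pi> x < \<pi> k then 0 else -1)"
proof -
  have "{k - 1<..Suc n} = insert k {k<..Suc n}" using assms by (auto simp: pairs_def)
  then show ?thesis using assms by (subst (1 2) zmin_sum) (auto simp: pairs_def)
qed

definition pt :: "'z \<Rightarrow> 'z \<Rightarrow> complex" where "pt z = (\<lambda>w. if w = z then 1 else 0)"

text \<open>Column \<open>x\<close> carries the rho-shifted coordinate of \<open>lam\<close> with
  index \<open>\<pi> x\<close>, up to a common constant. \<open>Ex\<close> is a further invariant
  set to be removed: the integral set in the block argument, empty for the tame basis.\<close>

locale gt_perm = gt_generic n t for n t +
  fixes \<pi> :: "nat \<Rightarrow> nat" and sg :: "nat \<Rightarrow> complex" and Ex :: "latt set" and lam :: weight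
  assumes perm: "\<pi> permutes {1..Suc n}" and sg: "\<And>a. sg a * sg a = 1"
    and Ex: "gclosed Ex" "zmin n \<pi> \<notin> Ex"
    and lam: "\<And>i. i \<in> {1..n} \<Longrightarrow> t (inv \<pi> i) - t (inv \<pi> (Suc i)) = lam i + 1"
begin

abbreviation up :: "nat \<times> nat \<Rightarrow> bool" where "up p \<equiv> \<pi> (fst p) < \<pi> (snd p)"

definition Adom :: "latt set" where
  "Adom = base \<inter> (\<Inter>p\<in>{p\<in>pairs n. up p}. above (fst p) (snd p))"
definition Bdom :: "latt set" where
  "Bdom = (\<Union>p\<in>{p\<in>pairs n. \<not> up p}. above (fst p) (snd p)) \<union> Ex"
text \<open>For each pair \<open>x < k\<close>, the increment of column \<open>x\<close> from row
  \<open>k - 1\<close> to row \<open>k\<close> is nonnegative or negative according to the order of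
  \<open>\<pi> x\<close> and \<open>\<pi> k\<close>. Apart from \<open>Ex\<close>, the increments
  are otherwise unrestricted: one natural number for each positive root, as in the character of a
  Verma module.\<close>

definition S :: "latt set" where "S = Adom - Bdom"

lemma gclosed_dom: "gclosed Adom" "gclosed Bdom"
  unfolding Adom_def Bdom_def
  by (intro gclosed_Int gclosed_base gclosed_INT gclosed_above gclosed_Un gclosed_UN Ex; auto simp: pairs_def)+

definition pr :: "(latt \<Rightarrow> complex) \<Rightarrow> latt \<Rightarrow> complex" where
  "pr f = (\<lambda>z. if z \<in> S then f z else 0)"

definition tr :: "endo \<Rightarrow> (latt \<Rightarrow> complex) \<Rightarrow> latt \<Rightarrow> complex" where
  "tr Y f = pr (app Y (pr f))"

lemma pr_simps: "pr (f + g) = pr f + pr g" "pr (f - g) = pr f - pr g" "pr (fsc c f) = fsc c (pr f)"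
  "pr 0 = 0" "pr (pr f) = pr f"
  by (auto simp: pr_def fsc_def fun_eq_iff)

lemma app_fsc: "app Y (fsc c f) = fsc c (app Y f)"
  by (simp add: fsc_def app_simps)

text \<open>\<open>S\<close> is a difference of two sets that the operators cannot leave, so no path of operators
  starting and ending in \<open>S\<close> passes through its complement, and truncation is multiplicative.\<close>
lemma tr_mult:
  assumes Y: "preserves Bdom Y" and Z: "preserves Adom Z"
  shows "tr Y (tr Z f) = tr (Y * Z) f"
proof -
  define \<psi> where "\<psi> = app Z (pr f)"
  have "supp_in Adom (pr f)" by (auto simp: supp_in_def pr_def S_def)
  then have "supp_in Adom \<psi>" using Z by (simp add: preserves_def \<psi>_def)
  then have "supp_in Bdom (\<psi> - pr \<psi>)" by (auto simp: supp_in_def pr_def S_def)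
  then have "supp_in Bdom (app Y (\<psi> - pr \<psi>))" using Y by (simp add: preserves_def)
  then have "pr (app Y (\<psi> - pr \<psi>)) = 0" by (auto simp: supp_in_def pr_def S_def fun_eq_iff)
  moreover have "app Y \<psi> = app Y (\<psi> - pr \<psi>) + app Y (pr \<psi>)"
    using app_simps(6)[of Y "\<psi> - pr \<psi>" "pr \<psi>"] by simp
  ultimately have "pr (app Y \<psi>) = pr (app Y (pr \<psi>))" by (simp add: pr_simps)
  then show ?thesis by (simp add: tr_def app_simps \<psi>_def pr_simps)
qed

definition rep :: "mat \<Rightarrow> (latt \<Rightarrow> complex) \<Rightarrow> latt \<Rightarrow> complex" where
  "rep = (\<lambda>A f. \<Sum>a=1..Suc n. \<Sum>b=1..Suc n. fsc (A a b) (tr (X a b) f))"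

lemma lie_module_rep: "lie_module n fsc rep"
  unfolding rep_def
proof (rule gl_family_lie_module[OF vector_space_fsc])
  show "Vector_Spaces.linear fsc fsc (tr (X a b))" for a b
    unfolding Vector_Spaces.linear_iff using vector_space_fsc
    by (auto simp: tr_def pr_simps app_simps app_fsc)
  fix a b c d f assume ab: "a \<in> {1..Suc n}" "b \<in> {1..Suc n}" and cd: "c \<in> {1..Suc n}" "d \<in> {1..Suc n}"
  note P = preserves_X[OF gclosed_dom(1)] preserves_X[OF gclosed_dom(2)]
  have "tr (X a b) (tr (X c d) f) - tr (X c d) (tr (X a b) f) = tr (comm (X a b) (X c d)) f"
    using ab cd by (simp add: tr_mult P) (simp add: tr_def comm_def app_simps pr_simps)
  also have "\<dots> = (if b = c then tr (X a d) f else 0) - (if d = a then tr (X c b) f else 0)"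
    unfolding X_gl[OF ab cd] by (auto simp: tr_def app_simps pr_simps)
  finally show "tr (X a b) (tr (X c d) f) - tr (X c d) (tr (X a b) f) = (if b = c then tr (X a d) f else 0) - (if d = a then tr (X c b) f else 0)" .
qed

text \<open>In \<open>rep\<close> the vector at \<open>zm\<close> is of highest weight for the order
  of the indices given by \<open>\<pi>\<close>. The twist carries that order to the standard one, so
  \<open>srep\<close> can be compared with \<open>\<rho>\<close>.\<close>

definition srep :: "mat \<Rightarrow> (latt \<Rightarrow> complex) \<Rightarrow> latt \<Rightarrow> complex" where
  "srep B = rep (\<lambda>a b. sg a * sg b * B (\<pi> a) (\<pi> b))"

lemma lie_module_srep: "lie_module n fsc srep"
  using lie_module_signed_permutation[OF lie_module_rep perm sg] by (simp add: srep_def[abs_def])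

lemma rep_Emat:
  assumes "c \<in> {1..Suc n}" "d \<in> {1..Suc n}"
  shows "rep (\<lambda>a b. u * Emat c d a b) f = fsc u (tr (X c d) f)"
proof -
  have "rep (\<lambda>a b. u * Emat c d a b) f = (\<Sum>a=1..Suc n. \<Sum>b=1..Suc n. if b = d then (if a = c then fsc u (tr (X c d) f) else 0) else 0)"
    unfolding rep_def by (intro sum.cong refl) (auto simp: Emat_def fsc_def fun_eq_iff)
  then show ?thesis using assms by (simp only: sum.delta finite_atLeastAtMost if_True)
qed

lemma rep_diag:
  assumes H: "\<And>a b. a \<noteq> b \<Longrightarrow> H a b = 0" and z: "z \<in> S"
  shows "rep H (pt z) = fsc (\<Sum>a=1..Suc n. H a a * dcoef a z) (pt z)"
proof -
  have "rep H (pt z) = (\<Sum>a=1..Suc n. \<Sum>b=1..Suc n. if b = a then fsc (H a a) (tr (X a a) (pt z)) else 0)"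
    unfolding rep_def by (intro sum.cong refl) (auto simp: H fsc_def fun_eq_iff)
  also have "\<dots> = (\<Sum>a=1..Suc n. fsc (H a a) (tr (X a a) (pt z)))"
    by (intro sum.cong refl) (simp only: sum.delta finite_atLeastAtMost if_True)
  also have "\<dots> = (\<Sum>a=1..Suc n. fsc (H a a * dcoef a z) (pt z))"
  proof (intro sum.cong refl ext)
    fix a w
    show "fsc (H a a) (tr (X a a) (pt z)) w = fsc (H a a * dcoef a z) (pt z) w"
      using z by (auto simp: tr_def pr_def pt_def X_D app_gD fsc_def)
  qed
  also have "\<dots> = fsc (\<Sum>a=1..Suc n. H a a * dcoef a z) (pt z)"
  proof -
    interpret v: vector_space "fsc :: complex \<Rightarrow> (latt \<Rightarrow> complex) \<Rightarrow> _" by (rule vector_space_fsc)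
    show ?thesis by (rule v.scale_sum_left[symmetric])
  qed
  finally show ?thesis .
qed

abbreviation "zm \<equiv> zmin n \<pi>"

lemma zm_S: "zm \<in> S"
proof -
  have "zm \<in> base" by (auto simp: base_def zmin_def)
  moreover have "zm \<in> above (fst p) (snd p) \<longleftrightarrow> up p" if "p \<in> pairs n" for p
    using zmin_step[of "fst p" "snd p" n \<pi>] that by (auto simp: above_def split: if_splits)
  ultimately show ?thesis using Ex by (auto simp: S_def Adom_def Bdom_def)
qed

definition Sw :: "(nat \<Rightarrow> int) \<Rightarrow> latt set" where
  "Sw \<mu> = {z\<in>S. \<forall>a\<in>{1..Suc n}. zd a z = zd a zm + \<mu> (\<pi> a)}"

lemma inv_in: "a \<in> {1..Suc n} \<Longrightarrow> inv \<pi> a \<in> {1..Suc n}"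
  using permutes_in_image[OF permutes_inv[OF perm]] by blast

lemma pi_in: "a \<in> {1..Suc n} \<Longrightarrow> \<pi> a \<in> {1..Suc n}"
  using permutes_in_image[OF perm] by blast

lemma pi_inv: "\<pi> (inv \<pi> a) = a" "inv \<pi> (\<pi> a) = a"
  using permutes_inverses[OF perm] by simp_all

lemma srep_Emat:
  assumes "a \<in> {1..Suc n}" "b \<in> {1..Suc n}"
  shows "srep (Emat a b) f = fsc (sg (inv \<pi> a) * sg (inv \<pi> b)) (tr (X (inv \<pi> a) (inv \<pi> b)) f)"
proof -
  have "(\<lambda>x y. sg x * sg y * Emat a b (\<pi> x) (\<pi> y)) = (\<lambda>x y. sg (inv \<pi> a) * sg (inv \<pi> b) * Emat (inv \<pi> a) (inv \<pi> b) x y)"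
    by (auto simp: Emat_def fun_eq_iff pi_inv)
  then show ?thesis unfolding srep_def using rep_Emat[OF inv_in[OF assms(1)] inv_in[OF assms(2)]] by simp
qed

lemma srep_Emat_wt:
  assumes ab: "a \<in> {1..Suc n}" "b \<in> {1..Suc n}" and f: "supp_in (Sw \<mu>) f"
  shows "supp_in (Sw (\<lambda>c. letter_wt (a,b) c + \<mu> c)) (srep (Emat a b) f)"
proof -
  let ?c = "inv \<pi> a" let ?d = "inv \<pi> b"
  have "pr f = f" using f by (auto simp: pr_def supp_in_def Sw_def fun_eq_iff)
  moreover have "wsupp (\<lambda>x. zd x zm + \<mu> (\<pi> x)) f" using f by (auto simp: wsupp_def supp_in_def Sw_def)
  ultimately have "wsupp (\<lambda>x. zd x zm + \<mu> (\<pi> x) + (if x = ?c then 1 else 0) - (if x = ?d then 1 else 0)) (app (X ?c ?d) (pr f))"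
    using wsupp_X[OF inv_in[OF ab(1)] inv_in[OF ab(2)]] by simp
  moreover have "x = ?c \<longleftrightarrow> a = \<pi> x" "x = ?d \<longleftrightarrow> b = \<pi> x" for x using pi_inv by metis+
  ultimately have "supp_in (Sw (\<lambda>c. letter_wt (a,b) c + \<mu> c)) (tr (X ?c ?d) f)"
    by (auto simp: supp_in_def Sw_def tr_def pr_def wsupp_def letter_wt_def)
  then show ?thesis unfolding srep_Emat[OF ab] by (auto simp: supp_in_def fsc_def)
qed

lemma act_word_supp:
  "set w \<subseteq> neg_letters n \<Longrightarrow> supp_in (Sw (mset_wt (mset w))) (act_word srep w (pt zm))"
proof (induction w)
  case Nil
  then show ?case using zm_S by (auto simp: supp_in_def Sw_def pt_def)
next
  case (Cons y w)
  obtain a b where y: "y = (a,b)" by force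
  have "a \<in> {1..Suc n}" "b \<in> {1..Suc n}" "bas y = Emat a b"
    using Cons.prems by (auto simp: y neg_letters_def bas_def)
  then show ?case using srep_Emat_wt[of a b] Cons by (simp add: y)
qed

text \<open>Coordinates on \<open>S\<close>: \<open>lt\<close> attaches a negative root to each pair
  and \<open>mm\<close> its multiplicity. A negative increment is at most \<open>-1\<close>, whence
  the correction by one in \<open>mm\<close>. The multiset \<open>\<Phi> z\<close> is thus a Kostant
  partition of the weight of \<open>z\<close> relative to \<open>zm\<close>.\<close>

definition lt :: "nat \<times> nat \<Rightarrow> nat \<times> nat" where
  "lt p = (if up p then (\<pi> (snd p), \<pi> (fst p)) else (\<pi> (fst p), \<pi> (snd p)))"
definition mm :: "nat \<times> nat \<Rightarrow> latt \<Rightarrow> nat" where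
  "mm p z = nat (if up p then dd (snd p) (fst p) z else - dd (snd p) (fst p) z - 1)"
definition \<Phi> :: "latt \<Rightarrow> (nat \<times> nat) multiset" where
  "\<Phi> z = (\<Sum>p\<in>pairs n. replicate_mset (mm p z) (lt p))"

lemma pi_eq: "\<pi> a = \<pi> b \<longleftrightarrow> a = b"
  using permutes_inj[OF perm] by (auto dest: injD)

lemma lt_neg: "p \<in> pairs n \<Longrightarrow> lt p \<in> neg_letters n"
  using pi_in[of "fst p"] pi_in[of "snd p"] pi_eq[of "fst p" "snd p"]
  by (auto simp: lt_def neg_letters_def pairs_def)

lemma lt_inj: "inj_on lt (pairs n)"
  by (rule inj_onI) (auto simp: lt_def pairs_def pi_eq split: if_splits)

lemma set_Phi: "set_mset (\<Phi> z) \<subseteq> neg_letters n"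
  using lt_neg by (auto simp: \<Phi>_def set_mset_sum split: if_splits)

lemma count_Phi: "p \<in> pairs n \<Longrightarrow> count (\<Phi> z) (lt p) = mm p z"
proof -
  assume p: "p \<in> pairs n"
  have "count (\<Phi> z) (lt p) = (\<Sum>q\<in>pairs n. if q = p then mm p z else 0)"
    unfolding \<Phi>_def count_sum using p lt_inj by (intro sum.cong) (auto dest: inj_onD)
  then show ?thesis using p by simp
qed

lemma S_dd:
  assumes z: "z \<in> S" and p: "p \<in> pairs n"
  shows "int (mm p z) = (if up p then dd (snd p) (fst p) z else - dd (snd p) (fst p) z - 1)"
proof -
  have "up p \<Longrightarrow> z \<in> above (fst p) (snd p)" "\<not> up p \<Longrightarrow> z \<notin> above (fst p) (snd p)"
    using z p by (cases p; force simp: S_def Adom_def Bdom_def)+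
  then show ?thesis by (cases "up p") (simp_all add: mm_def above_def dd_def)
qed

lemma Phi_inj: "inj_on \<Phi> S"
proof (rule inj_onI)
  fix z z' assume z: "z \<in> S" "z' \<in> S" "\<Phi> z = \<Phi> z'"
  have b: "z \<in> base" "z' \<in> base" using z by (auto simp: S_def Adom_def)
  have d: "dd k x z = dd k x z'" if "(x,k) \<in> pairs n" for x k
  proof -
    have "mm (x,k) z = mm (x,k) z'" using count_Phi[OF that, of z] count_Phi[OF that, of z'] z(3) by simp
    then show ?thesis using S_dd[OF z(1) that] S_dd[OF z(2) that] by (auto split: if_splits)
  qed
  show "z = z'"
  proof (intro ext)
    fix k x
    show "z k x = z' k x"
    proof (cases "1 \<le> x \<and> x \<le> k \<and> k \<le> n")
      case True
      then have "z k x = - (\<Sum>j\<in>{k<..Suc n}. dd j x z)" "z' k x = - (\<Sum>j\<in>{k<..Suc n}. dd j x z')"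
        using base_telescope[OF b(1)] base_telescope[OF b(2)] by auto
      moreover have "(\<Sum>j\<in>{k<..Suc n}. dd j x z) = (\<Sum>j\<in>{k<..Suc n}. dd j x z')"
        using True by (intro sum.cong d) (auto simp: pairs_def)
      ultimately show ?thesis by simp
    next
      case False then show ?thesis using b by (auto simp: base_def)
    qed
  qed
qed

lemma mset_wt_sum: "mset_wt (\<Sum>p\<in>I. f p) c = (\<Sum>p\<in>I. mset_wt (f p) c)"
  by (induction I rule: infinite_finite_induct) simp_all

lemma mset_wt_replicate: "mset_wt (replicate_mset m l) c = int m * letter_wt l c"
  by (simp add: mset_wt_def)

lemma zm_dd: "p \<in> pairs n \<Longrightarrow> dd (snd p) (fst p) zm = (if up p then 0 else -1)"
  using zmin_step[of "fst p" "snd p" n \<pi>] by (simp add: dd_def)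

lemma Phi_wt:
  assumes z: "z \<in> S" and a: "a \<in> {1..Suc n}"
  shows "mset_wt (\<Phi> z) (\<pi> a) = zd a z - zd a zm"
proof -
  let ?g = "\<lambda>p. dd (snd p) (fst p) z - dd (snd p) (fst p) zm"
  have b: "z \<in> base" "zm \<in> base" using z zm_S by (auto simp: S_def Adom_def)
  have "mset_wt (\<Phi> z) (\<pi> a) = (\<Sum>p\<in>pairs n. ?g p * ((if snd p = a then 1 else 0) - (if fst p = a then 1 else 0)))"
    unfolding \<Phi>_def mset_wt_sum mset_wt_replicate
  proof (rule sum.cong[OF refl])
    fix p assume p: "p \<in> pairs n"
    show "int (mm p z) * letter_wt (lt p) (\<pi> a) = ?g p * ((if snd p = a then 1 else 0) - (if fst p = a then 1 else 0))"
      unfolding S_dd[OF z p] zm_dd[OF p] by (auto simp: lt_def letter_wt_def pi_eq)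
  qed
  also have "\<dots> = (\<Sum>x\<in>{1..<a}. ?g (x,a)) - (\<Sum>k\<in>{a<..Suc n}. ?g (a,k))" by (rule sum_pairs_incidence[OF a])
  also have "\<dots> = zd a z - zd a zm" using zd_dd[OF b(1) a] zd_dd[OF b(2) a] by (simp add: sum_subtractf)
  finally show ?thesis .
qed

lemma Sw_Phi: "z \<in> Sw \<mu> \<Longrightarrow> c \<in> {1..Suc n} \<Longrightarrow> mset_wt (\<Phi> z) c = \<mu> c"
  using Phi_wt[of z "inv \<pi> c"] inv_in[of c] by (auto simp: Sw_def pi_inv)

end

lemma mset_wt_outside:
  assumes "set_mset m \<subseteq> neg_letters n" "c \<notin> {1..Suc n}"
  shows "mset_wt m c = 0"
  using assms(1)
proof (induction m)
  case (add x m)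
  then have "letter_wt x c = 0" using assms(2) by (auto simp: letter_wt_def neg_letters_def)
  then show ?case using add by simp
qed simp

text \<open>The height of a weight in epsilon coordinates, with the sign for which a lowering letter
  \<open>(a,b)\<close> has positive height \<open>a - b\<close>.\<close>

definition ht :: "nat \<Rightarrow> (nat \<Rightarrow> int) \<Rightarrow> int" where
  "ht n \<mu> = (\<Sum>c=1..Suc n. int c * \<mu> c)"

lemma ht_letter: "(a,b) \<in> sl_letters n \<Longrightarrow> ht n (letter_wt (a,b)) = int a - int b"
proof -
  assume ab: "(a,b) \<in> sl_letters n"
  have "ht n (letter_wt (a,b)) = (\<Sum>c=1..Suc n. (if c = a then int a else 0) - (if c = b then int b else 0))"
    unfolding ht_def by (rule sum.cong) (auto simp: letter_wt_def)
  then show ?thesis using ab unfolding sum_subtractf by (simp only: sum.delta finite_atLeastAtMost) (auto simp: sl_letters_def)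
qed

lemma ht_add: "ht n (\<lambda>c. \<mu> c + \<nu> c) = ht n \<mu> + ht n \<nu>"
  by (simp only: ht_def distrib_left sum.distrib)

lemma ht_mset: "set_mset m \<subseteq> neg_letters n \<Longrightarrow> ht n (mset_wt m) \<ge> int (size m)"
proof (induction m)
  case empty then show ?case by (simp add: ht_def)
next
  case (add x m)
  obtain a b where x: "x = (a,b)" by force
  have "(a,b) \<in> sl_letters n" "a > b" using add.prems by (auto simp: x sl_letters_def neg_letters_def)
  then have "ht n (letter_wt x) \<ge> 1" using ht_letter[of a b n] by (simp add: x)
  then show ?case using add ht_add[of n "letter_wt x" "mset_wt m"] by simp
qed

lemma finite_msets_wt: "finite {m. set_mset m \<subseteq> neg_letters n \<and> mset_wt m = \<mu>}"
proof (rule finite_subset)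
  show "{m. set_mset m \<subseteq> neg_letters n \<and> mset_wt m = \<mu>} \<subseteq> (\<Union>k\<in>{..nat (ht n \<mu>)}. {m. set_mset m \<subseteq> neg_letters n \<and> size m = k})"
  proof
    fix m assume m: "m \<in> {m. set_mset m \<subseteq> neg_letters n \<and> mset_wt m = \<mu>}"
    then have "int (size m) \<le> ht n \<mu>" using ht_mset[of m n] by auto
    then show "m \<in> (\<Union>k\<in>{..nat (ht n \<mu>)}. {m. set_mset m \<subseteq> neg_letters n \<and> size m = k})" using m by auto
  qed
  show "finite (\<Union>k\<in>{..nat (ht n \<mu>)}. {m. set_mset m \<subseteq> neg_letters n \<and> size m = k})"
    by (intro finite_UN_I finite_multisets_of_size[unfolded multisets_of_size_def]) auto
qed

context gt_perm begin

text \<open>The indices with smaller \<open>\<pi>\<close>-value than \<open>a\<close> number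
  \<open>\<pi> a - 1\<close>. They split into those left of \<open>a\<close> and those right of
  \<open>a\<close>, and the increments of \<open>zm\<close> count inversions on either side.\<close>

lemma zm_zd: "a \<in> {1..Suc n} \<Longrightarrow> zd a zm = int (\<pi> a) - int a"
proof -
  assume a: "a \<in> {1..Suc n}"
  have b: "zm \<in> base" using zm_S by (auto simp: S_def Adom_def)
  let ?L = "{x\<in>{1..<a}. \<pi> x < \<pi> a}" let ?L' = "{x\<in>{1..<a}. \<not> \<pi> x < \<pi> a}"
  let ?R = "{k\<in>{a<..Suc n}. \<not> \<pi> a < \<pi> k}"
  have "(\<Sum>x\<in>{1..<a}. dd a x zm) = (\<Sum>x\<in>{1..<a}. if \<not> \<pi> x < \<pi> a then -1 else 0)"
    using a zm_dd[of "(_,a)"] by (intro sum.cong) (auto simp: pairs_def)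
  also have "\<dots> = - int (card ?L')" by (simp add: sum.inter_filter[symmetric])
  finally have 1: "(\<Sum>x\<in>{1..<a}. dd a x zm) = - int (card ?L')" .
  have "(\<Sum>k\<in>{a<..Suc n}. dd k a zm) = (\<Sum>k\<in>{a<..Suc n}. if \<not> \<pi> a < \<pi> k then -1 else 0)"
    using a zm_dd[of "(a,_)"] by (intro sum.cong) (auto simp: pairs_def)
  also have "\<dots> = - int (card ?R)" by (simp add: sum.inter_filter[symmetric])
  finally have 2: "(\<Sum>k\<in>{a<..Suc n}. dd k a zm) = - int (card ?R)" .
  have "{1..<a} = ?L \<union> ?L'" by auto
  then have "a - 1 = card (?L \<union> ?L')" by (metis card_atLeastLessThan)
  also have "\<dots> = card ?L + card ?L'" by (rule card_Un_disjoint) auto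
  finally have 3: "a - 1 = card ?L + card ?L'" .
  have "\<pi> ` (?L \<union> ?R) = {1..<\<pi> a}"
  proof
    show "\<pi> ` (?L \<union> ?R) \<subseteq> {1..<\<pi> a}"
    proof
      fix y assume "y \<in> \<pi> ` (?L \<union> ?R)"
      then obtain x where x: "y = \<pi> x" "x \<in> ?L \<union> ?R" by blast
      then have "x \<in> {1..Suc n}" "x \<noteq> a" using a by auto
      then have "\<pi> x \<ge> 1" "\<pi> x \<noteq> \<pi> a" using pi_in[of x] pi_eq by auto
      then show "y \<in> {1..<\<pi> a}" using x by auto
    qed
    show "{1..<\<pi> a} \<subseteq> \<pi> ` (?L \<union> ?R)"
    proof
      fix y assume y: "y \<in> {1..<\<pi> a}"
      then have "y \<in> {1..Suc n}" using pi_in[OF a] by auto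
      then have x: "inv \<pi> y \<in> {1..Suc n}" "\<pi> (inv \<pi> y) = y" using inv_in pi_inv by auto
      then have "inv \<pi> y \<noteq> a" using y by auto
      then have "inv \<pi> y \<in> ?L \<union> ?R" using x y by auto
      from imageI[OF this, of \<pi>] show "y \<in> \<pi> ` (?L \<union> ?R)" unfolding x(2) .
    qed
  qed
  then have "card (?L \<union> ?R) = \<pi> a - 1"
    using card_image[of \<pi> "?L \<union> ?R"] pi_eq by (auto simp: inj_on_def)
  moreover have "card (?L \<union> ?R) = card ?L + card ?R" by (rule card_Un_disjoint) auto
  moreover have "\<pi> a \<ge> 1" "a \<ge> 1" using pi_in[OF a] a by auto
  ultimately show ?thesis using zd_dd[OF b a] 1 2 3 by linarith
qed

text \<open>The offset \<open>\<pi> a - a\<close> of \<open>zm\<close> and the shift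
  \<open>a - 1\<close> in \<open>dcoef\<close> add up to \<open>\<pi> a - 1\<close>. Between
  neighbouring values of \<open>\<pi> a\<close> this differs by one, which cancels the rho shift in
  \<open>t\<close>.\<close>

lemma srep_hv_zm: "i \<in> {1..n} \<Longrightarrow> srep (hv i) (pt zm) = fsc (lam i) (pt zm)"
proof -
  assume i: "i \<in> {1..n}"
  let ?H = "\<lambda>a b. sg a * sg b * hv i (\<pi> a) (\<pi> b)"
  have dc: "dcoef (inv \<pi> b) zm = t (inv \<pi> b) + of_nat b - 1" if "b \<in> {1..Suc n}" for b
  proof -
    have "of_int (int b - int (inv \<pi> b)) = (of_nat b - of_nat (inv \<pi> b) :: complex)" by simp
    moreover have "of_nat (inv \<pi> b - 1) = (of_nat (inv \<pi> b) - 1 :: complex)" using inv_in[OF that] by (simp add: of_nat_diff)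
    ultimately show ?thesis using dcoef_zd[of "inv \<pi> b" zm] zm_zd[OF inv_in[OF that]] inv_in[OF that] by (simp add: pi_inv)
  qed
  have "srep (hv i) (pt zm) = fsc (\<Sum>a=1..Suc n. ?H a a * dcoef a zm) (pt zm)"
    unfolding srep_def by (rule rep_diag[OF _ zm_S]) (auto simp: hv_def pi_eq)
  also have "(\<Sum>a=1..Suc n. ?H a a * dcoef a zm) = (\<Sum>a=1..Suc n. hv i (\<pi> a) (\<pi> a) * dcoef (inv \<pi> (\<pi> a)) zm)"
    by (intro sum.cong) (simp_all add: sg pi_inv)
  also have "\<dots> = (\<Sum>b=1..Suc n. hv i b b * dcoef (inv \<pi> b) zm)"
    using sum.permute[OF perm, of "\<lambda>b. hv i b b * dcoef (inv \<pi> b) zm"] by (simp add: comp_def)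
  also have "\<dots> = (\<Sum>b=1..Suc n. (if b = i then dcoef (inv \<pi> i) zm else 0) - (if b = Suc i then dcoef (inv \<pi> (Suc i)) zm else 0))"
    by (intro sum.cong) (auto simp: hv_def)
  also have "\<dots> = dcoef (inv \<pi> i) zm - dcoef (inv \<pi> (Suc i)) zm"
    using i unfolding sum_subtractf by (simp only: sum.delta finite_atLeastAtMost) auto
  also have "\<dots> = lam i" using i dc[of i] dc[of "Suc i"] lam[OF i] by (simp add: algebra_simps)
  finally show ?thesis .
qed

text \<open>A raising operator would lead to an array in \<open>S\<close> whose multiset
  \<open>\<Phi> z\<close> has negative height, while multisets of lowering letters have nonnegative
  height.\<close>

theorem srep_hw_vector: "hw_vector n fsc srep lam (pt zm)"
  unfolding hw_vector_def
proof (intro conjI ballI impI)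
  show "pt zm \<noteq> 0" by (auto simp: pt_def fun_eq_iff)
  show "srep (hv i) (pt zm) = fsc (lam i) (pt zm)" if "i \<in> {1..n}" for i using srep_hv_zm[OF that] .
  fix a b assume ab: "a \<in> {1..Suc n}" "b \<in> {1..Suc n}" "a < b"
  have "supp_in (Sw (\<lambda>_. 0)) (pt zm)" using zm_S by (auto simp: supp_in_def Sw_def pt_def)
  from srep_Emat_wt[OF ab(1,2) this]
  have supp: "supp_in (Sw (letter_wt (a,b))) (srep (Emat a b) (pt zm))" by simp
  have "z \<notin> Sw (letter_wt (a,b))" for z
  proof
    assume z: "z \<in> Sw (letter_wt (a,b))"
    have "ht n (mset_wt (\<Phi> z)) = ht n (letter_wt (a,b))"
      unfolding ht_def using Sw_Phi[OF z] by (intro sum.cong) auto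
    moreover have "(a,b) \<in> sl_letters n" using ab by (auto simp: sl_letters_def)
    ultimately show False using ht_letter[of a b n] ht_mset[OF set_Phi, of z] ab by simp
  qed
  then show "srep (Emat a b) (pt zm) = 0" using supp by (auto simp: supp_in_def fun_eq_iff)
qed

end

section \<open>The Weyl group and admissible weights\<close>

lemma brk_scaled_Emat:
  assumes "r \<in> {1..Suc n}" "s \<in> {1..Suc n}"
  shows "brk n (\<lambda>a b. c * Emat r s a b) Y = (\<lambda>a b. c * ((if a = r then Y s b else 0) - (if b = s then Y a r else 0)))"
proof -
  have "mmul n (\<lambda>a b. c * Emat r s a b) Y = (\<lambda>a b. c * mmul n (Emat r s) Y a b)"
    "mmul n Y (\<lambda>a b. c * Emat r s a b) = (\<lambda>a b. c * mmul n Y (Emat r s) a b)"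
    by (simp_all only: mmul_def sum_distrib_left ac_simps)
  then show ?thesis
    unfolding brk_def by (simp only: mmul_Emat_left[OF assms(2)] mmul_Emat_right[OF assms(1)] right_diff_distrib)
qed

text \<open>The third power of the adjoint action of a matrix unit outside the diagonal is zero, so
  the exponential series stops after the quadratic term.\<close>

lemma exp_ad_scaled_Emat:
  assumes rs: "r \<in> {1..Suc n}" "s \<in> {1..Suc n}" "r \<noteq> s"
  shows "exp_ad n (\<lambda>a b. c * Emat r s a b) Y = (\<lambda>a b. Y a b + c * ((if a = r then Y s b else 0) - (if b = s then Y a r else 0))
     - c * c * (if a = r \<and> b = s then Y s r else 0))"
proof -
  let ?A = "ad n (\<lambda>a b. c * Emat r s a b)"
  have n: "n \<ge> 1" using rs by auto
  have A: "?A Y = (\<lambda>a b. c * ((if a = r then Y s b else 0) - (if b = s then Y a r else 0)))" for Y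
    unfolding ad_def by (rule brk_scaled_Emat[OF rs(1,2)])
  have A2: "?A (?A Y) = (\<lambda>a b. - 2 * c * c * (if a = r \<and> b = s then Y s r else 0))"
    unfolding A using rs(3) by (auto simp: fun_eq_iff)
  have A3: "?A (?A (?A Y)) = (\<lambda>a b. 0)" unfolding A2 unfolding A using rs(3) by (auto simp: fun_eq_iff)
  have z: "(?A ^^ m) Y = (\<lambda>a b. 0)" if "m \<ge> 3" for m
    using that
  proof (induction m rule: nat_induct_at_least)
    case base show ?case using A3 by (simp add: numeral_3_eq_3)
  next
    case (Suc m)
    have "(?A ^^ Suc m) Y = ?A ((?A ^^ m) Y)" by simp
    also have "\<dots> = (\<lambda>a b. 0)" unfolding Suc.IH A by simp
    finally show ?case .
  qed
  show ?thesis
  proof (intro ext)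
    fix a b
    have "exp_ad n (\<lambda>a b. c * Emat r s a b) Y a b = (\<Sum>m\<in>{..<2 * Suc n}. (?A ^^ m) Y a b / of_nat (fact m))"
      by (simp add: exp_ad_def)
    also have "\<dots> = (\<Sum>m\<in>{0,1,2}. (?A ^^ m) Y a b / of_nat (fact m))"
    proof (rule sum.mono_neutral_right)
      show "{0,1,2} \<subseteq> {..<2 * Suc n}" using n by auto
      show "\<forall>m\<in>{..<2 * Suc n} - {0,1,2}. (?A ^^ m) Y a b / of_nat (fact m) = 0"
      proof
        fix m assume "m \<in> {..<2 * Suc n} - {0,1,2::nat}"
        then have "m \<ge> 3" by auto
        then show "(?A ^^ m) Y a b / of_nat (fact m) = 0" by (simp add: z)
      qed
    qed simp
    also have "\<dots> = Y a b + ?A Y a b + ?A (?A Y) a b / 2" by (simp add: numeral_2_eq_2)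
    also have "\<dots> = Y a b + c * ((if a = r then Y s b else 0) - (if b = s then Y a r else 0))
     - c * c * (if a = r \<and> b = s then Y s r else 0)"
      unfolding A2 unfolding A by simp
    finally show "exp_ad n (\<lambda>a b. c * Emat r s a b) Y a b = \<dots>" .
  qed
qed

abbreviation tp :: "nat \<Rightarrow> nat \<Rightarrow> nat" where "tp i \<equiv> Transposition.transpose i (Suc i)"

text \<open>The generator is conjugation by a signed permutation matrix of the simple transposition;
  the composite of the three quadratic maps is evaluated entrywise.\<close>

lemma rW_apply:
  assumes i: "i \<in> {1..n}"
  shows "rW n i Y a b = (if a = i then -1 else 1) * (if b = i then -1 else 1) * Y (tp i a) (tp i b)"
proof -
  have r: "Suc i \<in> {1..Suc n}" "i \<in> {1..Suc n}" "Suc i \<noteq> i" "i \<noteq> Suc i" using i by auto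
  have f: "fv i = (\<lambda>a b. 1 * Emat (Suc i) i a b)" and e: "(\<lambda>a b. - ev i a b) = (\<lambda>a b. (-1) * Emat i (Suc i) a b)"
    by (simp_all add: fv_def ev_def)
  show ?thesis
    unfolding rW_def comp_def f e exp_ad_scaled_Emat[OF r(1,2,3)] exp_ad_scaled_Emat[OF r(2,1,4)]
    by (auto simp: Transposition.transpose_def)
qed

text \<open>Epsilon coordinates normalized by a zero in position \<open>n + 1\<close>. Reflections
  respect this normalization only up to a common constant, so statements about the Weyl group action
  are made for differences.\<close>

definition ecoord :: "nat \<Rightarrow> weight \<Rightarrow> nat \<Rightarrow> complex" where
  "ecoord n \<xi> a = (\<Sum>k=a..n. \<xi> k)"

lemma ecoord_step: "j \<in> {1..n} \<Longrightarrow> ecoord n \<xi> j - ecoord n \<xi> (Suc j) = \<xi> j"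
  by (simp add: ecoord_def sum.atLeast_Suc_atMost)

lemma ecoord_diff: "x \<le> y \<Longrightarrow> y \<le> Suc n \<Longrightarrow> ecoord n \<xi> x - ecoord n \<xi> y = (\<Sum>k=x..<y. \<xi> k)"
proof -
  assume xy: "x \<le> y" "y \<le> Suc n"
  have "{x..n} = {x..<y} \<union> {y..n}" using xy by auto
  then have "ecoord n \<xi> x = (\<Sum>k=x..<y. \<xi> k) + ecoord n \<xi> y"
    unfolding ecoord_def by (simp add: sum.union_disjoint ivl_disj_int)
  then show ?thesis by simp
qed

abbreviation rootvec :: "nat \<Rightarrow> nat \<Rightarrow> nat \<Rightarrow> complex" where
  "rootvec a b c \<equiv> (if c = a then 1 else 0) - (if c = b then 1 else 0)"

lemma ecoord_alpha:
  assumes "i \<in> {1..n}" "a \<in> {1..Suc n}"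
  shows "ecoord n (alpha n i) a = rootvec i (Suc i) a + (if i = n then 1 else 0)"
proof -
  have "a \<le> Suc n" "a \<ge> 1" using assms by auto
  then show ?thesis
  proof (induction a rule: inc_induct)
    case base then show ?case using assms by (auto simp: ecoord_def)
  next
    case (step a)
    then have "ecoord n (alpha n i) a = alpha n i a + ecoord n (alpha n i) (Suc a)"
      using ecoord_step[of a n "alpha n i"] by (simp add: algebra_simps)
    moreover have "alpha n i a = (if a = i then 2 else if a = Suc i \<or> i = Suc a then -1 else 0)"
      using step by (auto simp: alpha_def)
    ultimately show ?case using step assms by auto
  qed
qed

lemma ecoord_sref:
  assumes i: "i \<in> {1..n}" and a: "a \<in> {1..Suc n}"
  shows "ecoord n (sref n i \<xi>) (tp i a) = ecoord n \<xi> a - \<xi> i * (if i = n then 1 else 0)"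
proof -
  have ta: "tp i a \<in> {1..Suc n}" using i a by (auto simp: Transposition.transpose_def)
  have "ecoord n (sref n i \<xi>) (tp i a) = ecoord n \<xi> (tp i a) - \<xi> i * ecoord n (alpha n i) (tp i a)"
    by (simp add: ecoord_def sref_def sum_subtractf sum_distrib_left)
  also have "\<dots> = ecoord n \<xi> (tp i a) - \<xi> i * (rootvec i (Suc i) (tp i a) + (if i = n then 1 else 0))"
    by (simp only: ecoord_alpha[OF i ta])
  also have "\<dots> = ecoord n \<xi> a - \<xi> i * (if i = n then 1 else 0)"
    using ecoord_step[OF i, of \<xi>] by (auto simp: Transposition.transpose_def algebra_simps)
  finally show ?thesis .
qed

definition word_auto :: "nat \<Rightarrow> nat list \<Rightarrow> mat \<Rightarrow> mat" where
  "word_auto n w = foldr (\<lambda>i u. rW n i \<circ> u) w id"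

lemma word_auto_Wbar: "set w \<subseteq> {1..n} \<Longrightarrow> word_auto n w \<in> Wbar n"
  unfolding word_auto_def by (induction w) (auto intro: Wbar.intros)

text \<open>One permutation describes both the automorphism on matrix entries, together with signs,
  and the action of the word on weights. Both are built letter by letter from
  \<open>rW_apply\<close> and \<open>ecoord_sref\<close>.\<close>

lemma word_auto_permutation:
  assumes "set w \<subseteq> {1..n}"
  obtains \<pi> sg where "\<pi> permutes {1..Suc n}" "\<And>a. sg a * sg a = (1::complex)"
    "\<And>Y a b. word_auto n w Y (\<pi> a) (\<pi> b) = sg a * sg b * Y a b"
    "\<And>\<xi> a b. \<lbrakk>a \<in> {1..Suc n}; b \<in> {1..Suc n}\<rbrakk> \<Longrightarrow>
      ecoord n (wact n w \<xi>) (\<pi> a) - ecoord n (wact n w \<xi>) (\<pi> b) = ecoord n \<xi> a - ecoord n \<xi> b"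
proof -
  have "\<exists>\<pi> sg. \<pi> permutes {1..Suc n} \<and> (\<forall>a. sg a * sg a = (1::complex)) \<and>
    (\<forall>Y a b. word_auto n w Y (\<pi> a) (\<pi> b) = sg a * sg b * Y a b) \<and>
    (\<forall>\<xi> a b. a \<in> {1..Suc n} \<longrightarrow> b \<in> {1..Suc n} \<longrightarrow>
      ecoord n (wact n w \<xi>) (\<pi> a) - ecoord n (wact n w \<xi>) (\<pi> b) = ecoord n \<xi> a - ecoord n \<xi> b)"
    using assms
  proof (induction w)
    case Nil
    show ?case by (rule exI[of _ id], rule exI[of _ "\<lambda>_. 1"]) (auto simp: word_auto_def wact_def permutes_id[unfolded id_def])
  next
    case (Cons i w)
    then have "set w \<subseteq> {1..n}" by simp
    from Cons.IH[OF this] obtain \<pi> sg where P: "\<pi> permutes {1..Suc n} \<and> (\<forall>a. sg a * sg a = (1::complex)) \<and>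
      (\<forall>Y a b. word_auto n w Y (\<pi> a) (\<pi> b) = sg a * sg b * Y a b) \<and>
      (\<forall>\<xi> a b. a \<in> {1..Suc n} \<longrightarrow> b \<in> {1..Suc n} \<longrightarrow>
        ecoord n (wact n w \<xi>) (\<pi> a) - ecoord n (wact n w \<xi>) (\<pi> b) = ecoord n \<xi> a - ecoord n \<xi> b)"
      by (elim exE)
    have IH: "\<pi> permutes {1..Suc n}" "\<And>a. sg a * sg a = (1::complex)"
      "\<And>Y a b. word_auto n w Y (\<pi> a) (\<pi> b) = sg a * sg b * Y a b"
      "\<And>\<xi> a b. a \<in> {1..Suc n} \<Longrightarrow> b \<in> {1..Suc n} \<Longrightarrow>
        ecoord n (wact n w \<xi>) (\<pi> a) - ecoord n (wact n w \<xi>) (\<pi> b) = ecoord n \<xi> a - ecoord n \<xi> b"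
      using P by blast+
    have i: "i \<in> {1..n}" using Cons.prems by simp
    define \<pi>' where "\<pi>' = tp i \<circ> \<pi>"
    define sg' where "sg' a = (if \<pi>' a = i then -1 else 1) * sg a" for a
    have "tp i permutes {1..Suc n}" using i by (intro permutes_swap_id) auto
    then have p: "\<pi>' permutes {1..Suc n}" unfolding \<pi>'_def using IH(1) by (rule permutes_compose[rotated])
    have s: "sg' a * sg' a = 1" for a using IH(2)[of a] by (simp add: sg'_def)
    have u: "word_auto n (i # w) Y (\<pi>' a) (\<pi>' b) = sg' a * sg' b * Y a b" for Y a b
    proof -
      have "word_auto n (i # w) Y (\<pi>' a) (\<pi>' b) = rW n i (word_auto n w Y) (\<pi>' a) (\<pi>' b)"
        by (simp add: word_auto_def)
      also have "\<dots> = (if \<pi>' a = i then -1 else 1) * (if \<pi>' b = i then -1 else 1) * word_auto n w Y (\<pi> a) (\<pi> b)"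
        unfolding rW_apply[OF i] by (simp add: \<pi>'_def)
      finally show ?thesis by (simp add: IH(3) sg'_def)
    qed
    have e: "ecoord n (wact n (i # w) \<xi>) (\<pi>' a) - ecoord n (wact n (i # w) \<xi>) (\<pi>' b) = ecoord n \<xi> a - ecoord n \<xi> b"
      if ab: "a \<in> {1..Suc n}" "b \<in> {1..Suc n}" for \<xi> a b
    proof -
      have m: "\<pi> a \<in> {1..Suc n}" "\<pi> b \<in> {1..Suc n}" using ab permutes_in_image[OF IH(1)] by auto
      have w: "wact n (i # w) \<xi> = sref n i (wact n w \<xi>)" by (simp add: wact_def)
      show ?thesis unfolding w \<pi>'_def comp_def ecoord_sref[OF i m(1)] ecoord_sref[OF i m(2)]
        using IH(4)[OF ab, of \<xi>] by simp
    qed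
    show ?case using p s u e by blast
  qed
  then show thesis using that by blast
qed

lemma weval_ecoord: "weval n \<xi> H = (\<Sum>a=1..Suc n. H a a * ecoord n \<xi> a)"
proof -
  have "weval n \<xi> H = (\<Sum>k=1..n. \<Sum>a=1..Suc n. if a \<le> k then \<xi> k * H a a else 0)"
    unfolding weval_def sum_distrib_left
    by (intro sum.cong refl sum.mono_neutral_cong_left) auto
  also have "\<dots> = (\<Sum>a=1..Suc n. \<Sum>k=1..n. if a \<le> k then \<xi> k * H a a else 0)" by (rule sum.swap)
  also have "\<dots> = (\<Sum>a=1..Suc n. \<Sum>k=a..n. \<xi> k * H a a)"
    by (intro sum.cong refl sum.mono_neutral_cong_right) auto
  finally show ?thesis by (simp only: ecoord_def sum_distrib_left mult.commute)
qed

text \<open>The permuted coordinates agree up to the constant \<open>?K\<close>, which pairs with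
  the trace of \<open>H\<close> and disappears.\<close>

lemma maps_base_word_auto:
  assumes perm: "\<pi> permutes {1..Suc n}" and sg: "\<And>a. sg a * sg a = (1::complex)"
    and u: "\<And>Y a b. word_auto n w Y (\<pi> a) (\<pi> b) = sg a * sg b * Y a b"
    and e: "\<And>\<xi> a b. \<lbrakk>a \<in> {1..Suc n}; b \<in> {1..Suc n}\<rbrakk> \<Longrightarrow>
      ecoord n (wact n w \<xi>) (\<pi> a) - ecoord n (wact n w \<xi>) (\<pi> b) = ecoord n \<xi> a - ecoord n \<xi> b"
  shows "maps_base n (word_auto n w) w"
  unfolding maps_base_def
proof (intro ballI)
  fix i H assume "i \<in> {1..n}" and H: "H \<in> cartan n"
  let ?\<alpha> = "alpha n i"
  let ?K = "ecoord n (wact n w ?\<alpha>) (\<pi> 1) - ecoord n ?\<alpha> 1"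
  have "weval n (wact n w ?\<alpha>) (word_auto n w H) = (\<Sum>a=1..Suc n. word_auto n w H (\<pi> a) (\<pi> a) * ecoord n (wact n w ?\<alpha>) (\<pi> a))"
    unfolding weval_ecoord using sum.permute[OF perm, of "\<lambda>a. word_auto n w H a a * ecoord n (wact n w ?\<alpha>) a"] by (simp add: comp_def)
  also have "\<dots> = (\<Sum>a=1..Suc n. H a a * ecoord n ?\<alpha> a + H a a * ?K)"
  proof (rule sum.cong[OF refl])
    fix a assume a: "a \<in> {1..Suc n}"
    have "ecoord n (wact n w ?\<alpha>) (\<pi> a) = ecoord n ?\<alpha> a + ?K" using e[OF a, of 1 ?\<alpha>] by (simp add: algebra_simps)
    then show "word_auto n w H (\<pi> a) (\<pi> a) * ecoord n (wact n w ?\<alpha>) (\<pi> a) = H a a * ecoord n ?\<alpha> a + H a a * ?K"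
      by (simp only: u sg mult_1 distrib_left)
  qed
  also have "\<dots> = weval n ?\<alpha> H + (\<Sum>a=1..Suc n. H a a) * ?K"
    by (simp only: weval_ecoord sum.distrib sum_distrib_right)
  also have "(\<Sum>a=1..Suc n. H a a) = 0" using H by (simp only: cartan_def sl_def mem_Collect_eq)
  finally show "weval n (wact n w ?\<alpha>) (word_auto n w H) = weval n ?\<alpha> H" by simp
qed

lemma ecoord_posroot:
  assumes ab: "1 \<le> a" "a < b" "b \<le> Suc n" and c: "c \<in> {1..Suc n}" "d \<in> {1..Suc n}"
  shows "ecoord n (posroot n a b) c - ecoord n (posroot n a b) d = rootvec a b c - rootvec a b d"
proof -
  have E: "ecoord n (posroot n a b) c = rootvec a b c + (\<Sum>k=a..<b. if k = n then 1 else 0)" if c: "c \<in> {1..Suc n}" for c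
  proof -
    have "ecoord n (posroot n a b) c = (\<Sum>k=a..<b. ecoord n (alpha n k) c)"
      unfolding ecoord_def posroot_def by (rule sum.swap)
    also have "\<dots> = (\<Sum>k=a..<b. rootvec k (Suc k) c + (if k = n then 1 else 0))"
      using ab c by (intro sum.cong ecoord_alpha) auto
    also have "\<dots> = (\<Sum>k=a..<b. rootvec k (Suc k) c) + (\<Sum>k=a..<b. if k = n then 1 else 0)" by (rule sum.distrib)
    also have "(\<Sum>k=a..<b. rootvec k (Suc k) c) = rootvec a b c"
    proof -
      have "a \<le> b" using ab by simp
      then show ?thesis by (induction b rule: dec_induct) (auto simp: )
    qed
    finally show ?thesis .
  qed
  show ?thesis unfolding E[OF c(1)] E[OF c(2)] by simp
qed

section \<open>Integral coroot values at admissible weights\<close>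

lemma integral_fraction:
  assumes "q > 0" "coprime p q" "of_nat p / of_nat q * of_int \<eta> \<in> (\<int> :: complex set)"
  shows "int q dvd \<eta>"
proof -
  obtain z where "of_nat p / of_nat q * of_int \<eta> = (of_int z :: complex)" using assms(3) by (auto elim: Ints_cases)
  then have "(of_int (int p * \<eta>) :: complex) = of_int (z * int q)" using assms(1) by (simp add: field_simps)
  then have "int p * \<eta> = z * int q" by (simp only: of_int_eq_iff)
  then have "int q dvd int p * \<eta>" by simp
  moreover have "coprime (int q) (int p)" using assms(2) by (simp add: coprime_commute)
  ultimately show ?thesis by (simp add: coprime_dvd_mult_right_iff)
qed

text \<open>Transporting the root back by \<open>w\<close>, the value is a pairing with
  \<open>\<mu> + \<rho> - (p/q) \<eta>\<close>. Integrality makes the pairing of \<open>eta\<close>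
  with the root divisible by \<open>q\<close>. If \<open>w\<close> keeps the root positive, the
  condition on \<open>eta\<close> leaves only \<open>0\<close>, and the value is that of
  \<open>\<mu> + \<rho>\<close>. Otherwise it leaves only \<open>q\<close>, and the value is
  \<open>p\<close> minus a pairing with \<open>\<mu> + \<rho>\<close>, positive since the pairing
  with the highest root is below \<open>p\<close>.\<close>

lemma admissible_integral_positive:
  assumes adm: "admissible_level n k p q" and lam: "lam \<in> Pr_bar n p q"
    and xy: "1 \<le> x" "x < y" "y \<le> Suc n"
    and int: "(\<Sum>k=x..<y. lam k + 1) \<in> \<int>"
  shows "\<exists>M::nat. M > 0 \<and> (\<Sum>k=x..<y. lam k + 1) = of_nat M"
proof -
  obtain mu w eta where mu: "mu \<in> Pr_Z n p" and w: "set w \<subseteq> {1..n}" and C: "Ccond n q w eta"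
    and eq: "\<forall>j\<in>{1..n}. lam j = dot n w (\<lambda>i. of_nat (mu i) - (of_nat p / of_nat q) * of_int (eta i)) j"
    using lam by (auto simp: Pr_bar_def)
  have pq: "q > 0" "coprime p q" "Suc n \<le> p" using adm by (auto simp: admissible_level_def)
  obtain \<pi> and sg :: "nat \<Rightarrow> complex" where perm: "\<pi> permutes {1..Suc n}"
    and e: "\<And>\<xi> a b. \<lbrakk>a \<in> {1..Suc n}; b \<in> {1..Suc n}\<rbrakk> \<Longrightarrow>
      ecoord n (wact n w \<xi>) (\<pi> a) - ecoord n (wact n w \<xi>) (\<pi> b) = ecoord n \<xi> a - ecoord n \<xi> b"
    using word_auto_permutation[OF w] by metis
  define \<xi> :: weight where "\<xi> i = of_nat (mu i) - (of_nat p / of_nat q) * of_int (eta i) + 1" for i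
  have lw: "lam j + 1 = wact n w \<xi> j" if "j \<in> {1..n}" for j
    using eq that by (simp add: dot_def rho_w_def \<xi>_def[abs_def])
  define a where "a = inv \<pi> x"
  define b where "b = inv \<pi> y"
  have \<pi>: "\<pi> a = x" "\<pi> b = y" using permutes_inverses[OF perm] by (simp_all add: a_def b_def)
  have ab: "a \<in> {1..Suc n}" "b \<in> {1..Suc n}"
    using permutes_in_image[OF permutes_inv[OF perm]] xy by (auto simp: a_def b_def)
  have \<pi>_eq: "\<pi> c = \<pi> d \<longleftrightarrow> c = d" for c d using permutes_inj[OF perm] by (auto dest: injD)
  have L: "(\<Sum>k=x..<y. lam k + 1) = ecoord n \<xi> a - ecoord n \<xi> b"
  proof -
    have "(\<Sum>k=x..<y. lam k + 1) = (\<Sum>k=x..<y. wact n w \<xi> k)" using xy lw by (intro sum.cong) auto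
    also have "\<dots> = ecoord n (wact n w \<xi>) x - ecoord n (wact n w \<xi>) y" using xy by (subst ecoord_diff) auto
    finally show ?thesis using e[OF ab, of \<xi>] by (simp add: \<pi>)
  qed
  have seg: "(\<Sum>k=c..<d. \<xi> k) = of_nat (\<Sum>k=c..<d. mu k + 1) - of_nat p / of_nat q * of_int (pair_root eta c d)" for c d
    unfolding \<xi>_def pair_root_def by (simp add: sum.distrib sum_subtractf sum_distrib_left algebra_simps)
  have wroot: "wact n w (posroot n c d) j = rootvec (\<pi> c) (\<pi> d) j - rootvec (\<pi> c) (\<pi> d) (Suc j)"
    if cd: "1 \<le> c" "c < d" "d \<le> Suc n" and j: "j \<in> {1..n}" for c d j
  proof -
    have p: "\<pi> (inv \<pi> j) = j" "\<pi> (inv \<pi> (Suc j)) = Suc j" using permutes_inverses[OF perm] by simp_all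
    have m: "inv \<pi> j \<in> {1..Suc n}" "inv \<pi> (Suc j) \<in> {1..Suc n}"
      using permutes_in_image[OF permutes_inv[OF perm]] j by auto
    have r: "rootvec c d (inv \<pi> j) = rootvec (\<pi> c) (\<pi> d) j" "rootvec c d (inv \<pi> (Suc j)) = rootvec (\<pi> c) (\<pi> d) (Suc j)"
      using \<pi>_eq[of "inv \<pi> j"] \<pi>_eq[of "inv \<pi> (Suc j)"] by (simp_all add: p)
    show ?thesis using ecoord_step[OF j, of "wact n w (posroot n c d)"] e[OF m, of "posroot n c d"]
      ecoord_posroot[OF cd m] unfolding p r by simp
  qed
  have "a \<noteq> b" using \<pi> xy by auto
  then consider "a < b" | "b < a" by linarith
  then show ?thesis
  proof cases
    case 1
    have "is_posroot n (wact n w (posroot n a b))"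
      unfolding is_posroot_def
    proof (intro exI conjI ballI)
      fix j assume j: "j \<in> {1..n}"
      have "posroot n x y j = rootvec x y j - rootvec x y (Suc j)"
        using ecoord_step[OF j, of "posroot n x y"] ecoord_posroot[OF xy, of j "Suc j"] j by auto
      then show "wact n w (posroot n a b) j = posroot n x y j"
        using wroot[of a b j] 1 ab j by (simp add: \<pi>)
    qed (use xy in auto)
    then have \<eta>: "0 \<le> pair_root eta a b" "pair_root eta a b \<le> int q - 1"
      using C[unfolded Ccond_def, rule_format, of a b] 1 ab by auto
    have v: "(\<Sum>k=x..<y. lam k + 1) = of_nat (\<Sum>k=a..<b. mu k + 1) - of_nat p / of_nat q * of_int (pair_root eta a b)"
      unfolding L using 1 ab by (subst ecoord_diff) (auto simp: seg)
    then have "of_nat p / of_nat q * of_int (pair_root eta a b) = of_nat (\<Sum>k=a..<b. mu k + 1) - (\<Sum>k=x..<y. lam k + 1)" by simp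
    also have "\<dots> \<in> \<int>" using int by (intro Ints_diff) auto
    finally have "int q dvd pair_root eta a b" by (rule integral_fraction[OF pq(1,2)])
    then have "pair_root eta a b = 0" using \<eta> by (auto dest: zdvd_imp_le)
    moreover have "(\<Sum>k=a..<b. mu k + 1) > 0" using 1 by (intro sum_pos) auto
    ultimately show ?thesis using v by (intro exI[of _ "\<Sum>k=a..<b. mu k + 1"]) simp
  next
    case 2
    have "\<not> is_posroot n (wact n w (posroot n b a))"
    proof
      assume "is_posroot n (wact n w (posroot n b a))"
      then obtain c d where cd: "1 \<le> c" "c < d" "d \<le> Suc n"
        and j: "\<forall>j\<in>{1..n}. wact n w (posroot n b a) j = posroot n c d j" by (auto simp: is_posroot_def)
      have "(\<Sum>k=x..<y. wact n w (posroot n b a) k) = (\<Sum>k=x..<y. posroot n c d k)"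
        using j xy by (intro sum.cong) auto
      then have "ecoord n (wact n w (posroot n b a)) (\<pi> a) - ecoord n (wact n w (posroot n b a)) (\<pi> b)
        = ecoord n (posroot n c d) x - ecoord n (posroot n c d) y"
        using xy by (simp add: ecoord_diff \<pi>)
      then have "rootvec b a a - rootvec b a b = rootvec c d x - rootvec c d y"
        using ecoord_posroot[OF cd, of x y] ecoord_posroot[of b a n a b] 2 ab xy by (simp add: e)
      then show False using 2 xy cd by (auto split: if_splits)
    qed
    then have \<eta>: "1 \<le> pair_root eta b a" "pair_root eta b a \<le> int q"
      using C[unfolded Ccond_def, rule_format, of b a] 2 ab by auto
    have v: "(\<Sum>k=x..<y. lam k + 1) = of_nat p / of_nat q * of_int (pair_root eta b a) - of_nat (\<Sum>k=b..<a. mu k + 1)"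
      using ecoord_diff[of b a n \<xi>] 2 ab unfolding L seg by (simp add: algebra_simps)
    then have "of_nat p / of_nat q * of_int (pair_root eta b a) = (\<Sum>k=x..<y. lam k + 1) + of_nat (\<Sum>k=b..<a. mu k + 1)" by simp
    also have "\<dots> \<in> \<int>" using int by (intro Ints_add) auto
    finally have "int q dvd pair_root eta b a" by (rule integral_fraction[OF pq(1,2)])
    then have "pair_root eta b a = int q" using \<eta> by (auto dest: zdvd_imp_le)
    then have v': "(\<Sum>k=x..<y. lam k + 1) = of_nat p - of_nat (\<Sum>k=b..<a. mu k + 1)" using v pq by simp
    have "(\<Sum>k=b..<a. mu k + 1) \<le> (\<Sum>k=1..n. mu k + 1)" using 2 ab by (intro sum_mono2) auto
    also have "\<dots> = (\<Sum>k=1..n. mu k) + n" by (subst sum.distrib) simp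
    also have "\<dots> < p" using mu by (simp add: Pr_Z_def)
    finally have "(\<Sum>k=b..<a. mu k + 1) < p" .
    then show ?thesis using v' by (intro exI[of _ "p - (\<Sum>k=b..<a. mu k + 1)"]) (simp add: of_nat_diff)
  qed
qed

section \<open>Comparing a free highest weight module with a Gelfand--Tsetlin module\<close>

definition psc :: "(complex \<Rightarrow> 'v \<Rightarrow> 'v) \<Rightarrow> (complex \<Rightarrow> 'w \<Rightarrow> 'w) \<Rightarrow> complex \<Rightarrow> 'v \<times> 'w \<Rightarrow> 'v \<times> 'w" where
  "psc sc sc' c p = (sc c (fst p), sc' c (snd p))"

definition prho :: "(mat \<Rightarrow> 'v \<Rightarrow> 'v) \<Rightarrow> (mat \<Rightarrow> 'w \<Rightarrow> 'w) \<Rightarrow> mat \<Rightarrow> 'v \<times> 'w \<Rightarrow> 'v \<times> 'w" where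
  "prho \<rho> \<rho>' A p = (\<rho> A (fst p), \<rho>' A (snd p))"

lemma psc_pair: "psc sc sc' c (x, y) = (sc c x, sc' c y)"
  by (simp add: psc_def)

lemma act_word_prho: "act_word (prho \<rho> \<rho>') w p = (act_word \<rho> w (fst p), act_word \<rho>' w (snd p))"
  by (induction w) (simp_all add: prho_def)

lemma lie_module_imp_sl_module: "lie_module n sc \<rho> \<Longrightarrow> sl_module sc n \<rho>"
  by (simp add: sl_module_def sl_module_axioms_def lie_module_def)

lemma lie_module_prod:
  assumes "lie_module n sc \<rho>" "lie_module n sc' \<rho>'"
  shows "lie_module n (psc sc sc') (prho \<rho> \<rho>')"
proof -
  interpret V: sl_module sc n \<rho> using assms(1) by (rule lie_module_imp_sl_module)
  interpret G: sl_module sc' n \<rho>' using assms(2) by (rule lie_module_imp_sl_module)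
  have vs: "Vector_Spaces.vector_space (psc sc sc')"
    by unfold_locales (auto simp: psc_def V.scale_right_distrib G.scale_right_distrib V.scale_left_distrib G.scale_left_distrib)
  have "\<forall>A\<in>sl n. Vector_Spaces.linear (psc sc sc') (psc sc sc') (prho \<rho> \<rho>' A)"
    unfolding Vector_Spaces.linear_iff using vs
    by (auto simp: psc_def prho_def V.rho_add G.rho_add V.rho_scale G.rho_scale)
  moreover have "\<forall>A\<in>sl n. \<forall>B\<in>sl n. \<forall>x. prho \<rho> \<rho>' (\<lambda>a b. A a b + B a b) x = prho \<rho> \<rho>' A x + prho \<rho> \<rho>' B x"
    by (auto simp: prho_def V.rho_add_left G.rho_add_left)
  moreover have "\<forall>A\<in>sl n. \<forall>c x. prho \<rho> \<rho>' (\<lambda>a b. c * A a b) x = psc sc sc' c (prho \<rho> \<rho>' A x)"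
    by (auto simp: psc_def prho_def V.rho_scale_left G.rho_scale_left)
  moreover have "\<forall>A\<in>sl n. \<forall>B\<in>sl n. \<forall>x. prho \<rho> \<rho>' (brk n A B) x
      = prho \<rho> \<rho>' A (prho \<rho> \<rho>' B x) - prho \<rho> \<rho>' B (prho \<rho> \<rho>' A x)"
    using assms by (auto simp: prho_def lie_module_def)
  ultimately show ?thesis unfolding lie_module_def using vs by blast
qed

lemma (in vector_space) span_image_finite_sum:
  assumes "x \<in> span {f m | m. m \<in> K}"
  shows "\<exists>I q. finite I \<and> I \<subseteq> K \<and> x = (\<Sum>m\<in>I. scale (q m) (f m))"
  using assms
proof (induction rule: span_induct_alt)
  case base
  show ?case by (rule exI[of _ "{}"]) simp
next
  case (step c x y)
  then obtain m I q where m: "m \<in> K" "x = f m" and I: "finite I" "I \<subseteq> K" "y = (\<Sum>m\<in>I. scale (q m) (f m))" by auto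
  have "y \<in> span {f k | k. k \<in> insert m I}"
    unfolding I(3) by (intro span_sum span_scale span_base) auto
  moreover have "scale c x \<in> span {f k | k. k \<in> insert m I}"
    unfolding m(2) by (intro span_scale span_base) auto
  ultimately have "scale c x + y \<in> span {f k | k. k \<in> insert m I}" by (rule span_add[rotated])
  then obtain q' where "scale c x + y = (\<Sum>k\<in>insert m I. scale (q' k) (f k))"
    using span_finite_image[of "insert m I" "scale c x + y" f] I(1) by auto
  then show ?case using m I by (intro exI[of _ "insert m I"] exI[of _ q']) auto
qed

text \<open>Two modules of the same highest weight, the first of them free over the lowering
  operators. The submodule of the product generated by the pair \<open>(v0, w0)\<close> plays the
  part of the universal map out of a Verma module.\<close>

locale hw_pair = V: hw_module sc n \<rho> lam v0 + G: hw_module sc' n \<rho>' lam w0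
  for sc :: "complex \<Rightarrow> 'v::ab_group_add \<Rightarrow> 'v" and n \<rho> lam v0
    and sc' :: "complex \<Rightarrow> 'w::ab_group_add \<Rightarrow> 'w" and \<rho>' w0 +
  fixes wd :: "(nat \<times> nat) multiset \<Rightarrow> (nat \<times> nat) list"
  assumes wd: "word_choice wd" and free: "V.pbw_free wd"
begin

sublocale P: hw_module "psc sc sc'" n "prho \<rho> \<rho>'" lam "(v0, w0)"
proof -
  interpret sl_module "psc sc sc'" n "prho \<rho> \<rho>'"
    by (rule lie_module_imp_sl_module[OF lie_module_prod[OF V.lie G.lie]])
  show "hw_module (psc sc sc') n (prho \<rho> \<rho>') lam (v0, w0)"
    by unfold_locales (use V.hw G.hw in \<open>auto simp: hw_vector_def prho_def psc_def zero_prod_def\<close>)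
qed

lemma psc_sum: "(\<Sum>m\<in>I. psc sc sc' (q m) (f m)) = (\<Sum>m\<in>I. sc (q m) (fst (f m)), \<Sum>m\<in>I. sc' (q m) (snd (f m)))"
  by (rule prod_eqI) (simp_all add: fst_sum snd_sum psc_def)

text \<open>Since the vectors \<open>y\<^sup>m v0\<close> are independent, the submodule generated by \<open>(v0, w0)\<close> in the
  product is the graph of a module map.\<close>
lemma graph_unique: "(0, y) \<in> P.pbw_all \<Longrightarrow> y = 0"
proof -
  assume "(0, y) \<in> P.pbw_all"
  then have "(0, y) \<in> P.span {act_word (prho \<rho> \<rho>') (wd m) (v0, w0) | m. m \<in> {m. set_mset m \<subseteq> neg_letters n}}"
    using P.pbw_all_eq[OF wd] by simp
  from P.span_image_finite_sum[OF this] obtain I q where I: "finite I" "I \<subseteq> {m. set_mset m \<subseteq> neg_letters n}"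
    and s: "(0, y) = (\<Sum>m\<in>I. psc sc sc' (q m) (act_word (prho \<rho> \<rho>') (wd m) (v0, w0)))"
    by (elim exE conjE)
  have "0 = (\<Sum>m\<in>I. sc (q m) (act_word \<rho> (wd m) v0))" "y = (\<Sum>m\<in>I. sc' (q m) (act_word \<rho>' (wd m) w0))"
    using s by (simp_all add: psc_sum act_word_prho)
  moreover from this(1) have "\<forall>m\<in>I. q m = 0"
    using free[unfolded V.pbw_free_def, rule_format, of I q] I by auto
  ultimately show "y = 0" by simp
qed

lemma P_add: "p \<in> P.pbw_all \<Longrightarrow> p' \<in> P.pbw_all \<Longrightarrow> p + p' \<in> P.pbw_all"
  and P_diff: "p \<in> P.pbw_all \<Longrightarrow> p' \<in> P.pbw_all \<Longrightarrow> p - p' \<in> P.pbw_all"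
  and P_scale: "p \<in> P.pbw_all \<Longrightarrow> psc sc sc' c p \<in> P.pbw_all"
  and P_word: "set w \<subseteq> neg_letters n \<Longrightarrow> act_word (prho \<rho> \<rho>') w (v0, w0) \<in> P.pbw_all"
  unfolding P.pbw_all_def by (auto intro: P.span_add P.span_diff P.span_scale P.span_base)

lemma graph_total: "x \<in> V.pbw_all \<Longrightarrow> \<exists>y. (x, y) \<in> P.pbw_all"
  unfolding V.pbw_all_def
proof (induction rule: V.span_induct_alt)
  case base
  have "0 \<in> P.pbw_all" by (simp add: P.pbw_all_def P.span_zero)
  then show ?case by (auto simp: zero_prod_def)
next
  case (step c x y)
  then obtain w y' where w: "x = act_word \<rho> w v0" "set w \<subseteq> neg_letters n" and y': "(y, y') \<in> P.pbw_all" by auto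
  from P_add[OF P_scale[OF P_word[OF w(2)], of c] y'] show ?case
    by (auto simp: psc_pair act_word_prho w(1))
qed

text \<open>Meaningful on \<open>pbw_all\<close> only; outside it the description operator returns
  an unspecified value, so the rules below ask for membership.\<close>

definition theta :: "'v \<Rightarrow> 'w" where "theta x = (THE y. (x, y) \<in> P.pbw_all)"

lemma theta_eqI: "(x, y) \<in> P.pbw_all \<Longrightarrow> theta x = y"
  unfolding theta_def
proof (rule the_equality)
  fix y' assume "(x, y) \<in> P.pbw_all" "(x, y') \<in> P.pbw_all"
  from P_diff[OF this] show "y' = y" using graph_unique[of "y - y'"] by simp
qed

lemma theta_graph: "x \<in> V.pbw_all \<Longrightarrow> (x, theta x) \<in> P.pbw_all"
  using graph_total theta_eqI by blast

lemma theta_add: "x \<in> V.pbw_all \<Longrightarrow> y \<in> V.pbw_all \<Longrightarrow> theta (x + y) = theta x + theta y"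
  using P_add[OF theta_graph theta_graph] by (intro theta_eqI) simp

lemma theta_scale: "x \<in> V.pbw_all \<Longrightarrow> theta (sc c x) = sc' c (theta x)"
  using P_scale[OF theta_graph] by (intro theta_eqI) (simp add: psc_pair)

lemma theta_zero: "theta 0 = 0"
  by (rule theta_eqI) (simp add: P.pbw_all_def P.span_zero flip: zero_prod_def)

lemma theta_rho: "A \<in> sl n \<Longrightarrow> x \<in> V.pbw_all \<Longrightarrow> theta (\<rho> A x) = \<rho>' A (theta x)"
  using P.pbw_all_stable[OF _ theta_graph] by (intro theta_eqI) (auto simp: prho_def)

lemma theta_word: "set w \<subseteq> neg_letters n \<Longrightarrow> theta (act_word \<rho> w v0) = act_word \<rho>' w w0"
  using P_word by (intro theta_eqI) (simp add: act_word_prho)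

lemma V_word: "set w \<subseteq> neg_letters n \<Longrightarrow> act_word \<rho> w v0 \<in> V.pbw_all"
  unfolding V.pbw_all_def by (rule V.span_base) auto

lemma V_sum: "(\<And>i. i \<in> I \<Longrightarrow> f i \<in> V.pbw_all) \<Longrightarrow> (\<Sum>i\<in>I. sc (c i) (f i)) \<in> V.pbw_all"
  unfolding V.pbw_all_def by (intro V.span_sum V.span_scale)

lemma theta_sum: "(\<And>i. i \<in> I \<Longrightarrow> f i \<in> V.pbw_all) \<Longrightarrow> theta (\<Sum>i\<in>I. sc (c i) (f i)) = (\<Sum>i\<in>I. sc' (c i) (theta (f i)))"
proof (induction I rule: infinite_finite_induct)
  case (insert i I)
  then have "(\<Sum>i\<in>I. sc (c i) (f i)) \<in> V.pbw_all" "sc (c i) (f i) \<in> V.pbw_all"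
    using V_sum[of I f c] by (auto simp: V.pbw_all_def V.span_scale)
  then show ?case using insert by (simp add: theta_add theta_scale)
qed (simp_all add: theta_zero)

lemma theta_injective:
  assumes irr: "irreducible_mod n sc \<rho>" and x: "theta x = 0"
  shows "x = 0"
proof -
  let ?K = "{x. theta x = 0}"
  note U = V.pbw_all_UNIV[OF irr]
  have "V.subspace ?K"
    by (rule V.subspaceI) (simp_all add: theta_zero theta_add theta_scale U)
  moreover have "\<forall>A\<in>sl n. \<forall>x\<in>?K. \<rho> A x \<in> ?K" using G.rho_zero by (simp add: theta_rho U)
  ultimately have "?K = {0} \<or> ?K = UNIV" using irr unfolding irreducible_mod_def by blast
  moreover have "v0 \<notin> ?K" using theta_word[of "[]"] G.v0_nonzero by simp
  ultimately show ?thesis using x by auto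
qed

end

locale gt_hw = gt_perm n t \<pi> sg Ex lam + V: hw_module sc n \<rho> lam v0
  for n t \<pi> sg Ex lam and sc :: "complex \<Rightarrow> 'v::ab_group_add \<Rightarrow> 'v" and \<rho> v0 +
  fixes wd :: "(nat \<times> nat) multiset \<Rightarrow> (nat \<times> nat) list"
  assumes wd: "word_choice wd" and free: "V.pbw_free wd"
begin

sublocale hw_pair sc n \<rho> lam v0 fsc srep "pt zm" wd
proof -
  interpret G: sl_module fsc n srep by (rule lie_module_imp_sl_module[OF lie_module_srep])
  show "hw_pair sc n \<rho> lam v0 fsc srep (pt zm) wd"
    by unfold_locales (rule srep_hw_vector wd free)+
qed

text \<open>The Kostant partitions of a weight. By freeness their number is the dimension of the
  corresponding weight space of the first module.\<close>

definition Mw :: "(nat \<Rightarrow> int) \<Rightarrow> (nat \<times> nat) multiset set" where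
  "Mw \<mu> = {m. set_mset m \<subseteq> neg_letters n \<and> mset_wt m = \<mu>}"

lemma finite_Mw: "finite (Mw \<mu>)"
  unfolding Mw_def by (rule finite_msets_wt)

lemma Phi_Sw:
  assumes "\<And>c. c \<notin> {1..Suc n} \<Longrightarrow> \<mu> c = 0"
  shows "\<Phi> ` Sw \<mu> \<subseteq> Mw \<mu>"
proof
  fix m assume "m \<in> \<Phi> ` Sw \<mu>"
  then obtain z where z: "m = \<Phi> z" "z \<in> Sw \<mu>" by blast
  have "mset_wt (\<Phi> z) c = \<mu> c" for c
    using Sw_Phi[OF z(2), of c] mset_wt_outside[OF set_Phi[of z], of c] assms[of c] by (cases "c \<in> {1..Suc n}") auto
  then show "m \<in> Mw \<mu>" using z set_Phi by (auto simp: Mw_def)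
qed

lemma Phi_inj_Sw: "inj_on \<Phi> (Sw \<mu>)"
  by (rule inj_on_subset[OF Phi_inj]) (auto simp: Sw_def)

lemma finite_Sw:
  assumes "\<And>c. c \<notin> {1..Suc n} \<Longrightarrow> \<mu> c = 0"
  shows "finite (Sw \<mu>)"
  by (rule finite_imageD[OF finite_subset[OF Phi_Sw finite_Mw] Phi_inj_Sw]) (rule assms)

lemma wd_neg: "set_mset m \<subseteq> neg_letters n \<Longrightarrow> set (wd m) \<subseteq> neg_letters n"
  using word_choice_set[OF wd] by simp

lemma theta_Mw_supp: "m \<in> Mw \<mu> \<Longrightarrow> supp_in (Sw \<mu>) (theta (act_word \<rho> (wd m) v0))"
  using act_word_supp[OF wd_neg[of m]] theta_word[OF wd_neg[of m]] wd by (auto simp: Mw_def word_choice_def)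

lemma theta_Mw_sum:
  "theta (\<Sum>m\<in>Mw \<mu>. sc (c m) (act_word \<rho> (wd m) v0)) = (\<Sum>m\<in>Mw \<mu>. fsc (c m) (theta (act_word \<rho> (wd m) v0)))"
proof (rule theta_sum)
  fix m assume "m \<in> Mw \<mu>"
  then show "act_word \<rho> (wd m) v0 \<in> V.pbw_all" using V_word[OF wd_neg[of m]] by (simp add: Mw_def)
qed

lemma Mw_free:
  assumes "(\<Sum>m\<in>Mw \<mu>. sc (c m) (act_word \<rho> (wd m) v0)) = 0" "m \<in> Mw \<mu>"
  shows "c m = 0"
proof -
  have "\<forall>m\<in>Mw \<mu>. set_mset m \<subseteq> neg_letters n" by (simp add: Mw_def)
  then show ?thesis using free assms finite_Mw[of \<mu>] unfolding V.pbw_free_def by blast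
qed

lemma fsc_sum_apply: "(\<Sum>m\<in>I. fsc (c m) (f m)) z = (\<Sum>m\<in>I. c m * f m z)"
  by (induction I rule: infinite_finite_induct) (simp_all add: fsc_def)

text \<open>By \<open>\<Phi>\<close>, a weight space of the target has at most
  \<open>card (Mw \<mu>)\<close> points. The unknown \<open>None\<close> belongs to the point
  function and the others to the images of the monomials, so there is one unknown more than
  equations. Injectivity of \<open>theta\<close> and freeness exclude a relation without the point
  function.\<close>

lemma point_in_range:
  assumes irr: "irreducible_mod n sc \<rho>" and z: "z \<in> S"
  shows "\<exists>x. theta x = pt z"
proof -
  define \<mu> where "\<mu> = mset_wt (\<Phi> z)"
  have zS: "z \<in> Sw \<mu>" using z Phi_wt[OF z] by (auto simp: Sw_def \<mu>_def)
  have out: "\<mu> c = 0" if "c \<notin> {1..Suc n}" for c unfolding \<mu>_def using mset_wt_outside[OF set_Phi that] .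
  have fin: "finite (Sw \<mu>)" by (rule finite_Sw) (rule out)
  have card: "card (Sw \<mu>) \<le> card (Mw \<mu>)" using card_inj_on_le[OF Phi_inj_Sw Phi_Sw[OF out] finite_Mw] .
  let ?f = "\<lambda>m. theta (act_word \<rho> (wd m) v0)"
  let ?I = "insert None (Some ` Mw \<mu>)"
  let ?g = "\<lambda>w i. case i of None \<Rightarrow> pt z w | Some m \<Rightarrow> ?f m w"
  have "card (Sw \<mu>) < card ?I" using card finite_Mw by (simp add: card_image)
  then obtain c where c: "\<exists>i\<in>?I. c i \<noteq> 0" "\<forall>w\<in>Sw \<mu>. (\<Sum>i\<in>?I. c i * ?g w i) = 0"
    using homogeneous_system_solution[OF fin, of ?I ?g] finite_Mw by auto
  define x where "x = (\<Sum>m\<in>Mw \<mu>. sc (c (Some m)) (act_word \<rho> (wd m) v0))"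
  have tx: "theta x w = (\<Sum>m\<in>Mw \<mu>. c (Some m) * ?f m w)" for w
    unfolding x_def theta_Mw_sum fsc_sum_apply ..
  have eq: "c None * pt z w + theta x w = 0" for w
  proof (cases "w \<in> Sw \<mu>")
    case True
    have "0 = (\<Sum>i\<in>?I. c i * ?g w i)" using c(2) True by auto
    also have "\<dots> = c None * pt z w + (\<Sum>m\<in>Mw \<mu>. c (Some m) * ?f m w)"
      using finite_Mw by (subst sum.insert) (auto simp: sum.reindex)
    finally show ?thesis by (simp add: tx)
  next
    case False
    then have "?f m w = 0" if "m \<in> Mw \<mu>" for m using theta_Mw_supp[OF that] by (auto simp: supp_in_def)
    then have "theta x w = 0" unfolding tx by (intro sum.neutral) simp
    moreover have "pt z w = 0" using False zS by (auto simp: pt_def)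
    ultimately show ?thesis by simp
  qed
  have "c None \<noteq> 0"
  proof
    assume c0: "c None = 0"
    then have "theta x = 0" using eq by (auto simp: fun_eq_iff)
    then have "x = 0" using theta_injective[OF irr] by simp
    then have "c (Some m) = 0" if "m \<in> Mw \<mu>" for m
      using Mw_free[of "\<lambda>m. c (Some m)" \<mu> m] that unfolding x_def by blast
    then show False using c(1) c0 by auto
  qed
  then have "pt z = fsc (- 1 / c None) (theta x)"
    using eq by (auto simp: fsc_def fun_eq_iff field_simps eq_neg_iff_add_eq_0)
  then show ?thesis using theta_scale[of x "- 1 / c None"] V.pbw_all_UNIV[OF irr] by (intro exI[of _ "sc (- 1 / c None) x"]) simp
qed

text \<open>If \<open>\<Phi>\<close> misses a Kostant partition, the target weight space is too
  small and \<open>theta\<close> has a kernel there. A nonzero weight vector of least height in the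
  kernel is singular, since raising operators stay in the kernel and lower the height.\<close>

lemma kernel_singular_vector:
  assumes \<mu>: "\<And>c. c \<notin> {1..Suc n} \<Longrightarrow> \<mu> c = 0" and m0: "m0 \<in> Mw \<mu>" "m0 \<notin> \<Phi> ` S"
  shows "\<exists>\<nu> z. z \<in> V.wt_space \<nu> \<and> z \<noteq> 0 \<and> ht n \<nu> > 0 \<and>
    (\<forall>a\<in>{1..Suc n}. \<forall>b\<in>{1..Suc n}. a < b \<longrightarrow> \<rho> (Emat a b) z = 0)"
proof -
  have PS: "\<Phi> ` Sw \<mu> \<subseteq> Mw \<mu>" by (rule Phi_Sw) (rule \<mu>)
  have fin: "finite (Sw \<mu>)" by (rule finite_Sw) (rule \<mu>)
  have "\<Phi> ` Sw \<mu> \<subseteq> Mw \<mu> - {m0}" using PS m0(2) by (auto simp: Sw_def)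
  then have "card (Sw \<mu>) \<le> card (Mw \<mu> - {m0})" using card_inj_on_le[OF Phi_inj_Sw] finite_Mw by blast
  also have "\<dots> < card (Mw \<mu>)" using m0(1) finite_Mw by (intro psubset_card_mono) auto
  finally have "card (Sw \<mu>) < card (Mw \<mu>)" .
  then obtain c where c: "\<exists>m\<in>Mw \<mu>. c m \<noteq> 0" "\<forall>w\<in>Sw \<mu>. (\<Sum>m\<in>Mw \<mu>. c m * theta (act_word \<rho> (wd m) v0) w) = 0"
    using homogeneous_system_solution[OF fin finite_Mw, of \<mu> "\<lambda>w m. theta (act_word \<rho> (wd m) v0) w"] by blast
  define x where "x = (\<Sum>m\<in>Mw \<mu>. sc (c m) (act_word \<rho> (wd m) v0))"
  have "theta x w = 0" for w
  proof (cases "w \<in> Sw \<mu>")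
    case True then show ?thesis using c(2) by (simp add: x_def theta_Mw_sum fsc_sum_apply)
  next
    case False
    then have "theta (act_word \<rho> (wd m) v0) w = 0" if "m \<in> Mw \<mu>" for m using theta_Mw_supp[OF that] by (auto simp: supp_in_def)
    then show ?thesis by (simp add: x_def theta_Mw_sum fsc_sum_apply)
  qed
  then have tx: "theta x = 0" by (auto simp: fun_eq_iff)
  have x0: "x \<noteq> 0" using Mw_free[of c \<mu>] c(1) unfolding x_def by blast
  have xw: "x \<in> V.wt_space \<mu>"
    unfolding x_def V.wt_space_def
  proof (intro V.span_sum V.span_scale V.span_base)
    fix m assume "m \<in> Mw \<mu>"
    then show "act_word \<rho> (wd m) v0 \<in> {act_word \<rho> w v0 |w. set w \<subseteq> neg_letters n \<and> mset_wt (mset w) = \<mu>}"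
      using wd wd_neg[of m] by (auto simp: Mw_def word_choice_def intro!: exI[of _ "wd m"])
  qed
  have all: "y \<in> V.pbw_all" if "y \<in> V.wt_space \<nu>" for y \<nu>
    using that V.span_mono[of "{act_word \<rho> w v0 |w. set w \<subseteq> neg_letters n \<and> mset_wt (mset w) = \<nu>}" "{act_word \<rho> w v0 |w. set w \<subseteq> neg_letters n}"]
    unfolding V.wt_space_def V.pbw_all_def by blast
  \<comment> \<open>At height at most zero only the empty word contributes, so \<open>y\<close> is a
    multiple of \<open>v0\<close>, and \<open>theta\<close> does not kill \<open>v0\<close>.\<close>
  have pos: "ht n \<nu> > 0" if y: "y \<in> V.wt_space \<nu>" "y \<noteq> 0" "theta y = 0" for y \<nu>
  proof (rule ccontr)
    assume le: "\<not> ht n \<nu> > 0"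
    have e: "w = []" if "set w \<subseteq> neg_letters n" "mset_wt (mset w) = \<nu>" for w
      using ht_mset[of "mset w" n] that le by (cases w) auto
    have "{act_word \<rho> w v0 |w. set w \<subseteq> neg_letters n \<and> mset_wt (mset w) = \<nu>} \<subseteq> {v0}" using e by force
    then have "V.wt_space \<nu> \<subseteq> V.span {v0}" unfolding V.wt_space_def by (rule V.span_mono)
    then obtain k where k: "y = sc k v0" using y(1) V.span_breakdown_eq[of y v0 "{}"] by auto
    then have "0 = fsc k (pt zm)" using theta_scale[of v0 k] theta_word[of "[]"] V_word[of "[]"] y(3) by simp
    from fun_cong[OF this, of zm] have "k = 0" by (simp add: fsc_def pt_def)
    then show False using k y(2) by simp
  qed
  define Q where "Q h \<longleftrightarrow> (\<exists>\<nu> y. y \<in> V.wt_space \<nu> \<and> y \<noteq> 0 \<and> theta y = 0 \<and> nat (ht n \<nu>) = h)" for h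
  have "Q (nat (ht n \<mu>))" unfolding Q_def using xw x0 tx by blast
  then obtain h where h: "Q h" "\<And>h'. h' < h \<Longrightarrow> \<not> Q h'" using exists_least_iff[of Q] by blast
  then obtain \<nu> z where z: "z \<in> V.wt_space \<nu>" "z \<noteq> 0" "theta z = 0" "nat (ht n \<nu>) = h" by (auto simp: Q_def)
  have "\<rho> (Emat a b) z = 0" if ab: "a \<in> {1..Suc n}" "b \<in> {1..Suc n}" "a < b" for a b
  proof (rule ccontr)
    assume nz: "\<rho> (Emat a b) z \<noteq> 0"
    have abl: "(a,b) \<in> sl_letters n" using ab by (auto simp: sl_letters_def)
    have m: "\<rho> (Emat a b) z \<in> V.wt_space (\<lambda>c. letter_wt (a,b) c + \<nu> c)" by (rule V.Emat_wt_space[OF abl z(1)])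
    have "theta (\<rho> (Emat a b) z) = 0"
      using theta_rho[OF Emat_in_sl[OF abl] all[OF z(1)]] z(3) G.rho_zero[OF Emat_in_sl[OF abl]] by simp
    moreover have "nat (ht n (\<lambda>c. letter_wt (a,b) c + \<nu> c)) < h"
      using ht_add[of n "letter_wt (a,b)" \<nu>] ht_letter[OF abl] ab z(4) pos[OF z(1-3)] by auto
    ultimately show False using h(2) m nz unfolding Q_def by blast
  qed
  then show ?thesis using z pos[OF z(1-3)] by blast
qed

end

section \<open>Nonintegrality\<close>

definition shift_letter :: "nat \<Rightarrow> nat \<times> nat \<Rightarrow> nat \<times> nat" where
  "shift_letter s x = (fst x + s, snd x + s)"

text \<open>The diagonal block on the indices \<open>s + 1, ..., s + r + 1\<close>, a copy of
  sl(r+1) attached to a string of simple roots.\<close>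

definition emb :: "nat \<Rightarrow> mat \<Rightarrow> mat" where
  "emb s A = (\<lambda>x y. if s < x \<and> s < y then A (x - s) (y - s) else 0)"

lemma inj_shift_letter: "inj (shift_letter s)"
  by (rule injI) (simp add: shift_letter_def prod_eq_iff)

lemma emb_Emat: "1 \<le> a \<Longrightarrow> 1 \<le> b \<Longrightarrow> emb s (Emat a b) = Emat (a + s) (b + s)"
  by (auto simp: emb_def Emat_def fun_eq_iff)

lemma emb_hv: "1 \<le> i \<Longrightarrow> emb s (hv i) = hv (i + s)"
  by (auto simp: emb_def hv_def fun_eq_iff)

lemma sum_block:
  fixes g :: "nat \<Rightarrow> complex"
  assumes "s + r \<le> n" "\<And>c. c \<in> {1..Suc n} \<Longrightarrow> \<not> (s < c \<and> c \<le> Suc (s + r)) \<Longrightarrow> g c = 0"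
  shows "(\<Sum>c=1..Suc n. g c) = (\<Sum>c=1..Suc r. g (c + s))"
proof -
  have im: "(\<lambda>c. c + s) ` {1..Suc r} = {1 + s..Suc r + s}" by (rule image_add_atLeastAtMost')
  have "(\<Sum>c=1..Suc n. g c) = (\<Sum>c\<in>(\<lambda>c. c + s) ` {1..Suc r}. g c)"
    unfolding im using assms by (intro sum.mono_neutral_right) auto
  then show ?thesis by (simp add: sum.reindex del: image_add_atLeastAtMost image_add_atLeastAtMost')
qed

lemma emb_in_sl:
  assumes "s + r \<le> n" "A \<in> sl r"
  shows "emb s A \<in> sl n"
proof -
  have g: "A a b = 0" if "a \<notin> {1..Suc r} \<or> b \<notin> {1..Suc r}" for a b using assms(2) that by (auto simp: sl_def in_gl_def)
  have "in_gl n (emb s A)" using assms(1) by (auto simp: in_gl_def emb_def intro!: g)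
  moreover have "(\<Sum>c=1..Suc n. emb s A c c) = (\<Sum>c=1..Suc r. emb s A (c + s) (c + s))"
    using assms(1) by (intro sum_block) (auto simp: emb_def intro!: g)
  moreover have "(\<Sum>c=1..Suc r. emb s A (c + s) (c + s)) = 0" using assms(2) by (simp add: emb_def sl_def)
  ultimately show ?thesis by (simp add: sl_def)
qed

lemma emb_mmul:
  assumes "s + r \<le> n" "A \<in> sl r" "B \<in> sl r"
  shows "mmul n (emb s A) (emb s B) = emb s (mmul r A B)"
proof (intro ext)
  fix x y
  have g: "A a b = 0" if "a \<notin> {1..Suc r} \<or> b \<notin> {1..Suc r}" for a b using assms(2) that by (auto simp: sl_def in_gl_def)
  have "mmul n (emb s A) (emb s B) x y = (\<Sum>c=1..Suc r. emb s A x (c + s) * emb s B (c + s) y)"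
    unfolding mmul_def using assms(1) by (intro sum_block) (auto simp: emb_def intro!: g)
  then show "mmul n (emb s A) (emb s B) x y = emb s (mmul r A B) x y"
    by (simp add: emb_def mmul_def)
qed

lemma emb_brk: "s + r \<le> n \<Longrightarrow> A \<in> sl r \<Longrightarrow> B \<in> sl r \<Longrightarrow> emb s (brk r A B) = brk n (emb s A) (emb s B)"
  unfolding brk_def by (simp only: emb_mmul) (auto simp: emb_def fun_eq_iff)

lemma letter_wt_shift:
  "1 \<le> fst x \<Longrightarrow> 1 \<le> snd x \<Longrightarrow> letter_wt (shift_letter s x) = (\<lambda>c. if s < c then letter_wt x (c - s) else 0)"
  by (auto simp: letter_wt_def shift_letter_def fun_eq_iff)

lemma mset_wt_shift:
  "set_mset m \<subseteq> neg_letters r \<Longrightarrow> mset_wt (image_mset (shift_letter s) m) = (\<lambda>c. if s < c then mset_wt m (c - s) else 0)"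
proof (induction m)
  case (add x m)
  then have "1 \<le> fst x" "1 \<le> snd x" by (auto simp: neg_letters_def)
  then show ?case using add by (auto simp: letter_wt_shift fun_eq_iff)
qed auto

lemma shift_neg: "s + r \<le> n \<Longrightarrow> x \<in> neg_letters r \<Longrightarrow> shift_letter s x \<in> neg_letters n"
  by (auto simp: neg_letters_def shift_letter_def)

lemma (in hw_module) pbw_freeD:
  "\<lbrakk>pbw_free wd; finite I; \<forall>m\<in>I. set_mset m \<subseteq> neg_letters n;
    (\<Sum>m\<in>I. sc (c m) (act_word \<rho> (wd m) v0)) = 0; m \<in> I\<rbrakk> \<Longrightarrow> c m = 0"
  unfolding pbw_free_def by blast

locale levi = hw_module sc n \<rho> lam v0 for sc n \<rho> lam v0 +
  fixes r s :: nat
  assumes block: "s + r \<le> n" "1 \<le> r"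
begin

abbreviation "rl A \<equiv> \<rho> (emb s A)"

lemma lie_module_levi: "lie_module r sc rl"
  unfolding lie_module_def
proof (intro conjI ballI allI)
  show "Vector_Spaces.vector_space sc" by (rule vector_space_axioms)
  fix A assume A: "A \<in> sl r"
  note eA = emb_in_sl[OF block(1) A]
  show "Vector_Spaces.linear sc sc (rl A)" by (rule lin[OF eA])
  have "emb s (\<lambda>a b. c * A a b) = (\<lambda>a b. c * emb s A a b)" for c by (auto simp: emb_def fun_eq_iff)
  then show "rl (\<lambda>a b. c * A a b) x = sc c (rl A x)" for c x by (simp add: rho_scale_left[OF eA])
  fix B x assume B: "B \<in> sl r"
  note eB = emb_in_sl[OF block(1) B]
  have "emb s (\<lambda>a b. A a b + B a b) = (\<lambda>a b. emb s A a b + emb s B a b)" by (auto simp: emb_def fun_eq_iff)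
  then show "rl (\<lambda>a b. A a b + B a b) x = rl A x + rl B x" by (simp add: rho_add_left[OF eA eB])
  show "rl (brk r A B) x = rl A (rl B x) - rl B (rl A x)"
    unfolding emb_brk[OF block(1) A B] rho_brk[OF eA eB] by simp
qed

sublocale L: hw_module sc r rl "\<lambda>i. lam (i + s)" v0
proof -
  interpret sl_module sc r rl by (rule lie_module_imp_sl_module[OF lie_module_levi])
  show "hw_module sc r rl (\<lambda>i. lam (i + s)) v0"
  proof unfold_locales
    show "hw_vector r sc rl (\<lambda>i. lam (i + s)) v0"
      using hw block by (simp add: hw_vector_def emb_Emat emb_hv)
  qed
qed

lemma act_word_levi: "set w \<subseteq> neg_letters r \<Longrightarrow> act_word rl w x = act_word \<rho> (map (shift_letter s) w) x"
proof (induction w)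
  case (Cons y w)
  then have "1 \<le> fst y" "1 \<le> snd y" "fst y \<noteq> snd y" by (auto simp: neg_letters_def)
  then have "emb s (bas y) = bas (shift_letter s y)" by (simp add: bas_def shift_letter_def emb_Emat)
  then show ?case using Cons by simp
qed simp

text \<open>An ordering for the block is shifted and extended by an arbitrary ordering to multisets
  not coming from the block; freeness of the whole module for this ordering restricts to the
  block.\<close>

lemma levi_free:
  assumes free: "\<And>wd. word_choice wd \<Longrightarrow> pbw_free wd" and wd': "word_choice wd'"
  shows "L.pbw_free wd'"
  unfolding L.pbw_free_def
proof (intro allI impI)
  let ?sh = "image_mset (shift_letter s)"
  have inj: "inj ?sh" by (rule multiset.inj_map[OF inj_shift_letter])
  obtain wd0 where wd0: "word_choice wd0" using word_choice_exists by blast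
  define wd where "wd m = (if m \<in> range ?sh then map (shift_letter s) (wd' (inv ?sh m)) else wd0 m)" for m
  have "mset (wd m) = m" for m
    using wd' wd0 by (auto simp: wd_def word_choice_def inv_f_f[OF inj])
  then have wd: "pbw_free wd" by (intro free) (simp add: word_choice_def)
  fix I c assume I: "finite I" "\<forall>m\<in>I. set_mset m \<subseteq> neg_letters r" and z: "(\<Sum>m\<in>I. sc (c m) (act_word rl (wd' m) v0)) = 0"
  have "(\<Sum>m\<in>?sh ` I. sc (c (inv ?sh m)) (act_word \<rho> (wd m) v0)) = (\<Sum>m\<in>I. sc (c m) (act_word \<rho> (wd (?sh m)) v0))"
    using inj by (subst sum.reindex) (auto simp: inj_on_def inv_f_f[OF inj])
  also have "\<dots> = (\<Sum>m\<in>I. sc (c m) (act_word rl (wd' m) v0))"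
  proof (rule sum.cong[OF refl])
    fix m assume "m \<in> I"
    then have "set (wd' m) \<subseteq> neg_letters r" using I(2) word_choice_set[OF wd'] by simp
    moreover have "wd (?sh m) = map (shift_letter s) (wd' m)" by (simp add: wd_def inv_f_f[OF inj])
    ultimately show "sc (c m) (act_word \<rho> (wd (?sh m)) v0) = sc (c m) (act_word rl (wd' m) v0)"
      using act_word_levi by simp
  qed
  finally have "(\<Sum>m\<in>?sh ` I. sc (c (inv ?sh m)) (act_word \<rho> (wd m) v0)) = 0" using z by simp
  moreover have "\<forall>m\<in>?sh ` I. set_mset m \<subseteq> neg_letters n" using I(2) shift_neg[OF block(1)] by fastforce
  ultimately have "c (inv ?sh m) = 0" if "m \<in> ?sh ` I" for m
    using pbw_freeD[OF wd, of "?sh ` I" "\<lambda>m. c (inv ?sh m)"] I(1) that by blast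
  then show "\<forall>m\<in>I. c m = 0" using inv_f_f[OF inj] by fastforce
qed

definition inblock :: "nat \<Rightarrow> bool" where "inblock a \<longleftrightarrow> s < a \<and> a \<le> Suc (s + r)"

text \<open>Bracketing an upper matrix unit outside the block with a lowering letter of the block
  gives, up to sign, an upper matrix unit outside the block or zero. So it can be moved through the
  word until it reaches \<open>v0\<close>.\<close>

lemma outer_kills_word:
  "set w \<subseteq> neg_letters r \<Longrightarrow> a \<in> {1..Suc n} \<Longrightarrow> b \<in> {1..Suc n} \<Longrightarrow> a < b \<Longrightarrow> \<not> (inblock a \<and> inblock b) \<Longrightarrow>
    \<rho> (Emat a b) (act_word \<rho> (map (shift_letter s) w) v0) = 0"
proof (induction w arbitrary: a b)
  case Nil then show ?case by (simp add: rho_upper_v0)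
next
  case (Cons y w)
  obtain c d where cd: "shift_letter s y = (c,d)" by force
  have y: "(c,d) \<in> neg_letters n" using shift_neg[OF block(1), of y] Cons.prems(1) by (simp add: cd)
  have in_b: "inblock c" "inblock d" "d < c" using Cons.prems(1) cd by (auto simp: inblock_def shift_letter_def neg_letters_def)
  have cdn: "c \<in> {1..Suc n}" "d \<in> {1..Suc n}" using y by (auto simp: neg_letters_def)
  have ab: "(a,b) \<in> sl_letters n" using Cons.prems by (auto simp: sl_letters_def)
  let ?x = "act_word \<rho> (map (shift_letter s) w) v0"
  have "brk n (Emat a b) (Emat c d) = (if b = c then Emat a d else if d = a then (\<lambda>x y. - 1 * Emat c b x y) else (\<lambda>_ _. 0))"
    unfolding brk_Emat[OF Cons.prems(2,3) cdn] using Cons.prems(4,5) in_b by (auto simp: fun_eq_iff)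
  moreover have "b = c \<Longrightarrow> \<rho> (Emat a d) ?x = 0"
    using Cons.prems in_b cdn by (intro Cons.IH) (auto simp: inblock_def)
  moreover have "\<rho> (\<lambda>x y. - 1 * Emat c b x y) ?x = 0" if "d = a"
  proof -
    have "\<rho> (Emat c b) ?x = 0" using that Cons.prems in_b cdn by (intro Cons.IH) (auto simp: inblock_def)
    moreover have "(c,b) \<in> sl_letters n" using that Cons.prems in_b cdn by (auto simp: inblock_def sl_letters_def)
    ultimately show ?thesis using rho_scale_left[OF Emat_in_sl, of c b "- 1" ?x] by simp
  qed
  ultimately have br: "\<rho> (brk n (Emat a b) (Emat c d)) ?x = 0" by (auto simp: rho_zero_left)
  have "\<rho> (Emat a b) ?x = 0" using Cons.prems by (intro Cons.IH) auto
  then show ?case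
    using rho_brk[OF Emat_in_sl[OF ab] neg_in_sl[OF y], of ?x] br bas_neg'[OF y] rho_zero[OF neg_in_sl[OF y]]
    by (simp add: cd)
qed

text \<open>A vector of positive height in the block module that is singular for the block is singular for the
  whole algebra, so it generates a submodule that avoids the highest weight vector.\<close>
lemma no_singular_in_levi:
  assumes irr: "irreducible_mod n sc \<rho>" and wd: "word_choice wd" and free: "pbw_free wd"
    and z: "z \<in> L.wt_space \<nu>" "z \<noteq> 0" "ht r \<nu> > 0"
    and sing: "\<And>a b. \<lbrakk>a \<in> {1..Suc r}; b \<in> {1..Suc r}; a < b\<rbrakk> \<Longrightarrow> rl (Emat a b) z = 0"
  shows False
proof -
  define \<nu>' where "\<nu>' c = (if s < c then \<nu> (c - s) else 0)" for c
  let ?G = "{act_word rl w v0 | w. set w \<subseteq> neg_letters r \<and> mset_wt (mset w) = \<nu>}"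
  \<comment> \<open>The vectors of positive height. This space is stable under lowering operators,
    contains \<open>z\<close>, and by freeness does not contain \<open>v0\<close>.\<close>
  define NE where "NE = span {act_word \<rho> w v0 | w. set w \<subseteq> neg_letters n \<and> w \<noteq> []}"
  have word: "\<exists>w'. x = act_word \<rho> (map (shift_letter s) w') v0 \<and> set w' \<subseteq> neg_letters r \<and> w' \<noteq> [] \<and>
    set (map (shift_letter s) w') \<subseteq> neg_letters n \<and> mset_wt (mset (map (shift_letter s) w')) = \<nu>'" if xG: "x \<in> ?G" for x
  proof -
    obtain w where w: "x = act_word rl w v0" "set w \<subseteq> neg_letters r" "mset_wt (mset w) = \<nu>" using xG by blast
    have "w \<noteq> []" using w(3) z(3) by (auto simp: ht_def)
    moreover have "set (map (shift_letter s) w) \<subseteq> neg_letters n" using w(2) shift_neg[OF block(1)] by auto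
    moreover have "mset_wt (mset (map (shift_letter s) w)) = \<nu>'"
      using mset_wt_shift[of "mset w" r s] w(2) unfolding w(3) by (simp add: \<nu>'_def[abs_def])
    ultimately show ?thesis using w act_word_levi by blast
  qed
  have zspan: "z \<in> span ?G" using z(1) by (simp add: L.wt_space_def)
  have "?G \<subseteq> {act_word \<rho> w v0 | w. set w \<subseteq> neg_letters n \<and> mset_wt (mset w) = \<nu>'}" using word by blast
  then have zw: "z \<in> wt_space \<nu>'" using zspan span_mono unfolding wt_space_def by blast
  have "?G \<subseteq> {act_word \<rho> w v0 | w. set w \<subseteq> neg_letters n \<and> w \<noteq> []}" using word by fastforce
  then have zNE: "z \<in> NE" using zspan span_mono unfolding NE_def by blast
  have kill: "\<rho> (Emat a b) z = 0" if ab: "a \<in> {1..Suc n}" "b \<in> {1..Suc n}" "a < b" for a b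
  proof (cases "inblock a \<and> inblock b")
    case True
    then have "emb s (Emat (a - s) (b - s)) = Emat a b" by (subst emb_Emat) (auto simp: inblock_def)
    then show ?thesis using sing[of "a - s" "b - s"] True ab by (auto simp: inblock_def)
  next
    case False
    have abl: "Emat a b \<in> sl n" using ab by (intro Emat_in_sl) (auto simp: sl_letters_def)
    have "\<rho> (Emat a b) z \<in> span {}"
    proof (rule rho_span_image[OF abl _ zspan])
      fix x assume "x \<in> ?G"
      then show "\<rho> (Emat a b) x \<in> span {}" using word[of x] outer_kills_word[OF _ ab False] by (auto simp: span_zero)
    qed
    then show ?thesis by simp
  qed
  \<comment> \<open>Being singular and a weight vector, \<open>z\<close> is itself a highest weight
    vector, so irreducibility makes the words applied to \<open>z\<close> span everything.\<close>
  interpret Z: hw_module sc n \<rho> "\<lambda>i. cart_eig (hv i) \<nu>'" z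
    by unfold_locales (use z(2) kill rho_cartan_wt_space[OF hv_in_cartan zw] in \<open>simp add: hw_vector_def\<close>)
  have NE_step: "\<rho> (bas y) x \<in> NE" if y: "y \<in> neg_letters n" and x: "x \<in> NE" for x y
    unfolding NE_def
  proof (rule rho_span_image[OF neg_in_sl[OF y] _ x[unfolded NE_def]])
    fix u assume "u \<in> {act_word \<rho> w v0 |w. set w \<subseteq> neg_letters n \<and> w \<noteq> []}"
    then obtain w where "u = act_word \<rho> w v0" "set w \<subseteq> neg_letters n" by blast
    then show "\<rho> (bas y) u \<in> span {act_word \<rho> w v0 |w. set w \<subseteq> neg_letters n \<and> w \<noteq> []}"
      using y by (intro span_base CollectI exI[of _ "y # w"]) simp
  qed
  have "act_word \<rho> w z \<in> NE" if "set w \<subseteq> neg_letters n" for w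
    using that by (induction w) (simp_all add: zNE NE_step)
  then have "Z.pbw_all \<subseteq> NE" unfolding Z.pbw_all_def NE_def by (intro span_minimal) auto
  then have "v0 \<in> NE" using Z.pbw_all_UNIV[OF irr] by auto
  moreover have "NE \<subseteq> span {act_word \<rho> (wd m) v0 | m. m \<in> {m. set_mset m \<subseteq> neg_letters n \<and> m \<noteq> {#}}}"
    unfolding NE_def
  proof (rule span_minimal)
    show "{act_word \<rho> w v0 |w. set w \<subseteq> neg_letters n \<and> w \<noteq> []}
      \<subseteq> span {act_word \<rho> (wd m) v0 | m. m \<in> {m. set_mset m \<subseteq> neg_letters n \<and> m \<noteq> {#}}}"
    proof
      fix x assume "x \<in> {act_word \<rho> w v0 |w. set w \<subseteq> neg_letters n \<and> w \<noteq> []}"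
      then obtain w where w: "x = act_word \<rho> w v0" "set w \<subseteq> neg_letters n" "w \<noteq> []" by blast
      have "ht n (mset_wt (mset w)) \<ge> int (length w)" using ht_mset[of "mset w" n] w(2) by simp
      moreover have "length w > 0" using w(3) by simp
      ultimately have "mset_wt (mset w) \<noteq> mset_wt {#}" by (auto simp: ht_def)
      then show "x \<in> span {act_word \<rho> (wd m) v0 | m. m \<in> {m. set_mset m \<subseteq> neg_letters n \<and> m \<noteq> {#}}}"
        unfolding w(1) by (intro set_mp[OF span_mono pbw_spanning[OF wd w(2)]]) force
    qed
  qed simp
  ultimately have "v0 \<in> span {act_word \<rho> (wd m) v0 | m. m \<in> {m. set_mset m \<subseteq> neg_letters n \<and> m \<noteq> {#}}}" by blast
  from span_image_finite_sum[OF this] obtain I q where I: "finite I" "I \<subseteq> {m. set_mset m \<subseteq> neg_letters n \<and> m \<noteq> {#}}"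
    and v: "v0 = (\<Sum>m\<in>I. sc (q m) (act_word \<rho> (wd m) v0))" by (elim exE conjE)
  \<comment> \<open>The coefficient \<open>-1\<close> at the empty multiset turns the expression of
    \<open>v0\<close> through nonempty words into a nontrivial relation.\<close>
  let ?c = "q({#} := - 1)"
  have nI: "{#} \<notin> I" using I(2) by blast
  have wd0: "wd {#} = []" using word_choice_length[OF wd, of "{#}"] by simp
  have "(\<Sum>m\<in>I. sc (?c m) (act_word \<rho> (wd m) v0)) = (\<Sum>m\<in>I. sc (q m) (act_word \<rho> (wd m) v0))"
    using nI by (intro sum.cong) auto
  then have "(\<Sum>m\<in>insert {#} I. sc (?c m) (act_word \<rho> (wd m) v0)) = sc (- 1) v0 + v0"
    using I(1) nI v by (simp add: wd0)
  also have "\<dots> = 0" by simp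
  finally have z0: "(\<Sum>m\<in>insert {#} I. sc (?c m) (act_word \<rho> (wd m) v0)) = 0" .
  have "finite (insert {#} I)" "\<forall>m\<in>insert {#} I. set_mset m \<subseteq> neg_letters n" using I by auto
  from pbw_freeD[OF free this z0, of "{#}"] show False by simp
qed

end

context hw_module begin

text \<open>Induction on the height of the root makes all shorter roots of its block nonintegral, so
  the first \<open>r\<close> columns are generic while columns \<open>1\<close> and
  \<open>r + 1\<close> differ by the integer \<open>M\<close>. Removing the resulting invariant set
  loses the Kostant partition consisting of \<open>M\<close> copies of the lowest root. The kernel
  then contains a singular vector, as for a reflection in a Verma module.\<close>

theorem free_irreducible_imp_nonintegral:
  assumes irr: "irreducible_mod n sc \<rho>" and all_free: "\<And>wd. word_choice wd \<Longrightarrow> pbw_free wd"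
    and pos: "\<And>x y. \<lbrakk>1 \<le> x; x < y; y \<le> Suc n; (\<Sum>k=x..<y. lam k + 1) \<in> \<int>\<rbrakk>
      \<Longrightarrow> \<exists>M::nat. M > 0 \<and> (\<Sum>k=x..<y. lam k + 1) = of_nat M"
  shows "\<lbrakk>1 \<le> x; x < y; y \<le> Suc n\<rbrakk> \<Longrightarrow> (\<Sum>k=x..<y. lam k + 1) \<notin> \<int>"
proof (induction "y - x" arbitrary: x y rule: less_induct)
  case less
  note xy = less.prems
  show ?case
  proof
    assume int: "(\<Sum>k=x..<y. lam k + 1) \<in> \<int>"
    then obtain M :: nat where M: "M > 0" "(\<Sum>k=x..<y. lam k + 1) = of_nat M" using pos[OF xy] by blast
    define r where "r = y - x"
    define s where "s = x - 1"
    have rs: "s + r \<le> n" "1 \<le> r" "s + 1 = x" "s + Suc r = y" using xy by (auto simp: r_def s_def)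
    interpret levi sc n \<rho> lam v0 r s using rs by unfold_locales auto
    define t where "t i = ecoord n (\<lambda>k. lam k + 1) (i + s)" for i
    have td: "t i - t j = (\<Sum>k=i + s..<j + s. lam k + 1)" if "i \<le> j" "j \<le> Suc r" for i j
      unfolding t_def using that rs by (intro ecoord_diff) auto
    have nint: "t i - t j \<notin> \<int>" if "i \<in> {1..r}" "j \<in> {1..r}" "i < j" for i j
    proof -
      have "(\<Sum>k=i + s..<j + s. lam k + 1) \<notin> \<int>" by (rule less.hyps) (use that rs in auto)
      then show ?thesis using td[of i j] that by simp
    qed
    interpret gt_generic r t
    proof
      fix i j assume ij: "i \<in> {1..r}" "j \<in> {1..r}" "i \<noteq> j"
      have "t j - t i \<notin> \<int> \<Longrightarrow> t i - t j \<notin> \<int>" using Ints_minus[of "t i - t j"] by auto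
      then show "t i - t j \<notin> \<int>" using nint[of i j] nint[of j i] ij by (cases "i < j") auto
    qed
    \<comment> \<open>The array \<open>zmin r id\<close> has offset zero at this position, so
      \<open>M > 0\<close> keeps it outside the removed set.\<close>
    define Ex where "Ex = {z\<in>base. z r 1 \<le> - int M}"
    have z0: "zmin r id r 1 = 0" using rs(2) by (auto simp: zmin_def)
    have e: "1 + s = x" "Suc r + s = y" using rs by auto
    have "t 1 - t (Suc r) = of_int (int M)" using td[of 1 "Suc r", unfolded e] M(2) by simp
    then have Ex: "gclosed Ex" unfolding Ex_def by (rule gclosed_integral) (rule rs(2))
    interpret gt_perm r t id "\<lambda>_. 1" Ex "\<lambda>i. lam (i + s)"
    proof
      show "id permutes {1..Suc r}" by (rule permutes_id)
      show "gclosed Ex" by (rule Ex)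
      show "zmin r id \<notin> Ex" using z0 M(1) by (simp add: Ex_def)
      show "t (inv id i) - t (inv id (Suc i)) = lam (i + s) + 1" if "i \<in> {1..r}" for i
        using ecoord_step[of "i + s" n "\<lambda>k. lam k + 1"] that rs by (simp add: t_def)
    qed simp
    obtain wd' where wd': "word_choice wd'" using word_choice_exists by blast
    interpret gt_hw r t id "\<lambda>_. 1" Ex "\<lambda>i. lam (i + s)" sc rl v0 wd'
      by unfold_locales (rule wd' levi_free[OF all_free wd'])+
    \<comment> \<open>An array with this multiset would have increment \<open>M\<close> in column
      \<open>1\<close> at the top row, hence offset \<open>- M\<close> in row \<open>r\<close>, and
      would lie in \<open>Ex\<close>.\<close>
    define m0 where "m0 = replicate_mset M (Suc r, 1::nat)"
    have m0: "set_mset m0 \<subseteq> neg_letters r" using rs(2) by (auto simp: m0_def neg_letters_def split: if_splits)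
    have m0S: "m0 \<notin> \<Phi> ` S"
    proof
      assume "m0 \<in> \<Phi> ` S"
      then obtain z where z: "z \<in> S" "m0 = \<Phi> z" by blast
      have p: "(1, Suc r) \<in> pairs r" using rs(2) by (simp add: pairs_def)
      have "M = mm (1, Suc r) z" using count_Phi[OF p, of z] rs(2) unfolding z(2)[symmetric] by (simp add: lt_def m0_def)
      moreover have "int (mm (1, Suc r) z) = dd (Suc r) 1 z" using S_dd[OF z(1) p] rs(2) by simp
      moreover have b: "z \<in> base" "z \<notin> Ex" using z(1) by (auto simp: S_def Adom_def Bdom_def)
      moreover have "z (Suc r) 1 = 0" using b(1) by (simp add: base_def)
      ultimately show False by (simp add: dd_def Ex_def)
    qed
    have m0M: "m0 \<in> Mw (mset_wt m0)" using m0 by (simp add: Mw_def)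
    have "\<exists>\<nu> z. z \<in> L.wt_space \<nu> \<and> z \<noteq> 0 \<and> ht r \<nu> > 0 \<and>
        (\<forall>a\<in>{1..Suc r}. \<forall>b\<in>{1..Suc r}. a < b \<longrightarrow> rl (Emat a b) z = 0)"
      by (rule kernel_singular_vector[OF _ m0M m0S]) (rule mset_wt_outside[OF m0])
    then obtain \<nu> z where z: "z \<in> L.wt_space \<nu>" "z \<noteq> 0" "ht r \<nu> > 0"
      "\<forall>a\<in>{1..Suc r}. \<forall>b\<in>{1..Suc r}. a < b \<longrightarrow> rl (Emat a b) z = 0" by (elim exE conjE)
    obtain wd where wd: "word_choice wd" using word_choice_exists by blast
    show False by (rule no_singular_in_levi[OF irr wd all_free[OF wd] z(1-3)]) (use z(4) in blast)
  qed
qed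

end

section \<open>The tame basis\<close>

lemma pt_apply: "pt z w = (if w = z then 1 else 0)"
  by (simp add: pt_def)

lemma pt_inj: "pt z = pt w \<Longrightarrow> z = w"
  by (metis pt_apply zero_neq_one)

context gt_perm begin

lemma pr_pt: "pr (pt z) = (if z \<in> S then pt z else 0)"
  by (auto simp: pr_def pt_def)

lemma S_base: "z \<in> S \<Longrightarrow> z \<in> base"
  by (simp add: S_def Adom_def)

lemma app_gop_pt: "app (gop \<kappa> c k r) (pt z) = (\<Sum>i=1..k. fsc (gcoef \<kappa> k r i z) (pt (z + unit k i c)))"
  unfolding gop_def app_sum
proof (intro sum.cong refl ext)
  fix i w
  show "app (atom (gcoef \<kappa> k r i) (unit k i c)) (pt z) w = fsc (gcoef \<kappa> k r i z) (pt (z + unit k i c)) w"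
    by (auto simp: app_atom fsc_def pt_def diff_eq_eq)
qed

lemma pr_sum: "pr (\<Sum>i\<in>I. fsc (c i) (f i)) = (\<Sum>i\<in>I. fsc (c i) (pr (f i)))"
  by (induction I rule: infinite_finite_induct) (simp_all only: sum.infinite sum.empty sum.insert pr_simps not_False_eq_True)

lemma tr_gop_pt:
  assumes "z \<in> S"
  shows "tr (gop \<kappa> c k r) (pt z) = (\<Sum>i=1..k. fsc (gcoef \<kappa> k r i z) (pr (pt (z + unit k i c))))"
proof -
  have "pr (pt z) = pt z" using assms by (simp add: pr_pt)
  then show ?thesis by (simp only: tr_def app_gop_pt pr_sum)
qed

lemma rep_ev_pt:
  assumes "k \<in> {1..n}" "z \<in> S"
  shows "rep (ev k) (pt z) = (\<Sum>i=1..k. fsc (gcoef (- 1) k (Suc k) i z) (pr (pt (z + unit k i 1))))"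
proof -
  have "rep (\<lambda>a b. 1 * Emat k (Suc k) a b) (pt z) = fsc 1 (tr (X k (Suc k)) (pt z))"
    using assms(1) by (intro rep_Emat) auto
  then have "rep (ev k) (pt z) = tr (X k (Suc k)) (pt z)" by (simp add: ev_def fsc_def)
  then show ?thesis unfolding X_e gE_def tr_gop_pt[OF assms(2)] .
qed

lemma rep_fv_pt:
  assumes "k \<in> {1..n}" "z \<in> S"
  shows "rep (fv k) (pt z) = (\<Sum>i=1..k. fsc (gcoef 1 k (k - 1) i z) (pr (pt (z + unit k i (- 1)))))"
proof -
  have "rep (\<lambda>a b. 1 * Emat (Suc k) k a b) (pt z) = fsc 1 (tr (X (Suc k) k) (pt z))"
    using assms(1) by (intro rep_Emat) auto
  then have "rep (fv k) (pt z) = tr (X (Suc k) k) (pt z)" by (simp add: fv_def fsc_def)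
  then show ?thesis unfolding X_f gF_def tr_gop_pt[OF assms(2)] .
qed

lemma rep_hv_pt:
  assumes "k \<in> {1..n}" "z \<in> S"
  shows "rep (hv k) (pt z) = fsc (2 * (\<Sum>i=1..k. V k i z) - (\<Sum>i=1..k-1. V (k-1) i z) - (\<Sum>i=1..Suc k. V (Suc k) i z) - 1) (pt z)"
proof -
  have "rep (hv k) (pt z) = fsc (\<Sum>a=1..Suc n. hv k a a * dcoef a z) (pt z)"
    by (rule rep_diag[OF _ assms(2)]) (simp add: hv_def)
  also have "(\<Sum>a=1..Suc n. hv k a a * dcoef a z) = (\<Sum>a=1..Suc n. (if a = k then dcoef k z else 0) - (if a = Suc k then dcoef (Suc k) z else 0))"
    by (intro sum.cong) (auto simp: hv_def)
  also have "\<dots> = dcoef k z - dcoef (Suc k) z"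
    using assms(1) unfolding sum_subtractf by (simp only: sum.delta finite_atLeastAtMost) auto
  also have "\<dots> = 2 * (\<Sum>i=1..k. V k i z) - (\<Sum>i=1..k-1. V (k-1) i z) - (\<Sum>i=1..Suc k. V (Suc k) i z) - 1"
    using assms(1) by (simp add: dcoef_def of_nat_diff del: sum.cl_ivl_Suc)
  finally show ?thesis .
qed

definition arr :: "latt \<Rightarrow> gtarray" where
  "arr z = (\<lambda>k i. if 1 \<le> i \<and> i \<le> k \<and> k \<le> Suc n then V k i z else 0)"

lemma arr_V: "k \<le> Suc n \<Longrightarrow> i \<in> {1..k} \<Longrightarrow> arr z k i = V k i z"
  by (simp add: arr_def)

lemma arr_inj: "inj_on arr base"
proof (rule inj_onI, intro ext)
  fix z z' k i assume z: "z \<in> base" "z' \<in> base" "arr z = arr z'"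
  show "z k i = z' k i"
  proof (cases "1 \<le> i \<and> i \<le> k \<and> k \<le> n")
    case True
    then show ?thesis using fun_cong[OF fun_cong[OF z(3), of k], of i] by (simp add: arr_def V_def)
  next
    case False then show ?thesis using z by (auto simp: base_def)
  qed
qed

lemma shift_arr: "k \<in> {1..n} \<Longrightarrow> i \<in> {1..k} \<Longrightarrow> shift (arr z) k i (of_int c) = arr (z + unit k i c)"
  by (auto simp: shift_def arr_def V_def unit_def fun_eq_iff)

lemma base_shift: "k \<in> {1..n} \<Longrightarrow> i \<in> {1..k} \<Longrightarrow> z \<in> base \<Longrightarrow> z + unit k i c \<in> base"
  by (auto simp: base_def unit_def)

text \<open>The convention for vanishing denominators in the definition of a tame module is never
  invoked for the arrays constructed here.\<close>

lemma den_nonzero: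
  assumes "k \<in> {1..n}" "i \<in> {1..k}"
  shows "(\<Prod>j\<in>{1..k}-{i}. V k i z - V k j z) \<noteq> 0"
proof -
  have "V k i z - V k j z \<noteq> 0" if "j \<in> {1..k} - {i}" for j
    using V_diff[of i j k z 0] assms that by auto
  then show ?thesis by (simp add: prod_zero_iff)
qed

lemma signed_permutation_in_sl:
  assumes u: "\<And>Y a b. u Y (\<pi> a) (\<pi> b) = sg a * sg b * Y a b" and A: "A \<in> sl n"
  shows "u A \<in> sl n"
proof -
  have "u A a b = 0" if ab: "a \<notin> {1..Suc n} \<or> b \<notin> {1..Suc n}" for a b
  proof -
    have "inv \<pi> a \<notin> {1..Suc n} \<or> inv \<pi> b \<notin> {1..Suc n}"
      using ab pi_in[of "inv \<pi> a"] pi_in[of "inv \<pi> b"] pi_inv by auto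
    then have "A (inv \<pi> a) (inv \<pi> b) = 0" using A by (auto simp: sl_def in_gl_def)
    then show ?thesis using u[of A "inv \<pi> a" "inv \<pi> b"] by (simp add: pi_inv)
  qed
  moreover have "(\<Sum>a=1..Suc n. u A a a) = (\<Sum>a=1..Suc n. u A (\<pi> a) (\<pi> a))"
    using sum.permute[OF perm, of "\<lambda>a. u A a a"] by (simp add: comp_def)
  moreover have "\<dots> = (\<Sum>a=1..Suc n. A a a)" by (simp only: u sg mult_1)
  ultimately show ?thesis using A by (simp add: sl_def in_gl_def)
qed

end

context gt_hw begin

text \<open>The twist by \<open>u\<close> undoes the signed permutation in \<open>srep\<close>, so
  \<open>theta\<close> intertwines the twisted action with \<open>rep\<close>. Each identity is
  checked after applying the injective map \<open>theta\<close>, where the tame basis becomes the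
  point functions.\<close>

theorem strongly_tame_twist:
  assumes irr: "irreducible_mod n sc \<rho>"
    and u: "\<And>Y a b. u Y (\<pi> a) (\<pi> b) = sg a * sg b * Y a b"
  shows "strongly_tame_GT n sc (\<lambda>A. \<rho> (u A))"
proof -
  note U = V.pbw_all_UNIV[OF irr]
  have in_all: "x \<in> V.pbw_all" for x using U by simp
  have theta_inj: "x = y" if "theta x = theta y" for x y
  proof -
    have "theta (x + sc (- 1) y) = theta x + fsc (- 1) (theta y)" by (simp only: theta_add[OF in_all in_all] theta_scale[OF in_all])
    also have "\<dots> = 0" using that by (auto simp: fsc_def fun_eq_iff)
    finally have "x + sc (- 1) y = 0" by (rule theta_injective[OF irr])
    then show ?thesis by simp
  qed
  have theta_uminus: "theta (- x) = - theta x" for x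
    using theta_scale[OF in_all, of "- 1" x] by (simp add: fsc_def fun_eq_iff)
  have equivariant: "theta (\<rho> (u A) x) = rep A (theta x)" if "A \<in> sl n" for A x
  proof -
    have "sg a * sg b * (sg a * sg b * A a b) = (sg a * sg a) * (sg b * sg b) * A a b" for a b by (simp only: ac_simps)
    then have one: "sg a * sg b * (sg a * sg b * A a b) = A a b" for a b unfolding sg by simp
    have "srep (u A) = rep A" by (simp only: srep_def u one)
    then show ?thesis using theta_rho[OF signed_permutation_in_sl[of u, OF u that] in_all] by simp
  qed
  obtain T0 where T0: "\<And>z. z \<in> S \<Longrightarrow> theta (T0 z) = pt z"
    using point_in_range[OF irr] bchoice[of S "\<lambda>z x. theta x = pt z"] by blast
  define Tz where "Tz z = (if z \<in> S then T0 z else 0)" for z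
  have theta_Tz: "theta (Tz z) = pr (pt z)" for z
    by (simp add: Tz_def T0 theta_zero pr_pt)
  define SA where "SA = arr ` S"
  define T where "T v = T0 (inv_into S arr v)" for v
  have arrS: "inj_on arr S" by (rule inj_on_subset[OF arr_inj]) (use S_base in blast)
  have TA: "T (arr z) = T0 z" if "z \<in> S" for z using inv_into_f_f[OF arrS that] by (simp add: T_def)
  let ?Tm = "\<lambda>v. if v \<in> SA then T v else 0"
  have Tm: "?Tm (arr z) = Tz z" if z: "z \<in> base" for z
  proof -
    have "arr z \<in> SA \<longleftrightarrow> z \<in> S" using inj_on_image_mem_iff[OF arr_inj z, of S] S_base by (auto simp: SA_def)
    then show ?thesis using TA by (simp add: Tz_def)
  qed
  have evS: "ev k \<in> sl n" and fvS: "fv k \<in> sl n" and hvS: "hv k \<in> sl n" if "k \<in> {1..n}" for k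
    using that cartan_imp_sl[OF hv_in_cartan[OF that]] by (auto simp: ev_def fv_def sl_letters_def intro!: Emat_in_sl)
  have E: "\<rho> (u (ev k)) (T (arr z)) = - (\<Sum>i=1..k.
      (let den = (\<Prod>j\<in>{1..k}-{i}. arr z k i - arr z k j) in
       if den = 0 then 0
       else sc ((\<Prod>j=1..Suc k. arr z k i - arr z (Suc k) j) / den) (?Tm (shift (arr z) k i 1))))" (is "_ = - ?R")
    if k: "k \<in> {1..n}" and z: "z \<in> S" for k z
  proof (rule theta_inj)
    define d where "d i = (\<Prod>j\<in>{1..k}-{i}. V k i z - V k j z)" for i
    define m where "m i = (\<Prod>j=1..Suc k. V k i z - V (Suc k) j z)" for i
    have "?R = (\<Sum>i=1..k. sc (m i / d i) (Tz (z + unit k i 1)))"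
    proof (rule sum.cong[OF refl])
      fix i assume i: "i \<in> {1..k}"
      have "(\<Prod>j\<in>{1..k}-{i}. arr z k i - arr z k j) = d i"
        unfolding d_def using k i by (intro prod.cong) (auto simp: arr_V)
      moreover have "(\<Prod>j=1..Suc k. arr z k i - arr z (Suc k) j) = m i"
        unfolding m_def using k i by (intro prod.cong) (auto simp: arr_V)
      moreover have "?Tm (shift (arr z) k i 1) = Tz (z + unit k i 1)"
      proof -
        have sh: "shift (arr z) k i 1 = arr (z + unit k i 1)" using shift_arr[OF k i, of z 1] by simp
        show ?thesis unfolding sh by (rule Tm[OF base_shift[OF k i S_base[OF z]]])
      qed
      moreover have "d i \<noteq> 0" unfolding d_def by (rule den_nonzero[OF k i])
      ultimately show "(let den = (\<Prod>j\<in>{1..k}-{i}. arr z k i - arr z k j) in if den = 0 then 0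
         else sc ((\<Prod>j=1..Suc k. arr z k i - arr z (Suc k) j) / den) (?Tm (shift (arr z) k i 1))) = sc (m i / d i) (Tz (z + unit k i 1))"
        by (simp only: Let_def if_False)
    qed
    then have "theta (- ?R) = - (\<Sum>i=1..k. fsc (m i / d i) (pr (pt (z + unit k i 1))))"
      by (simp only: theta_uminus theta_sum[OF in_all] theta_Tz)
    also have "\<dots> = (\<Sum>i=1..k. fsc (gcoef (- 1) k (Suc k) i z) (pr (pt (z + unit k i 1))))"
      unfolding sum_negf[symmetric] by (intro sum.cong refl) (auto simp: gcoef_def m_def d_def fsc_def fun_eq_iff)
    finally show "theta (\<rho> (u (ev k)) (T (arr z))) = theta (- ?R)"
      using equivariant[OF evS[OF k]] rep_ev_pt[OF k z] by (simp add: TA[OF z] T0[OF z])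
  qed
  have F: "\<rho> (u (fv k)) (T (arr z)) = (\<Sum>i=1..k.
      (let den = (\<Prod>j\<in>{1..k}-{i}. arr z k i - arr z k j) in
       if den = 0 then 0
       else sc ((\<Prod>j=1..k-1. arr z k i - arr z (k-1) j) / den) (?Tm (shift (arr z) k i (-1)))))" (is "_ = ?R")
    if k: "k \<in> {1..n}" and z: "z \<in> S" for k z
  proof (rule theta_inj)
    define d where "d i = (\<Prod>j\<in>{1..k}-{i}. V k i z - V k j z)" for i
    define m where "m i = (\<Prod>j=1..k-1. V k i z - V (k-1) j z)" for i
    have "?R = (\<Sum>i=1..k. sc (m i / d i) (Tz (z + unit k i (-1))))"
    proof (rule sum.cong[OF refl])
      fix i assume i: "i \<in> {1..k}"
      have "(\<Prod>j\<in>{1..k}-{i}. arr z k i - arr z k j) = d i"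
        unfolding d_def using k i by (intro prod.cong) (auto simp: arr_V)
      moreover have "(\<Prod>j=1..k-1. arr z k i - arr z (k-1) j) = m i"
        unfolding m_def using k i by (intro prod.cong) (auto simp: arr_V)
      moreover have "?Tm (shift (arr z) k i (-1)) = Tz (z + unit k i (-1))"
      proof -
        have sh: "shift (arr z) k i (-1) = arr (z + unit k i (-1))" using shift_arr[OF k i, of z "-1"] by simp
        show ?thesis unfolding sh by (rule Tm[OF base_shift[OF k i S_base[OF z]]])
      qed
      moreover have "d i \<noteq> 0" unfolding d_def by (rule den_nonzero[OF k i])
      ultimately show "(let den = (\<Prod>j\<in>{1..k}-{i}. arr z k i - arr z k j) in if den = 0 then 0
         else sc ((\<Prod>j=1..k-1. arr z k i - arr z (k-1) j) / den) (?Tm (shift (arr z) k i (-1)))) = sc (m i / d i) (Tz (z + unit k i (-1)))"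
        by (simp only: Let_def if_False)
    qed
    then have "theta ?R = (\<Sum>i=1..k. fsc (m i / d i) (pr (pt (z + unit k i (-1)))))"
      by (simp only: theta_sum[OF in_all] theta_Tz)
    also have "\<dots> = (\<Sum>i=1..k. fsc (gcoef 1 k (k - 1) i z) (pr (pt (z + unit k i (-1)))))"
      by (intro sum.cong refl) (simp add: gcoef_def m_def d_def)
    finally show "theta (\<rho> (u (fv k)) (T (arr z))) = theta ?R"
      using equivariant[OF fvS[OF k]] rep_fv_pt[OF k z] by (simp add: TA[OF z] T0[OF z])
  qed
  have H: "\<rho> (u (hv k)) (T (arr z)) = sc (2 * (\<Sum>i=1..k. arr z k i) - (\<Sum>i=1..k-1. arr z (k-1) i)
      - (\<Sum>i=1..Suc k. arr z (Suc k) i) - 1) (T (arr z))" (is "_ = sc ?c _")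
    if k: "k \<in> {1..n}" and z: "z \<in> S" for k z
  proof (rule theta_inj)
    have "(\<Sum>i=1..r. arr z r i) = (\<Sum>i=1..r. V r i z)" if "r \<le> Suc n" for r
      using that by (intro sum.cong) (auto simp: arr_V)
    from this[of k] this[of "k - 1"] this[of "Suc k"] k
    have c: "?c = 2 * (\<Sum>i=1..k. V k i z) - (\<Sum>i=1..k-1. V (k-1) i z) - (\<Sum>i=1..Suc k. V (Suc k) i z) - 1" by auto
    show "theta (\<rho> (u (hv k)) (T (arr z))) = theta (sc ?c (T (arr z)))"
      unfolding c equivariant[OF hvS[OF k]] theta_scale[OF in_all] TA[OF z] T0[OF z] by (rule rep_hv_pt[OF k z])
  qed
  have T0_inj: "inj_on T0 S"
  proof (rule inj_onI)
    fix z w assume zw: "z \<in> S" "w \<in> S" "T0 z = T0 w"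
    have "theta (T0 z) = theta (T0 w)" by (simp only: zw(3))
    then show "z = w" unfolding T0[OF zw(1)] T0[OF zw(2)] by (rule pt_inj)
  qed
  have img: "T ` SA = T0 ` S" using TA by (force simp: SA_def)
  have "inj_on T SA"
  proof (rule inj_onI)
    fix v v' assume "v \<in> SA" "v' \<in> SA" "T v = T v'"
    then obtain z z' where z: "z \<in> S" "v = arr z" "z' \<in> S" "v' = arr z'" "T (arr z) = T (arr z')"
      by (auto simp: SA_def)
    from z(5) have "z = z'" unfolding TA[OF z(1)] TA[OF z(3)] by (rule inj_onD[OF T0_inj _ z(1,3)])
    then show "v = v'" using z by simp
  qed
  \<comment> \<open>A relation is mapped by \<open>theta\<close> and evaluated at the lattice point
    of one basis vector, which isolates its coefficient.\<close>
  moreover have "\<not> V.dependent (T ` SA)"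
    unfolding V.dependent_explicit img
  proof (intro notI, elim exE conjE bexE)
    fix B c v1 assume B: "finite B" "B \<subseteq> T0 ` S" "(\<Sum>v\<in>B. sc (c v) v) = 0" "v1 \<in> B" "c v1 \<noteq> 0"
    obtain z1 where z1: "z1 \<in> S" "v1 = T0 z1" using B by blast
    have "(0::complex) = theta (\<Sum>v\<in>B. sc (c v) v) z1" by (simp add: B(3) theta_zero)
    also have "\<dots> = (\<Sum>v\<in>B. c v * theta v z1)" by (simp only: theta_sum[OF in_all] fsc_sum_apply)
    also have "\<dots> = (\<Sum>v\<in>B. if v = v1 then c v1 else 0)"
    proof (rule sum.cong[OF refl])
      fix v assume "v \<in> B"
      then obtain z where z: "z \<in> S" "v = T0 z" using B by blast
      have "theta v z1 = (if z1 = z then 1 else 0)" unfolding z(2) T0[OF z(1)] by (rule pt_apply)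
      moreover have "z1 = z \<longleftrightarrow> v = v1" using z z1 T0_inj by (auto dest: inj_onD)
      ultimately show "c v * theta v z1 = (if v = v1 then c v1 else 0)" by simp
    qed
    also have "\<dots> = c v1" using B by simp
    finally show False using B(5) by simp
  qed
  moreover have "V.span (T ` SA) = UNIV"
  proof -
    \<comment> \<open>The image of a word is supported in one weight set \<open>Sw \<mu>\<close>,
      which is finite, so it is a finite combination of point functions.\<close>
    have "act_word \<rho> w v0 \<in> V.span (T0 ` S)" if w: "set w \<subseteq> neg_letters n" for w
    proof -
      define \<mu> where "\<mu> = mset_wt (mset w)"
      let ?g = "act_word srep w (pt zm)"
      have fin: "finite (Sw \<mu>)" unfolding \<mu>_def by (rule finite_Sw) (rule mset_wt_outside, use w in auto)
      have supp: "supp_in (Sw \<mu>) ?g" unfolding \<mu>_def by (rule act_word_supp[OF w])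
      have "theta (\<Sum>z\<in>Sw \<mu>. sc (?g z) (T0 z)) = (\<Sum>z\<in>Sw \<mu>. fsc (?g z) (pt z))"
        unfolding theta_sum[OF in_all] by (intro sum.cong refl) (simp add: T0 Sw_def)
      also have "\<dots> = ?g"
      proof
        fix y
        have "(\<Sum>z\<in>Sw \<mu>. fsc (?g z) (pt z)) y = (\<Sum>z\<in>Sw \<mu>. if z = y then ?g y else 0)"
          unfolding fsc_sum_apply by (intro sum.cong) (simp_all add: pt_apply)
        then show "(\<Sum>z\<in>Sw \<mu>. fsc (?g z) (pt z)) y = ?g y" using fin supp by (auto simp: supp_in_def)
      qed
      also have "?g = theta (act_word \<rho> w v0)" using theta_word[OF w] by simp
      finally have "act_word \<rho> w v0 = (\<Sum>z\<in>Sw \<mu>. sc (?g z) (T0 z))" by (rule theta_inj[symmetric])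
      moreover have "(\<Sum>z\<in>Sw \<mu>. sc (?g z) (T0 z)) \<in> V.span (T0 ` S)"
        by (intro V.span_sum V.span_scale V.span_base) (auto simp: Sw_def)
      ultimately show ?thesis by simp
    qed
    then have "V.pbw_all \<subseteq> V.span (T0 ` S)" unfolding V.pbw_all_def by (intro V.span_minimal) auto
    then show ?thesis using U img by auto
  qed
  moreover have "SA \<subseteq> gt_arrays n" by (auto simp: SA_def gt_arrays_def arr_def)
  ultimately show ?thesis
    unfolding strongly_tame_GT_def Let_def
  proof (intro exI[of _ SA] exI[of _ T] conjI ballI)
    fix v k assume v: "v \<in> SA" and k: "k \<in> {1..n}"
    then obtain z where z: "z \<in> S" "v = arr z" by (auto simp: SA_def)
    note E[OF k z(1), unfolded Let_def, folded z(2)] F[OF k z(1), unfolded Let_def, folded z(2)] H[OF k z(1), folded z(2)]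
    then show "\<rho> (u (ev k)) (T v) = - (\<Sum>i=1..k.
        if (\<Prod>j\<in>{1..k}-{i}. v k i - v k j) = 0 then 0
        else sc ((\<Prod>j=1..Suc k. v k i - v (Suc k) j) / (\<Prod>j\<in>{1..k}-{i}. v k i - v k j)) (?Tm (shift v k i 1)))"
      "\<rho> (u (fv k)) (T v) = (\<Sum>i=1..k.
        if (\<Prod>j\<in>{1..k}-{i}. v k i - v k j) = 0 then 0
        else sc ((\<Prod>j=1..k-1. v k i - v (k-1) j) / (\<Prod>j\<in>{1..k}-{i}. v k i - v k j)) (?Tm (shift v k i (-1))))"
      "\<rho> (u (hv k)) (T v) = sc (2 * (\<Sum>i=1..k. v k i) - (\<Sum>i=1..k-1. v (k-1) i) - (\<Sum>i=1..Suc k. v (Suc k) i) - 1) (T v)"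
      by this
  qed
qed

end

theorem mainTheorem15:
  fixes n p q :: nat and k :: rat and lam :: weight
    and sc :: "complex \<Rightarrow> 'v::ab_group_add \<Rightarrow> 'v" and \<rho> :: "mat \<Rightarrow> 'v \<Rightarrow> 'v"
  assumes "1 \<le> n"
    and "admissible_level n k p q"
    and "lam \<in> Pr_bar n p q"
    and "is_L n sc \<rho> lam"
    and "assoc_var n sc \<rho> = closure (O_prin n)"
  shows "\<forall>w. set w \<subseteq> {1..n} \<longrightarrow>
           (\<exists>u\<in>Wbar n. maps_base n u w \<and> strongly_tame_GT n sc (\<lambda>A. \<rho> (u A)))"
proof (intro allI impI)
  fix w assume w: "set w \<subseteq> {1..n}"
  from assms(4) obtain v0 where L: "lie_module n sc \<rho>" and irr: "irreducible_mod n sc \<rho>"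
    and hw: "hw_vector n sc \<rho> lam v0" unfolding is_L_def by blast
  interpret sl_module sc n \<rho> by (rule lie_module_imp_sl_module[OF L])
  interpret hw_module sc n \<rho> lam v0 by unfold_locales (rule hw)
  have all_free: "pbw_free wd" if "word_choice wd" for wd
    using principal_variety_imp_free[OF assms(1) irr _ that] closure_subset assms(5) by blast
  have nonint: "ecoord n (\<lambda>k. lam k + 1) x - ecoord n (\<lambda>k. lam k + 1) y \<notin> \<int>"
    if xy: "x \<in> {1..Suc n}" "y \<in> {1..Suc n}" "x < y" for x y
    using free_irreducible_imp_nonintegral[OF irr all_free admissible_integral_positive[OF assms(2,3)], of x y]
      ecoord_diff[of x y n "\<lambda>k. lam k + 1"] xy by simp
  obtain \<pi> sg where perm: "\<pi> permutes {1..Suc n}" and sg: "\<And>a. sg a * sg a = (1::complex)"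
    and u: "\<And>Y a b. word_auto n w Y (\<pi> a) (\<pi> b) = sg a * sg b * Y a b"
    and wt: "\<And>\<xi> a b. \<lbrakk>a \<in> {1..Suc n}; b \<in> {1..Suc n}\<rbrakk> \<Longrightarrow>
      ecoord n (wact n w \<xi>) (\<pi> a) - ecoord n (wact n w \<xi>) (\<pi> b) = ecoord n \<xi> a - ecoord n \<xi> b"
    using word_auto_permutation[OF w] by metis
  \<comment> \<open>The rho-shifted coordinates of \<open>lam\<close>, permuted by
    \<open>\<pi>\<close>: the Weyl group element only reorders the columns of the arrays.\<close>
  define t where "t x = ecoord n (\<lambda>k. lam k + 1) (\<pi> x)" for x
  have generic: "t i - t j \<notin> \<int>" if ij: "i \<in> {1..n}" "j \<in> {1..n}" "i \<noteq> j" for i j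
  proof -
    have "\<pi> i \<in> {1..Suc n}" "\<pi> j \<in> {1..Suc n}" using permutes_in_image[OF perm] ij by auto
    moreover have "\<pi> i \<noteq> \<pi> j" using permutes_inj[OF perm] ij(3) by (auto dest: injD)
    moreover have "t j - t i \<in> \<int>" if "t i - t j \<in> \<int>" using Ints_minus[OF that] by simp
    ultimately show ?thesis using nonint[of "\<pi> i" "\<pi> j"] nonint[of "\<pi> j" "\<pi> i"] unfolding t_def
      by (meson linorder_neqE_nat)
  qed
  obtain wd where wd: "word_choice wd" using word_choice_exists by blast
  interpret gt_generic n t by unfold_locales (rule generic)
  \<comment> \<open>With all values nonintegral no further truncation occurs, and the removed set is
    empty.\<close>
  interpret gt_perm n t \<pi> sg "{}" lam
  proof
    show "t (inv \<pi> i) - t (inv \<pi> (Suc i)) = lam i + 1" if "i \<in> {1..n}" for i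
      using ecoord_step[OF that, of "\<lambda>k. lam k + 1"] permutes_inverses(1)[OF perm] by (simp add: t_def)
    show "\<pi> permutes {1..Suc n}" "gclosed {}" by (rule perm, simp add: gclosed_def)
  qed (simp_all add: sg)
  interpret gt_hw n t \<pi> sg "{}" lam sc \<rho> v0 wd
    by unfold_locales (rule wd all_free[OF wd])+
  show "\<exists>u\<in>Wbar n. maps_base n u w \<and> strongly_tame_GT n sc (\<lambda>A. \<rho> (u A))"
    using word_auto_Wbar[OF w] maps_base_word_auto[OF perm sg u wt] strongly_tame_twist[OF irr u] by blast
qed

end
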